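(* Let $G$ be a definably connected solvable group definable in an o-minimal structure. Then Cartan subgroups of $G$ exist and are conjugate in $G$, and they are definably connected and selfnormalizing. Moreover, for any Cartan subgroup $Q$ of $G$, the (definable) set $Q_0$ of elements of $Q$ contained in a unique $G$-conjugate of $Q$ is large in $Q$ and largely generous in $G$.
   Context: Definability is with parameters in a fixed o-minimal structure; $\dim$ denotes the usual o-minimal dimension of definable sets (quotients of definable groups by definable subgroups are treated as definable sets, as groups definable in o-minimal structures eliminate imaginaries). A definable group is definably connected if it has no proper definable subgroup of finite index. A subgroup $Q$ of a group $G$ is a Cartan subgroup if $Q$ is nilpotent and maximal nilpotent in $G$, and every normal finite-index subgroup $X$ of $Q$ has finite index in $N_G(X)$. For definable sets $X\subseteq Y$, $X$ is large in $Y$ if $\dim(Y\setminus X)<\dim(Y)$. For a definable subset $X$ of a definable group $G$, let $X^G=\{x^g: x\in X, g\in G\}$; $X$ is largely generous in $G$ if $X^G$ is large in $G$. *)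

theory Defs
  imports "HOL-Algebra.Solvable_Groups" "HOL-Algebra.Group_Action"
begin

text \<open>Points of M^n are lists of length n over the linearly ordered type 'a.
  A structure is given by the family S n of definable subsets of M^n
  (definable with parameters), following van den Dries' axioms.\<close>

definition open_interval :: "'a::linorder option \<Rightarrow> 'a option \<Rightarrow> 'a set" where
  "open_interval lo hi = {x. (\<forall>a. lo = Some a \<longrightarrow> a < x) \<and> (\<forall>b. hi = Some b \<longrightarrow> x < b)}"

definition o_minimal :: "(nat \<Rightarrow> 'a::linorder list set set) \<Rightarrow> bool" where
  "o_minimal S \<longleftrightarrow>
     \<comment> \<open>(M,<) is a dense linear order without endpoints\<close>
     (\<forall>x y::'a. x < y \<longrightarrow> (\<exists>z. x < z \<and> z < y)) \<and>
     (\<forall>x::'a. \<exists>y. y < x) \<and> (\<forall>x::'a. \<exists>y. x < y) \<and>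
     \<comment> \<open>S n is a Boolean algebra of subsets of M^n\<close>
     (\<forall>n A. A \<in> S n \<longrightarrow> A \<subseteq> {x. length x = n}) \<and>
     (\<forall>n. {x. length x = n} \<in> S n) \<and>
     (\<forall>n A B. A \<in> S n \<longrightarrow> B \<in> S n \<longrightarrow> A \<union> B \<in> S n) \<and>
     (\<forall>n A. A \<in> S n \<longrightarrow> {x. length x = n} - A \<in> S n) \<and>
     \<comment> \<open>products with M on both sides\<close>
     (\<forall>n A. A \<in> S n \<longrightarrow> {x @ [y] | x y. x \<in> A} \<in> S (Suc n)) \<and>
     (\<forall>n A. A \<in> S n \<longrightarrow> {y # x | x y. x \<in> A} \<in> S (Suc n)) \<and>
     \<comment> \<open>diagonals\<close>
     (\<forall>n i j. i < n \<longrightarrow> j < n \<longrightarrow> {x. length x = n \<and> x ! i = x ! j} \<in> S n) \<and>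
     \<comment> \<open>projections M^(n+1) to M^n\<close>
     (\<forall>n A. A \<in> S (Suc n) \<longrightarrow> butlast ` A \<in> S n) \<and>
     \<comment> \<open>parameters and the order\<close>
     (\<forall>c. {[c]} \<in> S 1) \<and>
     {[x, y] | x y. x < y} \<in> S 2 \<and>
     \<comment> \<open>o-minimality\<close>
     (\<forall>A \<in> S 1. \<exists>F I. finite F \<and> finite I \<and>
        A = {[x] | x. x \<in> F \<union> (\<Union>(lo, hi) \<in> I. open_interval lo hi)})"

text \<open>A subset of M^k has nonempty interior (product of order topologies)
  iff it contains a nonempty open box.\<close>

definition nonempty_interior :: "nat \<Rightarrow> 'a::linorder list set \<Rightarrow> bool" where
  "nonempty_interior k A \<longleftrightarrow>
     (\<exists>a b. length a = k \<and> length b = k \<and> (\<forall>i<k. a ! i < b ! i) \<and>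
        {x. length x = k \<and> (\<forall>i<k. a ! i < x ! i \<and> x ! i < b ! i)} \<subseteq> A)"

definition coord_proj :: "nat list \<Rightarrow> 'a list \<Rightarrow> 'a list" where
  "coord_proj is x = map (\<lambda>i. x ! i) is"

text \<open>The o-minimal dimension of a (definable) subset X of M^n: the largest k such
  that some coordinate projection of X to M^k has nonempty interior; the empty set
  gets dimension -1 (standing for minus infinity).\<close>

definition odim :: "nat \<Rightarrow> 'a::linorder list set \<Rightarrow> int" where
  "odim n X = (if X = {} then -1 else
     int (GREATEST k. \<exists>is. length is = k \<and> distinct is \<and> set is \<subseteq> {..<n} \<and>
                              nonempty_interior k (coord_proj is ` X)))"

definition large_in :: "nat \<Rightarrow> 'a::linorder list set \<Rightarrow> 'a list set \<Rightarrow> bool" where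
  "large_in n X Y \<longleftrightarrow> X \<subseteq> Y \<and> odim n (Y - X) < odim n Y"

definition definable_group ::
  "(nat \<Rightarrow> 'a list set set) \<Rightarrow> nat \<Rightarrow> 'a list monoid \<Rightarrow> bool" where
  "definable_group S n G \<longleftrightarrow> group G \<and> carrier G \<in> S n \<and>
     {x @ y @ (x \<otimes>\<^bsub>G\<^esub> y) | x y. x \<in> carrier G \<and> y \<in> carrier G} \<in> S (3 * n)"

definition finite_index :: "('a, 'b) monoid_scheme \<Rightarrow> 'a set \<Rightarrow> 'a set \<Rightarrow> bool" where
  "finite_index G K H \<longleftrightarrow> (\<exists>F. finite F \<and> F \<subseteq> H \<and> H = (\<Union>f\<in>F. K #>\<^bsub>G\<^esub> f))"

definition definably_connected ::
  "(nat \<Rightarrow> 'a list set set) \<Rightarrow> nat \<Rightarrow> 'a list monoid \<Rightarrow> 'a list set \<Rightarrow> bool" where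
  "definably_connected S n G H \<longleftrightarrow> H \<in> S n \<and> subgroup H G \<and>
     \<not> (\<exists>K. K \<in> S n \<and> subgroup K G \<and> K \<subset> H \<and> finite_index G K H)"

fun lower_central :: "('a, 'b) monoid_scheme \<Rightarrow> nat \<Rightarrow> 'a set" where
  "lower_central G 0 = carrier G"
| "lower_central G (Suc k) = generate G
     (\<Union>a \<in> lower_central G k. \<Union>b \<in> carrier G.
        {a \<otimes>\<^bsub>G\<^esub> b \<otimes>\<^bsub>G\<^esub> inv\<^bsub>G\<^esub> a \<otimes>\<^bsub>G\<^esub> inv\<^bsub>G\<^esub> b})"

definition nilpotent :: "('a, 'b) monoid_scheme \<Rightarrow> bool" where
  "nilpotent G \<longleftrightarrow> group G \<and> (\<exists>k. lower_central G k = {\<one>\<^bsub>G\<^esub>})"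

definition conj_set :: "('a, 'b) monoid_scheme \<Rightarrow> 'a \<Rightarrow> 'a set \<Rightarrow> 'a set" where
  "conj_set G g X = {g \<otimes>\<^bsub>G\<^esub> x \<otimes>\<^bsub>G\<^esub> inv\<^bsub>G\<^esub> g | x. x \<in> X}"

definition cartan_subgroup :: "('a, 'b) monoid_scheme \<Rightarrow> 'a set \<Rightarrow> bool" where
  "cartan_subgroup G Q \<longleftrightarrow> subgroup Q G \<and> nilpotent (G\<lparr>carrier := Q\<rparr>) \<and>
     (\<forall>K. subgroup K G \<and> Q \<subseteq> K \<and> nilpotent (G\<lparr>carrier := K\<rparr>) \<longrightarrow> K = Q) \<and>
     (\<forall>X. X \<lhd> G\<lparr>carrier := Q\<rparr> \<and> finite_index G X Q \<longrightarrow>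
          finite_index G X (normalizer G X))"

definition conj_closure :: "('a, 'b) monoid_scheme \<Rightarrow> 'a set \<Rightarrow> 'a set" where
  "conj_closure G X = {g \<otimes>\<^bsub>G\<^esub> x \<otimes>\<^bsub>G\<^esub> inv\<^bsub>G\<^esub> g | x g. x \<in> X \<and> g \<in> carrier G}"

definition largely_generous ::
  "nat \<Rightarrow> 'a::linorder list monoid \<Rightarrow> 'a list set \<Rightarrow> bool" where
  "largely_generous n G X \<longleftrightarrow> large_in n (conj_closure G X) (carrier G)"

definition generic_part :: "('a, 'b) monoid_scheme \<Rightarrow> 'a set \<Rightarrow> 'a set" where
  "generic_part G Q = {x \<in> Q. \<exists>!Q'. (\<exists>g \<in> carrier G. Q' = conj_set G g Q) \<and> x \<in> Q'}"

end

theory Submission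
 imports Defs
begin

text \<open>O-minimality enters through two facts: dimension is additive, which allows double counting,
 and the definable subgroups of full dimension of a definable group have bounded index, because a
 definable set has boundedly many clopen pieces of full dimension. Hence there is a descending chain
 condition on definable subgroups, and definable hulls and connected components exist.

 The theorem follows by induction on the dimension. Let \<open>A\<close> be an infinite definable connected
 normal subgroup of \<open>G\<close> of least dimension; it is abelian. Let \<open>H/A\<close> be a Cartan subgroup of
 \<open>G/A\<close>. If \<open>H\<close> is proper, a Cartan subgroup of \<open>H\<close> is one of \<open>G\<close>, by a Frattini argument.
 Otherwise \<open>G/A\<close> is nilpotent and we may assume that \<open>A\<close> is not central. Then \<open>A\<close> has a nilpotent
 complement \<open>Q\<close>. The elements with a nontrivial fixed point in \<open>A\<close> form a small set, since fixed
 spaces of \<open>gz\<close> for central weights \<open>z\<close> are independent; all others are conjugate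
 into \<open>Q\<close> under \<open>A\<close>, and two Cartan subgroups sharing such an element coincide.\<close>

text \<open>No definable choice, no cell decomposition and no generic points of a saturated
  extension are at hand. They are replaced by one principle about dimension: if a choice of
  parameter is free for each point, within a set of full dimension, then a single parameter serves
  many points at once.

  The induction passes to quotients, which are not literally definable subsets of a power of the
  line. Hence the group theory is done for abstract groups with a class of definable predicates and
  a dimension, and quotients are carried by chosen representatives.

  Derived subgroups and nilpotent subgroups need not be definable. Solvability is therefore restated
  by definable subgroups, and definable hulls mediate between arbitrary and definable subgroups. The
  induction runs over Carter subgroups (connected, nilpotent, of finite index in the normalizer),
  because being Cartan refers to subgroups that are not definable. Its hypothesis must also contain
  the smallness statements and a supplement property: in one case the complement of \<open>A\<close>
  is found through a quotient by another normal subgroup.\<close>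

notation mult (infixl "**\<index>" 70)
notation HOL.iff (infixr "<->" 25)

section \<open>Definability calculus\<close>

locale omin =
 fixes S :: "nat => 'a::linorder list set set"
 assumes omin: "o_minimal S"
begin

lemmas om = omin[unfolded o_minimal_def]
lemmas om1 = om[THEN conjunct2]
lemmas om2 = om1[THEN conjunct2]
lemmas om3 = om2[THEN conjunct2]
lemmas om4 = om3[THEN conjunct2]
lemmas om5 = om4[THEN conjunct2]
lemmas om6 = om5[THEN conjunct2]
lemmas om7 = om6[THEN conjunct2]
lemmas om8 = om7[THEN conjunct2]
lemmas om9 = om8[THEN conjunct2]
lemmas om10 = om9[THEN conjunct2]
lemmas om11 = om10[THEN conjunct2]
lemmas om12 = om11[THEN conjunct2]
lemmas om13 = om12[THEN conjunct2]

lemma dense: "x<y==>EX z::'a. x<z & z<y"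
 by (rule om[THEN conjunct1, rule_format])
lemma no_bot: "EX y::'a. y<x"
 by (rule om1[THEN conjunct1, rule_format])
lemma no_top: "EX y::'a. x<y"
 by (rule om2[THEN conjunct1, rule_format])
lemma S_len: "A:S n==>A<={x. length x = n}"
 by (rule om3[THEN conjunct1, rule_format])
lemma S_UNIV: "{x. length x = n}:S n"
 by (rule om4[THEN conjunct1, rule_format])
lemma S_Un: "A:S n==>B:S n==>A Un B:S n"
 by (rule om5[THEN conjunct1, rule_format])
lemma S_compl: "A:S n==>{x. length x = n} - A:S n"
 by (rule om6[THEN conjunct1, rule_format])
lemma S_snoc: "A:S n==>{x @ [y] | x y. x:A}:S (Suc n)"
 by (rule om7[THEN conjunct1, rule_format])
lemma S_Cons: "A:S n==>{y # x | x y. x:A}:S (Suc n)"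
 by (rule om8[THEN conjunct1, rule_format])
lemma S_diag: "i<n==>j<n==>{x. length x = n & x ! i = x ! j}:S n"
 by (rule om9[THEN conjunct1, rule_format])
lemma S_butlast: "A:S (Suc n)==>butlast ` A:S n"
 by (rule om10[THEN conjunct1, rule_format])
lemma S_const: "{[c]}:S 1"
 by (rule om11[THEN conjunct1, rule_format])
lemma S_less: "{[x, y] | x y. x<y}:S 2"
 by (rule om12[THEN conjunct1, rule_format])
lemma S_omin: "A:S 1==>EX F I. finite F & finite I &
    A = {[x] | x. x:F Un (UN (lo, hi):I. open_interval lo hi)}"
 by (rule om13[rule_format])

lemma S_Int: assumes "A:S n" "B:S n" shows "A Int B:S n"
proof -
 have "A Int B = {x. length x = n} - (({x. length x = n} - A) Un ({x. length x = n} - B))"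
  using S_len[OF assms(1)] by auto
 thus ?thesis using assms S_compl S_Un by metis
qed

lemma S_take: "X:S (m + k)==>take m ` X:S m"
proof (induction k arbitrary: X)
 case 0
 hence "take m ` X = X" using S_len[of X m] by (force simp: image_iff)
 with 0 show ?case by simp
next
 case (Suc k)
 have "take m ` X = take m ` butlast ` X"
  unfolding image_image using S_len[OF Suc.prems] by (intro image_cong) (auto simp: take_butlast)
 with Suc.IH[of "butlast ` X"] S_butlast[of X "m + k"] Suc.prems show ?case by simp
qed

lemma S_drop: "A:S n==>{z. length z = m + n & drop m z:A}:S (m + n)"
proof (induction m)
 case 0
 have "{z. length z = n & z:A} = A" using S_len[OF 0] by auto
 with 0 show ?case by simp
next
 case (Suc m)
 have "{z. length z = Suc m + n & drop (Suc m) z:A} = {y # x |x y. x:{z. length z = m + n & drop m z:A}}"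
  (is "?L = ?R")
 proof (intro Set.set_eqI iffI)
  fix z assume "z:?L" thus "z:?R" by (cases z) auto
 qed auto
 with S_Cons[OF Suc.IH[OF Suc.prems]] show ?case by simp
qed

text \<open>Formulas are predicates on environments; quantifiers bind variable 0 and shift the others
 (de Bruijn indices), so that definability is proved by introduction rules.\<close>

definition dep :: "nat => ((nat => 'a) => bool) => bool" where
 "dep n ph <-> (ALL e e'. (ALL i<n. e i = e' i) --> ph e = ph e')"

definition trace :: "nat => ((nat => 'a) => bool) => 'a list set" where
 "trace n ph = {x. length x = n & ph (%i. x ! i)}"

definition dfn :: "((nat => 'a) => bool) => bool" where
 "dfn ph <-> (EX n. dep n ph & trace n ph:S n)"

lemma dep_mono: "dep n ph==>n<=m==>dep m ph"
 unfolding dep_def by (meson le_trans less_le_trans)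

lemma depD: "dep n ph==>(!!i. i<n==>e i = e' i)==>ph e = ph e'"
 unfolding dep_def by blast

lemma trace_mono: assumes "dep n ph" "trace n ph:S n" "n<=m" shows "trace m ph:S m"
 using assms(3)
proof (induction m rule: dec_induct)
 case base show ?case by fact
next
 case (step m)
 have "trace (Suc m) ph = {x @ [y] |x y. x:trace m ph}" (is "?L = ?R")
 proof (intro Set.set_eqI iffI)
  fix z assume z: "z:?L"
  hence l: "length z = Suc m" and p: "ph ((!) z)" by (auto simp: trace_def)
  have "ph ((!) (butlast z)) = ph ((!) z)"
   using l step(1) by (intro depD[OF assms(1)]) (simp add: nth_butlast)
  hence "butlast z:trace m ph" using l p by (simp add: trace_def)
  moreover have "z = butlast z @ [last z]" using l by (metis append_butlast_last_id length_0_conv nat.distinct(1))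
  ultimately show "z:?R" by blast
 next
  fix z assume "z:?R"
  then obtain x y where z: "z = x @ [y]" "length x = m" "ph ((!) x)" by (auto simp: trace_def)
  have "ph ((!) z) = ph ((!) x)"
   using z step(1) by (intro depD[OF assms(1)]) (simp add: nth_append)
  with z show "z:?L" by (simp add: trace_def)
 qed
 with S_snoc[OF step.IH] show ?case by simp
qed

lemma dfnE:
 assumes "dfn ph" obtains n where "!!m. n<=m==>dep m ph" "!!m. n<=m==>trace m ph:S m"
 using assms dep_mono trace_mono unfolding dfn_def by metis

lemma dfnI: "dep n ph==>trace n ph:S n==>dfn ph"
 unfolding dfn_def by blast

lemma trace_exact: assumes "dfn ph" "dep n ph" shows "trace n ph:S n"
proof -
 obtain m where m: "!!k. m<=k==>trace k ph:S k" using dfnE[OF assms(1)] by blast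
 show ?thesis
 proof (cases "m<=n")
  case False
  have "take n ` trace m ph = trace n ph"
  proof (intro Set.set_eqI iffI)
   fix x assume "x:take n ` trace m ph"
   then obtain z where z: "z:trace m ph" "x = take n z" by blast
   have "ph ((!) x) = ph ((!) z)" using z by (intro depD[OF assms(2)]) simp
   with z False show "x:trace n ph" by (simp add: trace_def)
  next
   fix x assume x: "x:trace n ph"
   let ?z = "x @ replicate (m - n) undefined"
   have "ph ((!) ?z) = ph ((!) x)" using x by (intro depD[OF assms(2)]) (simp add: trace_def nth_append)
   hence "?z:trace m ph" using x False by (simp add: trace_def)
   moreover have "x = take n ?z" using x by (simp add: trace_def)
   ultimately show "x:take n ` trace m ph" by blast
  qed
  moreover have "take n ` trace m ph:S n"
   using m[of m] S_take[of "trace m ph" n "m - n"] False by simp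
  ultimately show ?thesis by simp
 qed (rule m)
qed

lemma dfn_not: assumes "dfn ph" shows "dfn (%e. ~ph e)"
proof -
 obtain n where n: "dep n ph" "trace n ph:S n" using assms unfolding dfn_def by blast
 have "trace n (%e. ~ph e) = {x. length x = n} - trace n ph" by (auto simp: trace_def)
 with n S_compl show ?thesis by (intro dfnI[of n]) (auto simp: dep_def)
qed

lemma dfn_conj: assumes "dfn ph" "dfn ps" shows "dfn (%e. ph e & ps e)"
proof -
 obtain n where n: "!!m. n<=m==>dep m ph" "!!m. n<=m==>trace m ph:S m" using dfnE[OF assms(1)] by blast
 obtain k where k: "!!m. k<=m==>dep m ps" "!!m. k<=m==>trace m ps:S m" using dfnE[OF assms(2)] by blast
 have "trace (max n k) (%e. ph e & ps e) = trace (max n k) ph Int trace (max n k) ps" by (auto simp: trace_def)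
 moreover have "dep (max n k) (%e. ph e & ps e)"
  using n(1)[OF max.cobounded1] k(1)[OF max.cobounded2] unfolding dep_def by blast
 ultimately show ?thesis using n(2) k(2) S_Int by (intro dfnI) auto
qed

lemma dfn_disj: "dfn ph==>dfn ps==>dfn (%e. ph e | ps e)"
 using dfn_not[OF dfn_conj[OF dfn_not dfn_not]] by simp

lemma dfn_imp: assumes "dfn ph" "dfn ps" shows "dfn (%e. ph e --> ps e)"
proof -
 have "(%e. ph e --> ps e) = (%e. ~ph e | ps e)" by auto
 with dfn_disj[OF dfn_not[OF assms(1)] assms(2)] show ?thesis by (simp only:)
qed

lemma dfn_iff: assumes "dfn ph" "dfn ps" shows "dfn (%e. ph e = ps e)"
proof -
 have "(%e. ph e = ps e) = (%e. (ph e --> ps e) & (ps e --> ph e))" by auto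
 with dfn_conj[OF dfn_imp[OF assms] dfn_imp[OF assms(2,1)]] show ?thesis by (simp only:)
qed

lemma dfn_const: "dfn (%e. b)"
proof -
 have 1: "dfn (%e. True)"
  using S_UNIV[of 0] by (intro dfnI[of 0]) (auto simp: dep_def trace_def)
 show ?thesis using 1 dfn_not[OF 1] by (cases b) auto
qed

text \<open>The axioms know only cylinders, diagonals and projections. The renamed predicate is the
  projection of a set in M^(m+n) whose last n coordinates satisfy \<open>ph\<close> and are tied to
  the first m by diagonals.\<close>

lemma dfn_rename: assumes "dfn ph" shows "dfn (%e. ph (%i. e (f i)))"
proof -
 obtain n where n: "dep n ph" "trace n ph:S n" using assms unfolding dfn_def by blast
 \<comment> \<open>Exceeds every \<open>f i\<close> with \<open>i<n\<close>, so that the renamed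
   predicate depends on the first m variables only.\<close>
 define m where "m = Suc (SUM i<n. f i)"
 have fm: "f i<m" if "i<n" for i
  unfolding m_def using member_le_sum[of i "{..<n}" f] that by auto
 define C where "C = {z. length z = m + n & drop m z:trace n ph}"
 have C: "C:S (m + n)" unfolding C_def by (rule S_drop[OF n(2)])
 have E: "{z. length z = m + n & (ALL i<k. z ! (m + i) = z ! f i)}:S (m + n)" if "k<=n" for k
  using that
 proof (induction k)
  case 0 thus ?case using S_UNIV by simp
 next
  case (Suc k)
  have "{z. length z = m + n & (ALL i<Suc k. z ! (m + i) = z ! f i)} =
   {z. length z = m + n & (ALL i<k. z ! (m + i) = z ! f i)} Int {z. length z = m + n & z ! (m + k) = z ! f k}"
   by (auto simp: less_Suc_eq)
  moreover have "{z. length z = m + n & z ! (m + k) = z ! f k}:S (m + n)"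
   using Suc.prems fm[of k] by (intro S_diag) auto
  note S_Int[OF Suc.IH[OF Suc_leD[OF Suc.prems]] this]
  ultimately show ?case by metis
 qed
 let ?E = "{z. length z = m + n & (ALL i<n. z ! (m + i) = z ! f i)}"
 have "trace m (%e. ph (%i. e (f i))) = take m ` (C Int ?E)" (is "?L = ?R")
 proof (intro Set.set_eqI iffI)
  fix x assume "x:?L"
  hence x: "length x = m" "ph (%i. x ! f i)" by (auto simp: trace_def)
  let ?z = "x @ map (%i. x ! f i) [0..<n]"
  have "ph ((!) (map (%i. x ! f i) [0..<n])) = ph (%i. x ! f i)" by (intro depD[OF n(1)]) simp
  hence "?z:C Int ?E" using x fm by (auto simp: C_def trace_def nth_append)
  moreover have "x = take m ?z" using x by simp
  ultimately show "x:?R" by blast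
 next
  fix x assume "x:?R"
  then obtain z where z: "z:C" "z:?E" "x = take m z" by auto
  have "ph (%i. x ! f i) = ph ((!) (drop m z))"
   using z fm by (intro depD[OF n(1)]) (simp add: C_def)
  thus "x:?L" using z by (auto simp: C_def trace_def)
 qed
 moreover have "take m ` (C Int ?E):S m" using S_take[OF S_Int[OF C E[of n]]] by simp
 moreover have "dep m (%e. ph (%i. e (f i)))"
  unfolding dep_def by (intro allI impI depD[OF n(1)]) (simp add: fm)
 ultimately show ?thesis by (intro dfnI[of m]) simp_all
qed

text \<open>The axioms project away the last coordinate, while the bound variable is number 0; a
  renaming first moves it to position \<open>N\<close>.\<close>

lemma dfn_ex: assumes "dfn (%e. P (e 0) (%i. e (Suc i)))" shows "dfn (%e. EX x. P x e)"
proof -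
 let ?ph = "%e. P (e 0) (%i. e (Suc i))"
 obtain n0 where "dep n0 ?ph" using assms unfolding dfn_def by blast
 hence n0: "dep (Suc n0) ?ph" by (rule dep_mono) simp
 define N where "N = n0"
 let ?ch = "%e. ?ph (%i. e (case i of 0 => N | Suc j => j))"
 have "dfn ?ch" by (rule dfn_rename[OF assms])
 have depN: "dep (Suc N) ?ch"
  unfolding dep_def
 proof (intro allI impI)
  fix e e' :: "nat => 'a" assume h: "ALL i<Suc N. e i = e' i"
  show "?ch e = ?ch e'"
   using h unfolding N_def by (intro depD[OF n0]) (auto split: nat.split)
 qed
 have "trace (Suc N) ?ch:S (Suc N)" by (rule trace_exact[OF \<open>dfn ?ch\<close> depN])
 hence "butlast ` trace (Suc N) ?ch:S N" by (rule S_butlast)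
 moreover have "butlast ` trace (Suc N) ?ch = trace N (%e. EX x. P x e)"
 proof (intro Set.set_eqI iffI)
  fix x assume "x:butlast ` trace (Suc N) ?ch"
  then obtain z where z: "z:trace (Suc N) ?ch" "x = butlast z" by blast
  have "?ph (%i. case i of 0 => z ! N | Suc j => x ! j) = ?ch ((!) z)"
   using z by (intro depD[OF n0]) (auto simp: trace_def nth_butlast N_def split: nat.split)
  with z have "?ph (%i. case i of 0 => z ! N | Suc j => x ! j)" by (simp add: trace_def)
  thus "x:trace N (%e. EX x. P x e)" using z by (auto simp: trace_def)
 next
  fix x assume "x:trace N (%e. EX x. P x e)"
  then obtain t where t: "length x = N" "P t ((!) x)" by (auto simp: trace_def)
  have "?ch ((!) (x @ [t])) = ?ph (%i. case i of 0 => t | Suc j => x ! j)"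
   using t by (intro depD[OF n0]) (auto simp: nth_append N_def split: nat.split)
  with t have "x @ [t]:trace (Suc N) ?ch" by (simp add: trace_def)
  thus "x:butlast ` trace (Suc N) ?ch" by (rule image_eqI[rotated]) simp
 qed
 moreover have "dep N (%e. EX x. P x e)"
  unfolding dep_def
 proof (intro allI impI)
  fix e e' :: "nat => 'a" assume h: "ALL i<N. e i = e' i"
  have "P x e = P x e'" for x
  proof -
   let ?c = "%e i. case i of 0 => x | Suc j => e j"
   have "P (?c e 0) (%i. ?c e (Suc i)) = P (?c e' 0) (%i. ?c e' (Suc i))"
    using h by (intro depD[OF n0]) (auto simp: N_def split: nat.split)
   thus ?thesis by simp
  qed
  thus "(EX x. P x e) = (EX x. P x e')" by simp
 qed
 ultimately show ?thesis by (intro dfnI) auto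
qed

lemma dfn_all: "dfn (%e. P (e 0) (%i. e (Suc i)))==>dfn (%e. ALL x. P x e)"
 using dfn_not[OF dfn_ex[of "%x e. ~P x e", OF dfn_not]] by simp

lemma dfn_less_var: "dfn (%e. e i<e j)"
proof -
 have "dfn (%e. e 0<e 1)"
 proof (rule dfnI[of 2])
  have "trace 2 (%e. e 0<e 1) = {[x, y] | x y. x<y}"
   by (auto simp: trace_def length_Suc_conv numeral_2_eq_2)
  thus "trace 2 (%e. e 0<e 1):S 2" using S_less by simp
 qed (auto simp: dep_def)
 from dfn_rename[OF this, of "%k. if k = 0 then i else j"] show ?thesis by simp
qed

lemma dfn_eq_var: "dfn (%e. e i = e j)"
proof -
 have "dfn (%e. e 0 = e 1)"
 proof (rule dfnI[of 2])
  show "trace 2 (%e. e 0 = e 1):S 2" using S_diag[of 0 2 1] by (simp add: trace_def)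
 qed (auto simp: dep_def)
 from dfn_rename[OF this, of "%k. if k = 0 then i else j"] show ?thesis by simp
qed

lemma dfn_eq_param: "dfn (%e. e i = c)"
proof -
 have "dfn (%e. e 0 = c)"
 proof (rule dfnI[of 1])
  have "trace 1 (%e. e 0 = c) = {[c]}" by (auto simp: trace_def length_Suc_conv)
  thus "trace 1 (%e. e 0 = c):S 1" using S_const by simp
 qed (auto simp: dep_def)
 from dfn_rename[OF this, of "%k. i"] show ?thesis by simp
qed

lemma dfn_ball_less: "(!!i. i<n==>dfn (%e. P i e))==>dfn (%e. ALL i<(n::nat). P i e)"
proof (induction n)
 case 0 show ?case using dfn_const[of True] by simp
next
 case (Suc n)
 hence "dfn (%e. (ALL i<n. P i e) & P n e)" by (intro dfn_conj) auto
 moreover have "(%e. ALL i<Suc n. P i e) = (%e. (ALL i<n. P i e) & P n e)"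
  by (auto simp: less_Suc_eq)
 ultimately show ?case by simp
qed

text \<open>A quantifier over M^n: variables 0 to n-1 hold the bound tuple and the outer variables
  are shifted by n. Bounded quantifiers over points are derived from it.\<close>

lemma dfn_exl:
 "dfn (%e. P (map e [0..<n]) (%i. e (i + n)))==>dfn (%e. EX x. length x = n & P x e)"
proof (induction n arbitrary: P)
 case 0
 thus ?case by simp
next
 case (Suc n)
 have "dfn (%e. EX x. length x = n & P (x @ [e 0]) (%i. e (Suc i)))"
  by (rule Suc.IH) (use Suc.prems in simp)
 hence "dfn (%e. EX t x. length x = n & P (x @ [t]) e)"
  by (rule dfn_ex)
 moreover have "(EX t x. length x = n & P (x @ [t]) e) = (EX x. length x = Suc n & P x e)" for e
  by (metis append_butlast_last_id length_append_singleton length_butlast diff_Suc_1 length_0_conv nat.distinct(1))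
 ultimately show ?case by simp
qed

text \<open>The language is relational, so a term is a variable or a parameter.\<close>

definition trm :: "((nat => 'a) => 'a) => bool" where
 "trm t <-> (EX i. t = (%e. e i)) | (EX c. t = (%e. c))"

definition ltrm :: "nat => ((nat => 'a) => 'a list) => bool" where
 "ltrm n xs <-> (ALL e. length (xs e) = n) & (ALL i<n. trm (%e. xs e ! i))"

lemma trm_var: "trm (%e. e i)" and trm_const: "trm (%e. c)"
 unfolding trm_def by auto

text \<open>Renaming cannot insert parameters. The terms are therefore introduced as values of
  quantified variables that are set equal to them.\<close>

lemma dfn_subst: assumes "dfn ph" "!!i. trm (t i)" shows "dfn (%e. ph (%i. t i e))"
proof -
 obtain n where n: "dep n ph" using assms unfolding dfn_def by blast
 have 1: "ph ((!) (map e [0..<n])) = ph e" for e by (rule depD[OF n]) simp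
 have "dfn (%e. e i = t i (%j. e (j + n)))" for i
  using assms(2)[of i] dfn_eq_var dfn_eq_param unfolding trm_def by auto
 hence "dfn (%e. (ALL i<n. e i = t i (%j. e (j + n))) & ph e)"
  by (intro dfn_conj dfn_ball_less assms(1)) auto
 hence "dfn (%e. (ALL i<n. map e [0..<n] ! i = t i (%j. e (j + n))) & ph ((!) (map e [0..<n])))"
  unfolding 1 by simp
 hence "dfn (%e. EX x. length x = n & ((ALL i<n. x ! i = t i e) & ph ((!) x)))"
  by (rule dfn_exl)
 moreover have "(EX x. length x = n & ((ALL i<n. x ! i = t i e) & ph ((!) x))) = ph (%i. t i e)" for e
 proof
  assume "EX x. length x = n & ((ALL i<n. x ! i = t i e) & ph ((!) x))"
  then obtain x where x: "ALL i<n. x ! i = t i e" "ph ((!) x)" by blast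
  from x(1) have "ph ((!) x) = ph (%i. t i e)" by (intro depD[OF n]) simp
  with x show "ph (%i. t i e)" by simp
 next
  assume h: "ph (%i. t i e)"
  have "ph ((!) (map (%i. t i e) [0..<n])) = ph (%i. t i e)" by (intro depD[OF n]) simp
  with h show "EX x. length x = n & ((ALL i<n. x ! i = t i e) & ph ((!) x))"
   by (intro exI[of _ "map (%i. t i e) [0..<n]"]) simp
 qed
 ultimately show ?thesis by simp
qed

lemma dfn_subst2:
 assumes "dfn (%e. R (e 0) (e 1))" "trm s" "trm t" shows "dfn (%e. R (s e) (t e))"
 using dfn_subst[OF assms(1), of "%i. if i = 0 then s else t"] assms(2,3) by simp

lemma dfn_less: "trm s==>trm t==>dfn (%e. s e<t e)"
 using dfn_subst2[OF dfn_less_var[of 0 1]] .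

lemma dfn_eq: "trm s==>trm t==>dfn (%e. s e = t e)"
 using dfn_subst2[OF dfn_eq_var[of 0 1]] .

lemma dfn_le: "trm s==>trm t==>dfn (%e. s e<=t e)"
 using dfn_not[OF dfn_less[of t s]] by (simp add: not_less)

lemma ltrm_vars: "ltrm n (%e. map (%i. e (f i)) [0..<n])"
 unfolding ltrm_def by (simp add: trm_var)

lemma ltrm_const: "length c = n==>ltrm n (%e. c)"
 unfolding ltrm_def by (simp add: trm_const)

lemma ltrm_append: "ltrm n xs==>ltrm m ys==>ltrm (n + m) (%e. xs e @ ys e)"
 unfolding ltrm_def
proof (intro conjI allI impI; elim conjE)
 fix i assume h: "ALL e. length (xs e) = n" "ALL i<n. trm (%e. xs e ! i)" "ALL i<m. trm (%e. ys e ! i)" "i<n + m"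
 show "trm (%e. (xs e @ ys e) ! i)"
  using h by (cases "i<n") (simp_all add: nth_append)
qed simp

lemma ltrm_Cons: assumes "trm t" "ltrm n xs" shows "ltrm (Suc n) (%e. t e # xs e)"
 unfolding ltrm_def
proof (intro conjI allI impI)
 fix i assume "i<Suc n"
 thus "trm (%e. (t e # xs e) ! i)" using assms by (cases i) (auto simp: ltrm_def)
qed (use assms in "auto simp: ltrm_def")

lemma ltrm_Nil: "ltrm 0 (%e. [])"
 unfolding ltrm_def by simp

lemma trm_nth: "ltrm n xs==>i<n==>trm (%e. xs e ! i)"
 unfolding ltrm_def by simp

lemma dep_map: "dep n (%e. ph (map e [0..<n]))"
 unfolding dep_def
proof (intro allI impI)
 fix e e' :: "nat => 'a" assume "ALL i<n. e i = e' i"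
 hence "map e [0..<n] = map e' [0..<n]" by simp
 thus "ph (map e [0..<n]) = ph (map e' [0..<n])" by (rule arg_cong)
qed

lemma dfn_mem: assumes "A:S n" "ltrm m xs" "m = n" shows "dfn (%e. xs e:A)"
proof -
 have "map ((!) x) [0..<n] = x" if "length x = n" for x :: "'a list" using map_nth[of x] that by simp
 hence "trace n (%e. map e [0..<n]:A) = A"
  using S_len[OF assms(1)] by (auto simp: trace_def)
 hence "dfn (%e. map e [0..<n]:A)"
  using assms(1) by (intro dfnI[of n] dep_map) simp
 from dfn_subst[OF this, of "%i. if i<n then (%e. xs e ! i) else (%e. e 0)"]
 have 1: "dfn (%e. map (%i. (if i<n then (%e. xs e ! i) else (%e. e 0)) e) [0..<n]:A)"
  using assms trm_nth trm_var by simp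
 have "map (%i. (if i<n then (%e. xs e ! i) else (%e. e 0)) e) [0..<n] = xs e" for e
  using assms by (intro nth_equalityI) (auto simp: ltrm_def)
 with 1 show ?thesis by simp
qed

lemma S_I: assumes "dfn (%e. ph (map e [0..<n]))" shows "{x. length x = n & ph x}:S n"
proof -
 from trace_exact[OF assms dep_map] have "trace n (%e. ph (map e [0..<n])):S n" .
 moreover have "trace n (%e. ph (map e [0..<n])) = {x. length x = n & ph x}"
  unfolding trace_def using map_nth by (metis (no_types, lifting))
 ultimately show ?thesis by simp
qed

lemma dfn_bex: "A:S n==>dfn (%e. P (map e [0..<n]) (%i. e (i + n)))==>dfn (%e. EX x:A. P x e)"
proof -
 assume A: "A:S n" and P: "dfn (%e. P (map e [0..<n]) (%i. e (i + n)))"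
 have "dfn (%e. EX x. length x = n & (x:A & P x e))"
  by (intro dfn_exl dfn_conj dfn_mem[OF A ltrm_vars] P refl)
 moreover have "(EX x. length x = n & (x:A & P x e)) = (EX x:A. P x e)" for e
  using S_len[OF A] by auto
 ultimately show ?thesis by simp
qed

lemma dfn_ball: "A:S n==>dfn (%e. P (map e [0..<n]) (%i. e (i + n)))==>dfn (%e. ALL x:A. P x e)"
 using dfn_not[OF dfn_bex[of A n "%x e. ~P x e", OF _ dfn_not]] by simp

lemma dfn_bexl: "dfn (%e. P (map e [0..<n]) (%i. e (i + n)))==>dfn (%e. EX x:{x. length x = n}. P x e)"
 by (rule dfn_bex[OF S_UNIV])

lemma dfn_balll: "dfn (%e. P (map e [0..<n]) (%i. e (i + n)))==>dfn (%e. ALL x:{x. length x = n}. P x e)"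
 by (rule dfn_ball[OF S_UNIV])

lemma dfn_section:
 assumes "dfn (%e. P (e 0) (%i. e (Suc i)))" shows "dfn (%e. P (e 0) e')"
 using dfn_subst[OF assms, of "case_nat (%e. e 0) (%i e. e' i)"]
 by (auto simp: trm_var trm_const split: nat.split)

section \<open>The line\<close>

text \<open>What is kept of a finite union of points and intervals: one-sided germs are decided,
  also near minus infinity, and bounded nonempty sets have suprema and infima in the line, which
  itself need not be complete.\<close>

definition germ :: "'a set => bool" where
 "germ X <-> (ALL x. EX v>x. {x<..<v}<=X | {x<..<v} Int X = {}) &
  (ALL x. EX u<x. {u<..<x}<=X | {u<..<x} Int X = {}) &
  (EX v. {..<v}<=X | {..<v} Int X = {}) &
  (X~={} --> (EX b. ALL x:X. x<=b) --> (EX s. (ALL x:X. x<=s) & (ALL u<s. EX x:X. u<x))) &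
  (X~={} --> (EX b. ALL x:X. b<=x) --> (EX s. (ALL x:X. s<=x) & (ALL u>s. EX x:X. x<u)))"

lemma germ_right: "germ X==>EX v>x. {x<..<v}<=X | {x<..<v} Int X = {}"
 and germ_left: "germ X==>EX u<x. {u<..<x}<=X | {u<..<x} Int X = {}"
 and germ_bot: "germ X==>EX v. {..<v}<=X | {..<v} Int X = {}"
 unfolding germ_def by simp_all

lemma germ_sup: "germ X==>X~={}==>ALL x:X. x<=b==>EX s. (ALL x:X. x<=s) & (ALL u<s. EX x:X. u<x)"
 and germ_inf: "germ X==>X~={}==>ALL x:X. b<=x==>EX s. (ALL x:X. s<=x) & (ALL u>s. EX x:X. x<u)"
 unfolding germ_def by blast+

lemma germ_Un: assumes "germ X" "germ Y" shows "germ (X Un Y)"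
 unfolding germ_def
proof (intro conjI allI impI)
 fix x
 obtain v w where v: "v > x" "{x<..<v}<=X | {x<..<v} Int X = {}" "w > x" "{x<..<w}<=Y | {x<..<w} Int Y = {}"
  using germ_right[OF assms(1), of x] germ_right[OF assms(2), of x] by blast
 have "{x<..<min v w}<=X Un Y | {x<..<min v w} Int (X Un Y) = {}"
  using v(2,4) by fastforce
 thus "EX v>x. {x<..<v}<=X Un Y | {x<..<v} Int (X Un Y) = {}"
  using v(1,3) by (intro exI[of _ "min v w"]) simp
next
 fix x
 obtain v w where v: "v<x" "{v<..<x}<=X | {v<..<x} Int X = {}" "w<x" "{w<..<x}<=Y | {w<..<x} Int Y = {}"
  using germ_left[OF assms(1), of x] germ_left[OF assms(2), of x] by blast
 have "{max v w<..<x}<=X Un Y | {max v w<..<x} Int (X Un Y) = {}"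
  using v(2,4) by fastforce
 thus "EX v<x. {v<..<x}<=X Un Y | {v<..<x} Int (X Un Y) = {}"
  using v(1,3) by (intro exI[of _ "max v w"]) simp
next
 obtain v w where v: "{..<v}<=X | {..<v} Int X = {}" "{..<w}<=Y | {..<w} Int Y = {}"
  using germ_bot[OF assms(1)] germ_bot[OF assms(2)] by blast
 have "{..<min v w}<=X Un Y | {..<min v w} Int (X Un Y) = {}"
  using v by fastforce
 thus "EX v. {..<v}<=X Un Y | {..<v} Int (X Un Y) = {}" by blast
next
 assume ne: "X Un Y~={}" and "EX b. ALL x:X Un Y. x<=b"
 then obtain b where b: "ALL x:X. x<=b" "ALL x:Y. x<=b" by blast
 show "EX s. (ALL x:X Un Y. x<=s) & (ALL u<s. EX x:X Un Y. u<x)"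
 proof (cases "X = {} | Y = {}")
  case True
  thus ?thesis
  proof
   assume "X = {}" thus ?thesis using germ_sup[OF assms(2) _ b(2)] ne by simp
  next
   assume "Y = {}" thus ?thesis using germ_sup[OF assms(1) _ b(1)] ne by simp
  qed
 next
  case False
  then obtain s t where st: "ALL x:X. x<=s" "ALL u<s. EX x:X. u<x" "ALL x:Y. x<=t" "ALL u<t. EX x:Y. u<x"
   using germ_sup[OF assms(1) _ b(1)] germ_sup[OF assms(2) _ b(2)] by blast
  show ?thesis
  proof (intro exI[of _ "max s t"] conjI allI impI ballI)
   fix x assume "x:X Un Y" thus "x<=max s t" using st(1,3) by (auto simp: le_max_iff_disj)
  next
   fix u assume "u<max s t" thus "EX x:X Un Y. u<x" using st(2,4) by (auto simp: less_max_iff_disj)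
  qed
 qed
next
 assume ne: "X Un Y~={}" and "EX b. ALL x:X Un Y. b<=x"
 then obtain b where b: "ALL x:X. b<=x" "ALL x:Y. b<=x" by blast
 show "EX s. (ALL x:X Un Y. s<=x) & (ALL u>s. EX x:X Un Y. x<u)"
 proof (cases "X = {} | Y = {}")
  case True
  thus ?thesis
  proof
   assume "X = {}" thus ?thesis using germ_inf[OF assms(2) _ b(2)] ne by simp
  next
   assume "Y = {}" thus ?thesis using germ_inf[OF assms(1) _ b(1)] ne by simp
  qed
 next
  case False
  then obtain s t where st: "ALL x:X. s<=x" "ALL u>s. EX x:X. x<u" "ALL x:Y. t<=x" "ALL u>t. EX x:Y. x<u"
   using germ_inf[OF assms(1) _ b(1)] germ_inf[OF assms(2) _ b(2)] by blast
  show ?thesis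
  proof (intro exI[of _ "min s t"] conjI allI impI ballI)
   fix x assume "x:X Un Y" thus "min s t<=x" using st(1,3) by (auto simp: min_le_iff_disj)
  next
   fix u assume "u > min s t" thus "EX x:X Un Y. x<u" using st(2,4) by (auto simp: min_less_iff_disj)
  qed
 qed
qed

lemma germ_empty: "germ {}"
 unfolding germ_def using no_top no_bot by auto

lemma germ_point: "germ {c}"
 unfolding germ_def
proof (intro conjI allI impI)
 fix x
 show "EX v>x. {x<..<v}<={c} | {x<..<v} Int {c} = {}"
  using no_top[of x] by (cases "x<c") (auto intro: exI[of _ c])
 show "EX v<x. {v<..<x}<={c} | {v<..<x} Int {c} = {}"
  using no_bot[of x] by (cases "c<x") (auto intro: exI[of _ c])
qed (auto intro: exI[of _ c])

lemma open_interval_ray: "x:open_interval lo hi==>x<y==>y~:open_interval lo hi==>EX b. hi = Some b & b<=y"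
 "x:open_interval lo hi==>y<x==>y~:open_interval lo hi==>EX a. lo = Some a & y<=a"
 unfolding open_interval_def by (cases lo; cases hi; force)+

lemma germ_interval: "germ (open_interval lo hi)"
 unfolding germ_def
proof (intro conjI allI impI)
 let ?I = "open_interval lo hi"
 fix x :: 'a
 obtain y z where yz: "y<x" "x<z" using no_bot no_top by blast
 show "EX v>x. {x<..<v}<=?I | {x<..<v} Int ?I = {}"
 proof (cases "EX b. hi = Some b & b<=x")
  case True
  hence "{x<..<z} Int ?I = {}" by (auto simp: open_interval_def)
  thus ?thesis using yz by blast
 next
  case hi: False
  show ?thesis
  proof (cases "EX a. lo = Some a & x<a")
   case True
   then obtain a where a: "lo = Some a" "x<a" by blast
   hence "{x<..<a} Int ?I = {}" by (auto simp: open_interval_def)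
   thus ?thesis using a by blast
  next
   case False
   let ?v = "case hi of None => z | Some b => b"
   have "{x<..<?v}<=?I"
    using False by (cases lo; cases hi) (auto simp: open_interval_def)
   moreover have "x<?v" using hi yz by (cases hi) auto
   ultimately show ?thesis by blast
  qed
 qed
 show "EX v<x. {v<..<x}<=?I | {v<..<x} Int ?I = {}"
 proof (cases "EX a. lo = Some a & x<=a")
  case True
  hence "{y<..<x} Int ?I = {}" by (auto simp: open_interval_def)
  thus ?thesis using yz by blast
 next
  case lo: False
  show ?thesis
  proof (cases "EX b. hi = Some b & b<x")
   case True
   then obtain b where b: "hi = Some b" "b<x" by blast
   hence "{b<..<x} Int ?I = {}" by (auto simp: open_interval_def)
   thus ?thesis using b by blast
  next
   case False
   let ?v = "case lo of None => y | Some b => b"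
   have "{?v<..<x}<=?I"
    using False by (cases lo; cases hi) (auto simp: open_interval_def)
   moreover have "?v<x" using lo yz by (cases lo) auto
   ultimately show ?thesis by blast
  qed
 qed
next
 let ?I = "open_interval lo hi"
 show "EX v. {..<v}<=?I | {..<v} Int ?I = {}"
  by (cases lo; cases hi) (auto simp: open_interval_def intro: exI[of _ "the lo"] exI[of _ "the hi"])
next
 let ?I = "open_interval lo hi"
 assume ne: "?I~={}" and "EX b. ALL x:?I. x<=b"
 then obtain x c where x: "x:?I" and c: "ALL x:?I. x<=c" by auto
 obtain c' where "c<c'" using no_top by blast
 hence "c'~:?I" "x<c'" using c x by auto
 then obtain b where b: "hi = Some b" using open_interval_ray(1)[OF x] by blast
 show "EX s. (ALL x:?I. x<=s) & (ALL u<s. EX x:?I. u<x)"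
 proof (intro exI[of _ b] conjI allI impI)
  fix u assume "u<b"
  moreover have "x<b" using x b by (simp add: open_interval_def)
  ultimately obtain z where z: "max u x<z" "z<b" using dense[of "max u x" b] by auto
  thus "EX x:?I. u<x" using x b by (intro bexI[of _ z]) (auto simp: open_interval_def)
 qed (use b in "auto simp: open_interval_def")
next
 let ?I = "open_interval lo hi"
 assume ne: "?I~={}" and "EX b. ALL x:?I. b<=x"
 then obtain x c where x: "x:?I" and c: "ALL x:?I. c<=x" by auto
 obtain c' where "c'<c" using no_bot by blast
 hence "c'~:?I" "c'<x" using c x by auto
 then obtain a where a: "lo = Some a" using open_interval_ray(2)[OF x] by blast
 show "EX s. (ALL x:?I. s<=x) & (ALL u>s. EX x:?I. x<u)"
 proof (intro exI[of _ a] conjI allI impI)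
  fix u assume "a<u"
  moreover have "a<x" using x a by (simp add: open_interval_def)
  ultimately obtain z where z: "a<z" "z<min u x" using dense[of a "min u x"] by auto
  thus "EX x:?I. x<u" using x a by (intro bexI[of _ z]) (auto simp: open_interval_def)
 qed (use a in "auto simp: open_interval_def")
qed

lemma dfn1_form:
 assumes "dfn (%e. e 0:X)"
 obtains F I where "finite F" "finite I" "X = F Un (UN (lo, hi):I. open_interval lo hi)"
proof -
 have "trace 1 (%e. e 0:X):S 1" using assms by (rule trace_exact) (simp add: dep_def)
 moreover have "trace 1 (%e. e 0:X) = {[x] |x. x:X}"
 proof (intro Set.set_eqI iffI)
  fix z assume "z:trace 1 (%e. e 0:X)"
  thus "z:{[x] |x. x:X}" by (cases z) (auto simp: trace_def)
 qed (auto simp: trace_def)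
 ultimately have "{[x] |x. x:X}:S 1" by simp
 from S_omin[OF this] obtain F I where FI: "finite F" "finite I"
  and e: "{[x] |x. x:X} = {[x] | x. x:F Un (UN (lo, hi):I. open_interval lo hi)}" by (elim exE conjE)
 have "X = F Un (UN (lo, hi):I. open_interval lo hi)"
 proof (rule Set.set_eqI)
  fix x
  have "[x]:{[x] |x. x:X} <-> [x]:{[x] | x. x:F Un (UN (lo, hi):I. open_interval lo hi)}" by (simp only: e)
  thus "x:X <-> x:F Un (UN (lo, hi):I. open_interval lo hi)" by simp
 qed
 with FI show ?thesis by (rule that)
qed

lemma dfn1_germ: assumes "dfn (%e. e 0:X)" shows "germ X"
proof -
 obtain F I where FI: "finite F" "finite I" "X = F Un (UN (lo, hi):I. open_interval lo hi)"
  using dfn1_form[OF assms] .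
 have "germ F" using FI(1)
 proof (induction F)
  case (insert x F) thus ?case using germ_Un[OF germ_point, of F x] by simp
 qed (rule germ_empty)
 moreover have "germ (UN (lo, hi):I. open_interval lo hi)" using FI(2)
 proof (induction I)
  case (insert x F)
  thus ?case using germ_Un[OF germ_interval, of "UN (lo, hi):F. open_interval lo hi" "fst x" "snd x"]
   by (simp add: case_prod_unfold)
 qed (simp add: germ_empty)
 ultimately show ?thesis using germ_Un FI(3) by simp
qed

lemma dfn1_infinite: assumes "dfn (%e. e 0:X)" "infinite X" shows "EX a b. a<b & {a<..<b}<=X"
proof -
 obtain F I where FI: "finite F" "finite I" "X = F Un (UN (lo, hi):I. open_interval lo hi)"
  using dfn1_form[OF assms(1)] .
 obtain lo hi x where lh: "(lo, hi):I" "x:open_interval lo hi"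
  using assms(2) FI by (auto; metis all_not_in_conv finite.emptyI)
 obtain y z where yz: "y<x" "x<z" using no_bot no_top by blast
 let ?a = "case lo of None => y | Some a => a" and ?b = "case hi of None => z | Some b => b"
 have "?a<?b" using lh(2) yz by (auto simp: open_interval_def split: option.split)
 moreover have "{?a<..<?b}<=open_interval lo hi" by (auto simp: open_interval_def split: option.split)
 ultimately show ?thesis using lh(1) FI(3) by blast
qed

lemma interval_infinite: assumes "a<(b::'a)" shows "infinite {a<..<b}"
proof
 assume f: "finite {a<..<b}"
 have "{a<..<b}~={}" using dense[OF assms] by auto
 hence m: "Min {a<..<b}:{a<..<b}" using f by (rule Min_in[rotated])
 then obtain z where z: "a<z" "z<Min {a<..<b}" using dense by auto
 hence "z:{a<..<b}" using m by auto
 thus False using f z Min_le leD by blast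
qed

lemma infinite_iff_interval:
 "dfn (%e. e 0:X)==>infinite X <-> (EX a b. a<b & {a<..<b}<=X)"
 using dfn1_infinite interval_infinite finite_subset by metis

text \<open>Infinity of a definable subset of the line is first order, since it means containing an
  interval. This makes dimension a definable notion.\<close>

lemma dfn_infinite:
 assumes "dfn (%e. P (e 0) (%i. e (Suc i)))" shows "dfn (%e. infinite {t. P t e})"
proof -
 have "infinite {t. P t e} = (EX a b. a<b & (ALL t. a<t & t<b --> P t e))" for e
 proof -
  have "infinite {t. P t e} = (EX a b. a<b & {a<..<b}<={t. P t e})"
   using infinite_iff_interval[of "{t. P t e}"] dfn_section[OF assms, of e] by simp
  also have "... = (EX a b. a<b & (ALL t. a<t & t<b --> P t e))" by (simp add: subset_iff)
  finally show ?thesis .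
 qed
 \<comment> \<open>Under the three binders a, b, t the variable t has number 0 and the outer
   variables begin at 3.\<close>
 moreover have "dfn (%e. EX a b. a<b & (ALL t. a<t & t<b --> P t e))"
  using dfn_rename[OF assms, of "case_nat 0 (%i. i + 3)"]
  by (intro dfn_ex dfn_conj dfn_all dfn_imp dfn_less trm_var) (simp add: numeral_3_eq_3)
 ultimately show ?thesis by simp
qed

end

text \<open>The order is an explicit relation so that the same argument can be instantiated with
  \<open><\<close> and with \<open>>\<close>. \<open>DD\<close> stands for definability; of
  o-minimality only left germs and suprema are kept, which become right germs and infima after
  reversal.\<close>

locale oline =
 fixes lt :: "'a => 'a => bool" (infix "<<" 50) and DD :: "'a set => bool"
 assumes irr: "~x << x" and tr: "x << y==>y << z==>x << z" and tot: "x~=y==>x << y | y << x"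
  and dns: "x << y==>EX z. x << z & z << y"
  and gl: "DD X==>EX u. u << x & ((ALL y. u << y & y << x --> y:X) | (ALL y. u << y & y << x --> y~:X))"
  and sp: "DD X==>X~={}==>ALL x:X. ~b << x==>EX s. (ALL x:X. ~s << x) & (ALL u. u << s --> (EX x:X. u << x))"
begin

lemma mx: "u << s==>x << s==>EX w. w << s & (w = u | u << w) & (w = x | x << w)"
 using tot by blast

text \<open>Read \<open>pr x y\<close> as: the value at x is at most the value at y. At a jump all
  values just before t exceed all values just after t.\<close>

definition jump :: "('a => 'a => bool) => 'a => bool" where
 "jump pr t <-> (EX u v. u << t & t << v & (ALL y1 y2. u << y1 & y1 << t & t << y2 & y2 << v --> ~pr y1 y2))"

text \<open>If every point is a strict local minimum, then near the right end every point is a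
 downward jump; applied to the reversed order it also yields upward jumps, which is absurd.\<close>

lemma local_min_jump:
 assumes pq: "p << q" and total: "!!x y. pr x y | pr y x" and trans: "!!x y z. pr x y==>pr y z==>pr x z"
  and lm: "!!x. p << x==>x << q==>EX u v. u << x & x << v & (ALL y. u << y & y << v & y~=x --> ~pr y x)"
  and D1: "!!x. DD {y. x << y & y << q & pr y x}" and D2: "!!x. DD {y. x << y & y << q & ~pr y x}"
  and D3: "DD {x. p << x & x << q & (ALL y. x << y & y << q --> ~pr y x)}" and D4: "DD {t. jump pr t}"
 shows "EX d. (d = p | p << d) & d << q & (ALL t. d << t & t << q --> jump pr t)"
proof -
 \<comment> \<open>The points that lie strictly below everything to their right, up to
   \<open>q\<close>.\<close>
 define B where "B = {x. p << x & x << q & (ALL y. x << y & y << q --> ~pr y x)}"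
 obtain u0 where u0: "u0 << q" "(ALL y. u0 << y & y << q --> y:B) | (ALL y. u0 << y & y << q --> y~:B)"
  using gl[OF D3[folded B_def], of q] by blast
 obtain p1 where p1: "p1 << q" "p1 = u0 | u0 << p1" "p1 = p | p << p1" using mx[OF u0(1) pq] by blast
 \<comment> \<open>If \<open>B\<close> contained a point this far right, it would contain a whole
   left neighbourhood of q. A point z of \<open>B\<close> slightly left of y is then below y, but y
   is a strict local minimum, so z is above y.\<close>
 have noB: "y~:B" if h: "p1 << y" "y << q" for y
 proof
  assume "y:B"
  have "u0 << y" using p1 h tr by blast
  with \<open>y:B\<close> u0(2) h have all: "ALL y. u0 << y & y << q --> y:B" by blast
  have "p << y" using p1 h tr by blast
  obtain u v where uv: "u << y" "ALL z. u << z & z << v & z~=y --> ~pr z y" "y << v"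
   using lm[OF \<open>p << y\<close> h(2)] by blast
  obtain w where w: "w << y" "w = u | u << w" "w = p1 | p1 << w" using mx[OF uv(1) h(1)] by blast
  obtain z where z: "w << z" "z << y" using dns[OF w(1)] by blast
  have "u0 << z" using z w p1 tr by blast
  hence "z:B" using all z h tr by blast
  hence "~pr y z" using z h by (auto simp: B_def)
  moreover have "u << z" "z << v" "z~=y" using z w uv tr irr by blast+
  hence "~pr z y" using uv(2) by blast
  ultimately show False using total by blast
 qed
 have ex: "EX b. x << b & b << q & jump pr b" if x: "p1 << x" "x << q" for x
 proof -
  have px: "p << x" using p1 x tr by blast
  define Y where "Y = {y. x << y & y << q & pr y x}"
  define N where "N = {y. x << y & y << q & ~pr y x}"
  have "x~:B" using noB x by blast
  then obtain y0 where y0: "y0:Y" using px x by (auto simp: B_def Y_def)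
  obtain d where d: "d << q" "(ALL y. d << y & y << q --> y:Y) | (ALL y. d << y & y << q --> y~:Y)"
   using gl[OF D1[of x, folded Y_def], of q] by blast
  \<comment> \<open>Otherwise the supremum s of \<open>Y\<close> lies before q. If s is at most x in
    value, everything after s is above it and s belongs to \<open>B\<close>; if s is above x, the
    points of \<open>Y\<close> near s are below s, against its local minimality.\<close>
  have dY: "ALL y. d << y & y << q --> y:Y"
  proof (rule ccontr)
   assume "~?thesis"
   with d(2) have dj: "ALL y. d << y & y << q --> y~:Y" by blast
   have "ALL y:Y. ~d << y" using dj by (auto simp: Y_def)
   then obtain s where s: "ALL y:Y. ~s << y" "ALL u. u << s --> (EX y:Y. u << y)"
    using sp[OF D1[of x, folded Y_def]] y0 by blast
   have "~s << y0" using s y0 by blast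
   moreover have "x << y0" using y0 by (simp add: Y_def)
   ultimately have xs: "x << s" using tot[of s y0] tr[of x y0 s] by blast
   have sq: "s << q"
   proof (rule ccontr)
    assume "~s << q"
    hence "d << s" using d(1) tot[of s q] tr[of d q s] by blast
    then obtain y where "y:Y" "d << y" using s by blast
    thus False using dj by (auto simp: Y_def)
   qed
   have ps: "p << s" "p1 << s" using px x xs tr by blast+
   show False
   proof (cases "pr s x")
    case True
    have "s:B" unfolding B_def
    proof (intro CollectI conjI allI impI ps sq)
     fix y assume y: "s << y & y << q"
     hence "y~:Y" using s by blast
     hence "~pr y x" using y xs tr unfolding Y_def by blast
     thus "~pr y s" using True trans by blast
    qed
    thus False using noB ps sq by blast
   next
    case False
    obtain u v where uv: "u << s" "s << v" "ALL z. u << z & z << v & z~=s --> ~pr z s" using lm[OF ps(1) sq] by blast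
    obtain y where y: "y:Y" "u << y" using s uv by blast
    have "y~=s" using y False by (auto simp: Y_def)
    hence "y << s" using s y tot by blast
    hence "~pr y s" using uv y tr \<open>y~=s\<close> by blast
    moreover have "pr y x" "pr x s" using y False total by (auto simp: Y_def)
    ultimately show False using trans by blast
   qed
  qed
  obtain u v where uv: "u << x" "x << v" "ALL z. u << z & z << v & z~=x --> ~pr z x" using lm[OF px x(2)] by blast
  have "EX m. x << m & m << v & m << q"
  proof (cases "v << q")
   case True thus ?thesis using dns[OF uv(2)] tr by blast
  next
   case False
   hence "q = v | q << v" using tot by blast
   thus ?thesis using dns[OF x(2)] tr by blast
  qed
  then obtain m where m: "x << m" "m << v" "m << q" by blast
  hence mN: "m:N" using uv irr tr unfolding N_def by blast
  \<comment> \<open>\<open>N\<close> is nonempty because points just after x are above x. Its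
    supremum b is the last passage from values above x to values at most x.\<close>
  have "ALL y:N. ~d << y" using dY by (auto simp: Y_def N_def)
  then obtain b where b: "ALL y:N. ~b << y" "ALL u. u << b --> (EX y:N. u << y)"
   using sp[OF D2[of x, folded N_def]] mN by blast
  have xb: "x << b" using b(1) mN m(1) tot[of b m] tr[of x m b] by blast
  have bq: "b << q"
  proof (rule ccontr)
   assume "~b << q"
   hence "d << b" using d(1) tot[of b q] tr[of d q b] by blast
   then obtain y where "y:N" "d << y" using b by blast
   thus False using dY by (auto simp: Y_def N_def)
  qed
  have pb: "p << b" using px xb tr by blast
  obtain c where c: "c << b" "(ALL y. c << y & y << b --> y:N) | (ALL y. c << y & y << b --> y~:N)"
   using gl[OF D2[of x, folded N_def], of b] by blast
  have cN: "ALL y. c << y & y << b --> y:N"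
  proof (rule ccontr)
   assume "~?thesis"
   with c(2) have dj: "ALL y. c << y & y << b --> y~:N" by blast
   obtain y where y: "y:N" "c << y" using b c by blast
   hence "y = b" using dj b tot by blast
   hence nb: "~pr b x" using y by (auto simp: N_def)
   obtain u v where uv: "u << b" "b << v" "ALL z. u << z & z << v & z~=b --> ~pr z b" using lm[OF pb bq] by blast
   obtain w where w: "w << b" "w = u | u << w" "w = c | c << w" using mx[OF uv(1) c(1)] by blast
   obtain w' where w': "w' << b" "w' = w | w << w'" "w' = x | x << w'" using mx[OF w(1) xb] by blast
   obtain z where z: "w' << z" "z << b" using dns[OF w'(1)] by blast
   have zz: "u << z" "c << z" "x << z" using z w w' tr by blast+
   have "z << q" "z << v" "z~=b" using z bq uv tr irr by blast+
   hence "pr z x" "~pr z b" using dj z zz uv unfolding N_def by blast+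
   moreover have "pr x b" using nb total by blast
   ultimately show False using trans by blast
  qed
  \<comment> \<open>The value at x separates the two sides: just before b lies \<open>N\<close>,
    after b lies \<open>Y\<close>.\<close>
  have "jump pr b" unfolding jump_def
  proof (intro exI conjI allI impI)
   show "c << b" "b << q" by fact+
   fix y1 y2 assume y: "c << y1 & y1 << b & b << y2 & y2 << q"
   hence "~pr y1 x" using cN by (auto simp: N_def)
   moreover have "y2~:N" using b y by blast
   hence "pr y2 x" using y xb tr unfolding N_def by blast
   ultimately show "~pr y1 y2" using trans by blast
  qed
  thus ?thesis using xb bq by blast
 qed
 \<comment> \<open>Jumps occur after every point near q, and they form a definable set, so they fill
   an interval ending at q.\<close>
 obtain d where d: "d << q" "(ALL y. d << y & y << q --> y:{t. jump pr t}) | (ALL y. d << y & y << q --> y~:{t. jump pr t})"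
  using gl[OF D4, of q] by blast
 obtain w where w: "w << q" "w = p1 | p1 << w" "w = d | d << w" using mx[OF p1(1) d(1)] by blast
 obtain x where x: "w << x" "x << q" using dns[OF w(1)] by blast
 have "p1 << x" using x w tr by blast
 then obtain b where b: "x << b" "b << q" "jump pr b" using ex x by blast
 have "d << b" using b x w tr by blast
 hence "ALL y. d << y & y << q --> jump pr y" using d(2) b by blast
 hence "ALL y. w << y & y << q --> jump pr y" using w tr by blast
 moreover have "w = p | p << w" using w p1 tr by blast
 ultimately show ?thesis using w by blast
qed

end

section \<open>Monotonicity for definable preorders and the planar exchange of rows and
  columns\<close>

context omin
begin

lemmas dfnr = dfn_conj dfn_disj dfn_not dfn_imp dfn_iff dfn_ex dfn_all dfn_less dfn_le dfn_eq trm_var trm_const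

lemma oline_less: "oline (<) (%X. dfn (%e. e 0:X))"
proof (unfold_locales, goal_cases)
 case (4 x y) thus ?case using dense by blast
next
 case (5 X x) thus ?case using germ_left[OF dfn1_germ, of X x] by fastforce
next
 case (6 X b)
 thus ?case using germ_sup[OF dfn1_germ, of X b] by (simp add: not_less)
qed auto

lemma oline_greater: "oline (>) (%X. dfn (%e. e 0:X))"
proof (unfold_locales, goal_cases)
 case (4 x y) thus ?case using dense by blast
next
 case (5 X x) thus ?case using germ_right[OF dfn1_germ, of X x] by fastforce
next
 case (6 X b)
 thus ?case using germ_inf[OF dfn1_germ, of X b] by (simp add: not_less)
qed auto

text \<open>Applied to the order and then to its reverse on the interval found first,
  \<open>local_min_jump\<close> yields a point that is a jump in both directions. Two values on its
  two sides would then be incomparable.\<close>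

lemma no_local_min:
 assumes prd: "dfn (%e. pr (e 0) (e 1))" and total: "!!x y. pr x y | pr y x" and trans: "!!x y z. pr x y==>pr y z==>pr x z"
  and pq: "p<q" and lm: "!!x. p<x==>x<q==>EX u v. u<x & x<v & (ALL y. u<y & y<v & y~=x --> ~pr y x)"
 shows False
proof -
 note rr = dfnr dfn_subst2[OF prd]
 interpret L: oline "(<)" "%X. dfn (%e. e 0:X)" by (rule oline_less)
 interpret R: oline "(>)" "%X. dfn (%e. e 0:X)" by (rule oline_greater)
 have "EX d. (d = p | p<d) & d<q & (ALL t. d<t & t<q --> L.jump pr t)"
  by (rule L.local_min_jump[OF pq total trans lm])
    (simp_all only: mem_Collect_eq L.jump_def, (intro rr)+)
 then obtain d where d0: "d = p | p<d" and d': "d<q" "ALL t. d<t & t<q --> L.jump pr t" by blast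
 have d: "p<=d" "d<q" "ALL t. d<t & t<q --> L.jump pr t" using d0 d' by auto
 have "EX c. (c = q | c<q) & d<c & (ALL t. t<c & d<t --> R.jump pr t)"
 proof (rule R.local_min_jump[OF d(2) total trans])
  fix x assume "x<q" "d<x"
  thus "EX u v. x<u & v<x & (ALL y. y<u & v<y & y~=x --> ~pr y x)"
   using lm[of x] d by (meson le_less_trans)
 qed (simp_all only: mem_Collect_eq R.jump_def, (intro rr)+)
 then obtain c where c0: "c = q | c<q" and c': "d<c" "ALL t. t<c & d<t --> R.jump pr t" by blast
 have c: "d<c" "c<=q" "ALL t. t<c & d<t --> R.jump pr t" using c0 c' by auto
 obtain t where t: "d<t" "t<c" using dense c by blast
 have "L.jump pr t" "R.jump pr t" using t c d by auto
 then obtain u v u' v' where j: "u<t" "t<v" "ALL y1 y2. u<y1 & y1<t & t<y2 & y2<v --> ~pr y1 y2"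
  "t<u'" "v'<t" "ALL y1 y2. y1<u' & t<y1 & y2<t & v'<y2 --> ~pr y1 y2"
  unfolding L.jump_def R.jump_def by blast
 obtain y1 where y1: "max u v'<y1" "y1<t" using dense[of "max u v'" t] j by auto
 obtain y2 where y2: "t<y2" "y2<min v u'" using dense[of t "min v u'"] j by auto
 have "~pr y1 y2" "~pr y2 y1" using j y1 y2 by auto
 thus False using total by blast
qed

text \<open>The infimum of the points where comparison with x fails is reached from the left and can
  be passed to the right, so there is no such infimum.\<close>

lemma local_increasing:
 assumes prd: "dfn (%e. pr (e 0) (e 1))" and trans: "!!x y z. pr x y==>pr y z==>pr x z"
  and RU: "!!x. p<x==>x<q==>EX v>x. ALL y. x<y & y<v --> pr x y"
  and LD: "!!x. p<x==>x<q==>EX u<x. ALL y. u<y & y<x --> pr y x"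
  and xy: "p<x" "x<y" "y<q"
 shows "pr x y"
proof (rule ccontr)
 assume "~pr x y"
 define N where "N = {y. x<y & y<q & ~pr x y}"
 have "dfn (%e. e 0:N)" unfolding N_def mem_Collect_eq by (intro dfnr dfn_subst2[OF prd])
 moreover have yN: "y:N" using xy \<open>~pr x y\<close> by (simp add: N_def)
 moreover have "ALL y:N. x<=y" by (auto simp: N_def)
 ultimately obtain s where s: "ALL y:N. s<=y" "ALL u>s. EX y:N. y<u" using germ_inf[OF dfn1_germ] by blast
 obtain v where v: "v > x" "ALL y. x<y & y<v --> pr x y" using RU xy by (meson less_trans)
 have "~s<v" using s(2) v by (fastforce simp: N_def)
 hence xs: "x<s" using v by simp
 have sq: "s<q" "p<s" using s(1) yN xy xs by auto
 obtain u where u: "u<s" "ALL y. u<y & y<s --> pr y s" using LD sq by blast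
 obtain z where z: "max u x<z" "z<s" using dense[of "max u x" s] u xs by auto
 have "z~:N" using s z by auto
 hence "pr x z" using z sq by (auto simp: N_def)
 hence ps: "pr x s" using trans u z by (meson max_less_iff_conj)
 obtain w where w: "w > s" "ALL y. s<y & y<w --> pr s y" using RU sq by blast
 obtain m where m: "m:N" "m<w" using s w by blast
 hence "s<m" using s ps by (auto simp: N_def order.strict_iff_order)
 hence "pr s m" using w m by blast
 thus False using ps trans m by (auto simp: N_def)
qed

lemma shrink: assumes "dfn (%e. e 0:X)" "p<q"
 shows "EX q'. p<q' & q'<=q & ({p<..<q'}<=X | {p<..<q'} Int X = {})"
proof -
 obtain v where v: "v > p" "{p<..<v}<=X | {p<..<v} Int X = {}" using germ_right[OF dfn1_germ[OF assms(1)]] by blast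
 hence "{p<..<min v q}<=X | {p<..<min v q} Int X = {}" by fastforce
 thus ?thesis using v assms(2) by (intro exI[of _ "min v q"]) auto
qed

text \<open>The monotonicity theorem for a total preorder in place of a function. The values
  compared later are cuts of the line, which need not be points, so a preorder on the arguments is
  all that can be defined.\<close>

lemma preorder_monotone:
 assumes prd: "dfn (%e. pr (e 0) (e 1))" and total: "!!x y. pr x y | pr y x" and trans: "!!x y z. pr x y==>pr y z==>pr x z"
  and pq: "p<q"
 shows "EX q'. p<q' & q'<=q & ((ALL x y. p<x & x<y & y<q' --> pr x y) | (ALL x y. p<x & x<y & y<q' --> pr y x))"
proof -
 note rr = dfnr dfn_subst2[OF prd]
 \<comment> \<open>\<open>R\<close> and \<open>L\<close> name the side, \<open>U\<close> and
   \<open>D\<close> say that values there are at least or at most the value at the point. Shrinking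
   the interval makes each type hold everywhere or nowhere.\<close>
 define RU where "RU = {x. EX v. x<v & (ALL y. x<y & y<v --> pr x y)}"
 define RD where "RD = {x. EX v. x<v & (ALL y. x<y & y<v --> pr y x)}"
 define LU where "LU = {x. EX v. v<x & (ALL y. v<y & y<x --> pr x y)}"
 define LD where "LD = {x. EX v. v<x & (ALL y. v<y & y<x --> pr y x)}"
 have d: "dfn (%e. e 0:RU)" "dfn (%e. e 0:RD)" "dfn (%e. e 0:LU)" "dfn (%e. e 0:LD)"
  unfolding RU_def RD_def LU_def LD_def mem_Collect_eq by (intro rr)+
 obtain q1 where q1: "p<q1" "q1<=q" "{p<..<q1}<=RU | {p<..<q1} Int RU = {}" using shrink[OF d(1) pq] by blast
 obtain q2 where q2: "p<q2" "q2<=q1" "{p<..<q2}<=RD | {p<..<q2} Int RD = {}" using shrink[OF d(2) q1(1)] by blast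
 obtain q3 where q3: "p<q3" "q3<=q2" "{p<..<q3}<=LU | {p<..<q3} Int LU = {}" using shrink[OF d(3) q2(1)] by blast
 obtain q4 where q4: "p<q4" "q4<=q3" "{p<..<q4}<=LD | {p<..<q4} Int LD = {}" using shrink[OF d(4) q3(1)] by blast
 let ?I = "{p<..<q4}"
 have I: "?I<=RU | ?I Int RU = {}" "?I<=RD | ?I Int RD = {}" "?I<=LU | ?I Int LU = {}" "?I<=LD | ?I Int LD = {}"
 proof -
  have "?I<={p<..<q1}" "?I<={p<..<q2}" "?I<={p<..<q3}" using q1(2) q2(2) q3(2) q4(2) by auto
  thus "?I<=RU | ?I Int RU = {}" "?I<=RD | ?I Int RD = {}" "?I<=LU | ?I Int LU = {}" "?I<=LD | ?I Int LD = {}"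
   using q1(3) q2(3) q3(3) q4(3) by blast+
 qed
 have g1: "germ {y. pr x y}" and g2: "germ {y. pr y x}" for x
  by (rule dfn1_germ, unfold mem_Collect_eq, intro rr)+
 have nRU: "EX v>x. ALL y. x<y & y<v --> ~pr x y" if "x~:RU" for x
  using germ_right[OF g1[of x], of x] that unfolding RU_def subset_iff disjoint_iff greaterThanLessThan_iff mem_Collect_eq by blast
 have nRD: "EX v>x. ALL y. x<y & y<v --> ~pr y x" if "x~:RD" for x
  using germ_right[OF g2[of x], of x] that unfolding RD_def subset_iff disjoint_iff greaterThanLessThan_iff mem_Collect_eq by blast
 have nLU: "EX v<x. ALL y. v<y & y<x --> ~pr x y" if "x~:LU" for x
  using germ_left[OF g1[of x], of x] that unfolding LU_def subset_iff disjoint_iff greaterThanLessThan_iff mem_Collect_eq by blast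
 have nLD: "EX v<x. ALL y. v<y & y<x --> ~pr y x" if "x~:LD" for x
  using germ_left[OF g2[of x], of x] that unfolding LD_def subset_iff disjoint_iff greaterThanLessThan_iff mem_Collect_eq by blast
 have prd': "dfn (%e. pr (e 1) (e 0))" by (intro rr)
 have RUD: "x:RU | x:RD" for x
 proof (rule ccontr)
  assume "~?thesis"
  then obtain v w where "v > x" "ALL y. x<y & y<v --> ~pr x y" "w > x" "ALL y. x<y & y<w --> ~pr y x"
   using nRU nRD by blast
  moreover obtain y where "x<y" "y<min v w" using dense[of x "min v w"] calculation by auto
  ultimately show False using total by auto
 qed
 have LUD: "x:LU | x:LD" for x
 proof (rule ccontr)
  assume "~?thesis"
  then obtain v w where "v<x" "ALL y. v<y & y<x --> ~pr x y" "w<x" "ALL y. w<y & y<x --> ~pr y x"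
   using nLU nLD by blast
  moreover obtain y where "max v w<y" "y<x" using dense[of "max v w" x] calculation by auto
  ultimately show False using total by auto
 qed
 obtain x0 where x0: "x0:?I" using dense[OF q4(1)] by auto
 have inc: ?thesis if h: "?I<=RU" "?I<=LD"
 proof -
  have "pr x y" if "p<x" "x<y" "y<q4" for x y
   by (rule local_increasing[OF prd trans _ _ that(1) that(2) that(3)])
     (use h in "auto simp: RU_def LD_def subset_iff")
  thus ?thesis using q1 q2 q3 q4 by (intro exI[of _ q4]) auto
 qed
 have dec: ?thesis if h: "?I<=RD" "?I<=LU"
 proof -
  have "pr y x" if "p<x" "x<y" "y<q4" for x y
   by (rule local_increasing[of "%x y. pr y x", OF prd' _ _ _ that(1) that(2) that(3)])
     (use h in "auto simp: RD_def LU_def subset_iff intro: trans")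
  thus ?thesis using q1 q2 q3 q4 by (intro exI[of _ q4]) auto
 qed
 \<comment> \<open>With both monotone combinations excluded, \<open>RU\<close> everywhere forces
   \<open>LD\<close> nowhere, then \<open>LU\<close> everywhere and \<open>RD\<close> nowhere: every
   point is a strict local minimum. The other case is the same for the reversed preorder.\<close>
 show ?thesis
 proof (rule ccontr)
  assume nt: "~?thesis"
  have I2: "?I Int LD = {}" if "?I<=RU" using inc that I(4) nt by blast
  have I3: "?I Int LU = {}" if "?I<=RD" using dec that I(3) nt by blast
  show False
  proof (cases "x0:RU")
   case True
   hence "?I<=RU" using I(1) x0 by blast
   hence LD0: "?I Int LD = {}" by (rule I2)
   hence "?I<=LU" using LUD by blast
   hence RD0: "?I Int RD = {}" using I3 I(2) x0 by blast
   show False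
   proof (rule no_local_min[OF prd total trans q4(1)])
    fix x assume "p<x" "x<q4"
    hence "x~:RD" "x~:LD" using RD0 LD0 by auto
    then obtain v u where "v > x" "ALL y. x<y & y<v --> ~pr y x" "u<x" "ALL y. u<y & y<x --> ~pr y x"
     using nRD nLD by blast
    thus "EX u v. u<x & x<v & (ALL y. u<y & y<v & y~=x --> ~pr y x)"
     by (intro exI[of _ u] exI[of _ v]) (metis linorder_neqE)
   qed
  next
   case False
   hence RU0: "?I Int RU = {}" using I(1) x0 by blast
   hence "?I<=RD" using RUD by blast
   hence LU0: "?I Int LU = {}" by (rule I3)
   show False
   proof (rule no_local_min[of "%x y. pr y x", OF prd' _ _ q4(1)])
    fix x assume "p<x" "x<q4"
    hence "x~:RU" "x~:LU" using RU0 LU0 by auto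
    then obtain v u where "v > x" "ALL y. x<y & y<v --> ~pr x y" "u<x" "ALL y. u<y & y<x --> ~pr x y"
     using nRU nLU by blast
    thus "EX u v. u<x & x<v & (ALL y. u<y & y<v & y~=x --> ~pr x y)"
     by (intro exI[of _ u] exI[of _ v]) (metis linorder_neqE)
   qed (use total trans in blast)+
  qed
 qed
qed

text \<open>The core of the independence of dimension from the order of coordinates. From each
  infinite column the lowest component of its interior is taken. Its two ends vary monotonically, so
  if every row is finite the components over an interval are pairwise separated. Their suprema then
  form an infinite set and fill an interval, and some component contains the supremum of another
  one.\<close>

theorem infinite_columns_row:
 assumes Rd: "dfn (%e. R (e 0) (e 1))" and inf: "infinite {a. infinite {b. R a b}}"
 shows "EX b. infinite {a. R a b}"
proof (rule ccontr)
 assume nr: "~?thesis"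
 note r0 = dfnr dfn_subst2[OF Rd]
 define int where "int a b <-> (EX u v. u<b & b<v & (ALL t. u<t & t<v --> R a t))" for a b
 have intd: "dfn (%e. int (e 0) (e 1))" unfolding int_def by (intro r0)
 \<comment> \<open>The lowest convex component of the interior of column a.\<close>
 define K where "K a b <-> int a b & (ALL b'. b'<b & int a b' --> (ALL c. b'<c & c<b --> int a c))" for a b
 have Kd: "dfn (%e. K (e 0) (e 1))" unfolding K_def by (intro r0 dfn_subst2[OF intd])
 \<comment> \<open>The lower and upper end of the component as cuts, since an end may be infinite.
   The preorders \<open>pf\<close> and \<open>pg\<close> compare these cuts.\<close>
 define L where "L a b <-> (ALL k. K a k --> b<k)" for a b
 define U where "U a b <-> (EX k. K a k & b<k)" for a b
 have Ld: "dfn (%e. L (e 0) (e 1))" and Ud: "dfn (%e. U (e 0) (e 1))"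
  unfolding L_def U_def by (intro r0 dfn_subst2[OF Kd])+
 define pf where "pf a a' <-> (ALL b. L a b --> L a' b)" for a a'
 define pg where "pg a a' <-> (ALL b. U a b --> U a' b)" for a a'
 have pfd: "dfn (%e. pf (e 0) (e 1))" and pgd: "dfn (%e. pg (e 0) (e 1))"
  unfolding pf_def pg_def by (intro r0 dfn_subst2[OF Ld] dfn_subst2[OF Ud])+
 have Kdown: "EX b'<b. K a b'" if h: "K a b" for a b
 proof -
  obtain u v where uv: "u<b" "b<v" "ALL t. u<t & t<v --> R a t" using h unfolding K_def int_def by blast
  obtain b' where b': "u<b'" "b'<b" using dense uv by blast
  have "int a b'" unfolding int_def using uv b' by (meson less_trans)
  hence "K a b'" using h b' unfolding K_def by (meson less_trans)
  thus ?thesis using b' by blast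
 qed
 have Kup: "EX b'>b. K a b'" if h: "K a b" for a b
 proof -
  obtain u v where uv: "u<b" "b<v" "ALL t. u<t & t<v --> R a t" using h unfolding K_def int_def by blast
  obtain b' where b': "b<b'" "b'<v" using dense uv by blast
  have i: "int a c" if "u<c" "c<v" for c unfolding int_def using uv that by blast
  have "K a b'" unfolding K_def
  proof (intro conjI allI impI)
   show "int a b'" using i[of b'] b' uv by auto
   fix b'' c assume g: "b''<b' & int a b''" "b''<c & c<b'"
   show "int a c"
   proof (cases "c<b")
    case True
    hence "b''<b" using g by auto
    thus ?thesis using h g True unfolding K_def by blast
   next
    case False thus ?thesis using i[of c] g b' uv by auto
   qed
  qed
  thus ?thesis using b' by blast
 qed
 have Kconv: "K a c" if "K a k" "K a k'" "k<c" "c<k'" for a c k k'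
 proof -
  have "k<k'" using that by auto
  hence "int a c" using that unfolding K_def by blast
  thus ?thesis using that unfolding K_def by (meson less_trans)
 qed
 have KR: "R a b" if "K a b" for a b using that unfolding K_def int_def by blast
 have Kne: "EX b. K a b" if h: "infinite {b. R a b}" for a
 proof -
  have "dfn (%e. e 0:{b. R a b})" unfolding mem_Collect_eq by (intro r0)
  then obtain c d where cd: "c<d" "{c<..<d}<={b. R a b}" using dfn1_infinite h by blast
  obtain b0 where b0: "c<b0" "b0<d" using dense cd by blast
  have ib0: "int a b0" unfolding int_def using b0 cd by (intro exI[of _ c] exI[of _ d]) auto
  have "dfn (%e. e 0:{b. int a b})" unfolding mem_Collect_eq by (intro r0 dfn_subst2[OF intd])
  hence g: "germ {b. int a b}" by (rule dfn1_germ)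
  obtain v where v: "{..<v}<={b. int a b} | {..<v} Int {b. int a b} = {}" using germ_bot[OF g] by blast
  show ?thesis
  proof (cases "{..<v}<={b. int a b}")
   case True
   obtain b where "b<v" using no_bot by blast
   hence "K a b" unfolding K_def using True by (auto simp: subset_iff)
   thus ?thesis ..
  next
   case False
   hence "ALL b:{b. int a b}. v<=b" using v by (force simp: not_less[symmetric])
   then obtain s where s: "ALL x:{b. int a b}. s<=x" "ALL u>s. EX x:{b. int a b}. x<u"
    using germ_inf[OF g, of v] ib0 by blast
   have ns: "~int a s"
   proof
    assume "int a s"
    then obtain u v where uv: "u<s" "s<v" "ALL t. u<t & t<v --> R a t" unfolding int_def by blast
    obtain z where z: "u<z" "z<s" using dense uv by blast
    hence "int a z" unfolding int_def using uv by (meson less_trans)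
    thus False using s z by auto
   qed
   obtain w where w: "w > s" "{s<..<w}<={b. int a b} | {s<..<w} Int {b. int a b} = {}" using germ_right[OF g] by blast
   obtain x where x: "int a x" "x<w" using s w by blast
   hence "s<x" using s ns by (metis mem_Collect_eq order.not_eq_order_implies_strict)
   hence "x:{s<..<w} Int {b. int a b}" using x by simp
   hence sw: "{s<..<w}<={b. int a b}" using w(2) by blast
   have "K a x" unfolding K_def
   proof (intro conjI allI impI x)
    fix b' c assume "b'<x & int a b'" "b'<c & c<x"
    hence "s<c" "c<w" using s x by auto
    thus "int a c" using sw by auto
   qed
   thus ?thesis ..
  qed
 qed
 have mem: "K a b" if h: "U a b" "k<b" "~L a k" for a b k
 proof -
  obtain k' where "K a k'" "~k<k'" using h(3) unfolding L_def by blast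
  thus ?thesis using h Kconv unfolding U_def by (meson le_less_trans not_less)
 qed
 have KL: "K a k==>~L a k" and KU: "K a k==>U a k" for a k unfolding L_def U_def using Kup by blast+
 have pft: "pf x y | pf y x" for x y
 proof (rule ccontr)
  assume "~?thesis"
  then obtain b c where "L x b" "~L y b" "L y c" "~L x c" unfolding pf_def by blast
  then obtain k k' where "K y k" "k<=b" "c<k" "K x k'" "k'<=c" "b<k'" unfolding L_def by (metis not_less)
  thus False by simp
 qed
 have pgt: "pg x y | pg y x" for x y
 proof (rule ccontr)
  assume "~?thesis"
  then obtain b c where "U x b" "~U y b" "U y c" "~U x c" unfolding pg_def by blast
  then obtain k k' where "K x k" "b<k" "k<=c" "K y k'" "c<k'" "k'<=b" unfolding U_def by (metis not_less)
  thus False by simp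
 qed
 have "dfn (%e. infinite {b. R (e 0) b})" by (rule dfn_infinite) (intro r0)
 then obtain p q where pq: "p<q" "{p<..<q}<={a. infinite {b. R a b}}" using dfn1_infinite[of "{a. infinite {b. R a b}}"] inf by auto
 obtain q1 where q1: "p<q1" "q1<=q" "(ALL x y. p<x & x<y & y<q1 --> pf x y) | (ALL x y. p<x & x<y & y<q1 --> pf y x)"
  using preorder_monotone[OF pfd pft _ pq(1)] unfolding pf_def by blast
 obtain r where r: "p<r" "r<=q1" "(ALL x y. p<x & x<y & y<r --> pg x y) | (ALL x y. p<x & x<y & y<r --> pg y x)"
  using preorder_monotone[OF pgd pgt _ q1(1)] unfolding pg_def by blast
 have fm: "(ALL x y. p<x & x<y & y<r --> pf x y) | (ALL x y. p<x & x<y & y<r --> pf y x)"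
  using q1(3) r(2) by (meson less_le_trans)
 define I where "I = {p<..<r}"
 have Iinf: "infinite I" unfolding I_def by (rule interval_infinite[OF r(1)])
 have IK: "EX b. K a b" if "a:I" for a
 proof (rule Kne)
  have "a:{p<..<q}" using that q1(2) r(2) unfolding I_def by auto
  thus "infinite {b. R a b}" using pq(2) by blast
 qed
 have norow: False if "a0<a1" "!!a. a0<a==>a<a1==>K a b" for a0 a1 b
 proof -
  have "{a0<..<a1}<={a. R a b}" using that(2) KR by auto
  thus False using interval_infinite[OF that(1)] nr finite_subset by blast
 qed
 have between: "a:I" if "x:I" "y:I" "x<a" "a<y" for x y a using that unfolding I_def by auto
 \<comment> \<open>Whenever two components overlap suitably, monotonicity of the ends puts one fixed
   height into all components between them, which is an infinite row. If one end rises while the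
   other falls, the components are nested and this happens at once.\<close>
 have sep: "(ALL k k'. K a k --> K a' k' --> k<k') | (ALL k k'. K a k --> K a' k' --> k'<k)" if "a:I" "a':I" "a<a'" for a a'
 proof -
  consider (ii) "ALL x y. x:I & x<y & y:I --> pf x y" "ALL x y. x:I & x<y & y:I --> pg x y"
   | (id) "ALL x y. x:I & x<y & y:I --> pf x y" "ALL x y. x:I & x<y & y:I --> pg y x"
   | (di) "ALL x y. x:I & x<y & y:I --> pf y x" "ALL x y. x:I & x<y & y:I --> pg x y"
   | (dd) "ALL x y. x:I & x<y & y:I --> pf y x" "ALL x y. x:I & x<y & y:I --> pg y x"
   using fm r(3) unfolding I_def greaterThanLessThan_iff by (elim disjE) blast+
  thus ?thesis
  proof cases
   case ii
   have n: "~k'<k" if k: "K a k" "K a' k'" for k k'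
   proof
    assume "k'<k"
    show False
    proof (rule norow[OF \<open>a<a'\<close>, of k])
     fix c assume c: "a<c" "c<a'"
     hence "c:I" using between \<open>a:I\<close> \<open>a':I\<close> by blast
     hence "pf c a'" "pg a c" using ii c \<open>a:I\<close> \<open>a':I\<close> by blast+
     hence "~L c k'" "U c k" using KL[OF k(2)] KU[OF k(1)] unfolding pf_def pg_def by blast+
     thus "K c k" using mem \<open>k'<k\<close> by blast
    qed
   qed
   have "k<k'" if k: "K a k" "K a' k'" for k k'
    using n[OF k] Kdown[OF k(2)] n[OF k(1)] by (metis linorder_neqE)
   thus ?thesis by blast
  next
   case id
   obtain k where k: "K a' k" using IK \<open>a':I\<close> by blast
   obtain k' where k': "k'<k" "K a' k'" using Kdown[OF k] by blast
   have False
   proof (rule norow[OF \<open>a<a'\<close>, of k])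
    fix c assume c: "a<c" "c<a'"
    hence "c:I" using between \<open>a:I\<close> \<open>a':I\<close> by blast
    hence "pf c a'" "pg a' c" using id c \<open>a:I\<close> \<open>a':I\<close> by blast+
    hence "~L c k'" "U c k" using KL[OF k'(2)] KU[OF k] unfolding pf_def pg_def by blast+
    thus "K c k" using mem k' by blast
   qed
   thus ?thesis ..
  next
   case di
   obtain k where k: "K a k" using IK \<open>a:I\<close> by blast
   obtain k' where k': "k'<k" "K a k'" using Kdown[OF k] by blast
   have False
   proof (rule norow[OF \<open>a<a'\<close>, of k])
    fix c assume c: "a<c" "c<a'"
    hence "c:I" using between \<open>a:I\<close> \<open>a':I\<close> by blast
    hence "pf c a" "pg a c" using di c \<open>a:I\<close> \<open>a':I\<close> by blast+
    hence "~L c k'" "U c k" using KL[OF k'(2)] KU[OF k] unfolding pf_def pg_def by blast+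
    thus "K c k" using mem k' by blast
   qed
   thus ?thesis ..
  next
   case dd
   have n: "~k<k'" if k: "K a k" "K a' k'" for k k'
   proof
    assume "k<k'"
    show False
    proof (rule norow[OF \<open>a<a'\<close>, of k'])
     fix c assume c: "a<c" "c<a'"
     hence "c:I" using between \<open>a:I\<close> \<open>a':I\<close> by blast
     hence "pf c a" "pg a' c" using dd c \<open>a:I\<close> \<open>a':I\<close> by blast+
     hence "~L c k" "U c k'" using KL[OF k(1)] KU[OF k(2)] unfolding pf_def pg_def by blast+
     thus "K c k'" using mem \<open>k<k'\<close> by blast
    qed
   qed
   have "k'<k" if k: "K a k" "K a' k'" for k k'
    using n[OF k] Kdown[OF k(1)] n[OF _ k(2)] by (metis linorder_neqE)
   thus ?thesis by blast
  qed
 qed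
 have sep': "(ALL k k'. K a k --> K a' k' --> k<k') | (ALL k k'. K a k --> K a' k' --> k'<k)" if "a:I" "a':I" "a~=a'" for a a'
 proof (cases "a<a'")
  case True thus ?thesis using sep that by blast
 next
  case False
  hence "a'<a" using that by simp
  thus ?thesis using sep[of a' a] that by blast
 qed
 define sup where "sup a s <-> (ALL k. K a k --> k<=s) & (ALL u<s. EX k. K a k & u<k)" for a s
 define G where "G = {s. EX a. p<a & a<r & sup a s}"
 have Gd: "dfn (%e. e 0:G)" unfolding G_def sup_def mem_Collect_eq by (intro r0 dfn_subst2[OF Kd])
 define J where "J = {a:I. EX s. sup a s}"
 \<comment> \<open>Of two separated components the lower one is bounded by the other and has a
   supremum; so at most one component lacks it.\<close>
 have nJ: "a = b" if ab: "a:I - J" "b:I - J" for a b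
 proof (rule ccontr)
  assume "a~=b"
  have *: "EX s. sup x s" if xy: "x:I" "y:I" "ALL k k'. K x k --> K y k' --> k<k'" for x y
  proof -
   have "dfn (%e. e 0:{k. K x k})" unfolding mem_Collect_eq by (intro r0 dfn_subst2[OF Kd])
   moreover obtain k' where "K y k'" using IK xy by blast
   hence "ALL k:{k. K x k}. k<=k'" using xy by (auto intro: less_imp_le)
   moreover have "{k. K x k}~={}" using IK xy by auto
   ultimately have "EX s. (ALL k:{k. K x k}. k<=s) & (ALL u<s. EX k:{k. K x k}. u<k)"
    by (intro germ_sup[OF dfn1_germ]) auto
   thus ?thesis unfolding sup_def by auto
  qed
  show False using sep'[of a b] *[of a b] *[of b a] ab \<open>a~=b\<close> unfolding J_def by blast
 qed
 have "finite (I - J)"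
 proof (cases "I - J = {}")
  case True thus ?thesis by (metis finite.emptyI)
 next
  case False
  then obtain a where "I - J<={a}" using nJ by blast
  thus ?thesis using finite_subset by blast
 qed
 hence Jinf: "infinite J" using Iinf by (metis Diff_infinite_finite finite_Diff2)
 have supne: "a = b" if "a:I" "b:I" "sup a s" "sup b s" for a b s
 proof (rule ccontr)
  assume "a~=b"
  have *: False if h: "x:I" "y:I" "sup x s" "sup y s" "ALL k k'. K x k --> K y k' --> k<k'" for x y
  proof -
   obtain k where k: "K y k" using IK h by blast
   obtain k' where k': "k' > k" "K y k'" using Kup[OF k] by blast
   have "k<s" using k' h unfolding sup_def by (meson less_le_trans)
   then obtain j where "K x j" "k<j" using h unfolding sup_def by blast
   thus False using h k by (meson less_asym)
  qed
  show False using sep'[of a b] *[of a b] *[of b a] that \<open>a~=b\<close> by blast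
 qed
 have "infinite G"
 proof
  assume fG: "finite G"
  define f where "f a = (SOME s. sup a s)" for a
  have f: "sup a (f a)" if "a:J" for a using that unfolding J_def f_def by (auto intro: someI)
  have "inj_on f J" using f supne unfolding inj_on_def J_def by (metis (no_types, lifting) mem_Collect_eq J_def f)
  moreover have "f ` J<=G" using f unfolding G_def J_def I_def by auto
  ultimately show False using fG Jinf by (meson finite_imageD finite_subset)
 qed
 \<comment> \<open>Inside this interval every point is a supremum. A component whose supremum is an
   interior point \<open>s1\<close> reaches down into the interval, so it contains the supremum of a
   different component, and the two cannot be separated.\<close>
 then obtain c d where cd: "c<d" "{c<..<d}<=G" using dfn1_infinite[OF Gd] by blast
 obtain s0 where s0: "c<s0" "s0<d" using dense cd by blast
 obtain s1 where s1: "s0<s1" "s1<d" using dense s0 by blast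
 obtain b0 where b0: "b0:I" "sup b0 s0" using s0 cd unfolding G_def I_def by fastforce
 have "s1:G" using s0 s1 cd by (auto simp: subset_iff)
 then obtain b1 where b1: "b1:I" "sup b1 s1" unfolding G_def I_def by auto
 obtain k1 where k1: "K b1 k1" "s0<k1" using b1 s1 unfolding sup_def by blast
 hence "k1<=s1" using b1 unfolding sup_def by blast
 hence "k1:{c<..<d}" using k1 s0 s1 by auto
 hence "k1:G" using cd(2) by blast
 then obtain b2 where b2: "b2:I" "sup b2 k1" unfolding G_def I_def by auto
 have "b2~=b1" using Kup[OF k1(1)] b2 unfolding sup_def by (meson leD)
 moreover have False if "ALL k k'. K b2 k --> K b1 k' --> k<k'"
 proof -
  obtain k' where k': "k'<k1" "K b1 k'" using Kdown[OF k1(1)] by blast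
  then obtain k2 where "K b2 k2" "k'<k2" using b2 unfolding sup_def by blast
  thus False using that k' by (meson less_asym)
 qed
 moreover have False if "ALL k k'. K b2 k --> K b1 k' --> k'<k"
 proof -
  obtain k2 where k2: "K b2 k2" using IK b2 by blast
  thus False using that k1 b2 unfolding sup_def by (meson leD)
 qed
 ultimately show False using sep'[OF b2(1) b1(1)] by blast
qed

end

section \<open>Dimension\<close>

text \<open>The dimension is computed coordinate by coordinate; the value of the last coordinate adds one
 where the fibre is infinite. For this definition additivity is a formal identity, and
 o-minimality only enters through the independence of the order of the coordinates.\<close>

fun dge :: "nat => 'a list set => nat => bool" where
 "dge 0 A d = ([]:A & d = 0)"
| "dge (Suc n) A d = (dge n {y. EX t. y @ [t]:A} d | (0<d & dge n {y. infinite {t. y @ [t]:A}} (d - 1)))"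

lemma dge_mono: "A<=B==>dge n A d==>dge n B d"
proof (induction n arbitrary: A B d)
 case 0 thus ?case by auto
next
 case (Suc n)
 have 1: "{y. EX t. y @ [t]:A}<={y. EX t. y @ [t]:B}" using Suc.prems by blast
 have 2: "{y. infinite {t. y @ [t]:A}}<={y. infinite {t. y @ [t]:B}}"
 proof clarify
  fix y assume "infinite {t. y @ [t]:A}" "finite {t. y @ [t]:B}"
  moreover have "{t. y @ [t]:A}<={t. y @ [t]:B}" using Suc.prems by blast
  ultimately show False using finite_subset by blast
 qed
 show ?case using Suc.prems(2) Suc.IH[OF 1] Suc.IH[OF 2] by auto
qed

lemma dge_empty: "~dge n {} d"
 by (induction n arbitrary: d) auto

lemma dge_Un: "dge n (A Un B) d <-> dge n A d | dge n B d"
proof (induction n arbitrary: A B d)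
 case 0 thus ?case by auto
next
 case (Suc n)
 have 1: "{y. EX t. y @ [t]:A Un B} = {y. EX t. y @ [t]:A} Un {y. EX t. y @ [t]:B}" by auto
 have 2: "{y. infinite {t. y @ [t]:A Un B}} = {y. infinite {t. y @ [t]:A}} Un {y. infinite {t. y @ [t]:B}}"
  by (auto simp: Collect_disj_eq)
 show ?case unfolding dge.simps 1 2 Suc.IH by auto
qed

lemma dge_UN: "finite I==>dge n (UN i:I. A i) d <-> (EX i:I. dge n (A i) d)"
 by (induction rule: finite_induct) (auto simp: dge_empty dge_Un)

lemma dge_le: "dge n A d==>d<=n"
proof (induction n arbitrary: A d)
 case (Suc n)
 from Suc.prems show ?case using Suc.IH[of "{y. EX t. y @ [t]:A}" d] Suc.IH[of "{y. infinite {t. y @ [t]:A}}" "d - 1"] by auto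
qed simp

lemma dge_Suc: "dge n A (Suc d)==>dge n A d"
proof (induction n arbitrary: A d)
 case (Suc n)
 from Suc.prems consider "dge n {y. EX t. y @ [t]:A} (Suc d)" | "dge n {y. infinite {t. y @ [t]:A}} d" by auto
 thus ?case
 proof cases
  case 1 thus ?thesis using Suc.IH by simp
 next
  case 2
  have "{y. infinite {t. y @ [t]:A}}<={y. EX t. y @ [t]:A}" using not_finite_existsD by auto
  from dge_mono[OF this 2] show ?thesis by simp
 qed
qed simp

lemma dge_antimono: "d'<=d==>dge n A d==>dge n A d'"
 by (induction rule: inc_induct) (auto intro: dge_Suc)

lemma dge_len: "dge n (A Int {x. length x = n}) d = dge n A d"
proof (induction n arbitrary: A d)
 case (Suc n)
 have 1: "{y. EX t. y @ [t]:A Int {x. length x = Suc n}} = {y. EX t. y @ [t]:A} Int {x. length x = n}" by auto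
 have 2: "{y. infinite {t. y @ [t]:A Int {x. length x = Suc n}}} = {y. infinite {t. y @ [t]:A}} Int {x. length x = n}" by auto
 show ?case unfolding dge.simps 1 2 Suc.IH ..
qed auto

lemma dge_cong: assumes "!!x. length x = n==>x:A <-> x:B" shows "dge n A d = dge n B d"
proof -
 have "A Int {x. length x = n} = B Int {x. length x = n}" using assms by auto
 thus ?thesis using dge_len by metis
qed

lemma dge_0: "dge n A 0 <-> (EX x:A. length x = n)"
proof (induction n arbitrary: A)
 case (Suc n)
 have "dge (Suc n) A 0 <-> (EX x t. x @ [t]:A & length x = n)" using Suc.IH by auto
 also have "... <-> (EX x:A. length x = Suc n)" by (metis length_Suc_conv_rev)
 finally show ?case .
qed auto

lemma dge_1: "dge n A 1 <-> infinite (A Int {x. length x = n})"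
proof (induction n arbitrary: A)
 case 0
 have "finite (A Int {x. length x = 0})" by (rule finite_subset[of _ "{[]}"]) auto
 thus ?case by simp
next
 case (Suc n)
 let ?A = "A Int {x. length x = Suc n}"
 let ?P = "{y. EX t. y @ [t]:A} Int {x. length x = n}"
 have "dge (Suc n) A 1 <-> infinite ?P | (EX y. infinite {t. y @ [t]:A} & length y = n)"
  using Suc.IH dge_0[of n "{y. infinite {t. y @ [t]:A}}"] by auto
 also have "... <-> infinite ?A"
 proof
  assume "infinite ?P | (EX y. infinite {t. y @ [t]:A} & length y = n)"
  thus "infinite ?A"
  proof
   assume "infinite ?P"
   moreover have "?P<=butlast ` ?A"
   proof
    fix y assume "y:?P"
    then obtain t where "y @ [t]:?A" by auto
    thus "y:butlast ` ?A" by (rule rev_image_eqI) simp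
   qed
   ultimately show ?thesis using finite_subset by blast
  next
   assume "EX y. infinite {t. y @ [t]:A} & length y = n"
   then obtain y where y: "infinite {t. y @ [t]:A}" "length y = n" by blast
   have "(%t. y @ [t]) ` {t. y @ [t]:A}<=?A" using y by auto
   moreover have "infinite ((%t. y @ [t]) ` {t. y @ [t]:A})"
    using y by (simp add: finite_image_iff inj_on_def)
   ultimately show ?thesis using finite_subset by blast
  qed
 next
  assume i: "infinite ?A"
  show "infinite ?P | (EX y. infinite {t. y @ [t]:A} & length y = n)"
  proof (rule ccontr)
   assume "~?thesis"
   hence f: "finite ?P" "!!y. length y = n==>finite {t. y @ [t]:A}" by auto
   have "?A<=(UN y:?P. (%t. y @ [t]) ` {t. y @ [t]:A})"
   proof
    fix x assume x: "x:?A"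
    then obtain y t where "x = y @ [t]" "length y = n" by (auto simp: length_Suc_conv_rev)
    thus "x:(UN y:?P. (%t. y @ [t]) ` {t. y @ [t]:A})" using x by blast
   qed
   moreover have "finite (UN y:?P. (%t. y @ [t]) ` {t. y @ [t]:A})" using f by auto
   ultimately show False using i finite_subset by blast
  qed
 qed
 finally show ?case .
qed

lemma dge_finite: "finite A==>dge n A d==>d = 0"
 using dge_antimono[of 1 d n A] dge_1[of n A] by (cases d) auto

text \<open>An integral of dimensions: read \<open>F y b\<close> as a lower bound b for the fibre
  over y. Then \<open>J n F d\<close> bounds the dimension of the total space below by d, splitting
  d into base and fibre.\<close>

definition J :: "nat => ('a list => nat => bool) => nat => bool" where
 "J n F d <-> (EX a<=d. dge n {y. F y (d - a)} a)"

lemma dge_add: "dge (n + m) A d = J n (%y. dge m {z. y @ z:A}) d"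
proof (induction m arbitrary: A d)
 case 0
 have "J n (%y. dge 0 {z. y @ z:A}) d <-> dge n A d"
 proof
  assume "J n (%y. dge 0 {z. y @ z:A}) d"
  then obtain a where a: "a<=d" "dge n {y. y:A & d - a = 0} a" by (auto simp: J_def)
  hence "a = d" using dge_empty[of n] by (cases "d - a = 0") auto
  with a show "dge n A d" by simp
 qed (auto simp: J_def intro: exI[of _ d])
 thus ?case unfolding add_0_right by (rule sym)
next
 case (Suc m)
 let ?P = "{y. EX t. y @ [t]:A}" and ?I = "{y. infinite {t. y @ [t]:A}}"
 have "dge (n + Suc m) A d <-> J n (%y. dge m {z. y @ z:?P}) d | (0<d & J n (%y. dge m {z. y @ z:?I}) (d - 1))"
  using Suc.IH by simp
 also have "... <-> J n (%y. dge (Suc m) {z. y @ z:A}) d"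
 proof -
  have "{y. dge (Suc m) {z. y @ z:A} b} =
   {y. dge m {z. y @ z:?P} b} Un {y. 0<b & dge m {z. y @ z:?I} (b - 1)}" for b by auto
  hence "J n (%y. dge (Suc m) {z. y @ z:A}) d <-> J n (%y. dge m {z. y @ z:?P}) d |
    (EX a<=d. dge n {y. 0<d - a & dge m {z. y @ z:?I} (d - a - 1)} a)"
   unfolding J_def by (simp only: dge_Un) blast
  moreover have "(EX a<=d. dge n {y. 0<d - a & dge m {z. y @ z:?I} (d - a - 1)} a) <->
   0<d & J n (%y. dge m {z. y @ z:?I}) (d - 1)"
  proof
   assume "EX a<=d. dge n {y. 0<d - a & dge m {z. y @ z:?I} (d - a - 1)} a"
   then obtain a where a: "dge n {y. 0<d - a & dge m {z. y @ z:?I} (d - a - 1)} a" by blast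
   hence "0<d - a" using dge_empty[of n] by (cases "0<d - a") auto
   with a have "dge n {y. dge m {z. y @ z:?I} (d - 1 - a)} a" by (simp add: diff_commute)
   thus "0<d & J n (%y. dge m {z. y @ z:?I}) (d - 1)" using \<open>0<d - a\<close> unfolding J_def by (intro conjI exI[of _ a]) auto
  next
   assume h: "0<d & J n (%y. dge m {z. y @ z:?I}) (d - 1)"
   then obtain a where a: "a<=d - 1" "dge n {y. dge m {z. y @ z:?I} (d - 1 - a)} a" unfolding J_def by blast
   hence "0<d - a" using h by auto
   with a show "EX a<=d. dge n {y. 0<d - a & dge m {z. y @ z:?I} (d - a - 1)} a"
    by (intro exI[of _ a]) (auto simp: diff_commute)
  qed
  ultimately show ?thesis by blast
 qed
 finally show ?case .
qed

lemma J_cong: assumes "!!y b. length y = n==>F y b = F' y b" shows "J n F = J n F'"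
proof
 fix d
 have "dge n {y. F y b} a = dge n {y. F' y b} a" for a b by (rule dge_cong) (simp add: assms)
 thus "J n F d = J n F' d" unfolding J_def by simp
qed

lemma J_indicator: "J n (%y b. P y & b = 0) d = dge n {y. P y} d"
proof
 assume "J n (%y b. P y & b = 0) d"
 then obtain a where a: "a<=d" "dge n {y. P y & d - a = 0} a" by (auto simp: J_def)
 hence "a = d" using dge_empty[of n] by (cases "d - a = 0") auto
 with a show "dge n {y. P y} d" by simp
qed (auto simp: J_def intro: exI[of _ d])

lemma dge_ex_le: "dge n {y. EX b<=(k::nat). P b y} a <-> (EX b<=k. dge n {y. P b y} a)"
proof -
 have "{y. EX b<=k. P b y} = (UN b:{..k}. {y. P b y})" by auto
 thus ?thesis using dge_UN[of "{..k}" n "%b. {y. P b y}" a] by auto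
qed

lemma J_assoc: "J (n + m) F = J n (%y. J m (%z. F (y @ z)))"
proof
 fix d
 have "J n (%y. J m (%z. F (y @ z))) d <-> (EX a1<=d. EX a2<=d - a1. dge n {y. dge m {z. F (y @ z) (d - a1 - a2)} a2} a1)"
  unfolding J_def dge_ex_le ..
 also have "... <-> (EX a<=d. EX a1<=a. dge n {y. dge m {z. F (y @ z) (d - a)} (a - a1)} a1)" (is "?L <-> ?R")
 proof
  assume ?L
  then obtain a1 a2 where "a1<=d" "a2<=d - a1" "dge n {y. dge m {z. F (y @ z) (d - a1 - a2)} a2} a1" by blast
  thus ?R by (intro exI[of _ "a1 + a2"] conjI exI[of _ a1]) auto
 next
  assume ?R
  then obtain a a1 where "a<=d" "a1<=a" "dge n {y. dge m {z. F (y @ z) (d - a)} (a - a1)} a1" by blast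
  thus ?L by (intro exI[of _ a1] conjI exI[of _ "a - a1"]) auto
 qed
 also have "... <-> J (n + m) F d" unfolding J_def dge_add by simp
 finally show "J (n + m) F d = J n (%y. J m (%z. F (y @ z))) d" ..
qed

lemma J_Suc: "J (Suc m) F = J 1 (%s. J m (%z. F (s @ z)))"
 using J_assoc[of 1 m F] by simp

lemma J_0: "J 0 F = F []"
proof
 fix d show "J 0 F d = F [] d" unfolding J_def by auto
qed

lemma dge_Suc_0: "dge (Suc 0) B c <-> (c = 0 & (EX t. [t]:B)) | (c = 1 & infinite {t. [t]:B})"
 by auto

lemma finite_rel: "finite {x. EX y. R x y} & (ALL x. finite {y. R x y}) <-> finite {(x, y). R x y}"
proof
 assume h: "finite {x. EX y. R x y} & (ALL x. finite {y. R x y})"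
 have "{(x, y). R x y} = (SIGMA x:{x. EX y. R x y}. {y. R x y})" by auto
 thus "finite {(x, y). R x y}" using h by simp
next
 assume h: "finite {(x, y). R x y}"
 have "{x. EX y. R x y} = fst ` {(x, y). R x y}" by force
 moreover have "finite {y. R x y}" for x
  by (rule finite_subset[OF _ finite_imageI[OF h, of snd]]) force
 ultimately show "finite {x. EX y. R x y} & (ALL x. finite {y. R x y})" using h by simp
qed

lemma dge_plane: "dge 2 {y. length y = 2 & R (y ! 0) (y ! 1)} c <->
  (c = 0 & (EX x y. R x y)) | (c = 1 & infinite {(x, y). R x y}) | (c = 2 & infinite {x. infinite {y. R x y}})"
proof -
 have "dge 2 {y. length y = 2 & R (y ! 0) (y ! 1)} c <-> (c = 0 & (EX x y. R x y)) |
   (c = 1 & (infinite {x. EX y. R x y} | (EX x. infinite {y. R x y}))) | (c = 2 & infinite {x. infinite {y. R x y}})"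
  unfolding numeral_2_eq_2 dge.simps(2)[of "Suc 0"] dge_Suc_0 by auto
 thus ?thesis using finite_rel[of R] by auto
qed

section \<open>Definability of dimension, exchange of coordinates and double counting\<close>

context omin
begin

lemma trm_shift: "trm t==>trm (%e. t (%i. e (f i)))"
 unfolding trm_def by auto

lemma ltrm_shift: "ltrm n xs==>ltrm n (%e. xs (%i. e (f i)))"
 unfolding ltrm_def using trm_shift by blast

lemma ltrm_append': "ltrm n xs==>ltrm m ys==>k = n + m==>ltrm k (%e. xs e @ ys e)"
 using ltrm_append by simp

lemma dfn_bex_le: "(!!a. dfn (P a))==>dfn (%e. EX a<=(d::nat). P a e)"
proof (induction d)
 case (Suc d)
 hence "dfn (%e. (EX a<=d. P a e) | P (Suc d) e)" by (intro dfn_disj) auto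
 moreover have "(%e. EX a<=Suc d. P a e) = (%e. (EX a<=d. P a e) | P (Suc d) e)" by (auto simp: le_Suc_eq)
 ultimately show ?case by simp
qed simp

lemma dfn_dge: "dfn (%e. P (map e [0..<m]) (%i. e (i + m)))==>dfn (%e. dge m {z. P z e} d)"
proof (induction m arbitrary: P d)
 case 0
 thus ?case by (auto intro: dfn_conj dfn_const)
next
 case (Suc m)
 \<comment> \<open>The last coordinate is the one that \<open>dge\<close> peels off first; it is
   moved to variable 0, where the quantifier expects it.\<close>
 let ?f = "%i. if i<m then Suc i else if i = m then 0 else i"
 have m1: "map (%i. e (?f i)) [0..<Suc m] = map (%i. e (Suc i)) [0..<m] @ [e 0]" for e :: "nat => 'a" by simp
 have m2: "(%i. e (?f (i + Suc m))) = (%i. e (Suc (i + m)))" for e :: "nat => 'a" by auto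
 have h: "dfn (%e. P (map (%i. e (Suc i)) [0..<m] @ [e 0]) (%i. e (Suc (i + m))))"
  using dfn_rename[OF Suc.prems, of ?f] unfolding m1 m2 .
 have 1: "dfn (%e. dge m {y. EX t. P (y @ [t]) e} d)"
  by (rule Suc.IH) (rule dfn_ex, use h in simp)
 have 2: "dfn (%e. dge m {y. infinite {t. P (y @ [t]) e}} (d - 1))"
  by (rule Suc.IH) (rule dfn_infinite, use h in simp)
 show ?case using dfn_disj[OF 1 dfn_conj[OF dfn_const[of "0<d"] 2]] by simp
qed

text \<open>Dimensions 0 and 1 mean nonempty and infinite, which are symmetric. For dimension 2, if
  only finitely many rows were infinite, deleting them would leave infinitely many infinite columns
  and no infinite row, against \<open>infinite_columns_row\<close>.\<close>

lemma dge_plane_swap: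
 assumes Rd: "dfn (%e. R (e 0) (e 1))"
 shows "dge 2 {y. length y = 2 & R (y ! 0) (y ! 1)} c <-> dge 2 {y. length y = 2 & R (y ! 1) (y ! 0)} c"
proof -
 have 1: "infinite {y. infinite {x. Q x y}}" if Qd: "dfn (%e. Q (e 0) (e 1))" and i: "infinite {x. infinite {y. Q x y}}" for Q
 proof
  assume f: "finite {y. infinite {x. Q x y}}"
  let ?Q = "%x y. Q x y & ~infinite {x. Q x y}"
  have "{y. ?Q x y} = {y. Q x y} - {y. infinite {x. Q x y}}" for x by auto
  hence "infinite {x. infinite {y. ?Q x y}}" using i f by (simp add: Diff_infinite_finite)
  moreover have "dfn (%e. infinite {x. Q x (e 1)})" by (rule dfn_infinite) (intro dfn_subst2[OF Qd] dfnr)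
  hence "dfn (%e. ?Q (e 0) (e 1))" by (rule dfn_conj[OF Qd dfn_not])
  ultimately obtain y where "infinite {x. ?Q x y}" using infinite_columns_row[of ?Q] by blast
  thus False by (cases "infinite {x. Q x y}") auto
 qed
 have Rd': "dfn (%e. R (e 1) (e 0))" by (intro dfn_subst2[OF Rd] dfnr)
 have "infinite {x. infinite {y. R x y}} <-> infinite {y. infinite {x. R x y}}"
  using 1[OF Rd] 1[of "%x y. R y x", OF Rd'] by blast
 moreover have "finite {(x, y). R x y} <-> finite {(x, y). R y x}"
 proof -
  have "{(x, y). R x y} = prod.swap ` {(x, y). R y x}" "{(x, y). R y x} = prod.swap ` {(x, y). R x y}" by force+
  thus ?thesis by (metis finite_imageI)
 qed
 moreover have "(EX x y. R x y) <-> (EX x y. R y x)" by blast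
 ultimately show ?thesis unfolding dge_plane[of R] dge_plane[of "%x y. R y x"] by simp
qed

definition dfl2 :: "nat => nat => ('a list => 'a list => bool) => bool" where
 "dfl2 n m F <-> dfn (%e. F (map e [0..<n]) (map (%i. e (i + n)) [0..<m]))"

lemma dfl2_sub: assumes "dfl2 n m F" "ltrm n xs" "ltrm m ys" shows "dfn (%e. F (xs e) (ys e))"
proof -
 let ?t = "%i. if i<n then (%e. xs e ! i) else if i - n<m then (%e. ys e ! (i - n)) else (%e. e 0)"
 have "dfn (%e. F (map (%i. ?t i e) [0..<n]) (map (%i. ?t (i + n) e) [0..<m]))"
  using dfn_subst[OF assms(1)[unfolded dfl2_def], of ?t] assms(2,3) trm_nth trm_var by auto
 moreover have "map (%i. ?t i e) [0..<n] = xs e" for e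
  using assms(2) by (intro nth_equalityI) (auto simp: ltrm_def)
 moreover have "map (%i. ?t (i + n) e) [0..<m] = ys e" for e
  using assms(3) by (intro nth_equalityI) (auto simp: ltrm_def)
 ultimately show ?thesis by simp
qed

lemma dfl2_J: assumes "!!b. dfn (%e. F (map e [0..<m]) (%i. e (i + m)) b)" shows "dfn (%e. J m (%z. F z e) d)"
 unfolding J_def by (intro dfn_bex_le dfn_conj dfn_const dfn_dge assms)

lemma J_swap_11:
 assumes "!!b. dfl2 1 1 (%y z. F y z b)"
 shows "J 1 (%y. J 1 (%z. F y z)) = J 1 (%z. J 1 (%y. F y z))"
proof
 fix d
 have *: "J 1 (%y. J 1 (%z. H y z)) d = (EX a<=d. dge 2 {y. length y = 2 & H [y ! 0] [y ! 1] (d - a)} a)" for H :: "'a list => 'a list => nat => bool"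
 proof -
  have "J 1 (%y. J 1 (%z. H y z)) = J 1 (%y. J 1 (%z. H (take 1 (y @ z)) (drop 1 (y @ z))))"
   by (intro J_cong) (simp cong: J_cong)
  also have "... = J (1 + 1) (%w. H (take 1 w) (drop 1 w))" by (rule J_assoc[symmetric])
  finally have e: "J 1 (%y. J 1 (%z. H y z)) d = J 2 (%w. H (take 1 w) (drop 1 w)) d" by (simp add: numeral_2_eq_2)
  have "dge 2 {w. H (take 1 w) (drop 1 w) b} a = dge 2 {y. length y = 2 & H [y ! 0] [y ! 1] b} a" for a b
  proof (rule dge_cong)
   fix x :: "'a list" assume "length x = 2"
   then obtain s t where "x = [s, t]" by (auto simp: length_Suc_conv numeral_2_eq_2)
   thus "x:{w. H (take 1 w) (drop 1 w) b} <-> x:{y. length y = 2 & H [y ! 0] [y ! 1] b}"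
    by simp
  qed
  hence "J 2 (%w. H (take 1 w) (drop 1 w)) d = (EX a<=d. dge 2 {y. length y = 2 & H [y ! 0] [y ! 1] (d - a)} a)"
   unfolding J_def by (simp only:)
  with e show ?thesis by (simp only:)
 qed
 have "dfn (%e. F [e 0] [e 1] b)" for b
  using dfl2_sub[OF assms[of b], of "%e. [e 0]" "%e. [e 1]"] ltrm_Cons[OF trm_var ltrm_Nil] by simp
 from dge_plane_swap[of "%s t. F [s] [t] _", OF this]
 show "J 1 (%y. J 1 (%z. F y z)) d = J 1 (%z. J 1 (%y. F y z)) d"
  unfolding * *[of "%z y. F y z"] by simp
qed

text \<open>General exchange is generated by transpositions: one coordinate moves past a block of m
  coordinates one by one, and then a block moves coordinate by coordinate.\<close>

lemma J_swap_1:
 assumes "!!b. dfl2 1 m (%y z. F y z b)"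
 shows "J 1 (%y. J m (%z. F y z)) = J m (%z. J 1 (%y. F y z))"
 using assms
proof (induction m arbitrary: F)
 case 0 show ?case unfolding J_0 ..
next
 case (Suc m)
 have s1: "dfl2 1 1 (%y s. J m (%z. F y (s @ z)) b)" for b
  unfolding dfl2_def
 proof (rule dfl2_J)
  fix b
  show "dfn (%e. F (map (%i. e (i + m)) [0..<1]) (map (%i. e (i + 1 + m)) [0..<1] @ map e [0..<m]) b)"
   by (rule dfl2_sub[OF Suc.prems ltrm_vars], rule ltrm_append'[OF ltrm_vars ltrm_vars]) simp
 qed
 have s2: "dfl2 1 m (%y z. F y (s @ z) b)" if "length s = 1" for s b
  unfolding dfl2_def
  by (rule dfl2_sub[OF Suc.prems ltrm_vars], rule ltrm_append'[OF ltrm_const[OF that] ltrm_vars]) simp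
 have "J 1 (%y. J (Suc m) (%z. F y z)) = J 1 (%y. J 1 (%s. J m (%z. F y (s @ z))))"
  by (simp only: J_Suc[of m])
 also have "... = J 1 (%s. J 1 (%y. J m (%z. F y (s @ z))))" by (rule J_swap_11[OF s1])
 also have "... = J 1 (%s. J m (%z. J 1 (%y. F y (s @ z))))"
  by (intro J_cong fun_cong[OF Suc.IH] s2)
 also have "... = J (Suc m) (%z. J 1 (%y. F y z))" by (simp only: J_Suc[of m])
 finally show ?case .
qed

lemma J_swap:
 assumes "!!b. dfl2 n m (%y z. F y z b)"
 shows "J n (%y. J m (%z. F y z)) = J m (%z. J n (%y. F y z))"
 using assms
proof (induction n arbitrary: F)
 case 0 show ?case unfolding J_0 ..
next
 case (Suc n)
 have s1: "dfl2 1 m (%t z. J n (%y. F (t @ y) z) b)" for b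
  unfolding dfl2_def
 proof (rule dfl2_J)
  fix b
  show "dfn (%e. F (map (%i. e (i + n)) [0..<1] @ map e [0..<n]) (map (%i. e (i + 1 + n)) [0..<m]) b)"
   by (rule dfl2_sub[OF Suc.prems _ ltrm_vars], rule ltrm_append'[OF ltrm_vars ltrm_vars]) simp
 qed
 have s2: "dfl2 n m (%y z. F (t @ y) z b)" if "length t = 1" for t b
  unfolding dfl2_def
  by (rule dfl2_sub[OF Suc.prems _ ltrm_vars], rule ltrm_append'[OF ltrm_const[OF that] ltrm_vars]) simp
 have "J (Suc n) (%y. J m (%z. F y z)) = J 1 (%t. J n (%y. J m (%z. F (t @ y) z)))"
  by (simp only: J_Suc[of n])
 also have "... = J 1 (%t. J m (%z. J n (%y. F (t @ y) z)))"
  by (intro J_cong fun_cong[OF Suc.IH] s2)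
 also have "... = J m (%z. J 1 (%t. J n (%y. F (t @ y) z)))" by (rule J_swap_1[OF s1])
 also have "... = J m (%z. J (Suc n) (%y. F y z))" by (simp only: J_Suc[of n])
 finally show ?case .
qed

lemma fubini:
 assumes "dfl2 n m R"
 shows "J n (%y. dge m {z. R y z}) d = J m (%z. dge n {y. R y z}) d"
proof -
 have "dfl2 n m (%y z. R y z & b = 0)" for b
  using dfn_conj[OF assms[unfolded dfl2_def] dfn_const] unfolding dfl2_def .
 from J_swap[of n m "%y z b. R y z & b = 0", OF this] show ?thesis unfolding J_indicator by metis
qed

text \<open>The dimension of the relation is computed from both sides. Over y it is at least a+b;
  over z the fibres account for at most c of it, so the rest is carried by the z.\<close>

lemma double_count:
 assumes R: "dfl2 n m R" and lo: "dge n {y. dge m {z. R y z} b} a" and up: "!!z. length z = m==>~dge n {y. R y z} (Suc c)"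
 shows "dge m {z. EX y. length y = n & R y z} (a + b - c)"
proof -
 have "J n (%y. dge m {z. R y z}) (a + b)" using lo unfolding J_def by (intro exI[of _ a]) auto
 hence "J m (%z. dge n {y. R y z}) (a + b)" unfolding fubini[OF R] .
 then obtain k where k: "k<=a + b" "dge m {z. dge n {y. R y z} (a + b - k)} k" unfolding J_def by blast
 have "a + b - k<=c"
 proof (rule ccontr)
  assume "~?thesis"
  hence "dge m {z. dge n {y. R y z} (Suc c)} k"
   using k(2) dge_antimono[of "Suc c" "a + b - k"] by (elim dge_mono[rotated]) auto
  moreover have "dge m {z. dge n {y. R y z} (Suc c)} k = dge m ({} :: 'a list set) k" by (rule dge_cong) (simp add: up)
  ultimately show False by (simp add: dge_empty)
 qed
 have "dge m {z. EX y. length y = n & R y z} k"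
 proof (rule dge_mono[OF _ k(2)], clarify)
  fix z assume "dge n {y. R y z} (a + b - k)"
  hence "dge n {y. R y z} 0" by (rule dge_antimono[OF le0])
  thus "EX y. length y = n & R y z" unfolding dge_0 by auto
 qed
 moreover have "a + b - c<=k" using k(1) \<open>a + b - k<=c\<close> by linarith
 ultimately show ?thesis using dge_antimono by blast
qed

text \<open>If for many \<open>y\<close> the set of good parameters \<open>t\<close> has full dimension, then one
 parameter is good for many \<open>y\<close>; this replaces all arguments with generic points.\<close>

lemma fix_parameter:
 assumes R: "dfl2 n p R" and lo: "dge n {y. dge p {t. R y t} p} d"
 shows "EX t. length t = p & dge n {y. R y t} d"
proof (rule ccontr)
 assume h: "~?thesis"
 show False
 proof (cases d)
  case 0
  then obtain y where "dge p {t. R y t} p" "length y = n" using lo unfolding 0 dge_0 by auto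
  then obtain t where "R y t" "length t = p" using dge_antimono[OF le0] unfolding dge_0 by fastforce
  thus False using h 0 \<open>length y = n\<close> dge_0 by blast
 next
  case (Suc c)
  \<comment> \<open>Since d = c+1, the bound is p+1, which is impossible in M^p.\<close>
  have "dge p {t. EX y. length y = n & R y t} (d + p - c)"
   by (rule double_count[OF R lo]) (use h Suc in blast)
  thus False using dge_le[of p _ "d + p - c"] Suc by fastforce
 qed
qed

lemma box_full:
 "length a = k==>length b = k==>ALL i<k. a ! i<(b ! i :: 'a)==>dge k {x. length x = k & (ALL i<k. a ! i<x ! i & x ! i<b ! i)} k"
proof (induction k arbitrary: a b)
 case (Suc k)
 let ?B = "{x. length x = Suc k & (ALL i<Suc k. a ! i<x ! i & x ! i<b ! i)}"
 let ?a = "butlast a" and ?b = "butlast b"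
 have "dge k {x. length x = k & (ALL i<k. ?a ! i<x ! i & x ! i<?b ! i)} k"
  by (rule Suc.IH) (use Suc.prems in "auto simp: nth_butlast")
 moreover have "{x. length x = k & (ALL i<k. ?a ! i<x ! i & x ! i<?b ! i)}<={y. infinite {t. y @ [t]:?B}}"
 proof (intro subsetI CollectI)
  fix x assume "x:{x. length x = k & (ALL i<k. ?a ! i<x ! i & x ! i<?b ! i)}"
  hence "{a ! k<..<b ! k}<={t. x @ [t]:?B}"
   using Suc.prems by (auto simp: nth_append nth_butlast less_Suc_eq)
  moreover have "infinite {a ! k<..<b ! k}" using Suc.prems by (intro interval_infinite) auto
  ultimately show "infinite {t. x @ [t]:?B}" using finite_subset by blast
 qed
 ultimately have "dge k {y. infinite {t. y @ [t]:?B}} k" using dge_mono by blast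
 thus ?case by simp
qed simp

lemma dge_interior: "nonempty_interior k (W :: 'a list set)==>dge k W k"
proof -
 assume "nonempty_interior k W"
 then obtain a b where "length a = k" "length b = k" "ALL i<k. a ! i<b ! i"
  and sub: "{x. length x = k & (ALL i<k. a ! i<x ! i & x ! i<b ! i)}<=W"
  unfolding nonempty_interior_def by blast
 thus ?thesis by (intro dge_mono[OF sub] box_full)
qed

lemma dfn_mem': "A:S n==>ltrm n xs==>dfn (%e. xs e:A)"
 by (rule dfn_mem) auto

text \<open>By induction most base points have an interval in the fibre. Its endpoints depend on the
  base point, but can be moved freely in a set of dimension 2, so \<open>fix_parameter\<close> makes
  them constant over a set of full dimension, which contains a box.\<close>

lemma interior_dge:
 "W:S k==>dge k W k==>nonempty_interior k W"
proof (induction k arbitrary: W)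
 case 0 thus ?case by (auto simp: nonempty_interior_def)
next
 case (Suc k)
 define E where "E y t <-> t ! 0<t ! 1 & (ALL s. t ! 0<s & s<t ! 1 --> y @ [s]:W)" for y t :: "'a list"
 have mem: "dfn (%e. xs e @ [t e]:W)" if "ltrm k xs" "trm t" for xs t
  by (rule dfn_mem[OF Suc.prems(1) ltrm_append[OF that(1) ltrm_Cons[OF that(2) ltrm_Nil]]]) simp
 have E: "dfn (%e. E (xs e) (ts e))" if "ltrm k xs" "ltrm 2 ts" for xs ts
 proof -
  have "ltrm k (%e. xs (%i. e (Suc i)))" "trm (%e. ts (%i. e (Suc i)) ! 0)" "trm (%e. ts (%i. e (Suc i)) ! 1)"
   using ltrm_shift[OF that(1)] ltrm_shift[OF that(2)] trm_nth[of 2] by auto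
  thus ?thesis unfolding E_def by (intro dfnr trm_nth[OF that(2)] mem) auto
 qed
 have E2: "dfl2 k 2 E" unfolding dfl2_def by (rule E[OF ltrm_vars ltrm_vars])
 have "~dge k {y. EX t. y @ [t]:W} (Suc k)" using dge_le[of k _ "Suc k"] by auto
 hence "dge k {y. infinite {t. y @ [t]:W}} k" using Suc.prems(2) by simp
 moreover have "dge k {y. infinite {t. y @ [t]:W}} k = dge k {y. length y = k & infinite {t. y @ [t]:W}} k"
  by (rule dge_cong) simp
 moreover have "{y. length y = k & infinite {t. y @ [t]:W}}<={y. dge 2 {t. E y t} 2}"
 proof (rule subsetI)
  fix y assume "y:{y. length y = k & infinite {t. y @ [t]:W}}"
  hence y: "length y = k" "infinite {t. y @ [t]:W}" by simp_all
  have "dfn (%e. e 0:{t. y @ [t]:W})" unfolding mem_Collect_eq by (rule mem[OF ltrm_const[OF y(1)] trm_var])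
  then obtain c d where cd: "c<d" "{c<..<d}<={t. y @ [t]:W}" using dfn1_infinite y by blast
  \<comment> \<open>The left endpoint may vary in (c,m) and the right endpoint in (m,d).\<close>
  obtain m where m: "c<m" "m<d" using dense cd by blast
  have "dge 2 {x. length x = 2 & (ALL i<2. [c, m] ! i<x ! i & x ! i<[m, d] ! i)} 2"
   using m by (intro box_full) (auto simp: less_Suc_eq numeral_2_eq_2)
  moreover have "{x. length x = 2 & (ALL i<2. [c, m] ! i<x ! i & x ! i<[m, d] ! i)}<={t. E y t}"
  proof
   fix x assume "x:{x. length x = 2 & (ALL i<2. [c, m] ! i<x ! i & x ! i<[m, d] ! i)}"
   hence h: "ALL i<2. [c, m] ! i<x ! i & x ! i<[m, d] ! i" by simp
   have x: "c<x ! 0" "x ! 0<m" "m<x ! 1" "x ! 1<d" using h[rule_format, of 0] h[rule_format, of 1] by auto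
   have "y @ [s]:W" if "x ! 0<s" "s<x ! 1" for s
   proof -
    have "s:{c<..<d}" using that x by auto
    thus ?thesis using cd(2) by blast
   qed
   thus "x:{t. E y t}" using x unfolding E_def by auto
  qed
  ultimately show "y:{y. dge 2 {t. E y t} 2}" using dge_mono by blast
 qed
 ultimately have "dge k {y. dge 2 {t. E y t} 2} k" by (simp only: dge_mono)
 then obtain t where t: "length t = 2" "dge k {y. E y t} k" using fix_parameter[OF E2] by blast
 have "{y. length y = k & E y t}:S k" by (rule S_I) (rule E[OF ltrm_vars ltrm_const[OF t(1)]])
 moreover have "dge k {y. length y = k & E y t} k" using t(2) dge_cong[of k "{y. length y = k & E y t}" "{y. E y t}"] by simp
 ultimately obtain a b where ab: "length a = k" "length b = k" "ALL i<k. a ! i<b ! i"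
  "{x. length x = k & (ALL i<k. a ! i<x ! i & x ! i<b ! i)}<={y. length y = k & E y t}"
  using Suc.IH unfolding nonempty_interior_def by blast
 obtain x0 where "x0:{x. length x = k & (ALL i<k. a ! i<x ! i & x ! i<b ! i)}"
  using box_full[OF ab(1-3)] dge_antimono[of 0 k] dge_0 by blast
 hence t01: "t ! 0<t ! 1" using ab(4) unfolding E_def by blast
 have sub: "{x. length x = Suc k & (ALL i<Suc k. (a @ [t ! 0]) ! i<x ! i & x ! i<(b @ [t ! 1]) ! i)}<=W"
 proof
  fix x assume "x:{x. length x = Suc k & (ALL i<Suc k. (a @ [t ! 0]) ! i<x ! i & x ! i<(b @ [t ! 1]) ! i)}"
  hence x: "length x = Suc k" "ALL i<Suc k. (a @ [t ! 0]) ! i<x ! i & x ! i<(b @ [t ! 1]) ! i" by auto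
  then obtain y s where ys: "x = y @ [s]" "length y = k" by (metis length_Suc_conv_rev)
  have "ALL i<k. a ! i<y ! i & y ! i<b ! i" using x(2) ys ab by (auto simp: nth_append split: if_splits)
  hence "E y t" using ab(4) ys by blast
  moreover have "t ! 0<s & s<t ! 1" using x(2) ys ab by (auto simp: nth_append dest: spec[of _ k])
  ultimately show "x:W" unfolding E_def ys(1) by blast
 qed
 show ?case unfolding nonempty_interior_def
  by (intro exI[of _ "a @ [t ! 0]"] exI[of _ "b @ [t ! 1]"] conjI sub)
    (use ab t01 in "auto simp: nth_append less_Suc_eq")
qed

end

section \<open>The recursive dimension agrees with the dimension by projections\<close>

context omin
begin

lemma dfl2_swap: "dfl2 n m R==>dfl2 m n (%z y. R y z)"
 unfolding dfl2_def[of m n] by (erule dfl2_sub[OF _ ltrm_vars ltrm_vars])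

text \<open>Dimension does not grow along a finite-valued correspondence: in the double count the
  fibres over x contribute 0.\<close>

lemma dge_image:
 assumes R: "dfl2 n m R" and f: "!!x. length x = n==>finite {w. length w = m & R x w}"
  and d: "dge m {w. EX x. length x = n & R x w} d"
 shows "dge n {x. EX w. length w = m & R x w} d"
proof -
 have "dge n {x. EX w. length w = m & R x w} (d + 0 - 0)"
 proof (rule double_count[OF dfl2_swap[OF R]])
  show "dge m {w. dge n {x. R x w} 0} d" using d unfolding dge_0 by (elim dge_mono[rotated]) auto
  fix x :: "'a list" assume "length x = n"
  hence "finite ({w. R x w} Int {w. length w = m})" using f by (simp add: Int_def conj_commute)
  thus "~dge m {w. R x w} (Suc 0)" using dge_1[of m "{w. R x w}"] by simp
 qed
 thus ?thesis by simp
qed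

lemma dfn_list_eq: "ltrm n xs==>ltrm n ys==>dfn (%e. xs e = ys e)"
proof -
 assume h: "ltrm n xs" "ltrm n ys"
 have "dfn (%e. ALL i<n. xs e ! i = ys e ! i)" by (rule dfn_ball_less, rule dfn_eq, rule trm_nth[OF h(1)], assumption, rule trm_nth[OF h(2)])
 moreover have "(%e. xs e = ys e) = (%e. ALL i<n. xs e ! i = ys e ! i)"
  using h by (auto simp: ltrm_def list_eq_iff_nth_eq)
 ultimately show ?thesis by simp
qed

lemma ltrm_coord: "ltrm n xs==>set ks<={..<n}==>ltrm (length ks) (%e. coord_proj ks (xs e))"
 unfolding ltrm_def coord_proj_def by (auto simp: subset_iff)

lemma dge_coord_proj:
 assumes X: "X:S n" and ks: "set ks<={..<n}" and d: "dge (length ks) (coord_proj ks ` X) d"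
 shows "dge n X d"
proof -
 let ?R = "%x w. x:X & w = coord_proj ks x"
 have R: "dfl2 n (length ks) ?R"
  unfolding dfl2_def by (rule dfn_conj dfn_mem'[OF X] dfn_list_eq ltrm_vars ltrm_coord ks)+
 have "dge n {x. EX w. length w = length ks & ?R x w} d"
 proof (rule dge_image[OF R])
  show "dge (length ks) {w. EX x. length x = n & ?R x w} d"
   using d S_len[OF X] by (elim dge_mono[rotated]) auto
 qed simp
 thus ?thesis by (rule dge_mono[rotated]) auto
qed

lemma nonempty_interior_mono: "nonempty_interior k A==>A<=B==>nonempty_interior k B"
 unfolding nonempty_interior_def by (elim exE conjE) (intro exI conjI; (assumption | blast))

lemma S_proj: "X:S (Suc n)==>{y. EX t. y @ [t]:X}:S n"
proof -
 assume X: "X:S (Suc n)"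
 have "{y. EX t. y @ [t]:X} = butlast ` X"
 proof (intro Set.set_eqI iffI)
  fix y assume "y:butlast ` X"
  then obtain x where x: "x:X" "y = butlast x" by blast
  hence "length x = Suc n" using S_len[OF X] by auto
  hence "y @ [last x] = x" using x by (metis append_butlast_last_id length_0_conv nat.distinct(1))
  hence "y @ [last x]:X" using x(1) by simp
  thus "y:{y. EX t. y @ [t]:X}" by blast
 qed (force intro: rev_image_eqI)
 thus ?thesis using S_butlast[OF X] by simp
qed

lemma dfn_snoc: "X:S (Suc n)==>ltrm n xs==>trm t==>dfn (%e. xs e @ [t e]:X)"
 by (rule dfn_mem[OF _ ltrm_append[OF _ ltrm_Cons[OF _ ltrm_Nil]]]) auto

lemma S_inf: "X:S (Suc n)==>{y. infinite {t. y @ [t]:X}}:S n"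
proof -
 assume X: "X:S (Suc n)"
 have "{y. length y = n & infinite {t. y @ [t]:X}}:S n"
  by (rule S_I dfn_infinite dfn_snoc[OF X] ltrm_vars trm_var)+
 moreover have "{y. length y = n & infinite {t. y @ [t]:X}} = {y. infinite {t. y @ [t]:X}}"
 proof (intro Set.set_eqI iffI)
  fix y assume "y:{y. infinite {t. y @ [t]:X}}"
  then obtain t where "y @ [t]:X" using not_finite_existsD by blast
  hence "length y = n" using S_len[OF X] by auto
  thus "y:{y. length y = n & infinite {t. y @ [t]:X}}" using \<open>y:{y. infinite {t. y @ [t]:X}}\<close> by simp
 qed auto
 ultimately show ?thesis by simp
qed

text \<open>An infinite last fibre adds the last coordinate to the list of projections. In the other
  direction a coordinate projection is a definable map and cannot raise dimension. Via
  \<open>odim_ge\<close> this ties the inductive notion to \<open>odim\<close>.\<close>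

lemma dge_iff_proj:
 assumes "X:S n"
 shows "dge n X k <-> (EX ks. length ks = k & distinct ks & set ks<={..<n} & nonempty_interior k (coord_proj ks ` X))"
proof
 assume "dge n X k"
 with assms show "EX ks. length ks = k & distinct ks & set ks<={..<n} & nonempty_interior k (coord_proj ks ` X)"
 proof (induction n arbitrary: X k)
  case 0
  thus ?case by (intro exI[of _ "[]"]) (auto simp: nonempty_interior_def coord_proj_def image_iff)
 next
  case (Suc n)
  have nth: "coord_proj ks (y @ [t]) = coord_proj ks y" if "set ks<={..<n}" "length y = n" for "ks" y and t :: 'a
   using that by (auto simp: coord_proj_def nth_append subset_iff)
  have len: "length y = n" if "y @ [t]:X" for y t using that S_len[OF Suc.prems(1)] by auto
  from Suc.prems(2) consider "dge n {y. EX t. y @ [t]:X} k" | "0<k" "dge n {y. infinite {t. y @ [t]:X}} (k - 1)" by auto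
  thus ?case
  proof cases
   case 1
   then obtain "ks" where i: "length ks = k" "distinct ks" "set ks<={..<n}" "nonempty_interior k (coord_proj ks ` {y. EX t. y @ [t]:X})"
    using Suc.IH[OF S_proj[OF Suc.prems(1)]] by blast
   have "coord_proj ks ` {y. EX t. y @ [t]:X}<=coord_proj ks ` X"
   proof clarify
    fix y t assume "y @ [t]:X"
    thus "coord_proj ks y:coord_proj ks ` X" using nth[OF i(3) len] by (metis image_eqI)
   qed
   hence "nonempty_interior k (coord_proj ks ` X)" using i(4) nonempty_interior_mono by blast
   thus ?thesis using i by (intro exI[of _ "ks"]) auto
  next
   case 2
   let ?I = "{y. infinite {t. y @ [t]:X}}"
   obtain "ks" where i: "length ks = k - 1" "distinct ks" "set ks<={..<n}" "nonempty_interior (k - 1) (coord_proj ks ` ?I)"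
    using Suc.IH[OF S_inf[OF Suc.prems(1)] 2(2)] by blast
   let ?js = "ks @ [n]" and ?W = "coord_proj (ks @ [n]) ` X"
   have js: "set ?js<={..<Suc n}" "length ?js = k" using i 2 by auto
   have lt: "ltrm k (%e. coord_proj ?js (xs e))" if "ltrm (Suc n) xs" for xs using ltrm_coord[OF that js(1)] js(2) by simp
   have "{w. length w = k & (EX x:X. w = coord_proj ?js x)}:S k"
    by (rule S_I dfn_bex[OF Suc.prems(1)] dfn_list_eq ltrm_vars lt)+
   moreover have "{w. length w = k & (EX x:X. w = coord_proj ?js x)} = ?W" using js by (auto simp: coord_proj_def)
   ultimately have W: "?W:S k" by simp
   have "coord_proj ks ` ?I<={w. infinite {t. w @ [t]:?W}}"
   proof (intro image_subsetI CollectI)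
    fix y assume y: "y:?I"
    have "{t. y @ [t]:X}<={t. coord_proj ks y @ [t]:?W}"
    proof clarify
     fix t assume t: "y @ [t]:X"
     hence "coord_proj ?js (y @ [t]) = coord_proj ks y @ [t]" using nth[OF i(3) len[OF t]] len[OF t] by (simp add: coord_proj_def nth_append)
     thus "coord_proj ks y @ [t]:?W" using t by (metis image_eqI)
    qed
    thus "infinite {t. coord_proj ks y @ [t]:?W}" using y finite_subset by blast
   qed
   hence "dge (k - 1) {w. infinite {t. w @ [t]:?W}} (k - 1)" using dge_interior[OF i(4)] dge_mono by blast
   hence "dge (Suc (k - 1)) ?W (Suc (k - 1))" by simp
   hence "dge k ?W k" using 2(1) by simp
   hence "nonempty_interior k ?W" by (rule interior_dge[OF W])
   moreover have "distinct ?js" using i by auto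
   ultimately show ?thesis using js by blast
  qed
 qed
next
 assume "EX ks. length ks = k & distinct ks & set ks<={..<n} & nonempty_interior k (coord_proj ks ` X)"
 then obtain "ks" where "length ks = k" "set ks<={..<n}" "nonempty_interior k (coord_proj ks ` X)" by blast
 thus "dge n X k" using dge_coord_proj[OF assms, of "ks" k] dge_interior by blast
qed

lemma odim_ge: assumes "X:S n" shows "int d<=odim n X <-> dge n X d"
proof (cases "X = {}")
 case True thus ?thesis by (simp add: odim_def dge_empty)
next
 case False
 let ?g = "GREATEST k. dge n X k"
 have o: "odim n X = int ?g" using False unfolding odim_def dge_iff_proj[OF assms] by simp
 have "dge n X 0" using False S_len[OF assms] by (auto simp: dge_0)
 hence g: "dge n X ?g" by (rule GreatestI_nat[where b = n]) (rule dge_le)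
 have "dge n X d==>d<=?g" by (rule Greatest_le_nat[where b = n]) (auto intro: dge_le)
 thus ?thesis using o g dge_antimono by auto
qed

subsection \<open>Neighbourhoods\<close>

definition bx :: "nat => 'a list => 'a list => 'a list set" where
 "bx n u v = {x. length x = n & (ALL i<n. u ! i<x ! i & x ! i<v ! i)}"

text \<open>The property holds on an open box around y. Quantifying over the corner tuples keeps the
  topology first order.\<close>

definition nbh :: "nat => 'a list => ('a list => bool) => bool" where
 "nbh n y P <-> (EX u:{u. length u = n}. EX v:{v. length v = n}. y:bx n u v & (ALL x:{x. length x = n}. x:bx n u v --> P x))"

lemma nbhI: "length u = n==>length v = n==>y:bx n u v==>(!!x. length x = n==>x:bx n u v==>P x)==>nbh n y P"
 unfolding nbh_def by blast

lemma nbhE: assumes "nbh n y P" obtains u v where "length u = n" "length v = n" "y:bx n u v" "!!x. x:bx n u v==>P x"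
 using assms unfolding nbh_def bx_def by blast

lemma nbh_mono: "nbh n y P==>(!!x. length x = n==>P x==>Q x)==>nbh n y Q"
 unfolding nbh_def by blast

lemma nbh_self: "nbh n y P==>P y"
 unfolding nbh_def bx_def by blast

lemma nbh_conj: assumes "nbh n y P" "nbh n y Q" shows "nbh n y (%x. P x & Q x)"
proof -
 obtain u v where uv: "length u = n" "length v = n" "y:bx n u v" "!!x. x:bx n u v==>P x" using nbhE[OF assms(1)] by blast
 obtain u' v' where uv': "length u' = n" "length v' = n" "y:bx n u' v'" "!!x. x:bx n u' v'==>Q x" using nbhE[OF assms(2)] by blast
 let ?u = "map (%i. max (u ! i) (u' ! i)) [0..<n]" and ?v = "map (%i. min (v ! i) (v' ! i)) [0..<n]"
 have e: "bx n ?u ?v = bx n u v Int bx n u' v'" by (auto simp: bx_def)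
 show ?thesis
  by (rule nbhI[of ?u _ ?v]) (use uv uv' in "auto simp: e")
qed

lemma nbh_const: assumes "length y = n" "P" shows "nbh n y (%x. P)"
proof -
 have "EX u. ALL i. u i<y ! i" using choice[of "%i u. u<y ! i"] no_bot by blast
 moreover have "EX v. ALL i. y ! i<v i" using choice[of "%i v. y ! i<v"] no_top by blast
 ultimately obtain u v where "ALL i. u i<y ! i" "ALL i. y ! i<v i" by blast
 thus ?thesis
  by (intro nbhI[of "map u [0..<n]" _ "map v [0..<n]"]) (use assms in "auto simp: bx_def")
qed

lemma nbh_less: assumes "length y = n" "i<n" "y ! i<c" shows "nbh n y (%x. x ! i<c)"
proof -
 obtain u v where uv: "length u = n" "length v = n" "y:bx n u v" using nbh_const[OF assms(1), of True] unfolding nbh_def by blast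
 show ?thesis
  by (rule nbhI[of u _ "v[i := min c (v ! i)]"]) (use uv assms in "auto simp: bx_def nth_list_update")
qed

lemma nbh_greater: assumes "length y = n" "i<n" "c<y ! i" shows "nbh n y (%x. c<x ! i)"
proof -
 obtain u v where uv: "length u = n" "length v = n" "y:bx n u v" using nbh_const[OF assms(1), of True] unfolding nbh_def by blast
 show ?thesis
  by (rule nbhI[of "u[i := max c (u ! i)]" _ v]) (use uv assms in "auto simp: bx_def nth_list_update")
qed

lemma nbh_ball: "finite F==>length y = n==>(!!f. f:F==>nbh n y (P f))==>nbh n y (%x. ALL f:F. P f x)"
proof (induction F rule: finite_induct)
 case empty thus ?case by (simp add: nbh_const)
next
 case (insert a F)
 hence "nbh n y (%x. P a x & (ALL f:F. P f x))" by (intro nbh_conj) auto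
 thus ?case by simp
qed

lemma nbh_bx: "length u = n==>length v = n==>y:bx n u v==>nbh n y (%x. x:bx n u v)"
 by (rule nbhI)

lemma nbh_neq: assumes "length y = n" "length x = n" "x~=y" shows "nbh n y (%z. z~=x)"
proof -
 obtain i where i: "i<n" "x ! i~=y ! i" using assms by (metis nth_equalityI)
 then consider "x ! i<y ! i" | "y ! i<x ! i" by (meson linorder_neqE)
 thus ?thesis
 proof cases
  case 1 show ?thesis by (rule nbh_mono[OF nbh_greater[OF assms(1) i(1) 1]]) auto
 next
  case 2 show ?thesis by (rule nbh_mono[OF nbh_less[OF assms(1) i(1) 2]]) auto
 qed
qed

lemma nbh_avoid: assumes "finite F" "length y = n" "y~:F" "F<={x. length x = n}" shows "nbh n y (%z. z~:F)"
proof -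
 have "nbh n y (%z. ALL x:F. z~=x)" by (rule nbh_ball[OF assms(1,2)]) (use assms nbh_neq in auto)
 thus ?thesis by (rule nbh_mono) auto
qed

lemma dfn_bx: assumes "ltrm n xs" "ltrm n us" "ltrm n vs" shows "dfn (%e. xs e:bx n (us e) (vs e))"
proof -
 have "dfn (%e. ALL i<n. us e ! i<xs e ! i & xs e ! i<vs e ! i)"
  by (rule dfn_ball_less dfn_conj dfn_less trm_nth[OF assms(1)] trm_nth[OF assms(2)] trm_nth[OF assms(3)] | assumption)+
 moreover have "(%e. xs e:bx n (us e) (vs e)) = (%e. ALL i<n. us e ! i<xs e ! i & xs e ! i<vs e ! i)"
  using assms(1) by (auto simp: bx_def ltrm_def)
 ultimately show ?thesis by simp
qed

lemma dfn_nbh: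
 assumes xs: "ltrm n xs" and P: "dfn (%e. P (map e [0..<n]) (%i. e (i + n)))"
 shows "dfn (%e. nbh n (xs e) (%x. P x e))"
proof -
 have 1: "ltrm n (%e. xs (%i. e (i + n + n)))" using ltrm_shift[OF xs, of "%i. i + n + n"] .
 let ?f = "%i. if i<n then i else i + n + n"
 have m1: "map (%i. e (?f i)) [0..<n] = map e [0..<n]" for e :: "nat => 'a" by simp
 have m2: "(%i. e (?f (i + n))) = (%i. e (i + n + n + n))" for e :: "nat => 'a" by auto
 have 2: "dfn (%e. P (map e [0..<n]) (%i. e (i + n + n + n)))"
  using dfn_rename[OF P, of ?f] unfolding m1 m2 .
 show ?thesis unfolding nbh_def
  by (rule dfn_bexl dfn_conj dfn_balll dfn_imp dfn_bx 1 2 ltrm_vars)+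
qed

definition cl :: "nat => 'a list set => 'a list set" where
 "cl n A = {x. length x = n & ~nbh n x (%z. z~:A)}"

lemma S_cl: "A:S n==>cl n A:S n"
 unfolding cl_def by (rule S_I dfn_not dfn_nbh ltrm_vars dfn_mem' | assumption)+

lemma S_diff: "A:S n==>B:S n==>A - B:S n"
proof -
 assume "A:S n" "B:S n"
 moreover have "A - B = A Int ({x. length x = n} - B)" using S_len[OF \<open>A:S n\<close>] by auto
 ultimately show ?thesis using S_Int S_compl by simp
qed

lemma S_sub: assumes "A:S n" "dfn (%e. ph (map e [0..<n]))" shows "{x:A. ph x}:S n"
proof -
 have "{x. length x = n & ph x} Int A:S n" by (intro S_Int S_I assms)
 moreover have "{x. length x = n & ph x} Int A = {x:A. ph x}" using S_len[OF assms(1)] by auto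
 ultimately show ?thesis by simp
qed

text \<open>\<open>fix_parameter\<close> with the pair of corners of a box as parameter. A property
  of all small boxes around a point that may depend on y holds, for many y, with one common
  box.\<close>

lemma fix_box:
 assumes R: "dfn (%e. R (map e [0..<k]) (map (%i. e (i + k)) [0..<n]) (map (%i. e (i + (k + n))) [0..<n]))"
  and Y: "dge k Y d"
  and h: "!!y. y:Y==>length y = k==>EX x u v. length u = n & length v = n & x:bx n u v &
   (ALL u' v'. length u' = n & length v' = n & x:bx n u' v' & bx n u' v'<=bx n u v --> R y u' v')"
 shows "EX u v. length u = n & length v = n & dge k {y. R y u v} d"
proof -
 let ?R = "%y t. R y (take n t) (drop n t)"
 have "take n (map (%i. e (i + k)) [0..<n + n]) = map (%i. e (i + k)) [0..<n]"
  "drop n (map (%i. e (i + k)) [0..<n + n]) = map (%i. e (i + (k + n))) [0..<n]" for e :: "nat => 'a"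
  by (auto simp: take_map drop_map intro!: nth_equalityI) (simp add: add.commute add.left_commute)
 hence Rd: "dfl2 k (n + n) ?R" unfolding dfl2_def using R by simp
 have "dge k {y. dge (n + n) {t. ?R y t} (n + n)} d"
 proof (rule dge_mono[OF _ Y[folded dge_len[of k Y]]], rule subsetI)
  fix y assume "y:Y Int {x. length x = k}"
  hence y: "y:Y" "length y = k" by auto
  then obtain x u v where xuv: "length u = n" "length v = n" "x:bx n u v"
   "ALL u' v'. length u' = n & length v' = n & x:bx n u' v' & bx n u' v'<=bx n u v --> R y u' v'"
   using h by blast
  have x: "length x = n" "ALL i<n. u ! i<x ! i" "ALL i<n. x ! i<v ! i" using xuv(3) by (auto simp: bx_def)
  \<comment> \<open>Lower corners between u and x, upper corners between x and v: an open set of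
    parameters, each giving a box around x inside the given one.\<close>
  let ?B = "{t. length t = n + n & (ALL i<n + n. (u @ x) ! i<t ! i & t ! i<(x @ v) ! i)}"
  have "dge (n + n) ?B (n + n)" by (rule box_full) (use x xuv in "auto simp: nth_append")
  moreover have "?B<={t. ?R y t}"
  proof (intro subsetI CollectI)
   fix t assume "t:?B"
   hence t: "length t = n + n" "!!i. i<n + n==>(u @ x) ! i<t ! i & t ! i<(x @ v) ! i" by auto
   have 1: "u ! i<t ! i" "t ! i<x ! i" if "i<n" for i using t(2)[of i] that x xuv by (auto simp: nth_append)
   have 2: "x ! i<t ! (n + i)" "t ! (n + i)<v ! i" if "i<n" for i using t(2)[of "n + i"] that x xuv by (auto simp: nth_append)
   have "x:bx n (take n t) (drop n t)" using x(1) t(1) 1 2 by (auto simp: bx_def)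
   moreover have "bx n (take n t) (drop n t)<=bx n u v" using t(1) 1 2 by (fastforce simp: bx_def intro: less_trans)
   ultimately show "?R y t" using xuv(4) t(1) by auto
  qed
  ultimately show "y:{y. dge (n + n) {t. ?R y t} (n + n)}" using dge_mono by blast
 qed
 then obtain t where "length t = n + n" "dge k {y. ?R y t} d" using fix_parameter[OF Rd] by blast
 thus ?thesis by (intro exI[of _ "take n t"] exI[of _ "drop n t"]) auto
qed

text \<open>The frontier of a set has smaller dimension than the set. Otherwise it projects onto an
  open set of some M^d over which the fibres of \<open>A\<close> are mostly finite. A box around a
  frontier point avoiding such a fibre can be chosen uniformly over an open set, and there it
  contains frontier points but no point of \<open>A\<close>.\<close>

theorem frontier:
 assumes A: "A:S n" and d: "dge n (cl n A - A) d"
 shows "dge n A (Suc d)"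
proof (rule ccontr)
 assume nd: "~dge n A (Suc d)"
 let ?D = "cl n A - A"
 have D: "?D:S n" by (intro S_diff S_cl A)
 obtain "ks" where i: "length ks = d" "set ks<={..<n}" "nonempty_interior d (coord_proj ks ` ?D)"
  using d unfolding dge_iff_proj[OF D] by blast
 let ?pf = "coord_proj ks"
 have pl: "length (?pf x) = d" for x :: "'a list" using i(1) by (simp add: coord_proj_def)
 have ltpi: "ltrm d (%e. ?pf (xs e))" if "ltrm n xs" for xs using ltrm_coord[OF that i(2)] i(1) by simp
 \<comment> \<open>Base points with infinite fibre; d-dimensionally many of them would give
   \<open>A\<close> dimension d+1.\<close>
 define Wi where "Wi = {w. length w = d & dge n {x. x:A & ?pf x = w} 1}"
 have Wi: "~dge d Wi d"
 proof
  assume h: "dge d Wi d"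
  have "dfl2 d n (%w x. x:A & ?pf x = w)" unfolding dfl2_def by (rule dfn_conj dfn_mem'[OF A] dfn_list_eq ltpi ltrm_vars)+
  moreover have "dge d {w. dge n {x. x:A & ?pf x = w} 1} d" using h unfolding Wi_def by (elim dge_mono[rotated]) auto
  moreover have "~dge d {w. x:A & ?pf x = w} (Suc 0)" for x
   using dge_finite[of "{w. x:A & ?pf x = w}" d "Suc 0"] by auto
  ultimately have "dge n {x. EX w. length w = d & (x:A & ?pf x = w)} (d + 1 - 0)" by (rule double_count)
  thus False using nd dge_mono[of "{x. EX w. length w = d & (x:A & ?pf x = w)}" A] by auto
 qed
 define Y0 where "Y0 = ?pf ` ?D - Wi"
 have "dge d (?pf ` ?D) d" using dge_interior[OF i(3)] .
 moreover have "?pf ` ?D<=Y0 Un Wi" unfolding Y0_def by blast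
 ultimately have "dge d (Y0 Un Wi) d" using dge_mono by blast
 hence Y0: "dge d Y0 d" using Wi dge_Un by blast
 \<comment> \<open>The box meets the frontier over w but misses \<open>A\<close> over w.\<close>
 define R where "R w u v <-> (EX y:?D. ?pf y = w & y:bx n u v) & ~(EX x:A. ?pf x = w & x:bx n u v)" for w u v
 have "EX u v. length u = n & length v = n & dge d {w. R w u v} d"
 proof (rule fix_box[OF _ Y0])
  show "dfn (%e. R (map e [0..<d]) (map (%i. e (i + d)) [0..<n]) (map (%i. e (i + (d + n))) [0..<n]))"
   unfolding R_def by (rule dfn_conj dfn_not dfn_bex[OF D] dfn_bex[OF A] dfn_list_eq dfn_bx ltpi ltrm_vars)+
 next
  fix w assume w: "w:Y0" "length w = d"
  then obtain y where y: "y:?D" "?pf y = w" "w~:Wi" unfolding Y0_def by blast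
  let ?F = "{x. x:A & ?pf x = w}"
  have "?F Int {x. length x = n} = ?F" using S_len[OF A] by auto
  hence "finite ?F" using y(3) w(2) dge_1[of n ?F] unfolding Wi_def by auto
  moreover have ly: "length y = n" using S_len[OF D] y by auto
  ultimately have "nbh n y (%z. z~:?F)" by (intro nbh_avoid) (use y S_len[OF A] in auto)
  then obtain u v where uv: "length u = n" "length v = n" "y:bx n u v" "!!x. x:bx n u v==>x~:?F" using nbhE by blast
  show "EX x u v. length u = n & length v = n & x:bx n u v &
   (ALL u' v'. length u' = n & length v' = n & x:bx n u' v' & bx n u' v'<=bx n u v --> R w u' v')"
  proof (rule exI[of _ y], rule exI[of _ u], rule exI[of _ v], intro conjI allI impI)
   fix u' v' assume "length u' = n & length v' = n & y:bx n u' v' & bx n u' v'<=bx n u v"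
   thus "R w u' v'" unfolding R_def using y uv(4) by blast
  qed (rule uv)+
 qed
 then obtain u v where uv: "length u = n" "length v = n" "dge d {w. R w u v} d" by blast
 have "{w. length w = d & R w u v}:S d"
  unfolding R_def by (rule S_I dfn_conj dfn_not dfn_bex[OF D] dfn_bex[OF A] dfn_list_eq dfn_bx ltpi ltrm_vars ltrm_const uv(1) uv(2))+
 moreover have "dge d {w. length w = d & R w u v} d"
  using uv(3) dge_cong[of d "{w. length w = d & R w u v}" "{w. R w u v}"] by simp
 ultimately have "nonempty_interior d {w. length w = d & R w u v}" by (rule interior_dge)
 then obtain a b where ab: "length a = d" "length b = d" "ALL i<d. a ! i<b ! i" "bx d a b<={w. length w = d & R w u v}"
  unfolding nonempty_interior_def bx_def by blast
 obtain w where w: "w:bx d a b" using box_full[OF ab(1-3)] dge_antimono[of 0 d] dge_0 unfolding bx_def by blast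
 then obtain y where y: "y:?D" "?pf y = w" "y:bx n u v" using ab(4) unfolding R_def by blast
 have ly: "length y = n" using S_len[OF D] y by auto
 have "nbh n y (%x. ALL j:{..<d}. a ! j<x ! (ks ! j) & x ! (ks ! j)<b ! j)"
 proof (rule nbh_ball[OF _ ly])
  fix j assume j: "j:{..<d}"
  hence "ks ! j<n" using i by (metis lessThan_iff nth_mem subsetD)
  moreover have "w ! j = y ! (ks ! j)" using j y(2) i(1) by (auto simp: coord_proj_def)
  hence "a ! j<y ! (ks ! j)" "y ! (ks ! j)<b ! j" using w j by (auto simp: bx_def)
  ultimately show "nbh n y (%x. a ! j<x ! (ks ! j) & x ! (ks ! j)<b ! j)" by (intro nbh_conj nbh_less nbh_greater ly)
 qed simp
 hence "nbh n y (%x. ?pf x:bx d a b)" by (rule nbh_mono) (auto simp: bx_def coord_proj_def i(1))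
 hence "nbh n y (%x. x:bx n u v & ?pf x:bx d a b)" by (intro nbh_conj nbh_bx uv y(3))
 moreover have "z~:A" if "z:bx n u v & ?pf z:bx d a b" for z
 proof
  assume "z:A"
  moreover have "R (?pf z) u v" using that ab(4) by blast
  ultimately show False using that unfolding R_def by blast
 qed
 ultimately have "nbh n y (%z. z~:A)" by (elim nbh_mono)
 thus False using y(1) unfolding cl_def by blast
qed

text \<open>The points of \<open>Y1\<close> at which it is not open relative to \<open>Y\<close> lie
  on the frontier of \<open>Y - Y1\<close>. This is the usual way below to show that an exceptional
  set is small: definable conditions hold locally at most points where they hold.\<close>

lemma interior_large:
 assumes Y: "Y:S n" and Y1: "Y1:S n" "Y1<=Y" and d: "dge n {y:Y1. ~nbh n y (%z. z:Y --> z:Y1)} d"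
 shows "dge n Y (Suc d)"
proof -
 have YY: "Y - Y1:S n" by (intro S_diff Y Y1)
 have "{y:Y1. ~nbh n y (%z. z:Y --> z:Y1)}<=cl n (Y - Y1) - (Y - Y1)"
  using S_len[OF Y1(1)] by (auto simp: cl_def)
 hence "dge n (cl n (Y - Y1) - (Y - Y1)) d" using d dge_mono by blast
 hence "dge n (Y - Y1) (Suc d)" by (rule frontier[OF YY])
 thus ?thesis by (rule dge_mono[rotated]) auto
qed

end

section \<open>Generic semicontinuity of fibres\<close>

context omin
begin

lemma trm_last: "ltrm (Suc n) xs==>trm (%e. last (xs e))"
proof -
 assume h: "ltrm (Suc n) xs"
 have "last (xs e) = xs e ! n" for e
  using h by (subst last_conv_nth) (auto simp: ltrm_def, metis length_0_conv nat.distinct(1))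
 thus ?thesis using trm_nth[OF h, of n] by simp
qed

lemma ltrm_butlast: "ltrm (Suc n) xs==>ltrm n (%e. butlast (xs e))"
 unfolding ltrm_def by (auto simp: nth_butlast)

lemmas drl = dfn_conj dfn_disj dfn_imp dfn_iff dfn_infinite dfn_not dfn_ex dfn_all dfn_less dfn_le dfn_eq dfn_nbh
 trm_var trm_const ltrm_vars trm_last ltrm_butlast

lemma nbh_snoc:
 assumes "nbh (Suc n) (y @ [s]) Q"
 shows "EX c1 c2. c1<s & s<c2 & nbh n y (%y'. ALL r. c1<r & r<c2 --> Q (y' @ [r]))"
proof -
 obtain u v where uv: "length u = Suc n" "length v = Suc n" "y @ [s]:bx (Suc n) u v" "!!x. x:bx (Suc n) u v==>Q x"
  using nbhE[OF assms] by blast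
 have y: "length y = n" and b: "!!i. i<Suc n==>u ! i<(y @ [s]) ! i & (y @ [s]) ! i<v ! i"
  using uv(3) by (auto simp: bx_def)
 have "nbh n y (%y'. ALL r. u ! n<r & r<v ! n --> Q (y' @ [r]))"
 proof (rule nbhI[of "take n u" _ "take n v"])
  show "y:bx n (take n u) (take n v)" unfolding bx_def
  proof (intro CollectI conjI allI impI y)
   fix i assume "i<n"
   thus "take n u ! i<y ! i" "y ! i<take n v ! i" using b[of i] y by (auto simp: nth_append)
  qed
  fix x assume x: "x:bx n (take n u) (take n v)"
  show "ALL r. u ! n<r & r<v ! n --> Q (x @ [r])"
  proof (intro allI impI)
   fix r assume "u ! n<r & r<v ! n"
   hence "x @ [r]:bx (Suc n) u v" using x by (auto simp: bx_def nth_append less_Suc_eq)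
   thus "Q (x @ [r])" by (rule uv(4))
  qed
 qed (use uv in auto)
 moreover have "u ! n<s" "s<v ! n" using b[of n] y by (auto simp: nth_append)
 ultimately show ?thesis by blast
qed

lemma fix_interval:
 assumes R: "dfn (%e. R (map e [0..<k]) (e k) (e (Suc k)))" and Y: "dge k Y d"
  and h: "!!y. y:Y==>length y = k==>EX t c1 c2. c1<t & t<c2 &
   (ALL c1' c2'. c1'<t & t<c2' & {c1'<..<c2'}<={c1<..<c2} --> R y c1' c2')"
 shows "EX c1 c2. dge k {y. R y c1 c2} d"
proof -
 have "EX u v. length u = 1 & length v = 1 & dge k {y. R y (u ! 0) (v ! 0)} d"
 proof (rule fix_box[OF _ Y])
  show "dfn (%e. R (map e [0..<k]) (map (%i. e (i + k)) [0..<1] ! 0) (map (%i. e (i + (k + 1))) [0..<1] ! 0))"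
   using R by simp
  fix y assume "y:Y" "length y = k"
  then obtain t c1 c2 where t: "c1<t" "t<c2"
   "ALL c1' c2'. c1'<t & t<c2' & {c1'<..<c2'}<={c1<..<c2} --> R y c1' c2'" using h by blast
  show "EX x u v. length u = 1 & length v = 1 & x:bx 1 u v &
   (ALL u' v'. length u' = 1 & length v' = 1 & x:bx 1 u' v' & bx 1 u' v'<=bx 1 u v --> R y (u' ! 0) (v' ! 0))"
  proof (rule exI[of _ "[t]"], rule exI[of _ "[c1]"], rule exI[of _ "[c2]"], intro conjI allI impI)
   fix u' v' assume a: "length u' = 1 & length v' = 1 & [t]:bx 1 u' v' & bx 1 u' v'<=bx 1 [c1] [c2]"
   have "{u' ! 0<..<v' ! 0}<={c1<..<c2}"
   proof
    fix r assume "r:{u' ! 0<..<v' ! 0}"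
    hence "[r]:bx 1 u' v'" by (simp add: bx_def)
    hence "[r]:bx 1 [c1] [c2]" using a by blast
    thus "r:{c1<..<c2}" by (simp add: bx_def)
   qed
   moreover have "u' ! 0<t" "t<v' ! 0" using a by (auto simp: bx_def)
   ultimately show "R y (u' ! 0) (v' ! 0)" using t(3) by blast
  qed (use t in "auto simp: bx_def")
 qed
 thus ?thesis by blast
qed

definition prj :: "'a list set => 'a list set" where
 "prj W = {y. EX t. y @ [t]:W}"

lemma S_prj: "W:S (Suc n)==>prj W:S n"
 unfolding prj_def by (rule S_proj)

lemma prj_len: "W:S (Suc n)==>y @ [t]:W==>length y = n"
 using S_len by fastforce

text \<open>\<open>ep\<close> bounds the fibre dimension: 0 for finite fibres, 1 in general.\<close>

lemma prj_dge:
 assumes "dge (Suc n) D (e + ep)" "ep<=1" "ep = 0==>(!!y. finite {t. y @ [t]:D})"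
 shows "dge n (prj D) e"
proof -
 have i: "{y. infinite {t. y @ [t]:D}}<=prj D" unfolding prj_def using not_finite_existsD by auto
 from assms(1) consider "dge n (prj D) (e + ep)" | "0<e + ep" "dge n {y. infinite {t. y @ [t]:D}} (e + ep - 1)"
  unfolding prj_def by auto
 thus ?thesis
 proof cases
  case 1 thus ?thesis using dge_antimono[of e "e + ep"] by simp
 next
  case 2
  show ?thesis
  proof (cases "ep = 0")
   case True thus ?thesis using 2 assms(3) by (simp add: dge_empty)
  next
   case False
   hence "e + ep - 1 = e" using assms(2) by simp
   thus ?thesis using 2(2) dge_mono[OF i] by simp
  qed
 qed
qed

lemma dge_prj: "dge n (prj D) e==>dge (Suc n) D e"
 unfolding prj_def by simp

text \<open>The points of \<open>W\<close> at which the fibre is not lower semicontinuous: some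
  interval around the last coordinate is missed by nonempty fibres arbitrarily close to the base
  point.\<close>

definition lscbad :: "nat => 'a list set => 'a list set" where
 "lscbad n W = {w:W. EX c1 c2. c1<last w & last w<c2 &
   ~nbh n (butlast w) (%y'. (EX t. y' @ [t]:W) --> (EX t. c1<t & t<c2 & y' @ [t]:W))}"

lemma S_lscbad: assumes W: "W:S (Suc n)" shows "lscbad n W:S (Suc n)"
 unfolding lscbad_def by (rule S_sub[OF W], (rule drl dfn_snoc[OF W])+)

text \<open>The missed interval can be fixed on a large part of the exceptional set. The base points
  whose fibre meets that fixed interval are then a definable set that is not relatively open at too
  many points, against \<open>interior_large\<close>.\<close>

lemma lsc_generic:
 assumes W: "W:S (Suc n)" and e: "~dge n (prj W) (Suc e)" and ep: "ep<=1" "ep = 0==>(!!y. finite {t. y @ [t]:W})"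
 shows "~dge (Suc n) (lscbad n W) (e + ep)"
proof
 assume a: "dge (Suc n) (lscbad n W) (e + ep)"
 define R where "R w c1 c2 <-> w:W & c1<last w & last w<c2 &
   ~nbh n (butlast w) (%y'. (EX t. y' @ [t]:W) --> (EX t. c1<t & t<c2 & y' @ [t]:W))" for w c1 c2
 have "EX c1 c2. dge (Suc n) {w. R w c1 c2} (e + ep)"
 proof (rule fix_interval[OF _ a])
  show "dfn (%e. R (map e [0..<Suc n]) (e (Suc n)) (e (Suc (Suc n))))"
   unfolding R_def by (rule drl dfn_mem'[OF W] dfn_snoc[OF W])+
  fix w assume "w:lscbad n W"
  then obtain c1 c2 where c: "w:W" "c1<last w" "last w<c2"
   "~nbh n (butlast w) (%y'. (EX t. y' @ [t]:W) --> (EX t. c1<t & t<c2 & y' @ [t]:W))" unfolding lscbad_def by blast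
  show "EX t c1 c2. c1<t & t<c2 & (ALL c1' c2'. c1'<t & t<c2' & {c1'<..<c2'}<={c1<..<c2} --> R w c1' c2')"
  proof (rule exI[of _ "last w"], rule exI[of _ c1], rule exI[of _ c2], intro conjI allI impI c(2,3))
   fix c1' c2' assume h: "c1'<last w & last w<c2' & {c1'<..<c2'}<={c1<..<c2}"
   have "~nbh n (butlast w) (%y'. (EX t. y' @ [t]:W) --> (EX t. c1'<t & t<c2' & y' @ [t]:W))"
   proof
    assume "nbh n (butlast w) (%y'. (EX t. y' @ [t]:W) --> (EX t. c1'<t & t<c2' & y' @ [t]:W))"
    hence "nbh n (butlast w) (%y'. (EX t. y' @ [t]:W) --> (EX t. c1<t & t<c2 & y' @ [t]:W))"
     by (rule nbh_mono) (use h in "auto simp: subset_iff")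
    thus False using c(4) by blast
   qed
   thus "R w c1' c2'" unfolding R_def using c h by blast
  qed
 qed
 then obtain c1 c2 where D: "dge (Suc n) {w. R w c1 c2} (e + ep)" by blast
 have "dge n (prj {w. R w c1 c2}) e"
 proof (rule prj_dge[OF D ep(1)])
  fix y assume "ep = 0"
  hence "finite {t. y @ [t]:W}" by (rule ep(2))
  thus "finite {t. y @ [t]:{w. R w c1 c2}}" by (rule rev_finite_subset) (auto simp: R_def)
 qed
 define Y1 where "Y1 = {y:prj W. EX t. c1<t & t<c2 & y @ [t]:W}"
 have Y1: "Y1:S n" unfolding Y1_def by (rule S_sub[OF S_prj[OF W]], (rule drl dfn_snoc[OF W])+)
 have "prj {w. R w c1 c2}<={y:Y1. ~nbh n y (%z. z:prj W --> z:Y1)}"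
 proof
  fix y assume "y:prj {w. R w c1 c2}"
  then obtain t where t: "y @ [t]:W" "c1<t" "t<c2"
   "~nbh n y (%y'. (EX t. y' @ [t]:W) --> (EX t. c1<t & t<c2 & y' @ [t]:W))" unfolding prj_def R_def by auto
  hence "~nbh n y (%z. z:prj W --> z:Y1)"
   unfolding Y1_def prj_def by (auto elim!: notE nbh_mono)
  thus "y:{y:Y1. ~nbh n y (%z. z:prj W --> z:Y1)}" using t unfolding Y1_def prj_def by blast
 qed
 hence "dge n {y:Y1. ~nbh n y (%z. z:prj W --> z:Y1)} e"
  using \<open>dge n (prj {w. R w c1 c2}) e\<close> dge_mono by blast
 hence "dge n (prj W) (Suc e)" by (rule interior_large[OF S_prj[OF W] Y1, rotated]) (auto simp: Y1_def)
 thus False using e by blast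
qed

subsection \<open>Finiteness of the number of components\<close>

definition clopen :: "nat => 'a list set => 'a list set => bool" where
 "clopen n V P <-> P<=V & (ALL x:P. nbh n x (%z. z:V --> z:P)) & (ALL x:V - P. nbh n x (%z. z:V --> z~:P))"

text \<open>Clopenness refers to \<open>V\<close> but size is measured in \<open>W\<close>. This
  allows \<open>V\<close> to be cut into simpler parts \<open>W\<close>, which need not be clopen,
  while its pieces are counted.\<close>

definition pieces :: "nat => 'a list set => 'a list set => nat => 'a list set set => bool" where
 "pieces n V W d PP <-> finite PP & (ALL P:PP. ALL Q:PP. P~=Q --> P Int Q = {}) &
   (ALL P:PP. P:S n & clopen n V P & dge n (P Int W) d)"

text \<open>Only pieces of the top dimension are counted, so every part of smaller dimension may be
  discarded in the induction on n.\<close>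

definition bounded_pieces :: "nat => bool" where
 "bounded_pieces n <-> (ALL V:S n. ALL d. ~dge n V (Suc d) --> (EX N. ALL PP. pieces n V V d PP --> card PP<=N))"

text \<open>Definable connectedness of a closed interval, by the infimum of the complement.\<close>

lemma interval_clopen:
 assumes X: "dfn (%e. e 0:X)" and tt: "t<t'" "t:X"
  and op: "!!s. t<=s==>s<=t'==>s:X==>EX u v. u<s & s<v & (ALL r. u<r & r<v & t<=r & r<=t' --> r:X)"
  and cp: "!!s. t<=s==>s<=t'==>s~:X==>EX u v. u<s & s<v & (ALL r. u<r & r<v & t<=r & r<=t' --> r~:X)"
 shows "t':X"
proof (rule ccontr)
 assume nt: "t'~:X"
 define N where "N = {r. t<=r & r<=t' & r~:X}"
 have "dfn (%e. e 0:N)" unfolding N_def mem_Collect_eq by (rule drl X)+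
 moreover have "t':N" using tt nt by (simp add: N_def)
 moreover have "ALL r:N. t<=r" by (simp add: N_def)
 ultimately obtain s where s: "ALL r:N. s<=r" "ALL u>s. EX r:N. r<u" using germ_inf[OF dfn1_germ] by blast
 have st: "s<=t'" using s(1) \<open>t':N\<close> by blast
 have ts: "t<=s"
 proof (rule ccontr)
  assume "~t<=s"
  then obtain r where "r:N" "r<t" using s(2) by (meson not_le)
  thus False unfolding N_def by auto
 qed
 show False
 proof (cases "s:X")
  case True
  then obtain u v where uv: "u<s" "s<v" "ALL r. u<r & r<v & t<=r & r<=t' --> r:X" using op ts st by blast
  then obtain r where r: "r:N" "r<v" using s by blast
  hence "s<=r" using s by blast
  thus False using r uv unfolding N_def by fastforce
 next
  case False
  hence "t<s" using ts tt by (metis order.not_eq_order_implies_strict)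
  obtain u v where uv: "u<s" "s<v" "ALL r. u<r & r<v & t<=r & r<=t' --> r~:X" using cp ts st False by blast
  obtain r where r: "max u t<r" "r<s" using dense[of "max u t" s] uv \<open>t<s\<close> by auto
  hence "r:N" using uv st unfolding N_def by (auto intro: less_imp_le)
  thus False using s r by auto
 qed
qed

text \<open>Over each base point the fibre of \<open>W\<close> is convex, hence definably connected,
  so a relatively clopen set contains all of it or none.\<close>

lemma piece_fibre:
 assumes V: "clopen (Suc n) V P" "P:S (Suc n)" and W: "W<=V"
  and conv: "!!y t t' s. y @ [t]:W==>y @ [t']:W==>t<s==>s<t'==>y @ [s]:W"
  and t: "y @ [t]:W" "y @ [t]:P" "y @ [t']:W" and y: "length y = n"
 shows "y @ [t']:P"
proof -
 have wv: "y @ [s]:V" if "a<=s" "s<=b" "y @ [a]:W" "y @ [b]:W" for a b s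
  using conv[OF that(3,4)] that W by (cases "s = a"; cases "s = b") auto
 have nb: "EX u v. u<s & s<v & (ALL r. u<r & r<v --> Q (y @ [r]))" if q: "nbh (Suc n) (y @ [s]) Q" for s Q
  using nbh_snoc[OF q] nbh_self by blast
 have o: "EX u v. u<s & s<v & (ALL r. u<r & r<v & a<=r & r<=b --> y @ [r]:P)"
  if h: "a<=s" "s<=b" "y @ [s]:P" "y @ [a]:W" "y @ [b]:W" for a b s
  using nb[of s "%z. z:V --> z:P"] V(1) h wv unfolding clopen_def by meson
 have c: "EX u v. u<s & s<v & (ALL r. u<r & r<v & a<=r & r<=b --> y @ [r]~:P)"
  if h: "a<=s" "s<=b" "y @ [s]~:P" "y @ [a]:W" "y @ [b]:W" for a b s
 proof -
  have "y @ [s]:V - P" using h wv by blast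
  hence "nbh (Suc n) (y @ [s]) (%z. z:V --> z~:P)" using V(1) unfolding clopen_def by blast
  thus ?thesis using nb[of s "%z. z:V --> z~:P"] h wv by meson
 qed
 have d: "dfn (%e. y @ [e 0]:P)" by (rule dfn_snoc[OF V(2) ltrm_const[OF y] trm_var])
 consider "t = t'" | "t<t'" | "t'<t" by (meson linorder_neqE)
 thus ?thesis
 proof cases
  case 1 thus ?thesis using t by simp
 next
  case 2
  have "t':{s. y @ [s]:P}"
   by (rule interval_clopen[OF _ 2]) (use d t o[OF _ _ _ t(1,3)] c[OF _ _ _ t(1,3)] in simp_all)
  thus ?thesis by simp
 next
  case 3
  show ?thesis
  proof (rule ccontr)
   assume n: "y @ [t']~:P"
   have "t:{s. y @ [s]~:P}"
    by (rule interval_clopen[OF _ 3]) (use dfn_not[OF d] n o[OF _ _ _ t(3,1)] c[OF _ _ _ t(3,1)] in simp_all)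
   thus False using t by simp
  qed
 qed
qed

text \<open>When fibres are convex, a piece is determined by its shadow on the base. The shadows are
  disjoint and, over base points where the fibre is semicontinuous somewhere, clopen again; so the
  bound for one coordinate less applies.\<close>

lemma bounded_pieces_convex:
 fixes ep :: nat
 assumes BP: "bounded_pieces n" and V: "V:S (Suc n)" and W: "W:S (Suc n)" "W<=V"
  and conv: "!!y t t' s. y @ [t]:W==>y @ [t']:W==>t<s==>s<t'==>y @ [s]:W"
  and fib: "(ep = 0 & (ALL y. finite {t. y @ [t]:W})) | (ep = 1 & (ALL y:prj W. infinite {t. y @ [t]:W}))"
  and d: "~dge (Suc n) W (Suc d)"
 shows "EX N. ALL PP. pieces (Suc n) V W d PP --> card PP<=N"
proof -
 have lift: "dge (Suc n) {w:W. butlast w:Y} (a + ep)" if h: "dge n Y a" "Y<=prj W" for Y a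
 proof -
  from fib show ?thesis
  proof
   assume f: "ep = 0 & (ALL y. finite {t. y @ [t]:W})"
   have "prj {w:W. butlast w:Y} = Y" using h unfolding prj_def by auto
   thus ?thesis using dge_prj[of n "{w:W. butlast w:Y}" a] f h by simp
  next
   assume f: "ep = 1 & (ALL y:prj W. infinite {t. y @ [t]:W})"
   have "Y<={y. infinite {t. y @ [t]:{w:W. butlast w:Y}}}" using f h by auto
   hence "dge n {y. infinite {t. y @ [t]:{w:W. butlast w:Y}}} a" using h dge_mono by blast
   thus ?thesis using f by simp
  qed
 qed
 have ep: "ep<=1" "ep = 0==>(!!y. finite {t. y @ [t]:W})" using fib by auto
 show ?thesis
 proof (cases "prj W = {}")
  case True
  have "W = {}"
  proof (rule ccontr)
   assume "W~={}"
   then obtain w where "w:W" by blast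
   hence "length w = Suc n" using S_len[OF W(1)] by auto
   hence "w = butlast w @ [last w]" by (metis append_butlast_last_id length_0_conv nat.distinct(1))
   thus False using True \<open>w:W\<close> unfolding prj_def by (metis (mono_tags, lifting) empty_Collect_eq)
  qed
  hence "card PP<=0" if "pieces (Suc n) V W d PP" for PP
   using that unfolding pieces_def by (auto simp: dge_empty simp del: dge.simps)
  thus ?thesis by blast
 next
  case False
  have "dge n (prj W) 0" using False S_len[OF S_prj[OF W(1)]] unfolding dge_0 by auto
  from lift[OF this] have "dge (Suc n) {w:W. butlast w:prj W} ep" by simp
  hence "dge (Suc n) W ep" by (rule dge_mono[rotated]) auto
  hence "ep<=d" using d dge_antimono[of "Suc d" ep] by (meson not_less_eq_eq)
  \<comment> \<open>The dimension left for the base once the fibre dimension \<open>ep\<close> is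
    taken off; no truncation occurs by the line before.\<close>
  define e where "e = d - ep"
  have de: "d = e + ep" using \<open>ep<=d\<close> by (simp add: e_def)
  have ne: "~dge n (prj W) (Suc e)"
  proof
   assume "dge n (prj W) (Suc e)"
   from lift[OF this] have "dge (Suc n) {w:W. butlast w:prj W} (Suc d)" using de by simp
   hence "dge (Suc n) W (Suc d)" by (rule dge_mono[rotated]) auto
   thus False using d by blast
  qed
  let ?B = "lscbad n W"
  have bad: "~dge (Suc n) ?B (e + ep)" by (rule lsc_generic[OF W(1) ne ep])
  \<comment> \<open>Base points with at least one semicontinuous point above them. One point per
    fibre suffices, because a piece contains entire fibres.\<close>
  define Y' where "Y' = prj (W - ?B)"
  have Y': "Y':S n" unfolding Y'_def by (intro S_prj S_diff W S_lscbad)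
  have Y'W: "Y'<=prj W" unfolding Y'_def prj_def by auto
  have small: "~dge n (prj W - Y') e"
  proof
   assume "dge n (prj W - Y') e"
   from lift[OF this] have "dge (Suc n) {w:W. butlast w:prj W - Y'} (e + ep)" by blast
   moreover have "{w:W. butlast w:prj W - Y'}<=?B"
   proof
    fix w assume w: "w:{w:W. butlast w:prj W - Y'}"
    hence "length w = Suc n" using S_len[OF W(1)] by auto
    hence e: "butlast w @ [last w] = w" by (metis append_butlast_last_id length_0_conv nat.distinct(1))
    show "w:?B"
    proof (rule ccontr)
     assume "w~:?B"
     hence "butlast w @ [last w]:W - ?B" using w e by simp
     thus False using w unfolding Y'_def prj_def by blast
    qed
   qed
   ultimately show False using bad dge_mono by blast
  qed
  obtain N where N: "!!QQ. pieces n Y' Y' e QQ==>card QQ<=N"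
   using BP Y' ne dge_mono[OF Y'W] unfolding bounded_pieces_def by blast
  have "card PP<=N" if P: "pieces (Suc n) V W d PP" for PP
  proof -
   \<comment> \<open>The shadow of a piece on the base.\<close>
   define f where "f P = {y:Y'. EX t. y @ [t]:W & y @ [t]:P}" for P
   have S: "P:S (Suc n)" and co: "clopen (Suc n) V P" and dg: "dge (Suc n) (P Int W) d" if "P:PP" for P
    using P that unfolding pieces_def by blast+
   have fibre: "y @ [t']:P" if "P:PP" "y @ [t]:W" "y @ [t]:P" "y @ [t']:W" for P y t t'
    by (rule piece_fibre[OF co[OF that(1)] S[OF that(1)] W(2) conv that(2-4) prj_len[OF W(1) that(2)]])
   have dj: "f P Int f Q = {}" if PQ: "P:PP" "Q:PP" "P~=Q" for P Q
   proof (rule ccontr)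
    assume "f P Int f Q~={}"
    then obtain y t t' where "y @ [t]:W" "y @ [t]:P" "y @ [t']:W" "y @ [t']:Q" unfolding f_def by blast
    hence "y @ [t']:P Int Q" using fibre[OF PQ(1)] by blast
    thus False using P PQ unfolding pieces_def by blast
   qed
   have fe: "dge n (f P) e" if "P:PP" for P
   proof -
    have "dge n (prj (P Int W)) e"
    proof (rule prj_dge[of n _ e ep])
     show "dge (Suc n) (P Int W) (e + ep)" using dg[OF that] de by simp
     fix y assume "ep = 0"
     hence "finite {t. y @ [t]:W}" by (rule ep(2))
     thus "finite {t. y @ [t]:P Int W}" by (rule rev_finite_subset) auto
    qed (rule ep)
    moreover have "prj (P Int W)<=f P Un (prj W - Y')" unfolding f_def prj_def by blast
    ultimately have "dge n (f P Un (prj W - Y')) e" using dge_mono by blast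
    thus ?thesis using small dge_Un by blast
   qed
   have inj: "inj_on f PP"
   proof (rule inj_onI, rule ccontr)
    fix P Q assume "P:PP" "Q:PP" "f P = f Q" "P~=Q"
    hence "f P = {}" using dj by blast
    thus False using fe[OF \<open>P:PP\<close>] by (simp add: dge_empty)
   qed
   have "pieces n Y' Y' e (f ` PP)" unfolding pieces_def
   proof (intro conjI ballI impI)
    show "finite (f ` PP)" using P unfolding pieces_def by blast
    fix A B assume "A:f ` PP" "B:f ` PP" "A~=B" thus "A Int B = {}" using dj by blast
   next
    fix A assume "A:f ` PP"
    then obtain P where A: "A = f P" "P:PP" by blast
    show "A:S n" unfolding A f_def by (rule S_sub[OF Y'], (rule drl dfn_snoc[OF W(1)] dfn_snoc[OF S[OF A(2)]])+)
    have "f P<=Y'" unfolding f_def by blast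
    hence "f P Int Y' = f P" by blast
    thus "dge n (A Int Y') e" using fe[OF A(2)] A(1) by simp
    show "clopen n Y' A" unfolding clopen_def
    proof (intro conjI ballI)
     show "A<=Y'" using A \<open>f P<=Y'\<close> by simp
    next
     have good: "EX t. y @ [t]:W & (ALL Q. nbh (Suc n) (y @ [t]) Q --> nbh n y (%z. z:prj W --> (EX r. z @ [r]:W & Q (z @ [r]))))"
      if y: "y:Y'" for y
     proof -
      obtain t where t: "y @ [t]:W" "y @ [t]~:?B" using y unfolding Y'_def prj_def by blast
      have "nbh n y (%z. z:prj W --> (EX r. z @ [r]:W & Q (z @ [r])))" if q: "nbh (Suc n) (y @ [t]) Q" for Q
      proof -
       obtain c1 c2 where c: "c1<t" "t<c2" "nbh n y (%y'. ALL r. c1<r & r<c2 --> Q (y' @ [r]))"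
        using nbh_snoc[OF q] by blast
       have "nbh n y (%y'. (EX t. y' @ [t]:W) --> (EX t. c1<t & t<c2 & y' @ [t]:W))"
        using t c(1,2) unfolding lscbad_def by auto
       from nbh_conj[OF c(3) this] show ?thesis
        by (rule nbh_mono) (auto simp: prj_def)
      qed
      thus ?thesis using t by blast
     qed
     {
      fix y assume y: "y:A"
      hence "y:Y'" using A \<open>f P<=Y'\<close> by blast
      then obtain t where t: "y @ [t]:W" "!!Q. nbh (Suc n) (y @ [t]) Q==>nbh n y (%z. z:prj W --> (EX r. z @ [r]:W & Q (z @ [r])))"
       using good by blast
      have "y @ [t]:P" using y fibre[OF A(2)] t(1) unfolding A f_def by blast
      hence "nbh (Suc n) (y @ [t]) (%z. z:V --> z:P)" using co[OF A(2)] unfolding clopen_def by blast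
      from t(2)[OF this] show "nbh n y (%z. z:Y' --> z:A)"
       by (rule nbh_mono) (use W(2) Y'W in "auto simp: A f_def")
     next
      fix y assume y: "y:Y' - A"
      then obtain t where t: "y @ [t]:W" "!!Q. nbh (Suc n) (y @ [t]) Q==>nbh n y (%z. z:prj W --> (EX r. z @ [r]:W & Q (z @ [r])))"
       using good by blast
      have "y @ [t]:V - P" using y t(1) W(2) unfolding A f_def by blast
      hence "nbh (Suc n) (y @ [t]) (%z. z:V --> z~:P)" using co[OF A(2)] unfolding clopen_def by blast
      from t(2)[OF this] show "nbh n y (%z. z:Y' --> z~:A)"
      proof (rule nbh_mono, intro impI notI)
       fix z assume z: "z:prj W --> (EX r. z @ [r]:W & (z @ [r]:V --> z @ [r]~:P))" "z:Y'" "z:A"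
       then obtain r r' where "z @ [r]:W" "z @ [r]~:P" "z @ [r']:W" "z @ [r']:P"
        using W(2) Y'W unfolding A f_def by blast
       thus False using fibre[OF A(2)] by blast
      qed
     }
    qed
   qed
   hence "card (f ` PP)<=N" by (rule N)
   thus ?thesis using card_image[OF inj] by simp
  qed
  thus ?thesis by blast
 qed
qed

end

section \<open>Counting points in finite fibres\<close>

lemma card_below_Suc:
 fixes F :: "'a::linorder set"
 assumes "finite F"
 shows "Suc i<=card {s:F. s<t} <-> (EX s:F. s<t & i<=card {r:F. r<s})"
proof
 assume h: "Suc i<=card {s:F. s<t}"
 hence ne: "{s:F. s<t}~={}" by force
 have f: "finite {s:F. s<t}" using assms by simp
 define m where "m = Max {s:F. s<t}"
 have m: "m:{s:F. s<t}" unfolding m_def using f ne by (rule Max_in)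
 have "r<=m" if "r:{s:F. s<t}" for r unfolding m_def using f that by (rule Max_ge)
 hence "{s:F. s<t}<=insert m {r:F. r<m}" by (auto simp: le_less)
 hence "card {s:F. s<t}<=card (insert m {r:F. r<m})" using assms by (intro card_mono) auto
 also have "... = Suc (card {r:F. r<m})" using assms by simp
 finally have "i<=card {r:F. r<m}" using h by simp
 thus "EX s:F. s<t & i<=card {r:F. r<s}" using m by blast
next
 assume "EX s:F. s<t & i<=card {r:F. r<s}"
 then obtain s where s: "s:F" "s<t" "i<=card {r:F. r<s}" by blast
 have "Suc i<=card (insert s {r:F. r<s})" using assms s by simp
 also have "...<=card {r:F. r<t}" using assms s by (intro card_mono) auto
 finally show "Suc i<=card {s:F. s<t}" .
qed

lemma card_Suc_below:
 fixes F :: "'a::linorder set"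
 assumes "finite F"
 shows "Suc i<=card F <-> (EX s:F. i<=card {r:F. r<s})"
proof
 assume h: "Suc i<=card F"
 hence ne: "F~={}" by force
 define m where "m = Max F"
 have m: "m:F" unfolding m_def using assms ne by (rule Max_in)
 have "r<=m" if "r:F" for r unfolding m_def using assms that by (rule Max_ge)
 hence "F<=insert m {r:F. r<m}" by (auto simp: le_less)
 hence "card F<=card (insert m {r:F. r<m})" using assms by (intro card_mono) auto
 also have "... = Suc (card {r:F. r<m})" using assms by simp
 finally have "i<=card {r:F. r<m}" using h by simp
 thus "EX s:F. i<=card {r:F. r<s}" using m by blast
next
 assume "EX s:F. i<=card {r:F. r<s}"
 then obtain s where s: "s:F" "i<=card {r:F. r<s}" by blast
 have "Suc i<=card (insert s {r:F. r<s})" using assms s by simp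
 also have "...<=card F" using assms s by (intro card_mono) auto
 finally show "Suc i<=card F" .
qed

context omin
begin

lemma separate_points:
 fixes F :: "'a set"
 assumes "finite F"
 shows "EX l u. (ALL t:F. l t<t & t<u t) & (ALL t:F. ALL t':F. t<t' --> u t<=l t')"
 using assms
proof (induction F rule: finite_linorder_max_induct)
 case empty thus ?case by simp
next
 case (insert b F)
 then obtain l u where lu: "ALL t:F. l t<t & t<u t" "ALL t:F. ALL t':F. t<t' --> u t<=l t'" by blast
 obtain m where m: "m<b" "ALL t:F. t<m"
 proof (cases "F = {}")
  case True thus ?thesis using no_bot that by blast
 next
  case False
  hence "Max F<b" using insert.hyps by simp
  then obtain m where "Max F<m" "m<b" using dense by blast
  thus ?thesis using that[of m] insert.hyps(1) False by simp
 qed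
 obtain c where c: "b<c" using no_top by blast
 show ?case
 proof (rule exI[of _ "%t. if t = b then m else l t"], rule exI[of _ "%t. if t = b then c else min (u t) m"], intro conjI ballI impI)
  fix t assume "t:insert b F"
  thus "(if t = b then m else l t)<t" "t<(if t = b then c else min (u t) m)" using lu m c by auto
 next
  fix t t' assume t: "t:insert b F" "t':insert b F" "t<t'"
  have "t~=b" using t insert.hyps(2) by force
  thus "(if t = b then c else min (u t) m)<=(if t' = b then m else l t')"
   using t lu(2) by (auto simp: min_le_iff_disj)
 qed
qed

text \<open>Each fixed lower bound on a number of points is first order: at least i+1 points lie
  below t if some point s below t has at least i points below it.\<close>

lemma dfn_count:
 assumes E: "E:S (Suc n)" and f: "!!y. finite {t. y @ [t]:E}"
 shows "ltrm n xs==>trm t==>dfn (%e. i<=card {s. s<t e & xs e @ [s]:E})"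
proof (induction i arbitrary: xs t)
 case 0 thus ?case using dfn_const[of True] by simp
next
 case (Suc i)
 have "dfn (%e. EX s. s<t e & xs e @ [s]:E & i<=card {r. r<s & xs e @ [r]:E})"
  by (intro dfn_ex dfn_conj dfn_less dfn_snoc[OF E] Suc.IH trm_var trm_shift[OF Suc.prems(2)] ltrm_shift[OF Suc.prems(1)])
 moreover have "(Suc i<=card {s. s<t e & xs e @ [s]:E}) =
   (EX s. s<t e & xs e @ [s]:E & i<=card {r. r<s & xs e @ [r]:E})" for e
  using card_below_Suc[OF f[of "xs e"], of i "t e"] by (simp add: conj_commute conj_left_commute Bex_def)
 ultimately show ?case by simp
qed

lemma dfn_card:
 assumes E: "E:S (Suc n)" and f: "!!y. finite {t. y @ [t]:E}" and xs: "ltrm n xs"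
 shows "dfn (%e. i<=card {s. xs e @ [s]:E})"
proof (cases i)
 case 0 thus ?thesis using dfn_const[of True] by simp
next
 case (Suc j)
 have "dfn (%e. EX s. xs e @ [s]:E & j<=card {r. r<s & xs e @ [r]:E})"
  by (intro dfn_ex dfn_conj dfn_snoc[OF E] dfn_count[OF E f] trm_var ltrm_shift[OF xs])
 moreover have "(i<=card {s. xs e @ [s]:E}) = (EX s. xs e @ [s]:E & j<=card {r. r<s & xs e @ [r]:E})" for e
  using card_Suc_below[OF f[of "xs e"], of j] Suc by (simp add: conj_commute Bex_def)
 ultimately show ?thesis by simp
qed

lemma card_eq_le: "(c::nat) = i <-> i<=c & ~Suc i<=c" by auto

lemma isolate_point: assumes "finite (F :: 'a set)" shows "EX c1 c2. c1<t & t<c2 & F Int {c1<..<c2}<={t}"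
 using assms
proof (induction F)
 case empty thus ?case using no_bot no_top by blast
next
 case (insert x F)
 then obtain c1 c2 where c: "c1<t" "t<c2" "F Int {c1<..<c2}<={t}" by blast
 consider "x = t" | "x<t" | "t<x" by (meson linorder_neqE)
 thus ?case
 proof cases
  case 1 thus ?thesis using c by (intro exI[of _ c1] exI[of _ c2]) auto
 next
  case 2 thus ?thesis using c by (intro exI[of _ "max c1 x"] exI[of _ c2]) auto
 next
  case 3 thus ?thesis using c by (rule_tac exI[of _ c1], rule_tac exI[of _ "min c2 x"]) auto
 qed
qed

text \<open>The fibre over a good point is covered by finitely many small intervals; since no point of
 the set escapes from them, the number of points in nearby fibres is constant.\<close>

lemma card_fibre_locally_const:
 assumes E: "E:S (Suc n)" and f: "!!y. finite {t. y @ [t]:E}" and y: "y:prj E"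
  and lsc: "!!t. y @ [t]:E==>y @ [t]~:lscbad n E"
  and cls: "!!t. y @ [t]~:E==>nbh (Suc n) (y @ [t]) (%z. z~:E)"
  and uni: "!!t. y @ [t]:E==>EX c1 c2. c1<t & t<c2 &
   nbh n y (%y'. ALL r r'. c1<r & r<c2 & c1<r' & r'<c2 & y' @ [r]:E & y' @ [r']:E --> r = r')"
  and top: "EX c. nbh n y (%y'. ALL t. y' @ [t]:E --> t<c)" and bot: "EX c. nbh n y (%y'. ALL t. y' @ [t]:E --> c<t)"
 shows "nbh n y (%y'. y':prj E --> card {t. y' @ [t]:E} = card {t. y @ [t]:E})"
proof -
 let ?F = "{t. y @ [t]:E}"
 have ly: "length y = n" using y prj_len[OF E] unfolding prj_def by blast
 obtain l u where lu: "ALL t:?F. l t<t & t<u t" "ALL t:?F. ALL t':?F. t<t' --> u t<=l t'" using separate_points[OF f] by blast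
 have "EX c. ALL t:?F. fst (c t)<t & t<snd (c t) &
   nbh n y (%y'. ALL r r'. fst (c t)<r & r<snd (c t) & fst (c t)<r' & r'<snd (c t) & y' @ [r]:E & y' @ [r']:E --> r = r')"
  by (rule bchoice) (use uni in auto)
 then obtain c where c: "!!t. t:?F==>fst (c t)<t" "!!t. t:?F==>t<snd (c t)"
  "!!t. t:?F==>nbh n y (%y'. ALL r r'. fst (c t)<r & r<snd (c t) & fst (c t)<r' & r'<snd (c t) & y' @ [r]:E & y' @ [r']:E --> r = r')"
  by blast
 \<comment> \<open>The intervals in which nearby fibres have at most one point, cut down so that
   those for different fibre points are disjoint.\<close>
 define a where "a t = max (l t) (fst (c t))" for t
 define b where "b t = min (u t) (snd (c t))" for t
 have ab: "a t<t" "t<b t" if "t:?F" for t using lu(1) c(1,2) that unfolding a_def b_def by auto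
 have dj: "{a t<..<b t} Int {a t'<..<b t'} = {}" if "t:?F" "t':?F" "t~=t'" for t t'
 proof -
  have "u t<=l t' | u t'<=l t" using lu(2) that by (meson linorder_neqE)
  thus ?thesis unfolding a_def b_def by fastforce
 qed
 have n1: "nbh n y (%y'. ALL t:?F. ALL r r'. a t<r & r<b t & a t<r' & r'<b t & y' @ [r]:E & y' @ [r']:E --> r = r')"
 proof (rule nbh_ball[OF f ly])
  fix t assume "t:?F"
  from c(3)[OF this] show "nbh n y (%y'. ALL r r'. a t<r & r<b t & a t<r' & r'<b t & y' @ [r]:E & y' @ [r']:E --> r = r')"
   by (rule nbh_mono) (auto simp: a_def b_def)
 qed
 have n2: "nbh n y (%y'. ALL t:?F. y':prj E --> (EX r. a t<r & r<b t & y' @ [r]:E))"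
 proof (rule nbh_ball[OF f ly])
  fix t assume t: "t:?F"
  hence "y @ [t]~:lscbad n E" using lsc by simp
  hence "nbh n y (%y'. (EX t. y' @ [t]:E) --> (EX r. a t<r & r<b t & y' @ [r]:E))"
   using t ab[OF t] unfolding lscbad_def by auto
  thus "nbh n y (%y'. y':prj E --> (EX r. a t<r & r<b t & y' @ [r]:E))" unfolding prj_def by simp
 qed
 define J where "J = (UN t:?F. {a t<..<b t})"
 have Jd: "dfn (%e. e 0:(UN t:G. {a t<..<b t}))" if "finite G" for G
  using that
 proof (induction G)
  case empty thus ?case using dfn_const[of False] by simp
 next
  case (insert x G)
  hence "dfn (%e. (a x<e 0 & e 0<b x) | e 0:(UN t:G. {a t<..<b t}))" by (intro dfn_disj dfn_conj dfn_less trm_var trm_const) auto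
  thus ?case by simp
 qed
 have Jd': "dfn (%e. e i:J)" for i using dfn_rename[OF Jd[OF f], of "%k. i"] unfolding J_def by simp
 \<comment> \<open>Nearby fibres must not leave \<open>J\<close>. In place of compactness, the
   heights up to which they stay in \<open>J\<close> form a definable set; a supremum of it could be
   pushed further, whether or not it is a fibre point.\<close>
 define T where "T = {c. nbh n y (%y'. ALL r. r<=c & y' @ [r]:E --> r:J)}"
 have Td: "dfn (%e. e 0:T)" unfolding T_def mem_Collect_eq
  by (rule dfn_nbh[OF ltrm_const[OF ly]], (rule drl dfn_snoc[OF E] Jd')+)
 have down: "c':T" if "c:T" "c'<=c" for c c' using that unfolding T_def by (auto elim: nbh_mono)
 obtain c0 where "nbh n y (%y'. ALL t. y' @ [t]:E --> c0<t)" using bot by blast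
 hence c0: "c0:T" unfolding T_def by (auto elim!: nbh_mono)
 obtain c4 where c4: "nbh n y (%y'. ALL t. y' @ [t]:E --> t<c4)" using top by blast
 have "c4:T"
 proof (rule ccontr)
  assume "c4~:T"
  hence "ALL c:T. c<=c4" using down by (meson linear)
  then obtain s where s: "ALL c:T. c<=s" "ALL u<s. EX c:T. u<c" using germ_sup[OF dfn1_germ[OF Td]] c0 by blast
  have "EX c1 c2. c1<s & s<c2 & nbh n y (%y'. ALL r. c1<r & r<c2 & y' @ [r]:E --> r:J)"
  proof (cases "s:?F")
   case True
   have "nbh n y (%y'. True)" by (rule nbh_const[OF ly]) simp
   hence "nbh n y (%y'. ALL r. a s<r & r<b s & y' @ [r]:E --> r:J)"
    by (rule nbh_mono) (use True in "auto simp: J_def")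
   thus ?thesis using ab[OF True] by blast
  next
   case False
   hence "nbh (Suc n) (y @ [s]) (%z. z~:E)" using cls by simp
   from nbh_snoc[OF this] obtain c1 c2 where "c1<s" "s<c2" "nbh n y (%y'. ALL r. c1<r & r<c2 --> y' @ [r]~:E)" by blast
   moreover from this(3) have "nbh n y (%y'. ALL r. c1<r & r<c2 & y' @ [r]:E --> r:J)" by (rule nbh_mono) blast
   ultimately show ?thesis by blast
  qed
  then obtain c1 c2 where c12: "c1<s" "s<c2" "nbh n y (%y'. ALL r. c1<r & r<c2 & y' @ [r]:E --> r:J)" by blast
  obtain c where c: "c:T" "c1<c" using s c12 by blast
  obtain c' where c': "s<c'" "c'<c2" using dense c12 by blast
  have "nbh n y (%y'. (ALL r. r<=c & y' @ [r]:E --> r:J) & (ALL r. c1<r & r<c2 & y' @ [r]:E --> r:J))"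
   using c c12 unfolding T_def by (intro nbh_conj) auto
  hence "nbh n y (%y'. ALL r. r<=c' & y' @ [r]:E --> r:J)"
  proof (rule nbh_mono, intro allI impI)
   fix x r assume h: "(ALL r. r<=c & x @ [r]:E --> r:J) & (ALL r. c1<r & r<c2 & x @ [r]:E --> r:J)" "r<=c' & x @ [r]:E"
   show "r:J"
   proof (cases "r<=c")
    case True thus ?thesis using h by blast
   next
    case False
    hence "c1<r" "r<c2" using c(2) c'(2) h(2) by auto
    thus ?thesis using h by blast
   qed
  qed
  hence "c':T" unfolding T_def by simp
  thus False using s c' by auto
 qed
 hence "nbh n y (%y'. ALL r. r<=c4 & y' @ [r]:E --> r:J)" unfolding T_def by simp
 from nbh_conj[OF this c4] have n3: "nbh n y (%y'. ALL r. y' @ [r]:E --> r:J)" by (rule nbh_mono) (auto intro: less_imp_le)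
 from nbh_conj[OF n1 nbh_conj[OF n2 n3]] show ?thesis
 proof (rule nbh_mono, intro impI)
  fix y' assume h: "(ALL t:?F. ALL r r'. a t<r & r<b t & a t<r' & r'<b t & y' @ [r]:E & y' @ [r']:E --> r = r') &
    (ALL t:?F. y':prj E --> (EX r. a t<r & r<b t & y' @ [r]:E)) & (ALL r. y' @ [r]:E --> r:J)" and y': "y':prj E"
  let ?G = "%t. {r. a t<r & r<b t & y' @ [r]:E}"
  have one: "card (?G t) = 1" if t: "t:?F" for t
  proof -
   obtain r where "r:?G t" using h y' t by blast
   moreover have "r' = r" if "r':?G t" for r' using h t that \<open>r:?G t\<close> by blast
   ultimately have "?G t = {r}" by blast
   thus ?thesis by simp
  qed
  have "{t. y' @ [t]:E} = (UN t:?F. ?G t)" using h unfolding J_def by auto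
  hence "card {t. y' @ [t]:E} = (SUM t:?F. card (?G t))"
  proof (simp only:, intro card_UN_disjoint f ballI impI)
   show "finite (?G t)" for t by (rule finite_subset[OF _ f[of y']]) auto
   fix t t' assume "t:?F" "t':?F" "t~=t'"
   thus "?G t Int ?G t' = {}" using dj[of t t'] by (auto simp: disjoint_iff)
  qed
  thus "card {t. y' @ [t]:E} = card ?F" using one by simp
 qed
qed

text \<open>Off a small set of base points the number of fibre points is locally constant. Its level
  sets are then clopen pieces of the base, of which there are boundedly many by hypothesis, so only
  finitely many numbers occur.\<close>

lemma bounded_fibres:
 assumes BP: "bounded_pieces n" and E: "E:S (Suc n)" and f: "!!y. finite {t. y @ [t]:E}" and e: "~dge n (prj E) (Suc e)"
 shows "EX N. ~dge n {y. N<card {t. y @ [t]:E}} e"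
proof -
 let ?Y = "prj E"
 have Y: "?Y:S n" by (rule S_prj[OF E])
 have generic: False if h: "dge n {y:Y1. ~nbh n y (%z. z:?Y --> z:Y1)} e" "Y1:S n" "Y1<=?Y" for Y1
  using interior_large[OF Y h(2,3,1)] e by blast
 have fz: "0 = (0::nat)==>(!!y. finite {t. y @ [t]:E})" by (rule f)
 define B1 where "B1 = prj (lscbad n E)"
 have B1: "B1:S n" unfolding B1_def by (intro S_prj S_lscbad E)
 have nB1: "~dge n B1 e" using lsc_generic[OF E e, of 0, OF _ f] dge_prj[of n "lscbad n E" e] unfolding B1_def by auto
 define B2 where "B2 = prj (cl (Suc n) E - E)"
 have B2: "B2:S n" unfolding B2_def by (intro S_prj S_diff S_cl E)
 have nB2: "~dge n B2 e"
 proof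
  assume "dge n B2 e"
  hence "dge (Suc n) (cl (Suc n) E - E) e" unfolding B2_def by (rule dge_prj)
  hence "dge (Suc n) E (Suc e + 0)" using frontier[OF E] by simp
  hence "dge n ?Y (Suc e)" by (rule prj_dge) (use f in auto)
  thus False using e by blast
 qed
 let ?u = "%c1 c2 y'. ALL r r'. c1<r & r<c2 & c1<r' & r'<c2 & y' @ [r]:E & y' @ [r']:E --> r = r'"
 \<comment> \<open>Points without an interval that contains at most one point of every nearby fibre.
   A single fibre always admits such an interval; fixing it uniformly shows that the failure is
   rare.\<close>
 define E3 where "E3 = {w:E. ALL c1 c2. c1<last w & last w<c2 --> ~nbh n (butlast w) (?u c1 c2)}"
 have E3: "E3:S (Suc n)" unfolding E3_def by (rule S_sub[OF E], (rule drl dfn_snoc[OF E])+)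
 have nE3: "~dge (Suc n) E3 e"
 proof
  assume a: "dge (Suc n) E3 e"
  define R where "R w c1 c2 <-> w:E & c1<last w & last w<c2 & ?u c1 c2 (butlast w) & ~nbh n (butlast w) (?u c1 c2)" for w c1 c2
  have "EX c1 c2. dge (Suc n) {w. R w c1 c2} e"
  proof (rule fix_interval[OF _ a])
   show "dfn (%e. R (map e [0..<Suc n]) (e (Suc n)) (e (Suc (Suc n))))"
    unfolding R_def by (rule drl dfn_mem'[OF E] dfn_snoc[OF E])+
   fix w assume w: "w:E3"
   obtain c1 c2 where c: "c1<last w" "last w<c2" "{t. butlast w @ [t]:E} Int {c1<..<c2}<={last w}"
    using isolate_point[OF f] by blast
   show "EX t c1 c2. c1<t & t<c2 & (ALL c1' c2'. c1'<t & t<c2' & {c1'<..<c2'}<={c1<..<c2} --> R w c1' c2')"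
   proof (rule exI[of _ "last w"], rule exI[of _ c1], rule exI[of _ c2], intro conjI allI impI c(1,2))
    fix c1' c2' assume h: "c1'<last w & last w<c2' & {c1'<..<c2'}<={c1<..<c2}"
    have "r = last w" if "c1'<r" "r<c2'" "butlast w @ [r]:E" for r
    proof -
     have "r:{c1<..<c2}" using h that by auto
     thus ?thesis using c(3) that by blast
    qed
    hence "?u c1' c2' (butlast w)" by blast
    thus "R w c1' c2'" using w h unfolding R_def E3_def by blast
   qed
  qed
  then obtain c1 c2 where D: "dge (Suc n) {w. R w c1 c2} (e + 0)" by auto
  have "dge n (prj {w. R w c1 c2}) e"
   by (rule prj_dge[OF D]) (auto intro: finite_subset[OF _ f] simp: R_def)
  define Y1 where "Y1 = {y:?Y. ?u c1 c2 y}"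
  have Y1: "Y1:S n" unfolding Y1_def by (rule S_sub[OF Y], (rule drl dfn_snoc[OF E])+)
  have "prj {w. R w c1 c2}<={y:Y1. ~nbh n y (%z. z:?Y --> z:Y1)}"
  proof
   fix y assume "y:prj {w. R w c1 c2}"
   then obtain t where t: "y @ [t]:E" "?u c1 c2 y" "~nbh n y (?u c1 c2)" unfolding prj_def R_def by auto
   have "~nbh n y (%z. z:?Y --> z:Y1)"
   proof
    assume "nbh n y (%z. z:?Y --> z:Y1)"
    hence "nbh n y (?u c1 c2)" by (rule nbh_mono) (auto simp: Y1_def prj_def)
    thus False using t by blast
   qed
   thus "y:{y:Y1. ~nbh n y (%z. z:?Y --> z:Y1)}" using t unfolding Y1_def prj_def by blast
  qed
  hence "dge n {y:Y1. ~nbh n y (%z. z:?Y --> z:Y1)} e"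
   using \<open>dge n (prj {w. R w c1 c2}) e\<close> dge_mono by blast
  thus False by (rule generic[OF _ Y1]) (auto simp: Y1_def)
 qed
 define B3 where "B3 = prj E3"
 have B3: "B3:S n" "~dge n B3 e" unfolding B3_def using S_prj[OF E3] nE3 dge_prj by blast+
 \<comment> \<open>\<open>lt\<close> is instantiated with the order and with its reverse, so that
   one argument keeps nearby fibres bounded above and below.\<close>
 have ends: "{y:?Y. ALL c. ~nbh n y (%y'. ALL t. y' @ [t]:E --> lt t c)}:S n &
   ~dge n {y:?Y. ALL c. ~nbh n y (%y'. ALL t. y' @ [t]:E --> lt t c)} e" (is "?B:S n & _")
  if ltd: "dfn (%e. lt (e 0) (e 1))" and lti: "!!F. finite F==>infinite {c. ALL t:F. lt t c}" for lt :: "'a => 'a => bool"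
 proof
  note l2 = dfn_subst2[OF ltd]
  show "?B:S n" by (rule S_sub[OF Y], (rule drl dfn_snoc[OF E] l2)+)
  show "~dge n ?B e"
  proof
   assume a: "dge n ?B e"
   define R where "R y s <-> y:?Y & (ALL t. y @ [t]:E --> lt t (s ! 0)) & ~nbh n y (%y'. ALL t. y' @ [t]:E --> lt t (s ! 0))" for y and s :: "'a list"
   have tn: "trm (%e. map (%i. e (g i)) [0..<1] ! 0)" for g by (rule trm_nth[OF ltrm_vars]) simp
   have R: "dfl2 n 1 R" unfolding dfl2_def R_def by (rule drl dfn_mem'[OF Y] dfn_snoc[OF E] l2 tn)+
   have "?B<={y. dge 1 {s. R y s} 1}"
   proof
    fix y assume y: "y:?B"
    have "infinite {c. ALL t:{t. y @ [t]:E}. lt t c}" by (rule lti[OF f])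
    hence i: "infinite ((%c. [c]) ` {c. ALL t:{t. y @ [t]:E}. lt t c})" by (simp add: finite_image_iff inj_on_def)
    have "(%c. [c]) ` {c. ALL t:{t. y @ [t]:E}. lt t c}<={s. R y s} Int {s. length s = 1}" using y unfolding R_def by auto
    hence "infinite ({s. R y s} Int {s. length s = 1})" using i finite_subset by blast
    thus "y:{y. dge 1 {s. R y s} 1}" unfolding dge_1 by simp
   qed
   hence "dge n {y. dge 1 {s. R y s} 1} e" using a dge_mono by blast
   then obtain s where s: "dge n {y. R y s} e" using fix_parameter[OF R] by blast
   define c where "c = s ! 0"
   define Y1 where "Y1 = {y:?Y. ALL t. y @ [t]:E --> lt t c}"
   have Y1: "Y1:S n" unfolding Y1_def by (rule S_sub[OF Y], (rule drl dfn_snoc[OF E] l2)+)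
   have "{y. R y s}<={y:Y1. ~nbh n y (%z. z:?Y --> z:Y1)}"
   proof
    fix y assume y: "y:{y. R y s}"
    have "~nbh n y (%z. z:?Y --> z:Y1)"
    proof
     assume "nbh n y (%z. z:?Y --> z:Y1)"
     hence "nbh n y (%y'. ALL t. y' @ [t]:E --> lt t c)" by (rule nbh_mono) (auto simp: Y1_def prj_def)
     thus False using y unfolding R_def c_def by blast
    qed
    thus "y:{y:Y1. ~nbh n y (%z. z:?Y --> z:Y1)}" using y unfolding Y1_def R_def c_def by blast
   qed
   hence "dge n {y:Y1. ~nbh n y (%z. z:?Y --> z:Y1)} e" using s dge_mono by blast
   thus False by (rule generic[OF _ Y1]) (auto simp: Y1_def)
  qed
 qed
 have inf1: "infinite {c. ALL t:F. t<c}" if F: "finite F" for F :: "'a set"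
 proof -
  obtain b where b: "ALL t:F. t<=b" using F by (cases "F = {}") (auto intro: Max_ge)
  obtain c where "b<c" using no_top by blast
  hence "infinite {b<..<c}" by (rule interval_infinite)
  moreover have "{b<..<c}<={c. ALL t:F. t<c}" using b by (auto intro: le_less_trans)
  ultimately show ?thesis using finite_subset by blast
 qed
 have inf2: "infinite {c. ALL t:F. c<t}" if F: "finite F" for F :: "'a set"
 proof -
  obtain b where b: "ALL t:F. b<=t" using F by (cases "F = {}") (auto intro: Min_le)
  obtain c where "c<b" using no_bot by blast
  hence "infinite {c<..<b}" by (rule interval_infinite)
  moreover have "{c<..<b}<={c. ALL t:F. c<t}" using b by (auto intro: less_le_trans)
  ultimately show ?thesis using finite_subset by blast
 qed
 define B4 where "B4 = {y:?Y. ALL c. ~nbh n y (%y'. ALL t. y' @ [t]:E --> t<c)}"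
 define B5 where "B5 = {y:?Y. ALL c. ~nbh n y (%y'. ALL t. y' @ [t]:E --> c<t)}"
 have B4: "B4:S n" "~dge n B4 e" unfolding B4_def using ends[of "(<)", OF dfn_less_var inf1] by blast+
 have "dfn (%e. e 1<e (0::nat))" by (rule dfn_less_var)
 hence B5: "B5:S n" "~dge n B5 e" unfolding B5_def using ends[of "%t c. c<t", OF _ inf2] by blast+
 define Yg where "Yg = ?Y - (B1 Un B2 Un B3 Un B4 Un B5)"
 have Yg: "Yg:S n" unfolding Yg_def by (intro S_diff S_Un Y B1 B2 B3 B4 B5)
 let ?ct = "%y. card {t. y @ [t]:E}"
 have const: "nbh n y (%z. z:?Y --> ?ct z = ?ct y)" if y: "y:Yg" for y
 proof (rule card_fibre_locally_const[OF E f])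
  show "y:?Y" using y unfolding Yg_def by blast
  hence ly: "length y = n" using S_len[OF Y] by auto
  fix t
  show "y @ [t]~:lscbad n E" if "y @ [t]:E" using y unfolding Yg_def B1_def prj_def by blast
  show "nbh (Suc n) (y @ [t]) (%z. z~:E)" if "y @ [t]~:E"
  proof (rule ccontr)
   assume "~nbh (Suc n) (y @ [t]) (%z. z~:E)"
   hence "y @ [t]:cl (Suc n) E - E" using that ly unfolding cl_def by simp
   thus False using y unfolding Yg_def B2_def prj_def by blast
  qed
  show "EX c1 c2. c1<t & t<c2 & nbh n y (?u c1 c2)" if "y @ [t]:E"
  proof (rule ccontr)
   assume "~(EX c1 c2. c1<t & t<c2 & nbh n y (?u c1 c2))"
   hence "y @ [t]:E3" using that unfolding E3_def by simp
   thus False using y unfolding Yg_def B3_def prj_def by blast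
  qed
 next
  show "EX c. nbh n y (%y'. ALL t. y' @ [t]:E --> t<c)" using y unfolding Yg_def B4_def by blast
  show "EX c. nbh n y (%y'. ALL t. y' @ [t]:E --> c<t)" using y unfolding Yg_def B5_def by blast
 qed
 have bxd: "dfn (%e. dge n {x. x:Yg & x:bx n (map (%i. e (p i)) [0..<n]) (map (%i. e (q i)) [0..<n])} e')" for p q e'
  by (rule dfn_dge, (rule drl dfn_mem'[OF Yg] dfn_bx)+)
 \<comment> \<open>Points near which the good set has dimension below e. Without them each nonempty
   level set has dimension e, as pieces are required to have; a uniform box shows that they are
   few.\<close>
 define Yl where "Yl = {y:Yg. EX u:{u. length u = n}. EX v:{v. length v = n}. y:bx n u v & ~dge n {x. x:Yg & x:bx n u v} e}"
 have Yl: "Yl:S n" unfolding Yl_def by (rule S_sub[OF Yg], (rule dfn_bexl dfn_conj dfn_not dfn_bx bxd ltrm_vars)+)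
 have nYl: "~dge n Yl e"
 proof
  assume a: "dge n Yl e"
  define R where "R y u v <-> y:Yg & y:bx n u v & ~dge n {x. x:Yg & x:bx n u v} e" for y u v
  have "EX u v. length u = n & length v = n & dge n {y. R y u v} e"
  proof (rule fix_box[OF _ a])
   show "dfn (%e. R (map e [0..<n]) (map (%i. e (i + n)) [0..<n]) (map (%i. e (i + (n + n))) [0..<n]))"
    unfolding R_def by (rule dfn_conj dfn_not dfn_bx dfn_mem'[OF Yg] bxd ltrm_vars)+
   fix y assume "y:Yl"
   then obtain u v where uv: "length u = n" "length v = n" "y:bx n u v" "y:Yg" "~dge n {x. x:Yg & x:bx n u v} e"
    unfolding Yl_def by blast
   show "EX x u v. length u = n & length v = n & x:bx n u v &
    (ALL u' v'. length u' = n & length v' = n & x:bx n u' v' & bx n u' v'<=bx n u v --> R y u' v')"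
   proof (rule exI[of _ y], rule exI[of _ u], rule exI[of _ v], intro conjI allI impI uv(1-3))
    fix u' v' assume h: "length u' = n & length v' = n & y:bx n u' v' & bx n u' v'<=bx n u v"
    have "{x. x:Yg & x:bx n u' v'}<={x. x:Yg & x:bx n u v}" using h by blast
    hence "~dge n {x. x:Yg & x:bx n u' v'} e" using uv(5) dge_mono by blast
    thus "R y u' v'" using uv(4) h unfolding R_def by blast
   qed
  qed
  then obtain u v where uv: "dge n {y. R y u v} e" by blast
  have "EX y. R y u v" using dge_antimono[OF le0 uv] unfolding dge_0 by auto
  hence "~dge n {x. x:Yg & x:bx n u v} e" unfolding R_def by blast
  moreover have "{y. R y u v}<={x. x:Yg & x:bx n u v}" unfolding R_def by blast
  ultimately show False using uv dge_mono by blast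
 qed
 define Yp where "Yp = Yg - Yl"
 have Yp: "Yp:S n" unfolding Yp_def by (intro S_diff Yg Yl)
 have YpY: "Yp<=?Y" unfolding Yp_def Yg_def by blast
 define P where "P j = {y:Yp. ?ct y = j}" for j
 have PS: "P j:S n" for j
  unfolding P_def card_eq_le by (rule S_sub[OF Yp], (rule dfn_conj dfn_not dfn_card[OF E f] ltrm_vars)+)
 have Pc: "clopen n Yp (P j)" for j unfolding clopen_def
 proof (intro conjI ballI)
  show "P j<=Yp" unfolding P_def by blast
  fix y assume y: "y:P j"
  hence "nbh n y (%z. z:?Y --> ?ct z = ?ct y)" using const unfolding P_def Yp_def by blast
  thus "nbh n y (%z. z:Yp --> z:P j)" by (rule nbh_mono) (use y YpY in "auto simp: P_def")
 next
  fix y assume y: "y:Yp - P j"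
  hence "nbh n y (%z. z:?Y --> ?ct z = ?ct y)" using const unfolding Yp_def by blast
  thus "nbh n y (%z. z:Yp --> z~:P j)" by (rule nbh_mono) (use y YpY in "auto simp: P_def")
 qed
 have Pd: "dge n (P j) e" if ne: "P j~={}" for j
 proof -
  obtain y where y: "y:Yp" "?ct y = j" using ne unfolding P_def by blast
  have "nbh n y (%z. z:?Y --> ?ct z = ?ct y)" using const y unfolding Yp_def by blast
  then obtain u v where uv: "length u = n" "length v = n" "y:bx n u v" "!!z. z:bx n u v==>z:?Y --> ?ct z = ?ct y" using nbhE by blast
  have "dge n {x. x:Yg & x:bx n u v} e" using y(1) uv(1-3) unfolding Yp_def Yl_def by blast
  moreover have "{x. x:Yg & x:bx n u v}<=P j Un Yl"
   using uv(4) y(2) unfolding P_def Yp_def Yg_def by blast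
  ultimately have "dge n (P j Un Yl) e" using dge_mono by blast
  thus ?thesis using nYl dge_Un by blast
 qed
 obtain N0 where N0: "!!QQ. pieces n Yp Yp e QQ==>card QQ<=N0"
  using BP Yp e dge_mono[OF YpY] unfolding bounded_pieces_def by blast
 \<comment> \<open>The numbers of fibre points that occur. Boundedly many levels give finitely many
   numbers, and hence a largest one.\<close>
 define Js where "Js = {j. P j~={}}"
 have bound: "card K<=N0" if K: "finite K" "K<=Js" for K
 proof -
  have inj: "inj_on P K"
  proof (rule inj_onI, rule ccontr)
   fix i j assume "i:K" "j:K" "P i = P j" "i~=j"
   hence "P i = {}" unfolding P_def by blast
   thus False using \<open>i:K\<close> K unfolding Js_def by blast
  qed
  have "pieces n Yp Yp e (P ` K)" unfolding pieces_def
  proof (intro conjI ballI impI)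
   show "finite (P ` K)" using K by simp
   fix A B assume AB: "A:P ` K" "B:P ` K" "A~=B"
   then obtain i j where "A = P i" "B = P j" by blast
   thus "A Int B = {}" using AB(3) unfolding P_def by (cases "i = j") auto
  next
   fix A assume "A:P ` K"
   then obtain j where j: "A = P j" "j:K" by blast
   have "P j Int Yp = P j" unfolding P_def by blast
   thus "dge n (A Int Yp) e" using Pd[of j] j K unfolding Js_def by auto
   show "A:S n" "clopen n Yp A" using j PS Pc by simp_all
  qed
  from N0[OF this] show ?thesis using card_image[OF inj] by simp
 qed
 have "finite Js"
 proof (rule ccontr)
  assume "infinite Js"
  then obtain K where "K<=Js" "finite K" "card K = Suc N0" using infinite_arbitrarily_large by blast
  thus False using bound[of K] by simp
 qed
 then obtain N where N: "ALL j:Js. j<=N" by (meson finite_nat_set_iff_bounded_le)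
 have "{y. N<?ct y}<=B1 Un B2 Un B3 Un B4 Un B5 Un Yl"
 proof
  fix y assume y: "y:{y. N<?ct y}"
  hence "{t. y @ [t]:E}~={}" by (metis (no_types, lifting) card.empty mem_Collect_eq not_less_zero)
  hence "y:?Y" unfolding prj_def by blast
  moreover have "y~:Yp"
  proof
   assume "y:Yp"
   hence "?ct y:Js" unfolding Js_def P_def by blast
   thus False using N y by auto
  qed
  ultimately show "y:B1 Un B2 Un B3 Un B4 Un B5 Un Yl" unfolding Yp_def Yg_def by blast
 qed
 moreover have "~dge n (B1 Un B2 Un B3 Un B4 Un B5 Un Yl) e" using nB1 nB2 B3 B4 B5 nYl by (simp add: dge_Un)
 ultimately have "~dge n {y. N<?ct y} e" using dge_mono by blast
 thus ?thesis by blast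
qed

lemma bounded_pieces_0: "bounded_pieces 0"
 unfolding bounded_pieces_def
proof (intro ballI allI impI exI[of _ 1])
 fix V d PP assume P: "pieces 0 V V d PP"
 have "[]:A" if "A:PP" for A using P that unfolding pieces_def by auto
 hence "ALL A:PP. ALL B:PP. A = B" using P unfolding pieces_def by blast
 thus "card PP<=1" using P unfolding pieces_def by (simp add: card_le_Suc0_iff_eq)
qed

text \<open>Apart from a small set, the fibres of \<open>V\<close> have a bounded number of
  endpoints. Sorting the points by their position among the endpoints splits the rest into boundedly
  many parts with convex fibres, to which \<open>bounded_pieces_convex\<close> applies.\<close>

lemma bounded_pieces_Suc: assumes BP: "bounded_pieces n" shows "bounded_pieces (Suc n)"
 unfolding bounded_pieces_def
proof (intro ballI allI impI)
 fix V d assume V: "V:S (Suc n)" and d: "~dge (Suc n) V (Suc d)"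
 let ?int = "%w X. EX u v. u<last w & last w<v & (ALL r. u<r & r<v --> (butlast w @ [r]:V) = X)"
 \<comment> \<open>The endpoints of the fibres: points around which membership in \<open>V\<close>
   is constant on no interval of the vertical line. Isolated points and punctures count as
   well.\<close>
 define E where "E = {w. length w = Suc n & ~?int w True & ~?int w False}"
 have E: "E:S (Suc n)" unfolding E_def
  by (rule S_I, (rule dfn_conj dfn_not dfn_ex dfn_all dfn_imp dfn_less dfn_iff dfn_const trm_var trm_last ltrm_butlast ltrm_vars dfn_snoc[OF V])+)
 have Ef: "finite {t. y @ [t]:E}" for y
 proof (cases "length y = n")
  case True
  show ?thesis
  proof (rule ccontr)
   assume i: "infinite {t. y @ [t]:E}"
   have "dfn (%e. e 0:{t. y @ [t]:E})" unfolding mem_Collect_eq by (rule dfn_snoc[OF E ltrm_const[OF True] trm_var])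
   then obtain a b where ab: "a<b" "{a<..<b}<={t. y @ [t]:E}" using dfn1_infinite i by blast
   have "dfn (%e. e 0:{t. y @ [t]:V})" unfolding mem_Collect_eq by (rule dfn_snoc[OF V ltrm_const[OF True] trm_var])
   from shrink[OF this ab(1)] obtain q where q: "a<q" "q<=b"
    "{a<..<q}<={t. y @ [t]:V} | {a<..<q} Int {t. y @ [t]:V} = {}" by blast
   obtain t where t: "a<t" "t<q" using dense q by blast
   have "t:{a<..<b}" using t q by auto
   hence tE: "y @ [t]:E" using ab by blast
   have nT: "~(EX u v. u<t & t<v & (ALL r. u<r & r<v --> (y @ [r]:V) = True))"
    "~(EX u v. u<t & t<v & (ALL r. u<r & r<v --> (y @ [r]:V) = False))"
    using tE unfolding E_def mem_Collect_eq last_snoc butlast_snoc by - (elim conjE, assumption)+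
   have "(ALL r. a<r & r<q --> (y @ [r]:V) = True) | (ALL r. a<r & r<q --> (y @ [r]:V) = False)"
    using q(3) by (auto simp: subset_iff disjoint_iff)
   thus False using nT t by blast
  qed
 next
  case False thus ?thesis unfolding E_def by simp
 qed
 let ?ct = "%y. card {t. y @ [t]:E}"
 let ?fin = "%X. {w:V. infinite {t. butlast w @ [t]:V} = X}"
 have finS: "?fin X:S (Suc n)" for X
  by (rule S_sub[OF V], (rule dfn_iff dfn_const dfn_infinite ltrm_butlast ltrm_vars trm_var dfn_snoc[OF V])+)
 have fb: "{t. y @ [t]:?fin X} = (if infinite {t. y @ [t]:V} = X then {t. y @ [t]:V} else {})" for y X by auto
 \<comment> \<open>Base points with infinite and with finite fibre (\<open>X\<close>) are treated
   apart, because the fibre dimension \<open>ep\<close> enters in passing from a small set of base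
   points to a small subset of \<open>V\<close>.\<close>
 have left: "EX N. ~dge (Suc n) {w:?fin X. N<?ct (butlast w)} d" for X
 proof -
  define ep where "ep = (if X then 1 else 0 :: nat)"
  let ?V = "?fin X"
  show ?thesis
  proof (cases "?V = {}")
   case True
   hence e: "{w:?V. N<?ct (butlast w)} = {}" for N by (simp only: empty_iff Collect_empty_eq) simp
   show ?thesis unfolding e using dge_empty by blast
  next
   case False
   have lift: "dge (Suc n) ?V (a + ep)" if "dge n (prj ?V) a" for a
   proof (cases X)
    case True
    have "prj ?V<={y. infinite {t. y @ [t]:?V}}"
    proof
     fix y assume "y:prj ?V"
     hence "infinite {t. y @ [t]:V}" using True unfolding prj_def by auto
     thus "y:{y. infinite {t. y @ [t]:?V}}" using True unfolding fb by simp
    qed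
    hence "dge n {y. infinite {t. y @ [t]:?V}} a" using that dge_mono by blast
    hence "dge (Suc n) ?V (Suc a)" unfolding dge.simps(2) by (intro disjI2) simp
    thus ?thesis using True by (simp add: ep_def)
   next
    case False thus ?thesis using dge_prj[OF that] by (simp add: ep_def)
   qed
   obtain w where w: "w:?V" using False by blast
   hence "length w = Suc n" using S_len[OF finS] by blast
   hence "butlast w @ [last w] = w" "length (butlast w) = n" by (metis append_butlast_last_id length_0_conv nat.distinct(1), simp)
   hence "dge n (prj ?V) 0" using w unfolding dge_0 prj_def by (intro bexI[of _ "butlast w"]) (auto intro!: exI[of _ "last w"])
   from lift[OF this] have "dge (Suc n) ?V ep" by (simp only: add_0)
   hence "dge (Suc n) V ep" by (rule dge_mono[rotated]) auto
   hence "ep<=d" using d dge_antimono[of "Suc d" ep] by (meson not_less_eq_eq)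
   define e where "e = d - ep"
   have de: "d = e + ep" using \<open>ep<=d\<close> unfolding e_def by simp
   have ne: "~dge n (prj ?V) (Suc e)"
   proof
    assume "dge n (prj ?V) (Suc e)"
    from lift[OF this] have "dge (Suc n) ?V (Suc d)" using de by simp
    hence "dge (Suc n) V (Suc d)" by (rule dge_mono[rotated]) auto
    thus False using d by blast
   qed
   define E' where "E' = {w:E. butlast w:prj ?V}"
   have E': "E':S (Suc n)" unfolding E'_def
    by (rule S_sub[OF E], (rule dfn_mem'[OF S_prj[OF finS]] ltrm_butlast ltrm_vars)+)
   have E'f: "finite {t. y @ [t]:E'}" for y by (rule finite_subset[OF _ Ef[of y]]) (auto simp: E'_def)
   have "prj E'<=prj ?V"
   proof
    fix y assume "y:prj E'"
    then obtain t where "y @ [t]:E'" unfolding prj_def by blast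
    thus "y:prj ?V" unfolding E'_def by simp
   qed
   hence "~dge n (prj E') (Suc e)" using ne dge_mono by blast
   from bounded_fibres[OF BP E' E'f this] obtain N where N: "~dge n {y. N<card {t. y @ [t]:E'}} e" by blast
   have "~dge (Suc n) {w:?V. N<?ct (butlast w)} d"
   proof
    assume a: "dge (Suc n) {w:?V. N<?ct (butlast w)} d"
    have "dge n (prj {w:?V. N<?ct (butlast w)}) e"
    proof (rule prj_dge[of n _ e ep])
     show "dge (Suc n) {w:?V. N<?ct (butlast w)} (e + ep)" using a de by simp
     fix y assume "ep = 0"
     hence "~X" unfolding ep_def by (auto split: if_splits)
     have "{t. y @ [t]:{w:?V. N<?ct (butlast w)}}<={t. y @ [t]:?V}" by auto
     moreover have "finite {t. y @ [t]:?V}" unfolding fb using \<open>~X\<close> by auto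
     ultimately show "finite {t. y @ [t]:{w:?V. N<?ct (butlast w)}}" by (rule finite_subset)
    qed (simp add: ep_def)
    moreover have "prj {w:?V. N<?ct (butlast w)}<={y. N<card {t. y @ [t]:E'}}"
    proof
     fix y assume y: "y:prj {w:?V. N<?ct (butlast w)}"
     hence "y:prj ?V" "N<?ct y" unfolding prj_def by auto
     hence "{t. y @ [t]:E'} = {t. y @ [t]:E}" unfolding E'_def by auto
     thus "y:{y. N<card {t. y @ [t]:E'}}" using \<open>N<?ct y\<close> by simp
    qed
    ultimately show False using N dge_mono by blast
   qed
   thus ?thesis by blast
  qed
 qed
 obtain N1 where N1: "~dge (Suc n) {w:?fin True. N1<?ct (butlast w)} d" using left by blast
 obtain N2 where N2: "~dge (Suc n) {w:?fin False. N2<?ct (butlast w)} d" using left by blast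
 define N where "N = max N1 N2"
 define L where "L = {w:?fin True. N1<?ct (butlast w)} Un {w:?fin False. N2<?ct (butlast w)}"
 have L: "~dge (Suc n) L d" unfolding L_def using N1 N2 dge_Un by blast
 let ?cb = "%w. card {s. s<last w & butlast w @ [s]:E}"
 \<comment> \<open>\<open>k\<close> tells whether the point is an endpoint itself, \<open>i\<close>
   counts the endpoints strictly below it. Between neighbouring endpoints membership in
   \<open>V\<close> does not change, so fibres are convex.\<close>
 define W0 where "W0 k i = {w:V. (w:E) = k & ?cb w = i}" for k i
 have W0: "W0 k i:S (Suc n)" for k i
  unfolding W0_def card_eq_le
  by (rule S_sub[OF V], (rule dfn_conj dfn_not dfn_iff dfn_const dfn_mem'[OF E] dfn_count[OF E Ef] ltrm_butlast trm_last ltrm_vars)+)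
 \<comment> \<open>The last index separates infinite from finite fibres, which makes the fibre
   dimension constant on each part.\<close>
 define W where "W = (%(k, i, X). {w:W0 k i. infinite {t. butlast w @ [t]:W0 k i} = X})"
 have W: "W x:S (Suc n)" for x
  unfolding W_def case_prod_beta
  by (rule S_sub[OF W0], (rule dfn_iff dfn_const dfn_infinite ltrm_butlast ltrm_vars trm_var dfn_snoc[OF W0])+)
 have WV: "W x<=V" for x unfolding W_def W0_def case_prod_beta by blast
 have conv0: "y @ [s]:W0 k i" if h: "y @ [t]:W0 k i" "y @ [t']:W0 k i" "t<s" "s<t'" for y t t' s k i
 proof -
  let ?F = "{r. y @ [r]:E}"
  have c: "card {r. r<t & y @ [r]:E} = i" "card {r. r<t' & y @ [r]:E} = i" using h unfolding W0_def by auto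
  have fin: "finite {r. r<t' & y @ [r]:E}" by (rule finite_subset[OF _ Ef[of y]]) auto
  have "{r. r<t & y @ [r]:E}<={r. r<t' & y @ [r]:E}" using h(3,4) by auto
  hence eq: "{r. r<t & y @ [r]:E} = {r. r<t' & y @ [r]:E}" using card_subset_eq[OF fin] c by simp
  have noE: "y @ [r]~:E" if "t<=r" "r<t'" for r
  proof
   assume "y @ [r]:E"
   hence "r:{r. r<t' & y @ [r]:E}" using that by simp
   hence "r:{r. r<t & y @ [r]:E}" by (simp only: eq)
   thus False using that by auto
  qed
  have ly: "length y = n" using h(1) prj_len[OF W0] by blast
  have "y @ [t]~:E" using noE h(3,4) by auto
  hence k: "~k" using h(1) unfolding W0_def by auto
  have tE: "y @ [t']~:E" using h(2) k unfolding W0_def by auto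
  have loc: "EX u v. u<r & r<v & (ALL q. u<q & q<v --> (y @ [q]:V) = (y @ [r]:V))" if r: "t<=r" "r<=t'" for r
  proof -
   have "y @ [r]~:E" using noE tE r by (cases "r = t'") auto
   then obtain X u v where uv: "u<r" "r<v" "ALL q. u<q & q<v --> (y @ [q]:V) = X" using ly unfolding E_def by auto
   hence "X = (y @ [r]:V)" by blast
   thus ?thesis using uv by blast
  qed
  have "s:{r. y @ [r]:V}"
  proof (rule interval_clopen[of _ t])
   show "dfn (%e. e 0:{r. y @ [r]:V})" unfolding mem_Collect_eq by (rule dfn_snoc[OF V ltrm_const[OF ly] trm_var])
   show "t<s" "t:{r. y @ [r]:V}" using h unfolding W0_def by auto
   fix r assume r: "t<=r" "r<=s"
   hence "r<=t'" using h by auto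
   from loc[OF r(1) this] obtain u v where uv: "u<r" "r<v" "ALL q. u<q & q<v --> (y @ [q]:V) = (y @ [r]:V)" by blast
   { assume "r:{r. y @ [r]:V}"
    thus "EX u v. u<r & r<v & (ALL q. u<q & q<v & t<=q & q<=s --> q:{r. y @ [r]:V})"
     using uv by blast }
   { assume "r~:{r. y @ [r]:V}"
    thus "EX u v. u<r & r<v & (ALL q. u<q & q<v & t<=q & q<=s --> q~:{r. y @ [r]:V})"
     using uv by blast }
  qed
  moreover have "y @ [s]~:E" using noE h(3,4) by auto
  moreover have "{r. r<s & y @ [r]:E} = {r. r<t & y @ [r]:E}"
  proof -
   have "{r. r<s & y @ [r]:E}<={r. r<t' & y @ [r]:E}" using h(4) by auto
   hence "{r. r<s & y @ [r]:E}<={r. r<t & y @ [r]:E}" by (simp only: eq)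
   moreover have "{r. r<t & y @ [r]:E}<={r. r<s & y @ [r]:E}" using h(3) by auto
   ultimately show ?thesis by blast
  qed
  ultimately show ?thesis using k c(1) unfolding W0_def by simp
 qed
 have fbW: "{t. y @ [t]:W (k, i, X)} = (if infinite {t. y @ [t]:W0 k i} = X then {t. y @ [t]:W0 k i} else {})" for y k i X
  unfolding W_def by auto
 have conv: "y @ [s]:W x" if "y @ [t]:W x" "y @ [t']:W x" "t<s" "s<t'" for y t t' s x
 proof -
  obtain k i X where x: "x = (k, i, X)" by (cases x)
  show ?thesis using conv0[of y t k i t' s] that unfolding x W_def by simp
 qed
 have ex: "EX M. ALL PP. pieces (Suc n) V (W x) d PP --> card PP<=M" for x
 proof -
  obtain k i X where x: "x = (k, i, X)" by (cases x)
  show ?thesis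
  proof (rule bounded_pieces_convex[OF BP V W WV conv, where ep = "if X then 1 else 0"])
   show "((if X then 1 else 0) = (0::nat) & (ALL y. finite {t. y @ [t]:W x})) |
    ((if X then 1 else 0) = (1::nat) & (ALL y:prj (W x). infinite {t. y @ [t]:W x}))"
   proof (cases X)
    case True
    have "infinite {t. y @ [t]:W x}" if "y:prj (W x)" for y
    proof -
     have "{t. y @ [t]:W x}~={}" using that unfolding prj_def by blast
     thus ?thesis using True unfolding x fbW by (auto split: if_splits)
    qed
    thus ?thesis using True by simp
   next
    case False
    hence "finite {t. y @ [t]:W x}" for y unfolding x fbW by (auto split: if_splits)
    thus ?thesis using False by simp
   qed
   show "~dge (Suc n) (W x) (Suc d)" using d dge_mono[OF WV] by blast
  qed
 qed
 then obtain M where M: "!!x PP. pieces (Suc n) V (W x) d PP==>card PP<=M x" by metis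
 let ?I = "(UNIV :: bool set) \<times> {..N} \<times> (UNIV :: bool set)"
 have fI: "finite ?I" by simp
 show "EX M. ALL PP. pieces (Suc n) V V d PP --> card PP<=M"
 proof (intro exI[of _ "SUM x:?I. M x"] allI impI)
  fix PP assume P: "pieces (Suc n) V V d PP"
  have cover: "V<=L Un (UN x:?I. W x)"
  proof
   fix w assume w: "w:V"
   show "w:L Un (UN x:?I. W x)"
   proof (cases "w:L")
    case False
    hence "?ct (butlast w)<=N" using w unfolding L_def N_def by auto
    moreover have "?cb w<=?ct (butlast w)" by (rule card_mono[OF Ef]) auto
    ultimately have "?cb w:{..N}" by simp
    moreover have "w:W (w:E, ?cb w, infinite {t. butlast w @ [t]:W0 (w:E) (?cb w)})"
     using w unfolding W_def W0_def by simp
    ultimately show ?thesis by blast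
   qed simp
  qed
  have sub: "PP<=(UN x:?I. {A:PP. dge (Suc n) (A Int W x) d})"
  proof
   fix A assume A: "A:PP"
   hence "dge (Suc n) (A Int V) d" using P unfolding pieces_def by blast
   moreover have "A Int V<=L Un (UN x:?I. A Int W x)" using cover by blast
   ultimately have "dge (Suc n) (L Un (UN x:?I. A Int W x)) d" using dge_mono by blast
   hence "EX x:?I. dge (Suc n) (A Int W x) d" using L dge_UN[OF fI, of "Suc n" "%x. A Int W x" d] unfolding dge_Un by blast
   thus "A:(UN x:?I. {A:PP. dge (Suc n) (A Int W x) d})" using A by blast
  qed
  have fP: "finite PP" using P unfolding pieces_def by blast
  have "card PP<=card (UN x:?I. {A:PP. dge (Suc n) (A Int W x) d})"
   by (rule card_mono[OF _ sub]) (use fI fP in auto)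
  also have "...<=(SUM x:?I. card {A:PP. dge (Suc n) (A Int W x) d})" by (rule card_UN_le[OF fI])
  also have "...<=(SUM x:?I. M x)"
  proof (rule sum_mono)
   fix x
   have "pieces (Suc n) V (W x) d {A:PP. dge (Suc n) (A Int W x) d}" using P unfolding pieces_def by auto
   thus "card {A:PP. dge (Suc n) (A Int W x) d}<=M x" by (rule M)
  qed
  finally show "card PP<=(SUM x:?I. M x)" .
 qed
qed

theorem bounded_pieces: "bounded_pieces n"
 by (induction n) (auto intro: bounded_pieces_0 bounded_pieces_Suc)

end

section \<open>Definable groups\<close>

locale omin_group = omin S + group G for S :: "nat => 'a::linorder list set set" and G :: "'a list monoid" (structure) +
 fixes n :: nat
 assumes carrier_S: "carrier G:S n"
  and graph_S: "{x @ y @ (x ** y) | x y. x:carrier G & y:carrier G}:S (3 * n)"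
begin

abbreviation "Gr == {x @ y @ (x ** y) | x y. x:carrier G & y:carrier G}"

lemma len: "x:carrier G==>length x = n"
 using S_len[OF carrier_S] by auto

lemma graph_iff:
 assumes "length x = n" "length y = n"
 shows "x @ y @ z:Gr <-> x:carrier G & y:carrier G & z = x ** y"
proof
 assume "x @ y @ z:Gr"
 then obtain a b where ab: "x @ y @ z = a @ b @ (a ** b)" "a:carrier G" "b:carrier G" by auto
 hence "x = a" "y = b" "z = a ** b" using assms len by auto
 thus "x:carrier G & y:carrier G & z = x ** y" using ab by simp
qed auto

lemma dfn_graph: assumes "ltrm n xs" "ltrm n ys" "ltrm n zs" shows "dfn (%e. xs e @ ys e @ zs e:Gr)"
 by (rule dfn_mem[OF graph_S ltrm_append[OF assms(1) ltrm_append[OF assms(2,3)]]]) simp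

definition lcos :: "'a list => 'a list set => 'a list set" where
 "lcos h K = {h ** k | k. k:K}"

lemma lcos_self: "subgroup K G==>h:carrier G==>h:lcos h K"
 unfolding lcos_def using subgroup.one_closed by force

lemma lcos_eq: assumes K: "subgroup K G" and h: "h:carrier G" and y: "y:lcos h K" shows "lcos y K = lcos h K"
proof -
 obtain k where k: "k:K" "y = h ** k" using y unfolding lcos_def by blast
 have c: "x:carrier G" if "x:K" for x using subgroup.mem_carrier[OF K that] .
 show ?thesis
 proof (intro Set.set_eqI iffI)
  fix x assume "x:lcos y K"
  then obtain k' where "k':K" "x = h ** k ** k'" using k unfolding lcos_def by blast
  thus "x:lcos h K" using k h c subgroup.m_closed[OF K] unfolding lcos_def by (auto simp: m_assoc)
 next
  fix x assume "x:lcos h K"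
  then obtain k' where k': "k':K" "x = h ** k'" unfolding lcos_def by blast
  have "k ** (inv k ** k') = k'" using c k k' by (simp add: m_assoc[symmetric])
  hence "x = y ** (inv k ** k')" using k k' h c by (simp add: m_assoc)
  thus "x:lcos y K" using k k' subgroup.m_closed[OF K] subgroup.m_inv_closed[OF K] unfolding lcos_def by blast
 qed
qed

lemma lcos_sub: "subgroup K G==>subgroup H G==>K<=H==>h:H==>lcos h K<=H"
 unfolding lcos_def using subgroup.m_closed by fastforce

lemma dfn_lcos: assumes "K:S n" "K<=carrier G" "ltrm n xs" "ltrm n zs"
 shows "dfn (%e. EX k:K. xs e @ k @ zs e:Gr)"
 by (rule dfn_bex[OF assms(1)], rule dfn_graph[OF ltrm_shift[OF assms(3)] ltrm_vars[where f = "%i. i"] ltrm_shift[OF assms(4)]])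

lemma lcos_iff: assumes "K<=carrier G" "x:carrier G"
 shows "(EX k:K. x @ k @ z:Gr) <-> z:lcos x K"
proof -
 have "x @ k @ z:Gr <-> z = x ** k" if "k:K" for k
  using graph_iff[of x k z] len assms that by auto
 thus ?thesis unfolding lcos_def by blast
qed

lemma dge_lcos:
 assumes K: "K:S n" "subgroup K G" and h: "h:carrier G" and d: "dge n K d"
 shows "dge n (lcos h K) d"
proof -
 have Kc: "K<=carrier G" using K subgroup.subset by blast
 let ?R = "%x k. k:K & h @ k @ x:Gr"
 have R: "dfl2 n n ?R" unfolding dfl2_def by (rule dfn_conj dfn_mem'[OF K(1)] dfn_graph ltrm_const[OF len[OF h]] ltrm_vars)+
 have "dge n {x. EX k. length k = n & ?R x k} d"
 proof (rule dge_image[OF R])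
  fix x :: "'a list"
  have "k = k'" if "?R x k" "?R x k'" for k k'
   using that Kc h len graph_iff[of h k x] graph_iff[of h k' x] by (auto simp: subset_iff)
  hence "EX k0. {k. length k = n & ?R x k}<={k0}" by blast
  thus "finite {k. length k = n & ?R x k}" using finite_subset by blast
 next
  have "K<={k. EX x. length x = n & ?R x k}"
  proof
   fix k assume k: "k:K"
   hence "h @ k @ (h ** k):Gr" using Kc h by auto
   thus "k:{k. EX x. length x = n & ?R x k}" using k Kc h len by blast
  qed
  thus "dge n {k. EX x. length x = n & ?R x k} d" using d dge_mono by blast
 qed
 moreover have "{x. EX k. length k = n & ?R x k}<=lcos h K" using lcos_iff[OF Kc h] by blast
 ultimately show ?thesis using dge_mono by blast
qed

text \<open>Cosets are disjoint; if each is open near the points of \<open>V\<close>, then in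
  \<open>V\<close> the complement of a coset is open too, being covered by other cosets.\<close>

lemma coset_pieces:
 assumes K: "subgroup K G" and H: "subgroup H G" and V: "V<=H"
  and C: "finite CC" "CC<=(%h. lcos h K) ` H"
  and loc: "!!y. y:V==>nbh n y (%z. z:H --> z:lcos y K)"
  and SS: "!!h. h:H==>V Int lcos h K:S n" and dd: "!!h. h:H==>dge n (V Int lcos h K) d"
 shows "pieces n V V d ((Int) V ` CC) & inj_on ((Int) V) CC"
proof -
 have Hc: "H<=carrier G" using H subgroup.subset by blast
 have eq: "lcos y K = C" if "C:CC" "y:C" for C y
  using that C(2) lcos_eq[OF K] Hc by blast
 have ne: "V Int C~={}" if CC: "C:CC" for C
 proof
  assume e: "V Int C = {}"
  obtain h where "h:H" "C = lcos h K" using CC C(2) by blast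
  thus False using dd[of h] e by (simp add: dge_empty)
 qed
 have "inj_on ((Int) V) CC"
 proof (rule inj_onI)
  fix A B assume AB: "A:CC" "B:CC" "V Int A = V Int B"
  obtain y where "y:V Int A" using ne[OF AB(1)] by blast
  hence "y:A" "y:B" using AB(3) by blast+
  thus "A = B" using eq AB by blast
 qed
 moreover have "pieces n V V d ((Int) V ` CC)" unfolding pieces_def
 proof (intro conjI ballI impI)
  show "finite ((Int) V ` CC)" using C by simp
  fix P Q assume "P:(Int) V ` CC" "Q:(Int) V ` CC" "P~=Q"
  thus "P Int Q = {}" using eq by blast
 next
  fix P assume "P:(Int) V ` CC"
  then obtain h where h: "h:H" "P = V Int lcos h K" "lcos h K:CC" using C(2) by blast
  show "P:S n" using SS h by simp
  have "P Int V = P" using h by blast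
  thus "dge n (P Int V) d" using dd h by simp
  show "clopen n V P" unfolding clopen_def
  proof (intro conjI ballI)
   show "P<=V" using h by blast
   fix y assume y: "y:P"
   hence "nbh n y (%z. z:H --> z:lcos y K)" "lcos y K = lcos h K" using loc h eq by blast+
   thus "nbh n y (%z. z:V --> z:P)" by (elim nbh_mono) (use V h in auto)
  next
   fix y assume y: "y:V - P"
   hence l: "nbh n y (%z. z:H --> z:lcos y K)" using loc by blast
   have yc: "y:carrier G" using y V Hc by blast
   have "z~:lcos h K" if "z:lcos y K" for z
   proof
    assume "z:lcos h K"
    hence "lcos y K = lcos h K" using eq[OF h(3)] lcos_eq[OF K yc that] by simp
    thus False using lcos_self[OF K yc] y h by blast
   qed
   thus "nbh n y (%z. z:V --> z~:P)" using l by (elim nbh_mono) (use V h in auto)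
  qed
 qed
 ultimately show ?thesis by blast
qed

text \<open>Left multiplication by b, restricted to \<open>H\<close>, is discontinuous at y: some
  box containing the product has no preimage neighbourhood.\<close>

definition disc :: "'a list set => 'a list => 'a list => bool" where
 "disc H b y <-> (EX u:{u. length u = n}. EX v:{v. length v = n}. (EX w:bx n u v. b @ y @ w:Gr) &
   ~nbh n y (%z. z:H --> (EX w:bx n u v. b @ z @ w:Gr)))"

lemma dfn_bexbx:
 assumes "dfn (%e. P (map e [0..<n]) (%i. e (i + n)))" "ltrm n us" "ltrm n vs"
 shows "dfn (%e. EX w:bx n (us e) (vs e). P w e)"
proof -
 have "dfn (%e. EX w:{w. length w = n}. w:bx n (us e) (vs e) & P w e)"
  by (rule dfn_bexl, rule dfn_conj[OF dfn_bx[OF ltrm_vars[where f = "%i. i"] ltrm_shift[OF assms(2)] ltrm_shift[OF assms(3)]] assms(1)])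
 moreover have "(EX w:{w. length w = n}. w:bx n u v & P w e) = (EX w:bx n u v. P w e)" for u v e by (auto simp: bx_def)
 ultimately show ?thesis by simp
qed

lemma dfn_disc: assumes "H:S n" shows "dfn (%e. disc H (map (%i. e (f i)) [0..<n]) (map (%i. e (g i)) [0..<n]))"
 unfolding disc_def
 by (rule dfn_bexl dfn_conj dfn_not dfn_bexbx dfn_graph dfn_nbh dfn_imp dfn_mem'[OF assms] ltrm_vars)+

text \<open>Left multiplication by a generic element is continuous at a generic point, so on a large
 subset of the group, independent of the subgroup, the cosets are relatively clopen.\<close>

theorem bounded_index:
 assumes H: "H:S n" "subgroup H G" and d: "dge n H d" "~dge n H (Suc d)"
 shows "EX N. ALL K. K:S n & subgroup K G & K<=H & dge n K d --> finite ((%h. lcos h K) ` H) & card ((%h. lcos h K) ` H)<=N"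
proof -
 have Hc: "H<=carrier G" using H subgroup.subset by blast
 have bp: "EX N. ALL PP. pieces n V V d PP --> card PP<=N" if "V:S n" "V<=H" for V
  using bounded_pieces[of n] that d(2) dge_mono[OF that(2)] unfolding bounded_pieces_def by blast
 \<comment> \<open>A box witnessing discontinuity can be fixed for many y; the preimage of that
   fixed box is open at most of its points.\<close>
 have disc1: "~dge n {y:H. disc H b y} d" if b: "b:H" for b
 proof
  assume a: "dge n {y:H. disc H b y} d"
  have lb: "length b = n" using b Hc len by blast
  define R where "R y u v <-> y:H & (EX w:bx n u v. b @ y @ w:Gr) & ~nbh n y (%z. z:H --> (EX w:bx n u v. b @ z @ w:Gr))" for y u v
  have "EX u v. length u = n & length v = n & dge n {y. R y u v} d"
  proof (rule fix_box[OF _ a])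
   show "dfn (%e. R (map e [0..<n]) (map (%i. e (i + n)) [0..<n]) (map (%i. e (i + (n + n))) [0..<n]))"
    unfolding R_def by (rule dfn_conj dfn_not dfn_bexbx dfn_graph dfn_nbh dfn_imp dfn_mem'[OF H(1)] ltrm_const[OF lb] ltrm_vars)+
   fix y assume "y:{y:H. disc H b y}"
   then obtain u v w where uv: "y:H" "length u = n" "length v = n" "w:bx n u v" "b @ y @ w:Gr"
    "~nbh n y (%z. z:H --> (EX w:bx n u v. b @ z @ w:Gr))" unfolding disc_def by blast
   show "EX x u v. length u = n & length v = n & x:bx n u v &
    (ALL u' v'. length u' = n & length v' = n & x:bx n u' v' & bx n u' v'<=bx n u v --> R y u' v')"
   proof (rule exI[of _ w], rule exI[of _ u], rule exI[of _ v], intro conjI allI impI uv(2-4))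
    fix u' v' assume h: "length u' = n & length v' = n & w:bx n u' v' & bx n u' v'<=bx n u v"
    have "~nbh n y (%z. z:H --> (EX w:bx n u' v'. b @ z @ w:Gr))"
    proof
     assume "nbh n y (%z. z:H --> (EX w:bx n u' v'. b @ z @ w:Gr))"
     hence "nbh n y (%z. z:H --> (EX w:bx n u v. b @ z @ w:Gr))" by (rule nbh_mono) (use h in blast)
     thus False using uv(6) by blast
    qed
    thus "R y u' v'" using uv(1,5) h unfolding R_def by blast
   qed
  qed
  then obtain u v where uv: "length u = n" "length v = n" "dge n {y. R y u v} d" by blast
  define Y1 where "Y1 = {y:H. EX w:bx n u v. b @ y @ w:Gr}"
  have Y1: "Y1:S n" unfolding Y1_def
   by (rule S_sub[OF H(1)], (rule dfn_bexbx dfn_graph ltrm_const[OF lb] ltrm_const[OF uv(1)] ltrm_const[OF uv(2)] ltrm_vars)+)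
  have "{y. R y u v}<={y:Y1. ~nbh n y (%z. z:H --> z:Y1)}"
  proof
   fix y assume y: "y:{y. R y u v}"
   have "~nbh n y (%z. z:H --> z:Y1)"
   proof
    assume "nbh n y (%z. z:H --> z:Y1)"
    hence "nbh n y (%z. z:H --> (EX w:bx n u v. b @ z @ w:Gr))" by (rule nbh_mono) (auto simp: Y1_def)
    thus False using y unfolding R_def by blast
   qed
   thus "y:{y:Y1. ~nbh n y (%z. z:H --> z:Y1)}" using y unfolding R_def Y1_def by blast
  qed
  hence "dge n {y:Y1. ~nbh n y (%z. z:H --> z:Y1)} d" using uv(3) dge_mono by blast
  hence "dge n H (Suc d)" by (rule interior_large[OF H(1) Y1, rotated]) (auto simp: Y1_def)
  thus False using d(2) by blast
 qed
 \<comment> \<open>The points at which left multiplication by almost every b is continuous. The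
   choice does not involve \<open>K\<close>, which is what makes the final bound uniform.\<close>
 define V where "V = {y:H. ~dge n {b. b:H & disc H b y} d}"
 have V: "V:S n" "V<=H" unfolding V_def
  by (rule S_sub[OF H(1)], (rule dfn_not dfn_dge dfn_conj dfn_mem'[OF H(1)] dfn_disc[OF H(1)] ltrm_vars)+) auto
 have Vl: "~dge n (H - V) d"
 proof
  assume a: "dge n (H - V) d"
  let ?R = "%y b. y:H & b:H & disc H b y"
  have R: "dfl2 n n ?R" unfolding dfl2_def by (rule dfn_conj dfn_mem'[OF H(1)] dfn_disc[OF H(1)] ltrm_vars)+
  have lo: "dge n {y. dge n {b. ?R y b} d} d" using a by (rule dge_mono[rotated]) (auto simp: V_def)
  have up: "~dge n {y. ?R y b} d" for b
  proof (cases "b:H")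
   case True thus ?thesis using disc1[OF True] by simp
  next
   case False thus ?thesis by (simp add: dge_empty)
  qed
  show False
  proof (cases d)
   case 0
   then obtain y b where "?R y b" "length y = n" using lo unfolding 0 dge_0 by auto
   hence "dge n {y. ?R y b} d" unfolding 0 dge_0 by blast
   thus False using up by blast
  next
   case (Suc c)
   have "dge n {b. EX y. length y = n & ?R y b} (d + d - c)"
    by (rule double_count[OF R lo]) (use up Suc in auto)
   hence "dge n H (d + d - c)" by (rule dge_mono[rotated]) auto
   thus False using d(2) Suc dge_antimono[of "Suc d" "d + d - c"] by simp
  qed
 qed
 have main: "finite ((%h. lcos h K) ` H) & (ALL y:V. nbh n y (%z. z:H --> z:lcos y K))"
  if K: "K:S n" "subgroup K G" "K<=H" "dge n K d" for K
 proof -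
  have Kc: "K<=carrier G" using K Hc by blast
  define W where "W = {y:H. nbh n y (%z. z:H --> (EX k:K. y @ k @ z:Gr))}"
  have Weq: "W = {y:H. nbh n y (%z. z:H --> z:lcos y K)}" unfolding W_def using lcos_iff[OF Kc] Hc by auto
  have W: "W:S n" "W<=H" unfolding W_def
   by (rule S_sub[OF H(1)], (rule dfn_nbh dfn_imp dfn_mem'[OF H(1)] dfn_lcos[OF K(1) Kc] ltrm_vars)+) auto
  have cosS: "lcos h K:S n" if "h:H" for h
  proof -
   have "{z. length z = n & (EX k:K. h @ k @ z:Gr)}:S n"
    by (rule S_I dfn_lcos[OF K(1) Kc] ltrm_const[OF len] ltrm_vars subsetD[OF Hc that])+
   moreover have "{z. length z = n & (EX k:K. h @ k @ z:Gr)} = lcos h K"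
    using lcos_iff[OF Kc subsetD[OF Hc that]] lcos_sub[OF K(2) H(2) K(3) that] Hc len by blast
   ultimately show ?thesis by simp
  qed
  have cosH: "lcos h K<=H" if "h:H" for h by (rule lcos_sub[OF K(2) H(2) K(3) that])
  have bdry: "~dge n {y:lcos h K. ~nbh n y (%z. z:H --> z:lcos h K)} d" if h: "h:H" for h
   using interior_large[OF H(1) cosS[OF h] cosH[OF h]] d(2) by blast
  have cosd: "dge n (W Int lcos h K) d" if h: "h:H" for h
  proof -
   have "lcos h K<=(W Int lcos h K) Un {y:lcos h K. ~nbh n y (%z. z:H --> z:lcos h K)}"
    unfolding Weq using cosH[OF h] lcos_eq[OF K(2) subsetD[OF Hc h]] by auto
   hence "dge n ((W Int lcos h K) Un {y:lcos h K. ~nbh n y (%z. z:H --> z:lcos h K)}) d"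
    using dge_lcos[OF K(1,2) subsetD[OF Hc h] K(4)] dge_mono by blast
   thus ?thesis using bdry[OF h] dge_Un by blast
  qed
  \<comment> \<open>This bound still depends on \<open>K\<close>, through \<open>W\<close>. It only
    serves to make the number of cosets finite, so that the union of their boundaries is
    small.\<close>
  obtain N where N: "!!PP. pieces n W W d PP==>card PP<=N" using bp[OF W] by blast
  have fin: "finite ((%h. lcos h K) ` H)"
  proof (rule ccontr)
   assume "infinite ((%h. lcos h K) ` H)"
   then obtain CC where C: "CC<=(%h. lcos h K) ` H" "finite CC" "card CC = Suc N"
    using infinite_arbitrarily_large[of "(%h. lcos h K) ` H" "Suc N"] by (auto simp del: finite_imageI)
   have "pieces n W W d ((Int) W ` CC) & inj_on ((Int) W) CC"
    by (rule coset_pieces[OF K(2) H(2) W(2) C(2,1)]) (use Weq cosS cosd S_Int W(1) in auto)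
   thus False using N[of "(Int) W ` CC"] card_image[of "(Int) W" CC] C(3) by simp
  qed
  have "H - W<=(UN C:(%h. lcos h K) ` H. {y:C. ~nbh n y (%z. z:H --> z:C)})"
   unfolding Weq using lcos_self[OF K(2)] Hc by blast
  moreover have "~dge n (UN C:(%h. lcos h K) ` H. {y:C. ~nbh n y (%z. z:H --> z:C)}) d"
   unfolding dge_UN[OF fin] using bdry by blast
  ultimately have Wl: "~dge n (H - W) d" using dge_mono by blast
  have "nbh n y (%z. z:H --> z:lcos y K)" if y: "y:V" for y
  proof -
   have yH: "y:H" "y:carrier G" using y V Hc by auto
   \<comment> \<open>Neither set of exceptional b exhausts \<open>H\<close>. For a remaining b the
     coset is open at \<open>b ** y\<close>, and continuity carries this back to y.\<close>
   let ?B1 = "{b. b:H & disc H b y}" and ?B2 = "{b. b:H & b ** y:H - W}"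
   have b1: "~dge n ?B1 d" using y unfolding V_def by blast
   have b2: "~dge n ?B2 d"
   proof
    assume a: "dge n ?B2 d"
    have HW: "H - W:S n" by (intro S_diff H W)
    let ?R = "%x b. x:H - W & b:H & b @ y @ x:Gr"
    have R: "dfl2 n n ?R" unfolding dfl2_def
     by (rule dfn_conj dfn_mem'[OF HW] dfn_mem'[OF H(1)] dfn_graph ltrm_const[OF len[OF yH(2)]] ltrm_vars)+
    have "dge n {x. EX b. length b = n & ?R x b} d"
    proof (rule dge_image[OF R])
     fix x :: "'a list"
     have "b = b'" if bb: "?R x b" "?R x b'" for b b'
     proof -
      have "b:carrier G" "b':carrier G" "x = b ** y" "x = b' ** y"
       using bb graph_iff[of b y x] graph_iff[of b' y x] Hc len yH by auto
      thus ?thesis using yH by (metis right_cancel)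
     qed
     hence "EX k0. {b. length b = n & ?R x b}<={k0}" by blast
     thus "finite {b. length b = n & ?R x b}" using finite_subset by blast
    next
     have "?B2<={b. EX x. length x = n & ?R x b}"
     proof
      fix b assume b: "b:?B2"
      hence "b @ y @ (b ** y):Gr" using Hc yH by blast
      thus "b:{b. EX x. length x = n & ?R x b}" using b Hc len by blast
     qed
     thus "dge n {b. EX x. length x = n & ?R x b} d" using a dge_mono by blast
    qed
    hence "dge n (H - W) d" by (rule dge_mono[rotated]) auto
    thus False using Wl by blast
   qed
   have "~H<=?B1 Un ?B2" using d(1) b1 b2 dge_mono dge_Un by blast
   then obtain b where b: "b:H" "~disc H b y" "b ** y~:H - W" by blast
   have bc: "b:carrier G" using b Hc by blast
   have "b ** y:W" using b yH subgroup.m_closed[OF H(2)] by blast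
   hence "nbh n (b ** y) (%z. z:H --> z:lcos (b ** y) K)" unfolding Weq by blast
   then obtain u v where uv: "length u = n" "length v = n" "b ** y:bx n u v" "!!x. x:bx n u v==>x:H --> x:lcos (b ** y) K" using nbhE by blast
   have "b @ y @ (b ** y):Gr" using bc yH by blast
   hence "nbh n y (%z. z:H --> (EX w:bx n u v. b @ z @ w:Gr))" using b(2) uv(1-3) unfolding disc_def by blast
   thus ?thesis
   proof (rule nbh_mono, intro impI)
    fix z assume z: "z:H --> (EX w:bx n u v. b @ z @ w:Gr)" "z:H"
    have zc: "z:carrier G" using z Hc by blast
    have "b ** z:bx n u v" using z graph_iff[of b z] bc zc len by auto
    hence "b ** z:lcos (b ** y) K" using uv(4) subgroup.m_closed[OF H(2) b(1) z(2)] by blast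
    then obtain k where k: "k:K" "b ** z = b ** y ** k" unfolding lcos_def by blast
    hence "z = y ** k" using bc zc yH Kc by (simp add: m_assoc subset_iff)
    thus "z:lcos y K" using k unfolding lcos_def by blast
   qed
  qed
  thus ?thesis using fin by blast
 qed
 obtain N where N: "!!PP. pieces n V V d PP==>card PP<=N" using bp[OF V] by blast
 show ?thesis
 proof (intro exI[of _ N] allI impI conjI)
  fix K assume K: "K:S n & subgroup K G & K<=H & dge n K d"
  hence Kc: "K<=carrier G" using Hc by blast
  show fin: "finite ((%h. lcos h K) ` H)" using main K by blast
  have cosS: "V Int lcos h K:S n" if "h:H" for h
  proof -
   have "{z:V. EX k:K. h @ k @ z:Gr}:S n"
    by (rule S_sub[OF V(1)], (rule dfn_lcos[OF conjunct1[OF K] Kc] ltrm_const[OF len] ltrm_vars subsetD[OF Hc that])+)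
   moreover have "{z:V. EX k:K. h @ k @ z:Gr} = V Int lcos h K"
    using lcos_iff[OF Kc subsetD[OF Hc that]] by blast
   ultimately show ?thesis by simp
  qed
  have cosd: "dge n (V Int lcos h K) d" if h: "h:H" for h
  proof -
   have "lcos h K<=(V Int lcos h K) Un (H - V)" using lcos_sub[OF _ H(2) _ h] K by blast
   moreover have "dge n (lcos h K) d" using dge_lcos K Hc h by blast
   ultimately have "dge n ((V Int lcos h K) Un (H - V)) d" using dge_mono by blast
   thus ?thesis using Vl dge_Un by blast
  qed
  have "pieces n V V d ((Int) V ` (%h. lcos h K) ` H) & inj_on ((Int) V) ((%h. lcos h K) ` H)"
   by (rule coset_pieces[OF _ H(2) V(2) fin subset_refl]) (use K main cosS cosd in auto)
  thus "card ((%h. lcos h K) ` H)<=N" using N card_image by metis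
 qed
qed

end

section \<open>Groups with a dimension\<close>

text \<open>Definable predicates on the powers of a group, with de Bruijn variables as before. The
 class of these structures is closed under definable subgroups and quotients, which the
 induction over the dimension requires; quotients live on representatives of the same type.\<close>

locale ranked_group = group G for G :: "'b monoid" (structure) +
 fixes D :: "((nat => 'b) => bool) => bool" and dim :: "'b set => int"
 assumes D_cong: "D ph==>(!!e. range e<=carrier G==>ph e = ps e)==>D ps"
  and D_not: "D ph==>D (%e. ~ph e)"
  and D_conj: "D ph==>D ps==>D (%e. ph e & ps e)"
  and D_ex0: "D ph==>D (%e. EX x:carrier G. ph (case_nat x e))"
  and D_rename: "D ph==>D (%e. ph (%i. e (f i)))"
  and D_mult0: "D (%e. e 0 = e 1 ** e 2)"
  and D_eq0: "D (%e. e 0 = e 1)"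
  and D_const0: "c:carrier G==>D (%e. e 0 = c)"
  and dim_empty: "dim {} = -1"
  and dim_nonneg: "X<=carrier G==>D (%e. e 0:X)==>X~={}==>0<=dim X"
  and dim_single: "x:carrier G==>dim {x} = 0"
  and dim_mono0: "Y<=carrier G==>D (%e. e 0:X)==>D (%e. e 0:Y)==>X<=Y==>dim X<=dim Y"
  and dim_Un0: "X<=carrier G==>Y<=carrier G==>D (%e. e 0:X)==>D (%e. e 0:Y)==>dim (X Un Y) = max (dim X) (dim Y)"
  and double0: "D (%e. R (e 0) (e 1))==>X<=carrier G==>Y<=carrier G==>D (%e. e 0:X)==>D (%e. e 0:Y) ==>
   X~={}==>0<=a==>(!!x. x:X==>a<=dim {y:Y. R x y})==>(!!y. y:Y==>dim {x:X. R x y}<=b) ==>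
   dim X + a<=dim Y + b"
  and index0: "subgroup H G==>D (%e. e 0:H)==>EX N. ALL K. subgroup K G & D (%e. e 0:K) & K<=H & dim K = dim H -->
   finite ((%h. (%k. h ** k) ` K) ` H) & card ((%h. (%k. h ** k) ` K) ` H)<=N"
begin

abbreviation C where "C == carrier G"

definition ds :: "'b set => bool" where "ds X <-> X<=C & D (%e. e 0:X)"

definition dsub :: "'b set => bool" where "dsub H <-> subgroup H G & ds H"

definition T :: "((nat => 'b) => 'b) => bool" where
 "T t <-> (ALL e. range e<=C --> t e:C) & D (%e. e 0 = t (%i. e (Suc i)))"

lemma rng: "range e<=C==>e i:C" by auto

lemma D_ex: assumes "D (%e. P (e 0) (%i. e (Suc i)))" shows "D (%e. EX x:C. P x e)"
 using D_ex0[OF assms] by simp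

lemma D_disj: assumes "D ph" "D ps" shows "D (%e. ph e | ps e)"
 by (rule D_cong[OF D_not[OF D_conj[OF D_not[OF assms(1)] D_not[OF assms(2)]]]]) simp

lemma D_imp: assumes "D ph" "D ps" shows "D (%e. ph e --> ps e)"
 by (rule D_cong[OF D_disj[OF D_not[OF assms(1)] assms(2)]]) simp

lemma D_all: assumes "D (%e. P (e 0) (%i. e (Suc i)))" shows "D (%e. ALL x:C. P x e)"
 by (rule D_cong[OF D_not[OF D_ex[of "%x e. ~P x e", OF D_not[OF assms]]]]) simp

lemma T_var: "T (%e. e i)"
 unfolding T_def using D_rename[OF D_eq0, of "%k. if k = 0 then 0 else Suc i"] by (auto simp: rng)

lemma T_const: "c:C==>T (%e. c)"
 unfolding T_def using D_const0 by auto

lemma D_sub1: assumes P: "D (%e. P (e 0) (%i. e (Suc i)))" and t: "T t" shows "D (%e. P (t e) e)"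
proof -
 have "D (%e. EX x:C. x = t e & P x e)"
  by (rule D_ex, rule D_conj) (use P t in "auto simp: T_def")
 thus ?thesis by (rule D_cong) (use t in "auto simp: T_def")
qed

lemma TC: "T t==>(!!i. e i:C)==>t e:C"
 unfolding T_def by blast

lemma T_shift: assumes "T t" shows "T (%e. t (%i. e (f i)))"
 unfolding T_def
proof (intro conjI allI impI)
 fix e :: "nat => 'b" assume "range e<=C"
 thus "t (%i. e (f i)):C" using TC[OF assms, of "%i. e (f i)"] by auto
next
 have "D (%e. e 0 = t (%i. e (Suc i)))" using assms unfolding T_def by blast
 from D_rename[OF this, of "case_nat 0 (%i. Suc (f i))"] show "D (%e. e 0 = t (%i. e (Suc (f i))))" by simp
qed

lemma T_comp: assumes f: "T (%e. f (e 0))" and t: "T t" shows "T (%e. f (t e))"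
proof -
 have fc: "f x:C" if "x:C" for x using f that unfolding T_def by (auto dest: spec[of _ "%_. x"])
 have "D (%e. e 0 = f (e 1))" using f unfolding T_def by simp
 from D_rename[OF this, of "%i. if i = 0 then 1 else 0"] have "D (%e. e 1 = f (e 0))" by simp
 from D_sub1[of "%x e. e 0 = f x", OF _ T_shift[OF t, of Suc]] this
 have "D (%e. e 0 = f (t (%i. e (Suc i))))" by simp
 thus ?thesis using t fc unfolding T_def by simp
qed

lemma D_eq: assumes s: "T s" and t: "T t" shows "D (%e. s e = t e)"
proof -
 have "D (%e. e 0 = t (%i. e (Suc i)))" using t unfolding T_def by blast
 from D_sub1[of "%x e. x = t e", OF this s] show ?thesis .
qed

lemma T_mult: assumes s: "T s" and t: "T t" shows "T (%e. s e ** t e)"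
 unfolding T_def
proof (intro conjI allI impI)
 fix e :: "nat => 'b" assume "range e<=C"
 thus "s e ** t e:C" using s t unfolding T_def by auto
next
 have "D (%e. e 2 = e 1 ** e 0)"
  using D_rename[OF D_mult0, of "%k. if k = 0 then 2 else if k = 1 then 1 else 0"] by simp
 hence 1: "D (%e. e 1 = e 0 ** t (%i. e (i + 2)))"
  using D_sub1[of "%x e. e 1 = e 0 ** x", OF _ T_shift[OF t, of "%i. i + 2"]] by (simp add: numeral_2_eq_2)
 have "D (%e. e 0 = s (%i. e (i + 1)) ** t (%i. e (i + 1)))"
  using D_sub1[of "%x e. e 0 = x ** t (%i. e (i + 1))", OF _ T_shift[OF s, of "%i. i + 1"]] 1 by simp
 thus "D (%e. e 0 = s (%i. e (Suc i)) ** t (%i. e (Suc i)))" by simp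
qed

lemma T_inv: assumes t: "T t" shows "T (%e. inv (t e))"
 unfolding T_def
proof (intro conjI allI impI)
 fix e :: "nat => 'b" assume "range e<=C"
 thus "inv (t e):C" using t unfolding T_def by auto
next
 have "D (%e. e 0 ** t (%i. e (Suc i)) = \<one>)" by (rule D_eq[OF T_mult[OF T_var T_shift[OF t]] T_const]) simp
 thus "D (%e. e 0 = inv (t (%i. e (Suc i))))"
 proof (rule D_cong)
  fix e :: "nat => 'b" assume e: "range e<=C"
  hence "e 0:C" "t (%i. e (Suc i)):C" using TC[OF t, of "%i. e (Suc i)"] by auto
  thus "(e 0 ** t (%i. e (Suc i)) = \<one>) = (e 0 = inv (t (%i. e (Suc i))))" by (metis inv_equality l_inv)
 qed
qed

lemma D_mem: assumes "ds X" "T t" shows "D (%e. t e:X)"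
 using D_sub1[of "%x e. x:X", OF _ assms(2)] assms(1) unfolding ds_def by simp

lemma D_bex: assumes A: "ds A" and P: "D (%e. P (e 0) (%i. e (Suc i)))" shows "D (%e. EX x:A. P x e)"
proof -
 have "D (%e. EX x:C. x:A & P x e)" by (rule D_ex, rule D_conj[OF D_mem[OF A T_var] P])
 thus ?thesis by (rule D_cong) (use A in "auto simp: ds_def")
qed

lemma D_ball: assumes A: "ds A" and P: "D (%e. P (e 0) (%i. e (Suc i)))" shows "D (%e. ALL x:A. P x e)"
 by (rule D_cong[OF D_not[OF D_bex[of A "%x e. ~P x e", OF A D_not[OF P]]]]) simp

lemma ds_C: "ds C"
 unfolding ds_def by (auto intro!: D_cong[OF D_eq[OF T_var[of 0] T_var[of 0]]])

lemma ds_Collect: "ds A==>D (%e. ph (e 0))==>ds {x:A. ph x}"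
 unfolding ds_def using D_conj[of "%e. e 0:A" "%e. ph (e 0)"] by auto

lemmas Dr = D_conj D_disj D_imp D_not D_ball D_bex D_ex D_all D_mem D_eq T_mult T_inv T_const T_var

lemma ds_Int: "ds A==>ds B==>ds (A Int B)"
 unfolding ds_def using D_conj[of "%e. e 0:A" "%e. e 0:B"] by auto

lemma ds_Un: "ds A==>ds B==>ds (A Un B)"
 unfolding ds_def using D_disj[of "%e. e 0:A" "%e. e 0:B"] by auto

lemma ds_Diff: "ds A==>ds B==>ds (A - B)"
 unfolding ds_def using D_conj[OF _ D_not, of "%e. e 0:A" "%e. e 0:B"] by auto

lemma ds_empty: "ds {}"
 using ds_Diff[OF ds_C ds_C] by simp

lemma ds_single: "x:C==>ds {x}"
 unfolding ds_def using D_const0 by auto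

lemma ds_image: assumes "ds A" "T (%e. f (e 0))" shows "ds (f ` A)"
proof -
 have AC: "A<=C" using assms(1) unfolding ds_def by blast
 have fc: "f x:C" if "x:C" for x using assms(2) that unfolding T_def by (auto dest: spec[of _ "%_. x"])
 have "ds {y:C. EX x:A. y = f x}"
  by (rule ds_Collect[OF ds_C], rule D_bex[OF assms(1)], rule D_eq[OF T_var T_comp[OF assms(2) T_var]])
 moreover have "{y:C. EX x:A. y = f x} = f ` A" using fc AC by auto
 ultimately show ?thesis by simp
qed

lemma dim_ge: "ds X==>-1<=dim X"
 using dim_empty dim_nonneg[of X] unfolding ds_def by (cases "X = {}") auto

lemma dim_pos: "ds X==>X~={}==>0<=dim X"
 using dim_nonneg unfolding ds_def by blast

lemma dim_mono: "ds X==>ds Y==>X<=Y==>dim X<=dim Y"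
 using dim_mono0 unfolding ds_def by blast

lemma dim_Un: "ds X==>ds Y==>dim (X Un Y) = max (dim X) (dim Y)"
 using dim_Un0 unfolding ds_def by blast

lemma dim_less_Un: "ds X==>ds Y==>dim X<d==>dim Y<d==>dim (X Un Y)<d"
 using dim_Un by simp

lemma dim_finite: assumes "finite X" "X<=C" shows "ds X & dim X<=0"
 using assms
proof (induction X)
 case empty thus ?case using ds_empty dim_empty by simp
next
 case (insert x X)
 hence "ds ({x} Un X)" "dim ({x} Un X)<=0" using ds_Un[OF ds_single] dim_Un[OF ds_single] dim_single by auto
 thus ?case by simp
qed

lemma dim_UN: assumes "finite I" "!!i. i:I==>ds (A i) & dim (A i)<=d" "-1<=d" shows "ds (UN i:I. A i) & dim (UN i:I. A i)<=d"
 using assms(1,2)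
proof (induction I)
 case empty thus ?case using ds_empty dim_empty assms(3) by simp
next
 case (insert x I)
 thus ?case using ds_Un[of "A x" "UN i:I. A i"] dim_Un[of "A x" "UN i:I. A i"] by auto
qed

lemma double_count:
 assumes "D (%e. R (e 0) (e 1))" "ds X" "ds Y" "X~={}" "0<=a"
  "!!x. x:X==>a<=dim {y:Y. R x y}" "!!y. y:Y==>dim {x:X. R x y}<=b"
 shows "dim X + a<=dim Y + b"
 using double0[OF assms(1) _ _ _ _ assms(4,5,6,7)] assms(2,3) unfolding ds_def by blast

lemma D_fun: "T (%e. f (e 0))==>D (%e. e 1 = f (e 0))"
 by (rule D_eq[OF T_var T_comp[OF _ T_var]])

lemma dim_inj_le: assumes "ds X" "ds Y" "T (%e. f (e 0))" "f ` X<=Y" "inj_on f X" shows "dim X<=dim Y"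
proof (cases "X = {}")
 case True thus ?thesis using dim_empty dim_ge[OF assms(2)] by simp
next
 case False
 have "dim X + 0<=dim Y + 0"
 proof (rule double_count[OF D_fun[OF assms(3)] assms(1,2) False])
  fix x assume x: "x:X"
  hence "{y:Y. y = f x} = {f x}" "f x:C" using assms(2,4) unfolding ds_def by auto
  thus "0<=dim {y:Y. y = f x}" using dim_single by simp
 next
  fix y assume "y:Y"
  have "finite {x:X. y = f x}"
  proof (cases "EX x:X. y = f x")
   case True
   then obtain x where "x:X" "y = f x" by blast
   hence "{x:X. y = f x}<={x}" using assms(5) unfolding inj_on_def by auto
   thus ?thesis using finite_subset by blast
  next
   case False hence "{x:X. y = f x} = {}" by blast
   thus ?thesis by (metis finite.emptyI)
  qed
  thus "dim {x:X. y = f x}<=0" using dim_finite[of "{x:X. y = f x}"] assms(1) unfolding ds_def by auto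
 qed simp
 thus ?thesis by simp
qed

lemma l_cancel_inv: "x:C==>y:C==>inv x ** (x ** y) = y" and r_cancel_inv: "x:C==>y:C==>x ** (inv x ** y) = y"
 by (simp_all add: m_assoc[symmetric])

lemmas gsimps = m_assoc inv_mult_group l_cancel_inv r_cancel_inv

definition cj :: "'b => 'b => 'b" where "cj g x = g ** x ** inv g"
definition cm :: "'b => 'b => 'b" where "cm x y = x ** y ** inv x ** inv y"

lemma cj_closed[simp]: "g:C==>x:C==>cj g x:C" by (simp add: cj_def)
lemma cm_closed[simp]: "g:C==>x:C==>cm g x:C" by (simp add: cm_def)
lemma cj_cj: "g:C==>h:C==>x:C==>cj g (cj h x) = cj (g ** h) x" by (simp add: cj_def gsimps)
lemma cj_one[simp]: "x:C==>cj \<one> x = x" "g:C==>cj g \<one> = \<one>" by (simp_all add: cj_def)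
lemma cj_mult: "g:C==>x:C==>y:C==>cj g (x ** y) = cj g x ** cj g y" by (simp add: cj_def gsimps)
lemma cj_inv: "g:C==>x:C==>cj g (inv x) = inv (cj g x)" by (simp add: cj_def gsimps)
lemma cj_inv_cj[simp]: "g:C==>x:C==>cj (inv g) (cj g x) = x" "g:C==>x:C==>cj g (cj (inv g) x) = x" by (simp_all add: cj_cj)
lemma cj_cm: "g:C==>x:C==>y:C==>cj g (cm x y) = cm (cj g x) (cj g y)" by (simp add: cj_def cm_def gsimps)
lemma cm_cj: "x:C==>y:C==>cm x y = cj x y ** inv y" by (simp add: cj_def cm_def)
lemma cj_eq_cm: "x:C==>y:C==>cj x y = cm x y ** y" by (simp add: cj_def cm_def gsimps)
lemma cm_mult: "x:C==>y:C==>g:C==>cm (x ** y) g = cj x (cm y g) ** cm x g" by (simp add: cj_def cm_def gsimps)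
lemma cm_inv: "x:C==>g:C==>cm (inv x) g = cj (inv x) (inv (cm x g))" by (simp add: cj_def cm_def gsimps)
lemma cm_inverse: "x:C==>y:C==>inv (cm x y) = cm y x" by (simp add: cm_def gsimps)
lemma cm_eq_one: "x:C==>y:C==>cm x y = \<one> <-> x ** y = y ** x"
proof -
 assume h: "x:C" "y:C"
 have "x ** y = cm x y ** (y ** x)" using h by (simp add: cm_def gsimps)
 thus ?thesis using h by (metis cm_closed l_one m_closed r_cancel_one')
qed
lemma cj_fix: "x:C==>y:C==>cj x y = y <-> x ** y = y ** x"
 using cm_cj cm_eq_one by (metis cj_closed inv_closed inv_equality inv_inv r_inv)
lemma cj_inj: "g:C==>inj_on (cj g) C" by (rule inj_on_inverseI[of _ "cj (inv g)"]) simp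
lemma T_cj: "T s==>T t==>T (%e. cj (s e) (t e))" unfolding cj_def by (intro T_mult T_inv)
lemma T_cm: "T s==>T t==>T (%e. cm (s e) (t e))" unfolding cm_def by (intro T_mult T_inv)

lemma dsub_C: "dsub C" unfolding dsub_def using ds_C subgroup_self by blast
lemma dsubD: assumes "dsub H" shows "subgroup H G" "ds H" "H<=C" "\<one>:H"
 "!!x y. x:H==>y:H==>x ** y:H" "!!x. x:H==>inv x:H"
proof -
 show s: "subgroup H G" "ds H" using assms unfolding dsub_def by auto
 show "H<=C" "\<one>:H" using subgroup.subset[OF s(1)] subgroup.one_closed[OF s(1)] by auto
 fix x assume "x:H"
 thus "inv x:H" by (rule subgroup.m_inv_closed[OF s(1)])
 fix y assume "y:H"
 with \<open>x:H\<close> show "x ** y:H" by (rule subgroup.m_closed[OF s(1)])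
qed
lemma dsub_dim: "dsub H==>0<=dim H" using dim_pos dsubD by (metis empty_iff)
lemma dsubI: "ds H==>\<one>:H==>(!!x y. x:H==>y:H==>x ** y:H)==>(!!x. x:H==>inv x:H)==>dsub H"
 unfolding dsub_def ds_def by (auto intro!: subgroupI)
lemma dsub_Int: "dsub A==>dsub B==>dsub (A Int B)"
 using dsubD by (intro dsubI ds_Int) auto
lemma dsub_one: "dsub {\<one>}" by (rule dsubI) (auto simp: ds_single)

lemma dim_translate: assumes "ds X" "g:C" shows "ds ((%k. g ** k) ` X)" "dim ((%k. g ** k) ` X) = dim X"
proof -
 have XC: "X<=C" using assms unfolding ds_def by blast
 have t: "T (%e. h ** e 0)" if "h:C" for h by (intro T_mult T_const T_var that)
 show 1: "ds ((%k. g ** k) ` X)" by (rule ds_image[OF assms(1) t[OF assms(2)]])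
 have "dim X<=dim ((%k. g ** k) ` X)"
  by (rule dim_inj_le[OF assms(1) 1 t[OF assms(2)]]) (use XC assms in "auto simp: inj_on_def subset_iff")
 moreover have "dim ((%k. g ** k) ` X)<=dim X"
  by (rule dim_inj_le[OF 1 assms(1) t[of "inv g"]]) (use XC assms in "auto simp: inj_on_def subset_iff l_cancel_inv")
 ultimately show "dim ((%k. g ** k) ` X) = dim X" by simp
qed

lemma dim_cj: assumes "ds X" "g:C" shows "ds (cj g ` X)" "dim (cj g ` X) = dim X"
proof -
 have XC: "X<=C" using assms unfolding ds_def by blast
 have t: "T (%e. cj h (e 0))" if "h:C" for h by (intro T_cj T_const T_var that)
 show 1: "ds (cj g ` X)" by (rule ds_image[OF assms(1) t[OF assms(2)]])
 have "dim X<=dim (cj g ` X)"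
  by (rule dim_inj_le[OF assms(1) 1 t[OF assms(2)]]) (use inj_on_subset[OF cj_inj[OF assms(2)] XC] in auto)
 moreover have "dim (cj g ` X)<=dim X"
 proof (rule dim_inj_le[OF 1 assms(1) t[of "inv g"]])
  show "cj (inv g) ` cj g ` X<=X" using XC assms by (auto simp: subset_iff)
  show "inj_on (cj (inv g)) (cj g ` X)" by (rule inj_on_subset[OF cj_inj]) (use XC assms in "auto simp: subset_iff")
 qed (use assms in simp)
 ultimately show "dim (cj g ` X) = dim X" by simp
qed

lemma dsub_cj: assumes "dsub H" "g:C" shows "dsub (cj g ` H)"
proof (rule dsubI)
 note d = dsubD[OF assms(1)]
 show "ds (cj g ` H)" using dim_cj d assms by blast
 show "\<one>:cj g ` H" using d assms by (metis cj_one(2) image_eqI)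
 fix x assume x: "x:cj g ` H"
 then obtain a where a: "a:H" "x = cj g a" by blast
 have ac: "a:C" using a d(3) by blast
 have "inv x = cj g (inv a)" using a cj_inv[OF assms(2) ac] by simp
 thus "inv x:cj g ` H" using a d by blast
 fix y assume "y:cj g ` H"
 then obtain b where b: "b:H" "y = cj g b" by blast
 have bc: "b:C" using b d(3) by blast
 have "x ** y = cj g (a ** b)" using a b cj_mult[OF assms(2) ac bc] by simp
 thus "x ** y:cj g ` H" using a b d by blast
qed

definition mp :: "'b set => 'b set => 'b set" where "mp A B = {x:C. EX a:A. EX b:B. x = a ** b}"

lemma mpI: "a:A==>b:B==>A<=C==>B<=C==>a ** b:mp A B" unfolding mp_def by blast
lemma ds_mp: "ds A==>ds B==>ds (mp A B)" unfolding mp_def by (rule ds_Collect[OF ds_C]) (intro Dr)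
lemma mp_sub: assumes "dsub A" "dsub B" shows "A<=mp A B" "B<=mp A B"
proof -
 note a = dsubD[OF assms(1)] and b = dsubD[OF assms(2)]
 show "A<=mp A B"
 proof
  fix x assume "x:A" thus "x:mp A B" using mpI[of x A \<one> B] a b by auto
 qed
 show "B<=mp A B"
 proof
  fix x assume "x:B" thus "x:mp A B" using mpI[of \<one> A x B] a b by auto
 qed
qed
lemma mp_least: "dsub L==>A<=L==>B<=L==>mp A B<=L" unfolding mp_def using dsubD by blast

text \<open>The product set need not be a subgroup. Two double counts along multiplication give the
  formula: the fibres are translates of \<open>A Int B\<close> over the product and of
  \<open>B\<close> over \<open>A\<close>.\<close>

lemma dim_mp: assumes "dsub A" "dsub B" shows "dim (mp A B) + dim (A Int B) = dim A + dim B"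
proof -
 note a = dsubD[OF assms(1)] and b = dsubD[OF assms(2)]
 have M: "ds (mp A B)" by (rule ds_mp[OF a(2) b(2)])
 have I: "ds (A Int B)" by (rule ds_Int[OF a(2) b(2)])
 have R: "D (%e. inv (e 1) ** e 0:B)" "D (%e. inv (e 0) ** e 1:B)" by (rule D_mem[OF b(2)], intro Dr)+
 have 1: "dim {y:A. inv y ** x:B} = dim (A Int B)" if x: "x:mp A B" for x
 proof -
  obtain a0 b0 where ab: "a0:A" "b0:B" "x = a0 ** b0" using x unfolding mp_def by blast
  have c: "a0:C" "b0:C" using ab a b by auto
  have "{y:A. inv y ** x:B} = (%k. a0 ** k) ` (A Int B)"
  proof (intro Set.set_eqI iffI)
   fix y assume y: "y:{y:A. inv y ** x:B}"
   hence yc: "y:C" "y:A" using a by auto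
   have "b0 ** inv (inv y ** x):B" using y ab b by blast
   moreover have "b0 ** inv (inv y ** x) = inv a0 ** y" using ab c yc by (simp add: gsimps)
   ultimately have "inv a0 ** y:A Int B" using yc ab a by auto
   moreover have "y = a0 ** (inv a0 ** y)" using c yc by (simp add: gsimps)
   ultimately show "y:(%k. a0 ** k) ` (A Int B)" by blast
  next
   fix y assume "y:(%k. a0 ** k) ` (A Int B)"
   then obtain k where k: "k:A" "k:B" "y = a0 ** k" by blast
   have kc: "k:C" using k a by blast
   have "inv y ** x = inv k ** b0" using k ab c kc by (simp add: gsimps)
   thus "y:{y:A. inv y ** x:B}" using k ab a b by auto
  qed
  thus ?thesis using dim_translate(2)[OF I c(1)] by simp
 qed
 have 2: "dim {x:mp A B. inv y ** x:B} = dim B" if y: "y:A" for y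
 proof -
  have c: "y:C" using y a by blast
  have "{x:mp A B. inv y ** x:B} = (%k. y ** k) ` B"
  proof (intro Set.set_eqI iffI)
   fix x assume x: "x:{x:mp A B. inv y ** x:B}"
   hence "x:C" unfolding mp_def by blast
   hence "x = y ** (inv y ** x)" using c by (simp add: gsimps)
   thus "x:(%k. y ** k) ` B" using x by blast
  next
   fix x assume "x:(%k. y ** k) ` B"
   then obtain k where k: "k:B" "x = y ** k" by blast
   hence "inv y ** x = k" using c b by (simp add: gsimps subset_iff)
   thus "x:{x:mp A B. inv y ** x:B}" using k y mpI[of y A k B] a b by auto
  qed
  thus ?thesis using dim_translate(2)[OF b(2) c] by simp
 qed
 have ne: "mp A B~={}" "A~={}" using mp_sub[OF assms] a by auto
 have "dim (mp A B) + dim (A Int B)<=dim A + dim B"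
  by (rule double_count[OF R(1) M a(2) ne(1)]) (use 1 2 dsub_dim[OF dsub_Int[OF assms]] in simp_all)
 moreover have "dim A + dim B<=dim (mp A B) + dim (A Int B)"
  by (rule double_count[OF R(2) a(2) M ne(2)]) (use 1 2 dsub_dim[OF assms(2)] in simp_all)
 ultimately show ?thesis by simp
qed

text \<open>Definable connectedness phrased by dimension. By \<open>finite_index_dim\<close>
  equality of dimension is the same as finite index, so this is the usual notion.\<close>

definition conn :: "'b set => bool" where
 "conn H <-> dsub H & (ALL K. dsub K & K<=H & dim K = dim H --> K = H)"

abbreviation "lcosets K H == (%h. (%k. h ** k) ` K) ` H"

lemma lcoset_mem: assumes "dsub K" "h:C" "h':C" shows "(%k. h ** k) ` K = (%k. h' ** k) ` K <-> inv h ** h':K"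
proof
 note d = dsubD[OF assms(1)]
 assume "(%k. h ** k) ` K = (%k. h' ** k) ` K"
 moreover have "h' ** \<one>:(%k. h' ** k) ` K" using d by blast
 ultimately obtain k where "k:K" "h' = h ** k" using assms by auto
 thus "inv h ** h':K" using d assms by (auto simp: gsimps subset_iff)
next
 note d = dsubD[OF assms(1)]
 assume k: "inv h ** h':K"
 have e: "h' = h ** (inv h ** h')" "h = h' ** inv (inv h ** h')" using assms by (simp_all add: gsimps)
 show "(%k. h ** k) ` K = (%k. h' ** k) ` K"
 proof (intro Set.set_eqI iffI)
  fix x assume "x:(%k. h ** k) ` K"
  then obtain l where l: "l:K" "x = h ** l" by blast
  hence "x = h' ** (inv (inv h ** h') ** l)" using assms d by (simp add: gsimps subset_iff)
  thus "x:(%k. h' ** k) ` K" using d k l by blast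
 next
  fix x assume "x:(%k. h' ** k) ` K"
  then obtain l where l: "l:K" "x = h' ** l" by blast
  hence "x = h ** ((inv h ** h') ** l)" using assms d by (simp add: gsimps subset_iff)
  thus "x:(%k. h ** k) ` K" using d k l by blast
 qed
qed

lemma index: assumes "dsub H" shows "EX N. ALL K. dsub K & K<=H & dim K = dim H --> finite (lcosets K H) & card (lcosets K H)<=N"
 using index0[of H] assms unfolding dsub_def ds_def by blast

text \<open>A proper subgroup of \<open>K\<close> splits the coset \<open>K\<close> itself, so the
  number of cosets strictly grows. With its uniform bound this measures descent among subgroups of
  equal dimension.\<close>

lemma lcosets_card_less:
 assumes K: "dsub K" and M: "dsub M" and MK: "M \<subset> K" and KH: "K<=H" and H: "dsub H" and f: "finite (lcosets M H)"
 shows "card (lcosets K H)<card (lcosets M H)"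
proof -
 note h = dsubD[OF H]
 define f where "f X = mp X K" for X
 have im: "f ((%k. h ** k) ` M) = (%k. h ** k) ` K" if hh: "h:H" for h
 proof (intro Set.set_eqI iffI)
  fix x assume "x:f ((%k. h ** k) ` M)"
  then obtain m k where mk: "m:M" "k:K" "x = h ** m ** k" unfolding f_def mp_def by blast
  hence "x = h ** (m ** k)" "m ** k:K" using hh h dsubD[OF K] dsubD[OF M] MK by (auto simp: m_assoc subset_iff)
  thus "x:(%k. h ** k) ` K" by blast
 next
  fix x assume "x:(%k. h ** k) ` K"
  then obtain k where k: "k:K" "x = h ** k" by blast
  have hc: "h:C" using hh h by blast
  have "h ** \<one>:(%k. h ** k) ` M" using dsubD(4)[OF M] by blast
  hence "h ** \<one> ** k:f ((%k. h ** k) ` M)" unfolding f_def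
   by (rule mpI) (use k hc dsubD(3)[OF K] dsubD(3)[OF M] in auto)
  thus "x:f ((%k. h ** k) ` M)" using k hc by simp
 qed
 hence surj: "lcosets K H = f ` lcosets M H" by (auto simp: image_iff)
 obtain k where k: "k:K" "k~:M" using MK by blast
 have kc: "k:C" "k:H" using k KH h by auto
 let ?A = "(%x. \<one> ** x) ` M" and ?B = "(%x. k ** x) ` M"
 have AB: "?A:lcosets M H" "?B:lcosets M H" using h kc by blast+
 have "?A~=?B" using lcoset_mem[OF M one_closed kc(1)] k kc by simp
 moreover have "f ?A = f ?B"
  using im[OF h(4)] im[OF kc(2)] lcoset_mem[OF K one_closed kc(1)] k kc by simp
 ultimately have "~inj_on f (lcosets M H)" using AB unfolding inj_on_def by blast
 hence "card (f ` lcosets M H)~=card (lcosets M H)" using f eq_card_imp_inj_on by blast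
 thus ?thesis using surj card_image_le[OF f, of f] by simp
qed

text \<open>Descending chain condition: dimension first, then the number of cosets.\<close>

lemma least_dsub:
 assumes ne: "K0:FF" and ds: "!!K. K:FF==>dsub K" and int: "!!K L. K:FF==>L:FF==>K Int L:FF"
 shows "EX K:FF. ALL L:FF. K<=L"
proof -
 \<comment> \<open>All members below \<open>H\<close> have the dimension of \<open>H\<close>, which
   makes their numbers of cosets in \<open>H\<close> bounded.\<close>
 obtain H where H: "H:FF" "!!K. K:FF==>nat (dim H)<=nat (dim K)"
  using ex_has_least_nat[of "%K. K:FF" K0 "%K. nat (dim K)"] ne by blast
 have dH: "dsub H" using ds H by blast
 have eq: "dim K = dim H" if "K:FF" "K<=H" for K
 proof -
  have "dim K<=dim H" using that ds dH dim_mono dsubD(2) by blast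
  moreover have "dim H<=dim K" using H(2)[OF that(1)] dsub_dim[OF ds[OF that(1)]] dsub_dim[OF dH] by linarith
  ultimately show ?thesis by simp
 qed
 obtain N where N: "!!K. dsub K==>K<=H==>dim K = dim H==>finite (lcosets K H) & card (lcosets K H)<=N"
  using index[OF dH] by blast
 have b: "ALL K. K:FF & K<=H --> card (lcosets K H)<Suc N" using N ds eq by (simp add: less_Suc_eq_le)
 obtain K where K: "K:FF & K<=H" "ALL L. L:FF & L<=H --> card (lcosets L H)<=card (lcosets K H)"
  using ex_has_greatest_nat[of "%K. K:FF & K<=H" H "%K. card (lcosets K H)" "Suc N"] b H(1) by (auto intro: less_imp_le)
 have "K<=L" if L: "L:FF" for L
 proof (rule ccontr)
  assume "~K<=L"
  hence M: "K Int L \<subset> K" "K Int L:FF" "K Int L<=H" using int K L by blast+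
  have "card (lcosets K H)<card (lcosets (K Int L) H)"
   by (rule lcosets_card_less[OF _ _ M(1) _ dH]) (use K M ds N eq in auto)
  thus False using K(2) M by (meson leD)
 qed
 thus ?thesis using K by blast
qed

definition hull :: "'b set => 'b set" where
 "hull X = (SOME K. dsub K & X<=K & (ALL L. dsub L & X<=L --> K<=L))"

lemma hull: assumes "X<=C" shows "dsub (hull X)" "X<=hull X" "!!L. dsub L==>X<=L==>hull X<=L"
proof -
 have "EX K:{K. dsub K & X<=K}. ALL L:{K. dsub K & X<=K}. K<=L"
  by (rule least_dsub[of C]) (use assms dsub_C dsub_Int in auto)
 hence "EX K. dsub K & X<=K & (ALL L. dsub L & X<=L --> K<=L)" by blast
 from someI_ex[OF this] show "dsub (hull X)" "X<=hull X" "!!L. dsub L==>X<=L==>hull X<=L"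
  unfolding hull_def by blast+
qed

text \<open>The product of \<open>K\<close> with a full-dimensional subgroup cannot exceed
  \<open>dim H\<close>, so \<open>dim_mp\<close> leaves no loss for the intersection.\<close>

lemma dim_Int_full:
 assumes "dsub H" "dsub K" "dsub L" "K<=H" "L<=H" "dim L = dim H" shows "dim (K Int L) = dim K"
proof -
 have "dim (mp K L)<=dim H" using mp_least[OF assms(1,4,5)] ds_mp dsubD(2) assms dim_mono by blast
 moreover have "dim (K Int L)<=dim K" using dsub_Int assms dsubD(2) dim_mono by (metis Int_lower1)
 ultimately show ?thesis using dim_mp[OF assms(2,3)] assms(6) by linarith
qed

text \<open>The definably connected component of the identity.\<close>

definition cc :: "'b set => 'b set" where
 "cc H = (SOME K. dsub K & K<=H & dim K = dim H & (ALL L. dsub L & L<=H & dim L = dim H --> K<=L))"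

lemma cc: assumes H: "dsub H"
 shows "conn (cc H)" "cc H<=H" "dim (cc H) = dim H" "!!L. dsub L==>L<=H==>dim L = dim H==>cc H<=L"
proof -
 have "EX K:{K. dsub K & K<=H & dim K = dim H}. ALL L:{K. dsub K & K<=H & dim K = dim H}. K<=L"
  by (rule least_dsub[of H]) (use H dsub_Int dim_Int_full[OF H] in auto)
 hence "EX K. dsub K & K<=H & dim K = dim H & (ALL L. dsub L & L<=H & dim L = dim H --> K<=L)" by blast
 from someI_ex[OF this] have *: "dsub (cc H)" "cc H<=H" "dim (cc H) = dim H" "!!L. dsub L==>L<=H==>dim L = dim H==>cc H<=L"
  unfolding cc_def by blast+
 show "cc H<=H" "dim (cc H) = dim H" "!!L. dsub L==>L<=H==>dim L = dim H==>cc H<=L" by (fact *)+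
 show "conn (cc H)" unfolding conn_def using * by (metis subset_antisym subset_trans)
qed

lemma conn_dsub: "conn H==>dsub H" unfolding conn_def by blast
lemma connD: "conn H==>dsub K==>K<=H==>dim K = dim H==>K = H" unfolding conn_def by blast
lemma conn_dim_less: "conn H==>dsub K==>K<=H==>K~=H==>dim K<dim H"
 using connD[of H K] dim_mono[of K H] dsubD(2) conn_dsub by (metis order_le_imp_less_or_eq)

lemma conn_sub_cc: assumes "conn K" "dsub H" "K<=H" shows "K<=cc H"
proof -
 have "dim (K Int cc H) = dim K"
  using dim_Int_full[OF assms(2) conn_dsub[OF assms(1)] conn_dsub[OF cc(1)[OF assms(2)]]] cc[OF assms(2)] assms by blast
 hence "K Int cc H = K"
  using connD[OF assms(1) dsub_Int] conn_dsub assms cc(1) by blast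
 thus ?thesis by blast
qed

lemma conn_cj: assumes "conn H" "g:C" shows "conn (cj g ` H)"
 unfolding conn_def
proof (intro conjI allI impI)
 have H: "dsub H" using assms conn_dsub by blast
 show d: "dsub (cj g ` H)" using dsub_cj[OF H assms(2)] .
 fix K assume K: "dsub K & K<=cj g ` H & dim K = dim (cj g ` H)"
 have sub: "cj (inv g) ` K<=H"
 proof
  fix x assume "x:cj (inv g) ` K"
  then obtain h where "h:H" "x = cj (inv g) (cj g h)" using K by blast
  thus "x:H" using dsubD(3)[OF H] assms by auto
 qed
 have "cj (inv g) ` K = H"
  using connD[OF assms(1) dsub_cj[of K "inv g"] sub] K assms dim_cj dsubD(2) H by (metis inv_closed)
 moreover have "cj g ` cj (inv g) ` K = K" using K dsubD(3) assms(2) by (force simp: image_iff)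
 ultimately show "K = cj g ` H" by simp
qed

lemma cc_cj: assumes "dsub H" "g:C" "cj g ` H<=H" shows "cc H<=cj g ` cc H"
proof (rule cc(4)[OF assms(1)])
 show "dsub (cj g ` cc H)" using dsub_cj conn_dsub cc(1) assms by blast
 show "cj g ` cc H<=H" using cc(2)[OF assms(1)] assms(3) by blast
 show "dim (cj g ` cc H) = dim H" using dim_cj(2) cc[OF assms(1)] dsubD(2) conn_dsub assms by metis
qed

definition nm :: "'b set => 'b set => bool" where "nm K N <-> (ALL k:K. ALL x:N. cj k x:N)"

lemma nm_cc: assumes H: "dsub H" and K: "subgroup K G" and nm: "nm K H" shows "nm K (cc H)"
 unfolding nm_def
proof (intro ballI)
 fix k x assume k: "k:K" and x: "x:cc H"
 have kc: "k:C" "inv k:C" "inv k:K" using subgroup.mem_carrier[OF K k] subgroup.m_inv_closed[OF K k] by simp_all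
 have "cj (inv k) ` H<=H" using nm kc unfolding nm_def by blast
 hence "x:cj (inv k) ` cc H" using cc_cj[OF H kc(2)] x by blast
 then obtain y where "y:cc H" "x = cj (inv k) y" by blast
 thus "cj k x:cc H" using kc dsubD(3)[OF conn_dsub[OF cc(1)[OF H]]] by auto
qed

lemma mp_dsub: assumes A: "dsub A" and B: "dsub B" and nm: "nm A B" shows "dsub (mp A B)"
proof (rule dsubI)
 note a = dsubD[OF A] and b = dsubD[OF B]
 show "ds (mp A B)" by (rule ds_mp[OF a(2) b(2)])
 show "\<one>:mp A B" using mp_sub[OF A B] a by blast
 fix x assume "x:mp A B"
 then obtain a1 b1 where x: "a1:A" "b1:B" "x = a1 ** b1" unfolding mp_def by blast
 have xc: "a1:C" "b1:C" using x a b by auto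
 have "inv x = inv a1 ** cj a1 (inv b1)" using x xc by (simp add: cj_def gsimps)
 moreover have "cj a1 (inv b1):B" using nm x b unfolding nm_def by blast
 ultimately show "inv x:mp A B" using mpI[of "inv a1" A "cj a1 (inv b1)" B] x a b by auto
 fix y assume "y:mp A B"
 then obtain a2 b2 where y: "a2:A" "b2:B" "y = a2 ** b2" unfolding mp_def by blast
 have yc: "a2:C" "b2:C" using y a b by auto
 have "x ** y = (a1 ** a2) ** (cj (inv a2) b1 ** b2)" using x y xc yc by (simp add: cj_def gsimps)
 moreover have "cj (inv a2) b1:B" using nm x y a unfolding nm_def by blast
 ultimately show "x ** y:mp A B" using mpI[of "a1 ** a2" A "cj (inv a2) b1 ** b2" B] x y a b by auto
qed

lemma conn_mp: assumes "conn A" "conn B" "nm A B" shows "conn (mp A B)"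
proof -
 have d: "dsub (mp A B)" using mp_dsub conn_dsub assms by blast
 note m = mp_sub[OF conn_dsub[OF assms(1)] conn_dsub[OF assms(2)]]
 have "A<=cc (mp A B)" "B<=cc (mp A B)" using conn_sub_cc[OF assms(1) d m(1)] conn_sub_cc[OF assms(2) d m(2)] .
 hence "mp A B<=cc (mp A B)" using mp_least conn_dsub[OF cc(1)[OF d]] by blast
 hence "cc (mp A B) = mp A B" using cc(2)[OF d] by blast
 thus ?thesis using cc(1)[OF d] by simp
qed

text \<open>All fibres of a homomorphism are translates of the kernel, whence the dimension formula.
  The image of a connected group is connected because the preimage of a full-dimensional subgroup of
  the image has full dimension.\<close>

lemma hom_facts:
 assumes H: "dsub H" and f: "T (%e. f (e 0))" and hom: "!!x y. x:H==>y:H==>f (x ** y) = f x ** f y"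
 shows "dsub (f ` H)" "dsub {x:H. f x = \<one>}" "dim H = dim {x:H. f x = \<one>} + dim (f ` H)" "conn H==>conn (f ` H)"
proof -
 note h = dsubD[OF H]
 have fc: "f x:C" if "x:C" for x using f that unfolding T_def by (auto dest: spec[of _ "%_. x"])
 have fh: "f x:C" if "x:H" for x using fc h that by blast
 have f1: "f \<one> = \<one>" using hom[OF h(4,4)] fc[OF one_closed] by (simp add: r_cancel_one')
 have fi: "f (inv x) = inv (f x)" if "x:H" for x
 proof -
  have "f (inv x) ** f x = \<one>" using hom[of "inv x" x] h that f1 by (metis l_inv subsetD)
  thus ?thesis using inv_equality fh h that by metis
 qed
 have preim: "dsub {x:H. f x:L}" if L: "dsub L" for L
 proof (rule dsubI)
  note l = dsubD[OF L]
  show "ds {x:H. f x:L}" by (rule ds_Collect[OF h(2)], rule D_mem[OF l(2) f])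
 qed (use h f1 fi hom dsubD[OF L] in auto)
 show im: "dsub (f ` H)"
 proof (rule dsubI)
  show "ds (f ` H)" by (rule ds_image[OF h(2) f])
  show "\<one>:f ` H" using f1 h by (metis image_eqI)
  fix x assume "x:f ` H"
  then obtain a where a: "a:H" "x = f a" by blast
  thus "inv x:f ` H" using fi h by (metis image_eqI)
  fix y assume "y:f ` H"
  then obtain b where "b:H" "y = f b" by blast
  thus "x ** y:f ` H" using a hom h by (metis image_eqI)
 qed
 have "{x:H. f x = \<one>} = {x:H. f x:{\<one>}}" by auto
 thus ker: "dsub {x:H. f x = \<one>}" using preim[OF dsub_one] by simp
 have fibre: "dim {x:H. y = f x} = dim {x:H. f x = \<one>}" if y: "y:f ` H" for y
 proof -
  obtain x0 where x0: "x0:H" "y = f x0" using y by blast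
  have "{x:H. y = f x} = (%k. x0 ** k) ` {x:H. f x = \<one>}"
  proof (intro Set.set_eqI iffI)
   fix x assume x: "x:{x:H. y = f x}"
   have "f (inv x0 ** x) = \<one>" using hom[of "inv x0" x] fi x x0 h fh by (metis (mono_tags, lifting) l_inv mem_Collect_eq)
   moreover have "x = x0 ** (inv x0 ** x)" using x x0 h by (simp add: gsimps subset_iff)
   moreover have "inv x0 ** x:H" using x x0 h by blast
   ultimately show "x:(%k. x0 ** k) ` {x:H. f x = \<one>}" by blast
  next
   fix x assume "x:(%k. x0 ** k) ` {x:H. f x = \<one>}"
   then obtain k where k: "k:H" "f k = \<one>" "x = x0 ** k" by blast
   thus "x:{x:H. y = f x}" using hom[of x0 k] x0 h fh by auto
  qed
  thus ?thesis using dim_translate(2)[OF dsubD(2)[OF ker], of x0] x0 h by auto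
 qed
 have R: "D (%e. e 1 = f (e 0))" "D (%e. e 0 = f (e 1))" by (rule D_eq[OF T_var T_comp[OF f T_var]])+
 have dims: "dim {x:H. f x:L} = dim {x:H. f x = \<one>} + dim L" if L: "dsub L" "L<=f ` H" for L
 proof -
  let ?P = "{x:H. f x:L}"
  note P = dsubD[OF preim[OF L(1)]] and l = dsubD[OF L(1)]
  have one: "dim {y:L. y = f x} = 0" if "x:?P" for x
  proof -
   have "{y:L. y = f x} = {f x}" using that by auto
   thus ?thesis using dim_single fh that by simp
  qed
  have fb: "dim {x:?P. y = f x} = dim {x:H. f x = \<one>}" if "y:L" for y
  proof -
   have "{x:?P. y = f x} = {x:H. y = f x}" using that by auto
   thus ?thesis using fibre that L by auto
  qed
  have "dim ?P + 0<=dim L + dim {x:H. f x = \<one>}"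
   by (rule double_count[OF R(1) P(2) l(2)]) (use one fb P(4) in auto)
  moreover have "dim L + dim {x:H. f x = \<one>}<=dim ?P + 0"
   by (rule double_count[OF R(2) l(2) P(2)]) (use one fb l(4) dsub_dim[OF ker] in auto)
  ultimately show ?thesis by simp
 qed
 have "{x:H. f x:f ` H} = H" by blast
 thus dimH: "dim H = dim {x:H. f x = \<one>} + dim (f ` H)" using dims[OF im order_refl] by simp
 assume cH: "conn H"
 show "conn (f ` H)" unfolding conn_def
 proof (intro conjI allI impI im)
  fix L assume L: "dsub L & L<=f ` H & dim L = dim (f ` H)"
  hence "{x:H. f x:L} = H" using connD[OF cH preim] dims dimH by auto
  thus "L = f ` H" using L by blast
 qed
qed

end

context ranked_group
begin

subsection \<open>Relative upper central series\<close>

text \<open>For \<open>N\<close> normal in \<open>K\<close> this is the preimage of the i-th term of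
  the upper central series of \<open>K/N\<close>, and \<open>nilm K N\<close> says that
  \<open>K/N\<close> is nilpotent. Working with preimages avoids forming the quotient.\<close>

primrec U :: "'b set => 'b set => nat => 'b set" where
 "U K N 0 = N"
| "U K N (Suc i) = {x:K. ALL g:K. cm x g:U K N i}"

definition nilm :: "'b set => 'b set => bool" where "nilm K N <-> (EX i. K<=U K N i)"

lemma cm_split: "x:C==>g:C==>cm x g = x ** cj g (inv x)" by (simp add: cm_def cj_def gsimps)

lemma U_facts:
 assumes K: "dsub K" and N: "dsub N" "N<=K" "nm K N"
 shows "dsub (U K N i) & U K N i<=K & nm K (U K N i) & U K N i<=U K N (Suc i)"
proof -
 note k = dsubD[OF K]
 have up: "M<={x:K. ALL g:K. cm x g:M}" if M: "dsub M" "M<=K" "nm K M" for M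
 proof (intro subsetI CollectI conjI ballI)
  fix x g assume x: "x:M" and g: "g:K"
  have "x:C" "g:C" using x g M k by auto
  moreover have "cj g (inv x):M" using M x g dsubD(6)[OF M(1)] unfolding nm_def by blast
  ultimately show "cm x g:M" using x dsubD(5)[OF M(1)] cm_split by simp
 qed (use M in auto)
 have step: "dsub {x:K. ALL g:K. cm x g:M} & nm K {x:K. ALL g:K. cm x g:M}" if M: "dsub M" "M<=K" "nm K M" for M
 proof
  note m = dsubD[OF M(1)]
  let ?V = "{x:K. ALL g:K. cm x g:M}"
  show "dsub ?V"
  proof (rule dsubI)
   show "ds ?V" by (rule ds_Collect[OF k(2)], rule D_ball[OF k(2)], rule D_mem[OF m(2)], intro T_cm T_var)
   show "\<one>:?V" using up[OF M] m by blast
  next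
   fix x assume x: "x:?V"
   have xc: "x:C" using x k by auto
   show "inv x:?V"
   proof (intro CollectI conjI ballI)
    fix g assume g: "g:K"
    have "cj (inv x) (inv (cm x g)):M" using x g m M k unfolding nm_def by auto
    thus "cm (inv x) g:M" using cm_inv[OF xc] g k by auto
   qed (use x k in auto)
   fix y assume y: "y:?V"
   have yc: "y:C" using y k by auto
   show "x ** y:?V"
   proof (intro CollectI conjI ballI)
    fix g assume g: "g:K"
    have "cj x (cm y g):M" using x y g M unfolding nm_def by auto
    hence "cj x (cm y g) ** cm x g:M" using x g m by auto
    thus "cm (x ** y) g:M" using cm_mult[OF xc yc] g k by auto
   qed (use x y k in auto)
  qed
  show "nm K ?V" unfolding nm_def
  proof (intro ballI CollectI conjI)
   fix h x assume h: "h:K" and x: "x:?V"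
   have c: "h:C" "x:C" using h x k by auto
   show "cj h x:K" using h x k by (auto simp: cj_def)
   fix g assume g: "g:K"
   have gc: "g:C" using g k by auto
   have "cj (inv h) g:K" using h g k by (auto simp: cj_def)
   hence "cj h (cm x (cj (inv h) g)):M" using x h M unfolding nm_def by auto
   thus "cm (cj h x) g:M" using c gc by (simp add: cj_cm)
  qed
 qed
 show ?thesis
 proof (induction i)
  case 0 thus ?case using N up[OF N] by simp
 next
  case (Suc i)
  hence M: "dsub (U K N i)" "U K N i<=K" "nm K (U K N i)" by auto
  have M': "dsub (U K N (Suc i))" "U K N (Suc i)<=K" "nm K (U K N (Suc i))" using step[OF M] by auto
  thus ?case using up[OF M'] by auto
 qed
qed

lemma U_chain: assumes "dsub K" "dsub N" "N<=K" "nm K N" "i<=j" shows "U K N i<=U K N j"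
 using assms(5) by (induction rule: dec_induct) (use U_facts[OF assms(1-4)] in blast)+

lemma U_mono: "N<=M==>U K N i<=U K M i" by (induction i) auto

lemma U_add: "U K (U K N j) i = U K N (i + j)" by (induction i) auto

lemma U_sub: "dsub L==>L<=K==>U K N i Int L<=U L (N Int L) i"
proof (induction i)
 case (Suc i)
 note l = dsubD[OF Suc.prems(1)]
 show ?case
 proof
  fix x assume x: "x:U K N (Suc i) Int L"
  have "cm x g:U L (N Int L) i" if g: "g:L" for g
  proof -
   have "cm x g:L" using x g l unfolding cm_def by auto
   thus ?thesis using x g Suc by auto
  qed
  thus "x:U L (N Int L) (Suc i)" using x by auto
 qed
qed simp

lemma U_int: "U K N i Int U K M i<=U K (N Int M) i" by (induction i) auto

lemma nilm_mono: "nilm K N==>N<=M==>nilm K M" unfolding nilm_def using U_mono by blast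

lemma nilm_sub: "nilm K N==>dsub L==>L<=K==>nilm L (N Int L)" unfolding nilm_def using U_sub by blast

lemma nilm_int:
 assumes "dsub K" "dsub N" "N<=K" "nm K N" "dsub M" "M<=K" "nm K M" "nilm K N" "nilm K M" shows "nilm K (N Int M)"
proof -
 obtain i j where "K<=U K N i" "K<=U K M j" using assms unfolding nilm_def by blast
 hence "K<=U K N (max i j)" "K<=U K M (max i j)"
  using U_chain[OF assms(1-4), of i "max i j"] U_chain[OF assms(1,5-7), of j "max i j"] by auto
 thus ?thesis unfolding nilm_def using U_int by blast
qed

lemma nilm_trans: "nilm K N==>N<=U K M j==>nilm K M"
 unfolding nilm_def using U_mono[of N "U K M j" K] U_add by blast

text \<open>Take the first term of the series that leaves \<open>Q\<close>. Its elements have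
  commutators in \<open>Q\<close>, so they normalize \<open>Q\<close>: this gives the normalizer
  condition for nilpotent groups in the next lemmas.\<close>

lemma nilm_center:
 assumes K: "dsub K" and N: "dsub N" "N<=K" "nm K N" and Q: "N<=Q" "Q<=K" "Q~=K" and nil: "nilm K N"
 shows "EX i. EX x:U K N (Suc i). x~:Q & U K N i<=Q"
proof -
 obtain k where k: "K<=U K N k" using nil unfolding nilm_def by blast
 hence "~U K N k<=Q" using Q by blast
 then obtain m where m: "~U K N m<=Q" "!!i. i<m==>U K N i<=Q" using ex_least_nat_le[of "%i. ~U K N i<=Q"] by blast
 hence "m~=0" using Q by (cases m) auto
 then obtain i where "m = Suc i" using not0_implies_Suc by blast
 thus ?thesis using m by (intro exI[of _ i]) auto
qed

definition nrm :: "'b set => 'b set" where "nrm Q = {g:C. cj g ` Q = Q}"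

lemma nrm_iff: assumes "Q<=C" "g:C" shows "cj g ` Q = Q <-> (ALL x:Q. cj g x:Q) & (ALL x:Q. cj (inv g) x:Q)"
proof
 assume e: "cj g ` Q = Q"
 have "cj (inv g) x:Q" if xQ: "x:Q" for x
 proof -
  have "x:cj g ` Q" using e xQ by simp
  then obtain y where "y:Q" "x = cj g y" by blast
  thus ?thesis using assms by auto
 qed
 thus "(ALL x:Q. cj g x:Q) & (ALL x:Q. cj (inv g) x:Q)" using e by blast
next
 assume h: "(ALL x:Q. cj g x:Q) & (ALL x:Q. cj (inv g) x:Q)"
 show "cj g ` Q = Q"
 proof
  show "Q<=cj g ` Q"
  proof
   fix x assume "x:Q"
   hence "x = cj g (cj (inv g) x)" "cj (inv g) x:Q" using h assms by auto
   thus "x:cj g ` Q" by blast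
  qed
 qed (use h in blast)
qed

lemma nrm_dsub: assumes Q: "dsub Q" shows "dsub (nrm Q)" "Q<=nrm Q" "nm (nrm Q) Q"
proof -
 note q = dsubD[OF Q]
 have e: "nrm Q = {g:C. (ALL x:Q. cj g x:Q) & (ALL x:Q. cj (inv g) x:Q)}" unfolding nrm_def by (rule Collect_cong) (use nrm_iff[OF q(3)] in blast)
 show "dsub (nrm Q)"
 proof (rule dsubI)
  show "ds (nrm Q)" unfolding e
   by (rule ds_Collect[OF ds_C], rule D_conj) (rule D_ball[OF q(2)], rule D_mem[OF q(2)], intro T_cj T_var T_inv)+
  show "\<one>:nrm Q" unfolding e using q by (auto simp: subset_iff)
 next
  fix x assume x: "x:nrm Q"
  thus "inv x:nrm Q" unfolding e by auto
  fix y assume y: "y:nrm Q"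
  show "x ** y:nrm Q" unfolding e
  proof (intro CollectI conjI ballI)
   fix z assume z: "z:Q"
   hence zc: "z:C" using q by blast
   have "cj x (cj y z):Q" "cj (inv y) (cj (inv x) z):Q" using x y z unfolding e by auto
   thus "cj (x ** y) z:Q" "cj (inv (x ** y)) z:Q" using x y zc unfolding e by (auto simp: cj_cj inv_mult_group)
  qed (use x y in "auto simp: e")
 qed
 show "Q<=nrm Q" unfolding e using q by (auto simp: cj_def)
 show "nm (nrm Q) Q" unfolding e nm_def by blast
qed

lemma nilm_normalizer:
 assumes K: "dsub K" and N: "dsub N" "N<=K" "nm K N" and Q: "dsub Q" "N<=Q" "Q<=K" "Q~=K" and nil: "nilm K N"
 shows "EX x:K. x~:Q & x:nrm Q"
proof -
 obtain i x where x: "x:U K N (Suc i)" "x~:Q" "U K N i<=Q" using nilm_center[OF K N Q(2-4) nil] by blast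
 note q = dsubD[OF Q(1)] and k = dsubD[OF K]
 have xK: "x:K" "x:C" using x k by auto
 have Ud: "dsub (U K N (Suc i))" using U_facts[OF K N] by blast
 have *: "cj y z:Q" if "y:U K N (Suc i)" "z:Q" for y z
 proof -
  have "y:C" "z:C" using that k q by auto
  moreover have "cm y z:Q" using that x(3) Q(3) by auto
  ultimately show ?thesis using that q cj_eq_cm by simp
 qed
 have "cj x ` Q = Q" using nrm_iff[OF q(3) xK(2)] *[OF x(1)] *[OF dsubD(6)[OF Ud x(1)]] by blast
 hence "x:nrm Q" unfolding nrm_def using xK by blast
 thus ?thesis using x xK by blast
qed

text \<open>The trivial subgroup has the same dimension, hence finitely many cosets, and these are
  the points.\<close>

lemma finite_dim0: assumes X: "dsub X" "dim X = 0" shows "finite X"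
proof -
 have "{\<one>}<=X" "dim {\<one>} = dim X" using dim_single X dsubD(4)[OF X(1)] by auto
 hence "finite (lcosets {\<one>} X)" using index[OF X(1)] dsub_one by blast
 moreover have "lcosets {\<one>} X = (%h. {h}) ` X" using dsubD(3)[OF X(1)] by (auto simp: subset_iff)
 ultimately show ?thesis by (simp add: finite_image_iff inj_on_def)
qed

text \<open>A connected group acting with finite orbit acts trivially. Here \<open>H\<close> acts by
  conjugation on cosets of \<open>N\<close>, and a dimension of \<open>Y\<close> at most
  \<open>dim N\<close> means that the orbit of the coset of x is finite; the stabilizer
  \<open>M\<close> then has full dimension in \<open>H\<close>.\<close>

lemma orbit:
 assumes H: "conn H" and N: "dsub N" "nm C N" and x: "x:C" and Y: "ds Y" "!!h n. h:H==>n:N==>cj h x ** n:Y" "dim Y<=dim N"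
 shows "ALL h:H. inv x ** cj h x:N"
proof -
 note h = dsubD[OF conn_dsub[OF H]] and n = dsubD[OF N(1)]
 define M where "M = {k:H. inv x ** cj k x:N}"
 have Mi: "k:M <-> k:H & (EX m:N. cj k x = x ** m)" for k
 proof
  assume k: "k:M"
  hence "cj k x = x ** (inv x ** cj k x)" using x h unfolding M_def by (auto simp: r_cancel_inv)
  thus "k:H & (EX m:N. cj k x = x ** m)" using k unfolding M_def by blast
 next
  assume "k:H & (EX m:N. cj k x = x ** m)"
  thus "k:M" using x n unfolding M_def by (auto simp: l_cancel_inv subset_iff)
 qed
 have M: "dsub M"
 proof (rule dsubI)
  show "ds M" unfolding M_def by (rule ds_Collect[OF h(2)], rule D_mem[OF n(2)], intro T_mult T_inv T_const T_cj T_var x)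
  show "\<one>:M" unfolding M_def using x h n by simp
 next
  fix k assume k: "k:M"
  then obtain m where m: "m:N" "cj k x = x ** m" "k:H" unfolding Mi by blast
  have c: "k:C" "m:C" using m h n by auto
  have i: "cj (inv k) (inv m):N" using N c n m unfolding nm_def by auto
  have "cj (inv k) x ** cj (inv k) m = x" using c x m(2) by (simp add: cj_mult[symmetric] m(2)[symmetric])
  hence "cj (inv k) x = x ** cj (inv k) (inv m)" using c x by (metis cj_closed cj_inv inv_closed inv_solve_right)
  thus "inv k:M" unfolding Mi using i m h by blast
  fix l assume l: "l:M"
  then obtain p where p: "p:N" "cj l x = x ** p" "l:H" unfolding Mi by blast
  have c': "l:C" "p:C" using p h n by auto
  have "cj (k ** l) x = x ** (m ** cj k p)" using c c' x m p by (simp add: cj_cj[symmetric] cj_mult m_assoc)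
  moreover have "m ** cj k p:N" using N m p c n unfolding nm_def by auto
  ultimately show "k ** l:M" unfolding Mi using m p h by blast
 qed
 have R: "D (%e. inv (cj (e 0) x) ** e 1:N)" by (rule D_mem[OF n(2)], intro T_mult T_inv T_cj T_var T_const x)
 have "dim H + dim N<=dim Y + dim M"
 proof (rule double_count[OF R h(2) Y(1)])
  show "H~={}" using h by blast
  show "0<=dim N" by (rule dsub_dim[OF N(1)])
  fix k assume k: "k:H"
  hence c: "k:C" "cj k x:C" using h x by auto
  have "(%m. cj k x ** m) ` N<={y:Y. inv (cj k x) ** y:N}" using Y(2) k c n by (auto simp: l_cancel_inv subset_iff)
  moreover have "ds {y:Y. inv (cj k x) ** y:N}"
   by (rule ds_Collect[OF Y(1)], rule D_mem[OF n(2)], intro T_mult T_const T_var) (use c in simp)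
  ultimately show "dim N<=dim {y:Y. inv (cj k x) ** y:N}" using dim_translate[OF n(2) c(2)] dim_mono by metis
 next
  fix y assume "y:Y"
  hence yc: "y:C" using Y(1) unfolding ds_def by blast
  let ?X = "{k:H. inv (cj k x) ** y:N}"
  show "dim ?X<=dim M"
  proof (cases "?X = {}")
   case True thus ?thesis using dim_empty dsub_dim[OF M] by (simp only:)
  next
   case False
   then obtain k0 where k0: "k0:H" "inv (cj k0 x) ** y:N" by blast
   have c0: "k0:C" using k0 h by blast
   have "?X<=(%k. k0 ** k) ` M"
   proof
    fix k assume k: "k:?X"
    hence c: "k:C" using h by blast
    have "(inv (cj k0 x) ** y) ** inv (inv (cj k x) ** y):N" using k k0 n by auto
    moreover have "(inv (cj k0 x) ** y) ** inv (inv (cj k x) ** y) = inv (cj k0 x) ** cj k x" using c c0 x yc by (simp add: gsimps)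
    ultimately have "inv (cj k0 x) ** cj k x:N" by simp
    hence "cj (inv k0) (inv (cj k0 x) ** cj k x):N" using N c0 unfolding nm_def by auto
    moreover have "cj (inv k0) (inv (cj k0 x) ** cj k x) = inv x ** cj (inv k0 ** k) x" using c c0 x by (simp add: cj_def gsimps)
    ultimately have "inv k0 ** k:M" unfolding M_def using k k0 h by auto
    moreover have "k = k0 ** (inv k0 ** k)" using c c0 by (simp add: r_cancel_inv)
    ultimately show "k:(%k. k0 ** k) ` M" by blast
   qed
   moreover have "ds ?X" by (rule ds_Collect[OF h(2)], rule D_mem[OF n(2)], intro T_mult T_inv T_cj T_var T_const x yc)
   ultimately show ?thesis using dim_translate[OF dsubD(2)[OF M] c0] dim_mono by metis
  qed
 qed
 hence "dim H<=dim M" using Y(3) by simp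
 moreover have "M<=H" unfolding M_def by blast
 ultimately have "M = H" using connD[OF H M] dim_mono[OF dsubD(2)[OF M] h(2)] by force
 thus ?thesis unfolding M_def by blast
qed

lemma conn_fix: assumes "conn H" "x:C" "finite F" "F<=C" "!!h. h:H==>cj h x:F" "h:H" shows "cj h x = x"
proof -
 have hc: "H<=C" using dsubD(3) conn_dsub assms by blast
 have "ALL h:H. inv x ** cj h x:{\<one>}"
  by (rule orbit[OF assms(1) dsub_one _ assms(2), where Y = F])
    (use assms hc dim_finite[OF assms(3,4)] dim_single in "auto simp: nm_def subset_iff")
 hence "inv x ** cj h x = \<one>" using assms by blast
 hence "x ** (inv x ** cj h x) = x" using assms(2) by simp
 thus ?thesis using assms hc by (simp add: r_cancel_inv subset_iff)
qed

lemma conn_fix_normal: assumes "conn H" "dsub F" "dim F = 0" "nm H F" "h:H" "x:F" shows "cj h x = x"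
 by (rule conn_fix[OF assms(1) _ finite_dim0[OF assms(2,3)] _ _ assms(5)]) (use assms dsubD(3)[OF assms(2)] in "auto simp: nm_def")

text \<open>An infinite connected nilpotent group has infinite centre. If the centre were finite,
  elements of the second centre would have finite conjugacy classes and be central by
  \<open>orbit\<close>, so the series would stop at its first step.\<close>

lemma center_dim:
 assumes c: "conn C" and N: "dsub N" "nm C N" "dim N<dim C" and nil: "nilm C N"
 shows "dim N<dim (U C N 1)"
proof (rule ccontr)
 assume h: "~dim N<dim (U C N 1)"
 have NC: "N<=C" using dsubD(3)[OF N(1)] .
 note f = U_facts[OF dsub_C N(1) NC N(2)]
 note n = dsubD[OF N(1)]
 let ?V = "U C N 1"
 have V: "dsub ?V" "nm C ?V" using f[of 1] by auto
 note v = dsubD[OF V(1)]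
 have NV: "N<=?V" using f[of 0] by simp
 have step: "U C N 2<=?V"
 proof
  fix x assume x: "x:U C N 2"
  have xc: "x:C" using x by (simp add: numeral_2_eq_2)
  have U2: "dsub (U C N 2)" using f[of 2] by blast
  have *: "ALL h:C. inv y ** cj h y:N" if y: "y:U C N 2" for y
  proof (rule orbit[OF c N(1,2)])
   show yc: "y:C" using y by (simp add: numeral_2_eq_2)
   show "ds ((%k. y ** k) ` ?V)" "dim ((%k. y ** k) ` ?V)<=dim N" using dim_translate[OF v(2) yc] h by auto
   fix g m assume g: "g:C" and m: "m:N"
   have "inv y:U C N 2" using dsubD(6)[OF U2 y] .
   hence "cm (inv y) g:?V" using g by (simp add: numeral_2_eq_2)
   hence "cm (inv y) g ** m:?V" using m NV v by blast
   moreover have "cj g y ** m = y ** (cm (inv y) g ** m)" using yc g m n by (simp add: cm_def cj_def gsimps subset_iff)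
   ultimately show "cj g y ** m:(%k. y ** k) ` ?V" by blast
  qed
  have "inv x:?V"
   unfolding One_nat_def U.simps
  proof (intro CollectI conjI ballI)
   fix g assume g: "g:C"
   have "inv x ** cj g x:N" using *[OF x] g by blast
   thus "cm (inv x) g:N" using xc g by (simp add: cm_def cj_def gsimps)
  qed (use xc in simp)
  thus "x:?V" using v(6)[of "inv x"] xc by simp
 qed
 have "U C N i<=?V" for i
 proof (induction i)
  case 0 thus ?case using NV by simp
 next
  case (Suc i)
  hence "U C N (Suc i)<=U C N 2" by (auto simp: numeral_2_eq_2)
  thus ?case using step by blast
 qed
 hence "C<=?V" using nil unfolding nilm_def by blast
 hence "?V = C" using v by blast
 thus False using h N(3) by simp
qed

end

subsection \<open>Weights\<close>

locale minimal_action = ranked_group G D dim for G :: "'b monoid" (structure) and D dim +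
 fixes A :: "'b set"
 assumes cC: "conn C" and cA: "conn A" and nA: "nm C A" and abA: "!!a b. a:A==>b:A==>a ** b = b ** a"
  and minA: "!!B. dsub B==>B<=A==>nm C B==>dim B = 0 | B = A"
  and nilA: "nilm C A" and ncA: "~(ALL g:C. ALL a:A. cj g a = a)"
begin

lemmas dA = conn_dsub[OF cA]
lemmas A = dsubD[OF dA]

text \<open>\<open>Cz\<close> is the centralizer of \<open>A\<close>, \<open>Z\<close> the preimage
  of the centre of \<open>C/Cz\<close>, and \<open>Kf g\<close> the fixed points of g in
  \<open>A\<close>. Elements of \<open>Z\<close> play the role of scalars acting on
  \<open>A\<close>.\<close>

definition Cz where "Cz = {g:C. ALL a:A. cj g a = a}"
definition Z where "Z = U C Cz 1"
definition Kf where "Kf g = {a:A. cm a g = \<one>}"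

lemma AC: "a:A==>a:C" using A by blast

lemma Cz: "dsub Cz" "nm C Cz" "A<=Cz" "Cz<=C" "Cz~=C"
proof -
 show "dsub Cz"
 proof (rule dsubI)
  show "ds Cz" unfolding Cz_def by (rule ds_Collect[OF ds_C], rule D_ball[OF A(2)], rule D_eq[OF T_cj[OF T_var T_var] T_var])
 next
  fix x assume x: "x:Cz"
  have "cj (inv x) a = a" if "a:A" for a
  proof -
   have "cj x a = a" "x:C" "a:C" using x that AC unfolding Cz_def by auto
   thus ?thesis using cj_inv_cj(1)[of x a] by simp
  qed
  thus "inv x:Cz" using x unfolding Cz_def by auto
  fix y assume "y:Cz"
  thus "x ** y:Cz" using x AC unfolding Cz_def by (auto simp: cj_cj[symmetric])
 qed (use AC in "auto simp: Cz_def")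
 show "nm C Cz" unfolding nm_def
 proof (intro ballI)
  fix h x assume h: "h:C" and x: "x:Cz"
  have xc: "x:C" using x unfolding Cz_def by blast
  have "cj (cj h x) a = a" if a: "a:A" for a
  proof -
   have "cj (inv h) a:A" using nA h a unfolding nm_def by auto
   hence "cj x (cj (inv h) a) = cj (inv h) a" using x unfolding Cz_def by blast
   hence "cj h (cj x (cj (inv h) a)) = a" using h a AC by simp
   moreover have "cj h (cj x (cj (inv h) a)) = cj (cj h x) a" using h xc AC[OF a] by (simp add: cj_def gsimps)
   ultimately show ?thesis by simp
  qed
  thus "cj h x:Cz" using h xc unfolding Cz_def by simp
 qed
 show "A<=Cz"
 proof
  fix x assume x: "x:A"
  have "cj x a = a" if "a:A" for a using cj_fix[of x a] abA[OF x that] AC x that by blast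
  thus "x:Cz" using x AC unfolding Cz_def by blast
 qed
 show "Cz<=C" "Cz~=C" using ncA unfolding Cz_def by blast+
qed

lemma nilCz: "nilm C Cz" using nilm_mono[OF nilA Cz(3)] .

lemma Z: "dsub Z" "nm C Z" "Z<=C" "Cz<=Z" "dim Cz<dim Z"
proof -
 note f = U_facts[OF dsub_C Cz(1,4,2)]
 show "dsub Z" "nm C Z" "Z<=C" using f[of 1] unfolding Z_def by blast+
 show "Cz<=Z" using f[of 0] unfolding Z_def by simp
 show "dim Cz<dim Z" unfolding Z_def
  using center_dim[OF cC Cz(1,2) conn_dim_less[OF cC Cz(1,4,5)] nilCz] .
qed

lemma Z_comm: "z:Z==>g:C==>cm z g:Cz & cm g z:Cz"
proof -
 assume z: "z:Z" and g: "g:C"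
 have "cm z g:Cz" using z g unfolding Z_def by simp
 moreover have "inv (cm z g) = cm g z" using cm_inverse z g Z by blast
 ultimately show ?thesis using dsubD(6)[OF Cz(1)] by metis
qed

lemma cm_A: "a:A==>g:C==>cm a g:A"
 using cm_split[of a g] A nA unfolding nm_def by (metis AC)

text \<open>On the abelian normal subgroup \<open>A\<close> the map taking a to
  \<open>cm a g\<close> is the endomorphism 1-g in additive notation, with kernel
  \<open>Kf g\<close>.\<close>

lemma cm_hom: "a:A==>b:A==>g:C==>cm (a ** b) g = cm a g ** cm b g"
proof -
 assume h: "a:A" "b:A" "g:C"
 have "cj a (cm b g) = cm b g" using cj_fix[of a "cm b g"] abA[OF h(1) cm_A[OF h(2,3)]] AC h cm_A by blast
 thus ?thesis using cm_mult[of a b g] h AC abA[OF cm_A[OF h(1,3)] cm_A[OF h(2,3)]] by simp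
qed

lemma cm_Cz: assumes "a:A" "g:C" "c:Cz" shows "cm a (g ** c) = cm a g"
proof -
 have c: "c:C" "a:C" using assms Cz AC by auto
 have "cj c (inv a) = inv a" using assms A unfolding Cz_def by blast
 moreover have "cm a (g ** c) = a ** cj g (cj c (inv a))" using c assms by (simp add: cm_def cj_def gsimps)
 ultimately show ?thesis using c assms cm_split by simp
qed

text \<open>If g and h commute modulo the centralizer of \<open>A\<close>, then 1-g commutes with
  the action of h. For elements of \<open>Z\<close> this holds against every element of the
  group.\<close>

lemma cm_conj: assumes "a:A" "g:C" "h:C" "inv g ** cj (inv h) g:Cz" shows "cm (cj h a) g = cj h (cm a g)"
proof -
 have "cm (cj h a) g = cj h (cm a (cj (inv h) g))" using assms AC by (simp add: cj_cm)
 moreover have "cj (inv h) g = g ** (inv g ** cj (inv h) g)" using assms by (simp add: r_cancel_inv)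
 ultimately show ?thesis using cm_Cz[OF assms(1,2,4)] by simp
qed

lemma cm_conj_Z: "a:A==>z:Z==>h:C==>cm (cj h a) z = cj h (cm a z)"
proof -
 assume h: "a:A" "z:Z" "h:C"
 have zc: "z:C" using h Z by blast
 have "inv z ** cj (inv h) z = cm (inv z) (inv h)" using h zc by (simp add: cm_def cj_def gsimps)
 moreover have "inv z:Z" using dsubD(6)[OF Z(1)] h by blast
 ultimately show ?thesis using cm_conj[OF h(1) zc h(3)] Z_comm h by simp
qed

lemma cm_conj_by_Z: "a:A==>z:Z==>g:C==>cm (cj z a) g = cj z (cm a g)"
proof -
 assume h: "a:A" "z:Z" "g:C"
 have zc: "z:C" using h Z by blast
 have "inv g ** cj (inv z) g = cm (inv g) (inv z)" using h zc by (simp add: cm_def cj_def gsimps)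
 moreover have "inv z:Z" using dsubD(6)[OF Z(1)] h by blast
 ultimately show ?thesis using cm_conj[OF h(1,3) zc] Z_comm h by simp
qed

lemma T_cm_const: "g:C==>T (%e. cm (e 0) g)" by (intro T_cm T_var T_const)

lemma Kf: assumes "g:C" shows "dsub (Kf g)" "Kf g<=A" "dim A = dim (Kf g) + dim ((%a. cm a g) ` A)"
 "dsub ((%a. cm a g) ` A)" "(%a. cm a g) ` A<=A" "conn ((%a. cm a g) ` A)"
 using hom_facts[OF dA T_cm_const[OF assms] cm_hom[OF _ _ assms]] cA cm_A[OF _ assms] unfolding Kf_def by auto

lemma Kf_iff: "a:Kf g <-> a:A & cj g a = a" if "g:C"
proof -
 have "cm a g = \<one> <-> cj g a = a" if "a:A" for a
  using cm_eq_one[of a g] cj_fix[of g a] AC[OF that] \<open>g:C\<close> by metis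
 thus ?thesis unfolding Kf_def by blast
qed

text \<open>Schur's argument: the kernel of 1-z is normal because z is central modulo
  \<open>Cz\<close>, so it is finite by minimality, and then the image has full dimension in the
  connected group \<open>A\<close>.\<close>

lemma Z_onto0: assumes z: "z:Z" "z~:Cz" shows "dim (Kf z) = 0 & nm C (Kf z) & (%a. cm a z) ` A = A"
proof -
 have zc: "z:C" using z Z by blast
 have n: "nm C (Kf z)" unfolding nm_def
 proof (intro ballI)
  fix h a assume "h:C" "a:Kf z"
  thus "cj h a:Kf z" using cm_conj_Z[OF _ z(1)] nA unfolding Kf_def nm_def by auto
 qed
 have "Kf z~=A"
 proof
  assume "Kf z = A"
  hence "z:Cz" using Kf_iff[OF zc] zc unfolding Cz_def by blast
  thus False using z by blast
 qed
 hence d: "dim (Kf z) = 0" using minA[OF Kf(1,2)[OF zc] n] by blast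
 hence "dim ((%a. cm a z) ` A) = dim A" using Kf(3)[OF zc] by simp
 hence "(%a. cm a z) ` A = A" using connD[OF cA Kf(4,5)[OF zc]] by blast
 thus ?thesis using d n by blast
qed

lemma ex_Z: "EX z:cc Z. z~:Cz"
proof (rule ccontr)
 assume "~?thesis"
 hence "cc Z<=Cz" by blast
 hence "dim (cc Z)<=dim Cz" using dim_mono dsubD(2) conn_dsub[OF cc(1)[OF Z(1)]] Cz(1) by blast
 thus False using cc(3)[OF Z(1)] Z(5) by simp
qed

text \<open>The fixed points \<open>F\<close> form a finite group, being fixed by some z in
  \<open>Z\<close> outside \<open>Cz\<close>. Their preimage under 1-z is finite and normal, so the
  connected group fixes it too; hence the preimage lies in \<open>F\<close>, where 1-z vanishes,
  while 1-z is onto.\<close>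

lemma fixed_trivial: assumes "a:A" "!!h. h:C==>cj h a = a" shows "a = \<one>"
proof -
 obtain z where z: "z:Z" "z~:Cz" using ex_Z cc(2)[OF Z(1)] by blast
 have zc: "z:C" using z Z by blast
 define F where "F = {a:A. ALL h:C. cj h a = a}"
 have FK: "F<=Kf z" using Kf_iff[OF zc] zc unfolding F_def by blast
 have F: "dsub F"
 proof (rule dsubI)
  show "ds F" unfolding F_def by (rule ds_Collect[OF A(2)], rule D_ball[OF ds_C], rule D_eq[OF T_cj[OF T_var T_var] T_var])
 qed (use A AC in "auto simp: F_def cj_mult cj_inv")
 have "dim F<=dim (Kf z)" using dim_mono[OF dsubD(2)[OF F] dsubD(2)[OF Kf(1)[OF zc]] FK] .
 hence dF: "dim F = 0" using Z_onto0[OF z] dsub_dim[OF F] by simp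
 define P where "P = {a:A. cm a z:F}"
 have P: "dsub P"
 proof (rule dsubI)
  show "ds P" unfolding P_def by (rule ds_Collect[OF A(2)], rule D_mem[OF dsubD(2)[OF F] T_cm[OF T_var T_const[OF zc]]])
  show "\<one>:P" unfolding P_def using A dsubD(4)[OF F] zc by (simp add: cm_def)
 next
  fix x assume x: "x:P"
  hence xA: "x:A" unfolding P_def by blast
  have "cm (inv x) z ** cm x z = \<one>" using cm_hom[of "inv x" x z] A xA zc AC by (simp add: cm_def)
  hence "cm (inv x) z = inv (cm x z)" using inv_equality AC xA zc A(6)[OF xA] by simp
  thus "inv x:P" using x A dsubD(6)[OF F] unfolding P_def by simp
  fix y assume "y:P"
  thus "x ** y:P" using x A cm_hom[OF _ _ zc] dsubD(5)[OF F] unfolding P_def by auto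
 qed
 have nP: "nm C P" unfolding nm_def
 proof (intro ballI)
  fix h x assume h: "h:C" and x: "x:P"
  have "cm (cj h x) z = cj h (cm x z)" using cm_conj_Z[OF _ z(1) h] x unfolding P_def by blast
  also have "... = cm x z" using x h unfolding P_def F_def by blast
  finally show "cj h x:P" using x h nA unfolding P_def nm_def by auto
 qed
 have "dim P = dim {a:P. cm a z = \<one>} + dim ((%a. cm a z) ` P)"
  by (rule hom_facts(3)[OF P T_cm_const[OF zc]]) (use cm_hom[OF _ _ zc] in "auto simp: P_def")
 moreover have "dim {a:P. cm a z = \<one>}<=0"
 proof -
  have "dsub {a:P. cm a z = \<one>}"
   by (rule hom_facts(2)[OF P T_cm_const[OF zc]]) (use cm_hom[OF _ _ zc] in "auto simp: P_def")
  hence "dim {a:P. cm a z = \<one>}<=dim (Kf z)"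
   by (intro dim_mono dsubD(2) Kf(1)[OF zc]) (auto simp: P_def Kf_def)
  thus ?thesis using Z_onto0[OF z] by simp
 qed
 moreover have "dim ((%a. cm a z) ` P)<=0"
 proof -
  have "dsub ((%a. cm a z) ` P)"
   by (rule hom_facts(1)[OF P T_cm_const[OF zc]]) (use cm_hom[OF _ _ zc] in "auto simp: P_def")
  hence "dim ((%a. cm a z) ` P)<=dim F" by (intro dim_mono dsubD(2) F) (auto simp: P_def)
  thus ?thesis using dF by simp
 qed
 ultimately have dP: "dim P = 0" using dsub_dim[OF P] by simp
 have PF: "P<=F" using conn_fix_normal[OF cC P dP nP] unfolding F_def P_def by blast
 have aF: "a:F" using assms unfolding F_def by blast
 obtain b where b: "b:A" "a = cm b z" using Z_onto0[OF z] assms(1) by blast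
 hence "b:F" using PF aF unfolding P_def by blast
 hence "cm b z = \<one>" using FK unfolding Kf_def by blast
 thus ?thesis using b by simp
qed

lemma normal_dim0_trivial: assumes "dsub B" "B<=A" "nm C B" "dim B = 0" shows "B = {\<one>}"
proof -
 have "x = \<one>" if "x:B" for x using fixed_trivial[of x] conn_fix_normal[OF cC assms(1,4,3) _ that] that assms(2) by blast
 thus ?thesis using dsubD(4)[OF assms(1)] by blast
qed

lemma Z_inj: "z:Z==>z~:Cz==>Kf z = {\<one>}"
 using normal_dim0_trivial[of "Kf z"] Kf[of z] Z_onto0[of z] Z(3) by blast

text \<open>The fixed points of any g are normalized by the connected group \<open>cc Z\<close>. If
  there are finitely many they are centralized by it, but some element of \<open>cc Z\<close> has no
  fixed points. So a nontrivial fixed space always has positive dimension.\<close>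

lemma Kf_finite_trivial: assumes g: "g:C" and d: "dim (Kf g) = 0" shows "Kf g = {\<one>}"
proof -
 obtain z where z: "z:cc Z" "z~:Cz" using ex_Z by blast
 have zZ: "z:Z" "z:C" using z cc(2)[OF Z(1)] Z(3) by auto
 have n: "nm (cc Z) (Kf g)" unfolding nm_def
 proof (intro ballI)
  fix y a assume y: "y:cc Z" and a: "a:Kf g"
  have "y:Z" "y:C" using y cc(2)[OF Z(1)] Z(3) by auto
  thus "cj y a:Kf g" using a cm_conj_by_Z[OF _ _ g, of a y] nA unfolding Kf_def nm_def by auto
 qed
 have "a = \<one>" if a: "a:Kf g" for a
 proof -
  have "cj z a = a" by (rule conn_fix_normal[OF cc(1)[OF Z(1)] Kf(1)[OF g] d n z(1) a])
  hence "a:Kf z" using Kf_iff[OF zZ(2)] a Kf(2)[OF g] by blast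
  thus ?thesis using Z_inj[OF zZ(1) z(2)] by blast
 qed
 thus ?thesis using dsubD(4)[OF Kf(1)[OF g]] by blast
qed

text \<open>Eigenspaces of \<open>g\<close> for distinct eigenvalues from the central subgroup \<open>Z\<close> are independent.\<close>

lemma weights_independent:
 assumes g: "g:C"
 shows "finite F==>F<=Z==>(!!z z'. z:F==>z':F==>z~=z'==>inv z ** z'~:Cz)==>(!!z. z:F==>0<dim (Kf (g ** z))) ==>
  EX S. dsub S & S<=A & (ALL s:S. cj g s:S) & nm Z S & int (card F)<=dim S &
   (ALL z:Z. (ALL z':F. inv z ** z'~:Cz) --> (ALL s:S. cm s (g ** z) = \<one> --> s = \<one>))"
proof (induction F rule: finite_induct)
 case empty
 show ?case
  by (rule exI[of _ "{\<one>}"]) (use dsub_one A g Z dim_single in "auto simp: nm_def subset_iff")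
next
 case (insert y F)
 have "EX S. dsub S & S<=A & (ALL s:S. cj g s:S) & nm Z S & int (card F)<=dim S &
   (ALL z:Z. (ALL z':F. inv z ** z'~:Cz) --> (ALL s:S. cm s (g ** z) = \<one> --> s = \<one>))"
  by (rule insert.IH) (use insert.prems in auto)
 then obtain S where S: "dsub S" "S<=A" "ALL s:S. cj g s:S" "nm Z S" "int (card F)<=dim S"
  and Sp: "!!z s. z:Z==>(ALL z':F. inv z ** z'~:Cz)==>s:S==>cm s (g ** z) = \<one>==>s = \<one>" by blast
 have ZC: "z:C" if "z:Z" for z using that Z by blast
 have y: "y:Z" "y:C" "ALL z':F. inv y ** z'~:Cz" using insert.prems(1,2) insert.hyps ZC by auto
 have invar: "(ALL a:Kf (g ** z). cj g a:Kf (g ** z)) & nm Z (Kf (g ** z))" if z: "z:Z" for z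
 proof
  have c: "g ** z:C" "z:C" "inv z:Z" using g ZC z dsubD(6)[OF Z(1)] by auto
  show "ALL a:Kf (g ** z). cj g a:Kf (g ** z)"
  proof
   fix a assume a: "a:Kf (g ** z)"
   have "inv (g ** z) ** cj (inv g) (g ** z) = cm (inv z) (inv g)" using g c by (simp add: cm_def cj_def gsimps)
   hence "cm (cj g a) (g ** z) = cj g (cm a (g ** z))"
    using cm_conj[OF _ c(1) g] a Z_comm[OF c(3)] g unfolding Kf_def by simp
   thus "cj g a:Kf (g ** z)" using a g nA unfolding Kf_def nm_def by auto
  qed
  show "nm Z (Kf (g ** z))" unfolding nm_def
  proof (intro ballI)
   fix x a assume x: "x:Z" and a: "a:Kf (g ** z)"
   thus "cj x a:Kf (g ** z)" using cm_conj_by_Z[OF _ x c(1)] nA ZC unfolding Kf_def nm_def by auto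
  qed
 qed
 let ?E = "Kf (g ** y)"
 have gy: "g ** y:C" using g y by simp
 have E: "dsub ?E" "?E<=A" using Kf[OF gy] by auto
 have nSE: "nm S ?E" unfolding nm_def
 proof (intro ballI)
  fix s a assume "s:S" "a:?E"
  moreover hence "cj s a = a" using cj_fix[of s a] abA[of s a] S(2) E(2) AC by blast
  ultimately show "cj s a:?E" by simp
 qed
 have M: "dsub (mp S ?E)" by (rule mp_dsub[OF S(1) E(1) nSE])
 have trivial: "S Int ?E = {\<one>}" using Sp[OF y(1) y(3)] dsubD(4)[OF S(1)] dsubD(4)[OF E(1)] unfolding Kf_def by blast
 have dimM: "dim (mp S ?E) = dim S + dim ?E" using dim_mp[OF S(1) E(1)] trivial dim_single by simp
 show ?case
 proof (rule exI[of _ "mp S ?E"], intro conjI ballI impI M)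
  show "mp S ?E<=A" by (rule mp_least[OF dA S(2) E(2)])
  show "int (card (insert y F))<=dim (mp S ?E)" using dimM S(5) insert.prems(3)[of y] insert.hyps by simp
  show "nm Z (mp S ?E)" unfolding nm_def
  proof (intro ballI)
   fix x m assume x: "x:Z" and "m:mp S ?E"
   then obtain s a where sa: "s:S" "a:?E" "m = s ** a" unfolding mp_def by blast
   have "cj x m = cj x s ** cj x a" using sa cj_mult[of x s a] ZC x S(2) E(2) AC by blast
   moreover have "cj x s:S" "cj x a:?E" using S(4) invar[OF y(1)] x sa unfolding nm_def by blast+
   ultimately show "cj x m:mp S ?E" using mpI[of "cj x s" S "cj x a" ?E] dsubD(3)[OF S(1)] dsubD(3)[OF E(1)] by simp
  qed
  fix m assume "m:mp S ?E"
  then obtain s a where sa: "s:S" "a:?E" "m = s ** a" unfolding mp_def by blast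
  have sac: "s:A" "a:A" "s:C" "a:C" using sa S(2) E(2) AC by auto
  have "cj g m = cj g s ** cj g a" using sa cj_mult[of g s a] g sac by simp
  moreover have "cj g s:S" "cj g a:?E" using S(3) invar[OF y(1)] sa by blast+
  ultimately show "cj g m:mp S ?E" using mpI[of "cj g s" S "cj g a" ?E] dsubD(3)[OF S(1)] dsubD(3)[OF E(1)] by simp
  \<comment> \<open>Applying 1-gy to m removes a and lands in \<open>S\<close>; the result is still
    fixed by gz, so it is trivial and s vanishes. What remains is fixed by both gy and gz, hence by
    the inverse of z times y, which has no fixed points.\<close>
  fix z assume z: "z:Z" "ALL z':insert y F. inv z ** z'~:Cz" "cm m (g ** z) = \<one>"
  have zc: "z:C" "g ** z:C" using ZC z g by auto
  have mA: "m:A" using sa sac A by simp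
  let ?x = "cm m (g ** y)"
  have mK: "m:Kf (g ** z)" using mA z unfolding Kf_def by blast
  have "?x = cm s (g ** y) ** cm a (g ** y)" using cm_hom[OF sac(1,2) gy] sa by simp
  hence x1: "?x = cm s (g ** y)" using sa cm_A[OF sac(1) gy] AC unfolding Kf_def by simp
  have gyinv: "cj (g ** y) w:W" if "ALL a:W. cj g a:W" "nm Z W" "w:W" "W<=A" for w W
   using that y g AC cj_cj[of g y w, symmetric] unfolding nm_def by auto
  have "?x:S"
   using x1 cm_split[OF sac(3) gy] gyinv[OF S(3,4) _ S(2)] dsubD(5,6)[OF S(1)] sa by simp
  moreover have "?x:Kf (g ** z)"
  proof -
   note i = invar[OF z(1)] and k = Kf(1,2)[OF zc(2)]
   have "cj (g ** y) (inv m):Kf (g ** z)" using gyinv[OF conjunct1[OF i] conjunct2[OF i] _ k(2)] mK dsubD(6)[OF k(1)] by blast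
   thus ?thesis using cm_split[OF AC[OF mA] gy] dsubD(5)[OF k(1)] mK by simp
  qed
  ultimately have "?x = \<one>" using Sp[OF z(1)] z(2) unfolding Kf_def by blast
  hence "s = \<one>" using Sp[OF y(1) y(3) sa(1)] x1 by simp
  hence ma: "m = a" using sa sac by simp
  have f: "cj (g ** y) a = a" "cj (g ** z) a = a" using Kf_iff[OF gy, of a] Kf_iff[OF zc(2), of a] sa(2) mK unfolding ma by simp_all
  have "cj (inv (g ** z)) (cj (g ** z) a) = a" using zc sac by simp
  hence "cj (inv (g ** z)) a = a" using f by simp
  hence "cj (inv (g ** z)) (cj (g ** y) a) = a" using f by simp
  moreover have "inv (g ** z) ** (g ** y) = inv z ** y" using g y zc by (simp add: gsimps)
  ultimately have "cj (inv z ** y) a = a" using cj_cj[of "inv (g ** z)" "g ** y" a] gy zc sac by simp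
  moreover have w: "inv z ** y:Z" "inv z ** y~:Cz" using z y dsubD(5,6)[OF Z(1)] by auto
  ultimately have "a:Kf (inv z ** y)" using Kf_iff[of "inv z ** y"] sac y zc by simp
  thus "m = \<one>" using Z_inj[OF w] ma by blast
 qed
qed

definition Tb where "Tb = {g:C. EX a:A. a~=\<one> & cm a g = \<one>}"

lemma ds_Tb: "ds Tb"
 unfolding Tb_def by (rule ds_Collect[OF ds_C], rule D_bex[OF A(2)], rule D_conj[OF D_not[OF D_eq[OF T_var T_const[OF one_closed]]]], rule D_eq[OF T_cm[OF T_var T_var] T_const[OF one_closed]])

text \<open>Each coset of \<open>Z\<close> meets \<open>Tb\<close> in finitely many cosets of
  \<open>Cz\<close>, their number being at most \<open>dim A\<close>. Double counting gives
  \<open>dim Tb + dim Z\<close> at most \<open>dim C + dim Cz\<close>, and \<open>Cz\<close> has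
  smaller dimension than \<open>Z\<close>.\<close>

theorem Tb_small: "dim Tb<dim C"
proof (cases "Tb = {}")
 case True thus ?thesis using dim_empty dsub_dim[OF dsub_C] by simp
next
 case False
 have ZC: "z:C" if "z:Z" for z using that Z by blast
 have b: "dim {x:Tb. inv g ** x:Z}<=dim Cz" if g: "g:C" for g
 proof -
  define ok where "ok F <-> finite F & F<=Z & (ALL z:F. ALL z':F. z~=z' --> inv z ** z'~:Cz) & (ALL z:F. 0<dim (Kf (g ** z)))" for F
  have bound: "card F<=nat (dim A)" if F: "ok F" for F
  proof -
   have f: "finite F" "F<=Z" "!!z z'. z:F==>z':F==>z~=z'==>inv z ** z'~:Cz" "!!z. z:F==>0<dim (Kf (g ** z))"
    using F unfolding ok_def by blast+
   have "EX S. dsub S & S<=A & (ALL s:S. cj g s:S) & nm Z S & int (card F)<=dim S &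
     (ALL z:Z. (ALL z':F. inv z ** z'~:Cz) --> (ALL s:S. cm s (g ** z) = \<one> --> s = \<one>))"
    by (rule weights_independent[OF g f(1,2)]) (use f(3,4) in blast)+
   then obtain S where S: "dsub S" "S<=A" "int (card F)<=dim S" by (elim exE conjE)
   have "dim S<=dim A" using dim_mono[OF dsubD(2)[OF S(1)] A(2) S(2)] .
   thus ?thesis using S(3) by linarith
  qed
  have "ok {}" unfolding ok_def by simp
  \<comment> \<open>A largest set of weights of g that are distinct modulo \<open>Cz\<close>. By
    maximality every element of \<open>Tb\<close> in the coset of g agrees with one of them modulo
    \<open>Cz\<close>.\<close>
  then obtain F where F: "ok F" "ALL F'. ok F' --> card F'<=card F"
   using ex_has_greatest_nat[of ok "{}" card "Suc (nat (dim A))"] bound by (metis le_imp_less_Suc)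
  have "{x:Tb. inv g ** x:Z}<=(UN z:F. (%c. (g ** z) ** c) ` Cz)"
  proof
   fix x assume x: "x:{x:Tb. inv g ** x:Z}"
   hence xc: "x:C" unfolding Tb_def by blast
   define z where "z = inv g ** x"
   have z: "z:Z" "z:C" "x = g ** z" using x xc g unfolding z_def by (auto simp: r_cancel_inv)
   have "Kf x~={\<one>}" using x unfolding Tb_def Kf_def by blast
   hence "dim (Kf x)~=0" using Kf_finite_trivial[OF xc] by blast
   hence pos: "0<dim (Kf (g ** z))" using dsub_dim[OF Kf(1)[OF xc]] z by simp
   have "EX z':F. inv z ** z':Cz"
   proof (rule ccontr)
    assume n: "~?thesis"
    have n': "inv z' ** z~:Cz" if "z':F" for z'
    proof
     assume a: "inv z' ** z:Cz"
     have "z':C" using that F ZC unfolding ok_def by blast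
     hence "inv (inv z' ** z) = inv z ** z'" using z by (simp add: gsimps)
     thus False using dsubD(6)[OF Cz(1) a] n that by simp
    qed
    have "z~:F"
    proof
     assume "z:F" thus False using n z dsubD(4)[OF Cz(1)] by (metis l_inv)
    qed
    moreover have "ok (insert z F)" unfolding ok_def using F(1) z pos n n' unfolding ok_def by auto
    ultimately show False using F(2)[rule_format, of "insert z F"] F(1) unfolding ok_def by simp
   qed
   then obtain z' where z': "z':F" "inv z ** z':Cz" by blast
   have zc': "z':C" using z' F ZC unfolding ok_def by blast
   have "inv (inv z ** z') = inv z' ** z" using z zc' by (simp add: gsimps)
   hence "inv z' ** z:Cz" using dsubD(6)[OF Cz(1) z'(2)] by simp
   moreover have "x = (g ** z') ** (inv z' ** z)" using z zc' g by (simp add: gsimps)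
   ultimately show "x:(UN z:F. (%c. (g ** z) ** c) ` Cz)" using z' by blast
  qed
  moreover have "ds (UN z:F. (%c. (g ** z) ** c) ` Cz) & dim (UN z:F. (%c. (g ** z) ** c) ` Cz)<=dim Cz"
  proof (rule dim_UN)
   fix z assume "z:F"
   hence "g ** z:C" using F ZC g unfolding ok_def by blast
   thus "ds ((%c. (g ** z) ** c) ` Cz) & dim ((%c. (g ** z) ** c) ` Cz)<=dim Cz" using dim_translate[OF dsubD(2)[OF Cz(1)]] by simp
  qed (use F dsub_dim[OF Cz(1)] in "auto simp: ok_def")
  moreover have "ds {x:Tb. inv g ** x:Z}"
   by (rule ds_Collect[OF ds_Tb], rule D_mem[OF dsubD(2)[OF Z(1)]], intro T_mult T_const T_var) (use g in simp)
  ultimately show ?thesis using dim_mono[of "{x:Tb. inv g ** x:Z}"] by (meson order_trans)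
 qed
 have R: "D (%e. inv (e 1) ** e 0:Z)" by (rule D_mem[OF dsubD(2)[OF Z(1)]], intro T_mult T_inv T_var)
 have "dim Tb + dim Z<=dim C + dim Cz"
 proof (rule double_count[OF R ds_Tb ds_C False dsub_dim[OF Z(1)] _ b])
  fix x assume "x:Tb"
  hence xc: "x:C" unfolding Tb_def by blast
  have "(%z. x ** z) ` Z<={y:C. inv y ** x:Z}"
  proof
   fix y assume "y:(%z. x ** z) ` Z"
   then obtain z where z: "z:Z" "y = x ** z" by blast
   hence "inv y ** x = inv z" using xc ZC by (simp add: gsimps)
   thus "y:{y:C. inv y ** x:Z}" using z xc ZC dsubD(6)[OF Z(1)] by simp
  qed
  moreover have "ds {y:C. inv y ** x:Z}"
   by (rule ds_Collect[OF ds_C], rule D_mem[OF dsubD(2)[OF Z(1)]], intro T_mult T_inv T_const T_var xc)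
  ultimately show "dim Z<=dim {y:C. inv y ** x:Z}" using dim_translate[OF dsubD(2)[OF Z(1)] xc] dim_mono by metis
 qed
 thus ?thesis using Z(5) by simp
qed

text \<open>An injective endomorphism of the connected group \<open>A\<close> is onto, by
  dimension.\<close>

lemma not_Tb: assumes g: "g:C" "g~:Tb" shows "Kf g = {\<one>}" "(%a. cm a g) ` A = A"
proof -
 show k: "Kf g = {\<one>}" using g A unfolding Tb_def Kf_def by (auto simp: cm_def)
 hence "dim ((%a. cm a g) ` A) = dim A" using Kf(3)[OF g(1)] dim_single by simp
 thus "(%a. cm a g) ` A = A" using connD[OF cA Kf(4,5)[OF g(1)]] by blast
qed

end

subsection \<open>Definable subgroups\<close>

context ranked_group
begin

text \<open>\<open>bad\<close> is the complement in \<open>Q\<close> of the generic part, and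
  \<open>unc\<close> is what the conjugates of \<open>Q\<close> leave uncovered.\<close>

abbreviation bad :: "'b set => 'b set => 'b set" where "bad K Q == {x:Q. EX g:K. x:cj g ` Q & cj g ` Q~=Q}"
abbreviation unc :: "'b set => 'b set => 'b set" where "unc K Q == {x:K. ALL g:K. x~:cj g ` Q}"

text \<open>\<open>Q\<close> behaves in \<open>K\<close>, modulo \<open>N\<close>, as a Carter subgroup of \<open>K/N\<close> should.\<close>

definition rel :: "'b set => 'b set => 'b set => bool" where
 "rel K N Q <-> conn Q & N<=Q & Q<=K & nilm Q N & nrm Q Int K = Q &
   (ALL Q'. conn Q' & N<=Q' & Q'<=K & nilm Q' N & dim (nrm Q' Int K) = dim Q' --> (EX g:K. Q' = cj g ` Q)) &
   dim (bad K Q)<dim Q &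
   dim (unc K Q)<dim K &
   (ALL M. conn M & N<=M & M<=K & nm K M & nilm K M --> mp Q M = K)"

lemma relD: assumes "rel K N Q"
 shows "conn Q" "N<=Q" "Q<=K" "nilm Q N" "nrm Q Int K = Q"
  "!!Q'. conn Q'==>N<=Q'==>Q'<=K==>nilm Q' N==>dim (nrm Q' Int K) = dim Q'==>EX g:K. Q' = cj g ` Q"
  "dim (bad K Q)<dim Q" "dim (unc K Q)<dim K"
  "!!M. conn M==>N<=M==>M<=K==>nm K M==>nilm K M==>mp Q M = K"
proof -
 note a = assms[unfolded rel_def]
 have c: "ALL Q'. conn Q' & N<=Q' & Q'<=K & nilm Q' N & dim (nrm Q' Int K) = dim Q' --> (EX g:K. Q' = cj g ` Q)" using a by (elim conjE)
 have m: "ALL M. conn M & N<=M & M<=K & nm K M & nilm K M --> mp Q M = K" using a by (elim conjE)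
 show "conn Q" using a by (elim conjE)
 show "N<=Q" using a by (elim conjE)
 show "Q<=K" using a by (elim conjE)
 show "nilm Q N" using a by (elim conjE)
 show "nrm Q Int K = Q" using a by (elim conjE)
 show "dim (bad K Q)<dim Q" using a by (elim conjE)
 show "dim (unc K Q)<dim K" using a by (elim conjE)
 show "EX g:K. Q' = cj g ` Q" if "conn Q'" "N<=Q'" "Q'<=K" "nilm Q' N" "dim (nrm Q' Int K) = dim Q'" for Q'
  by (rule c[rule_format], intro conjI that)
 show "mp Q M = K" if "conn M" "N<=M" "M<=K" "nm K M" "nilm K M" for M
  by (rule m[rule_format], intro conjI that)
qed

abbreviation sg :: "'b set => 'b monoid" where "sg H == G(|carrier := H|)"

text \<open>The derived series need not consist of definable subgroups. This form says that no
  nontrivial definable section \<open>K/N\<close> is definably perfect; it passes to definable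
  subgroups and quotients and is all that is used of solvability in the induction.\<close>

definition solv :: bool where
 "solv <-> (ALL N K. dsub N & dsub K & N \<subset> K & nm K N --> (EX L. dsub L & N<=L & L \<subset> K & (ALL x:K. ALL y:K. cm x y:L)))"

definition DS :: "'b set => ((nat => 'b) => bool) => bool" where
 "DS H ph <-> (EX ps. D ps & (ALL e. range e<=H --> ph e = ps e))"

lemma DS_I: "D ps==>(!!e. range e<=H==>ph e = ps e)==>DS H ph" unfolding DS_def by blast

lemma DS_ds: assumes H: "dsub H" and X: "X<=H" "DS H (%e. e 0:X)" shows "ds X"
proof -
 note h = dsubD[OF H]
 obtain ps where ps: "D ps" "!!e. range e<=H==>(e 0:X) = ps e" using X(2) unfolding DS_def by blast
 have "D (%e. e 0:H & ps (%i. e 0))" by (rule D_conj[OF D_mem[OF h(2) T_var] D_rename[OF ps(1), of "%i. 0"]])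
 hence "D (%e. e 0:X)"
 proof (rule D_cong)
  fix e :: "nat => 'b"
  show "(e 0:H & ps (%i. e 0)) = (e 0:X)" using ps(2)[of "%i. e 0"] X(1) by auto
 qed
 thus ?thesis unfolding ds_def using X h by blast
qed

lemma sub_ranked_group: assumes H: "dsub H" shows "ranked_group (sg H) (DS H) dim"
proof -
 note h = dsubD[OF H]
 interpret S: group "sg H" by (rule subgroup.subgroup_is_group[OF h(1) is_group])
 note ds = DS_ds[OF H]
 have sc: "carrier (sg H) = H" "mult (sg H) = mult G" by simp_all
 show ?thesis
 proof (unfold_locales, simp_all only: sc)
  fix ph ps assume "DS H ph" "!!e. range e<=H==>ph e = ps e" thus "DS H ps" unfolding DS_def by auto
 next
  fix ph assume "DS H ph" thus "DS H (%e. ~ph e)" unfolding DS_def using D_not by blast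
 next
  fix ph ps assume "DS H ph" "DS H ps"
  then obtain ph' ps' where "D ph'" "D ps'" "!!e. range e<=H==>ph e = ph' e" "!!e. range e<=H==>ps e = ps' e" unfolding DS_def by blast
  thus "DS H (%e. ph e & ps e)" by (intro DS_I[OF D_conj]) auto
 next
  fix ph assume "DS H ph"
  then obtain ps where p: "D ps" "!!e. range e<=H==>ph e = ps e" unfolding DS_def by blast
  have "case_nat (e 0) (%i. e (Suc i)) = e" for e :: "nat => 'b" by (rule ext) (simp split: nat.split)
  hence "D (%e. EX x:H. ps (case_nat x e))" using D_bex[OF h(2), of "%x e. ps (case_nat x e)"] p(1) by simp
  thus "DS H (%e. EX x:H. ph (case_nat x e))"
  proof (rule DS_I)
   fix e :: "nat => 'b" assume e: "range e<=H"
   have "e i:H" for i using e by blast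
   hence "range (case_nat x e)<=H" if "x:H" for x using that by (auto split: nat.split)
   thus "(EX x:H. ph (case_nat x e)) = (EX x:H. ps (case_nat x e))" using p(2) by blast
  qed
 next
  fix ph f assume "DS H ph"
  then obtain ps where p: "D ps" "!!e. range e<=H==>ph e = ps e" unfolding DS_def by blast
  show "DS H (%e. ph (%i. e (f i)))" by (rule DS_I[OF D_rename[OF p(1), of f]]) (rule p(2), auto)
 next
  show "DS H (%e. e 0 = e 1 ** e 2)" by (rule DS_I[OF D_mult0]) simp
  show "DS H (%e. e 0 = e 1)" by (rule DS_I[OF D_eq0]) simp
  show "dim {} = -1" by (rule dim_empty)
 next
  fix c assume "c:H" thus "DS H (%e. e 0 = c)" using h by (intro DS_I[OF D_const0[of c]]) auto
 next
  fix X assume "X<=H" "DS H (%e. e 0:X)" "X~={}" thus "0<=dim X" using ds dim_pos by blast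
 next
  fix x assume "x:H" thus "dim {x} = 0" using dim_single h by blast
 next
  fix X Y assume "Y<=H" "DS H (%e. e 0:X)" "DS H (%e. e 0:Y)" "X<=Y"
  thus "dim X<=dim Y" using ds[of X] ds[of Y] dim_mono[of X Y] by simp
 next
  fix X Y assume "X<=H" "Y<=H" "DS H (%e. e 0:X)" "DS H (%e. e 0:Y)"
  thus "dim (X Un Y) = max (dim X) (dim Y)" using ds[of X] ds[of Y] dim_Un[of X Y] by simp
 next
  fix R X Y a b assume r: "DS H (%e. R (e 0) (e 1))" and xy: "X<=H" "Y<=H" "DS H (%e. e 0:X)" "DS H (%e. e 0:Y)" "X~={}" "0<=a"
   and ab: "!!x. x:X==>a<=dim {y:Y. R x y}" "!!y. y:Y==>dim {x:X. R x y}<=b"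
  obtain ps where ps: "D ps" "!!e. range e<=H==>R (e 0) (e 1) = ps e" using r unfolding DS_def by blast
  have "D (%e. e 0:H & e 1:H & ps (%i. e (if i = 0 then 0 else 1)))"
   by (rule D_conj[OF D_mem[OF h(2) T_var] D_conj[OF D_mem[OF h(2) T_var] D_rename[OF ps(1), of "%i. if i = 0 then 0 else 1"]]])
  hence R: "D (%e. e 0:H & e 1:H & R (e 0) (e 1))"
  proof (rule D_cong)
   fix e :: "nat => 'b"
   show "(e 0:H & e 1:H & ps (%i. e (if i = 0 then 0 else 1))) = (e 0:H & e 1:H & R (e 0) (e 1))"
    using ps(2)[of "%i. e (if i = 0 then 0 else 1)"] by (cases "e 0:H & e 1:H") (auto simp: image_subset_iff)
  qed
  have s: "{y:Y. x:H & y:H & R x y} = {y:Y. R x y}" if "x:X" for x using that xy by blast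
  have s': "{x:X. x:H & y:H & R x y} = {x:X. R x y}" if "y:Y" for y using that xy by blast
  show "dim X + a<=dim Y + b"
   by (rule double_count[OF R ds[OF xy(1,3)] ds[OF xy(2,4)] xy(5,6)]) (use s s' ab in simp_all)
 next
  fix L assume L: "subgroup L (sg H)" "DS H (%e. e 0:L)"
  have d: "dsub K" if K: "subgroup K (sg H)" "DS H (%e. e 0:K)" for K
  proof -
   have "K<=H" using subgroup.subset[OF K(1)] by simp
   thus ?thesis unfolding dsub_def using incl_subgroup[OF h(1) K(1)] ds K(2) by blast
  qed
  show "EX M. ALL K. subgroup K (sg H) & DS H (%e. e 0:K) & K<=L & dim K = dim L -->
    finite ((%h. (%k. h ** k) ` K) ` L) & card ((%h. (%k. h ** k) ` K) ` L)<=M"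
   using index[OF d[OF L]] d by blast
 qed
qed

lemma
 assumes H: "dsub H"
 shows sub_conn: "conn H==>ranked_group.conn (sg H) (DS H) dim H"
  and sub_solv: "solv==>ranked_group.solv (sg H) (DS H)"
  and sub_rel: "ranked_group.rel (sg H) (DS H) dim H {\<one>} Q==>rel H {\<one>} Q"
proof -
 note h = dsubD[OF H]
 interpret S: ranked_group "sg H" "DS H" dim by (rule sub_ranked_group[OF H])
 have inv: "inv\<^bsub>sg H\<^esub> x = inv x" if "x:H" for x using m_inv_consistent[OF h(1) that] .
 have ds: "S.ds X <-> ds X & X<=H" for X
 proof
  assume "S.ds X" thus "ds X & X<=H" using DS_ds[OF H] unfolding S.ds_def by simp
 next
  assume a: "ds X & X<=H"
  hence "D (%e. e 0:X)" unfolding ds_def by blast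
  thus "S.ds X" unfolding S.ds_def using a DS_I[of "%e. e 0:X" H] by simp
 qed
 have dsub: "S.dsub X <-> dsub X & X<=H" for X
 proof
  assume "S.dsub X" thus "dsub X & X<=H" unfolding dsub_def S.dsub_def ds using incl_subgroup[OF h(1)] by blast
 next
  assume "dsub X & X<=H" thus "S.dsub X" unfolding dsub_def S.dsub_def ds using subgroup_incl[OF _ h(1)] by blast
 qed
 have cj: "S.cj g x = cj g x" if "g:H" for g x using inv[OF that] unfolding S.cj_def cj_def by simp
 have cm: "S.cm g x = cm g x" if "g:H" "x:H" for g x using inv that unfolding S.cm_def cm_def by simp
 have conn: "S.conn X <-> conn X & X<=H" for X unfolding S.conn_def conn_def dsub by blast
 have nm: "S.nm K M = nm K M" if "K<=H" for K M using cj that unfolding S.nm_def nm_def by (simp add: subset_iff)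
 have U: "S.U K M i = U K M i" if "K<=H" for K M i
 proof (induction i)
  case (Suc i)
  have "S.cm x g = cm x g" if "x:K" "g:K" for x g using cm that \<open>K<=H\<close> by blast
  thus ?case using Suc by auto
 qed simp
 have nilm: "S.nilm K M = nilm K M" if "K<=H" for K M using U[OF that] unfolding S.nilm_def nilm_def by simp
 have cji: "S.cj g ` X = cj g ` X" if "g:H" for g X using cj[OF that] by simp
 have nrm: "S.nrm X = nrm X Int H" for X
 proof -
  have "(S.cj g ` X = X) = (cj g ` X = X)" if "g:H" for g using cji[OF that, of X] by (simp only:)
  moreover have "{g:H. p g} = {g:C. r g} Int H" if "!!g. g:H==>p g = r g" for p r using that h(3) by blast
  ultimately show ?thesis unfolding S.nrm_def nrm_def by simp
 qed
 have mp: "S.mp X Y = mp X Y" if "X<=H" "Y<=H" for X Y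
  unfolding S.mp_def mp_def using that h by (auto simp: subset_iff)
 show "conn H==>S.conn H" using conn by blast
 have solvI: "solv==>S.solv"
  unfolding S.solv_def
 proof (intro allI impI, elim conjE)
  fix M K assume s: solv and a: "S.dsub M" "S.dsub K" "M \<subset> K" "S.nm K M"
  have K: "K<=H" using a dsub by blast
  have "dsub M & dsub K & M \<subset> K & nm K M" using a nm[OF K, of M] dsub[of M] dsub[of K] by blast
  then obtain L where "dsub L" "M<=L" "L \<subset> K" "ALL x:K. ALL y:K. cm x y:L"
   using s[unfolded solv_def, rule_format, of M K] by blast
  thus "EX L. S.dsub L & M<=L & L \<subset> K & (ALL x:K. ALL y:K. S.cm x y:L)"
   using cm K dsub by (intro exI[of _ L]) (auto simp: subset_iff)
 qed
 thus "solv==>S.solv" .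
 assume r: "S.rel H {\<one>} Q"
 have QH: "Q<=H" using r unfolding S.rel_def by blast
 have e1: "S.bad H Q = bad H Q" and e2: "S.unc H Q = unc H Q" using cji by auto
 note r' = r[unfolded S.rel_def e1 e2 conn nrm, simplified]
 show "rel H {\<one>} Q" unfolding rel_def
  using r' nilm[OF QH] nilm nm[OF order_refl] nilm[OF order_refl] mp[OF QH] cji by auto
qed

end

subsection \<open>Definable quotients\<close>

locale quot = ranked_group G D dim for G :: "'b monoid" (structure) and D dim +
 fixes N :: "'b set" assumes dN: "dsub N" and nN: "nm C N"
begin

lemmas N = dsubD[OF dN]

text \<open>Representatives come from an arbitrary choice and their set need not be definable. That
  is harmless: \<open>DQ\<close> and \<open>dimQ\<close> refer to preimages in the group, and
  \<open>rep x\<close> depends only on the coset of x, since equivalent elements define the same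
  predicate under the choice operator.\<close>

definition rep :: "'b => 'b" where "rep x = (SOME y. y:C & inv y ** x:N)"
definition Q :: "'b monoid" where "Q = (|carrier = rep ` C, mult = (%x y. rep (x ** y)), one = rep \<one>|)"
definition DQ :: "((nat => 'b) => bool) => bool" where "DQ ph <-> D (%e. ph (%i. rep (e i)))"
definition pr :: "'b set => 'b set" where "pr X = {x:C. rep x:X}"
definition dimQ :: "'b set => int" where "dimQ X = (if X = {} then -1 else dim (pr X) - dim N)"

lemma Nc: "x:N==>x:C" using N by blast
lemma Ncj: "g:C==>x:N==>cj g x:N" using nN unfolding nm_def by blast

lemma N_sym: assumes "x:C" "y:C" "inv x ** y:N" shows "inv y ** x:N"
proof -
 have "inv (inv x ** y) = inv y ** x" using assms by (simp add: gsimps)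
 thus ?thesis using N(6)[OF assms(3)] by simp
qed

lemma N_trans: assumes "x:C" "y:C" "z:C" "inv x ** y:N" "inv y ** z:N" shows "inv x ** z:N"
proof -
 have "(inv x ** y) ** (inv y ** z) = inv x ** z" using assms by (simp add: gsimps)
 thus ?thesis using N(5)[OF assms(4,5)] by simp
qed

lemma rep: assumes "x:C" shows "rep x:C" "inv (rep x) ** x:N"
proof -
 have "x:C & inv x ** x:N" using assms N by simp
 from someI[of "%y. y:C & inv y ** x:N", OF this] show "rep x:C" "inv (rep x) ** x:N" unfolding rep_def by blast+
qed

lemma rep_eq: assumes "x:C" "y:C" shows "rep x = rep y <-> inv x ** y:N"
proof
 assume "rep x = rep y"
 thus "inv x ** y:N" using N_trans[of x "rep x" y] N_sym[of "rep x" x] rep[OF assms(1)] rep[OF assms(2)] assms by simp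
next
 assume a: "inv x ** y:N"
 have "(%z. z:C & inv z ** x:N) = (%z. z:C & inv z ** y:N)"
  using N_trans[of _ x y] N_trans[of _ y x] N_sym[OF assms a] a assms by blast
 thus "rep x = rep y" unfolding rep_def by simp
qed

lemma rep_rep: "x:C==>rep (rep x) = rep x" using rep_eq[of "rep x" x] rep by blast

lemma rep_mult: assumes "x:C" "y:C" shows "rep (rep x ** y) = rep (x ** y)" "rep (x ** rep y) = rep (x ** y)"
proof -
 note rx = rep[OF assms(1)] and ry = rep[OF assms(2)]
 have "inv (rep x ** y) ** (x ** y) = cj (inv y) (inv (rep x) ** x)" using assms rx(1) by (simp add: cj_def gsimps)
 thus "rep (rep x ** y) = rep (x ** y)" using rep_eq[of "rep x ** y" "x ** y"] Ncj[OF _ rx(2), of "inv y"] assms rx(1) by simp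
 have "inv (x ** rep y) ** (x ** y) = inv (rep y) ** y" using assms ry(1) by (simp add: gsimps)
 thus "rep (x ** rep y) = rep (x ** y)" using rep_eq[of "x ** rep y" "x ** y"] ry assms by simp
qed

lemma rep_mult2: "x:C==>y:C==>rep (rep x ** rep y) = rep (x ** y)" using rep_mult rep by simp

lemma Q_simps[simp]: "carrier Q = rep ` C" "mult Q = (%x y. rep (x ** y))" "one Q = rep \<one>" unfolding Q_def by simp_all

lemma QC_C: "x:rep ` C==>x:C" "x:rep ` C==>rep x = x" using rep rep_rep by auto

lemma QC_C': "x:carrier Q==>x:C" "x:carrier Q==>rep x = x" unfolding Q_simps by (fact QC_C)+

lemma group_Q: "group Q"
proof (rule groupI)
 fix x y assume "x:carrier Q" "y:carrier Q"
 hence "x:C" "y:C" using QC_C'(1) by blast+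
 thus "x \<otimes>\<^bsub>Q\<^esub> y:carrier Q" by simp
next
 fix x y z assume "x:carrier Q" "y:carrier Q" "z:carrier Q"
 hence "x:C" "y:C" "z:C" using QC_C'(1) by blast+
 thus "x \<otimes>\<^bsub>Q\<^esub> y \<otimes>\<^bsub>Q\<^esub> z = x \<otimes>\<^bsub>Q\<^esub> (y \<otimes>\<^bsub>Q\<^esub> z)" by (simp add: rep_mult m_assoc)
next
 fix x assume "x:carrier Q"
 hence x: "x:C" "rep x = x" using QC_C' by blast+
 thus "\<one>\<^bsub>Q\<^esub> \<otimes>\<^bsub>Q\<^esub> x = x" by (simp add: rep_mult)
 show "EX y:carrier Q. y \<otimes>\<^bsub>Q\<^esub> x = \<one>\<^bsub>Q\<^esub>" using x by (auto simp: rep_mult intro!: bexI[of _ "inv x"])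
qed simp

lemma ds_pr: "DQ (%e. e 0:X)==>ds (pr X)"
 unfolding DQ_def pr_def by (rule ds_Collect[OF ds_C])

lemma pr_ne: "X<=rep ` C==>X~={}==>pr X~={}" unfolding pr_def by blast

lemma pr_coset: assumes "x:C" "rep x = x" shows "pr {x} = (%k. x ** k) ` N"
proof (intro Set.set_eqI iffI)
 fix y assume y: "y:pr {x}"
 hence "inv x ** y:N" using rep_eq[of x y] assms unfolding pr_def by simp
 moreover have "y = x ** (inv x ** y)" using y assms unfolding pr_def by (simp add: gsimps)
 ultimately show "y:(%k. x ** k) ` N" by blast
next
 fix y assume "y:(%k. x ** k) ` N"
 then obtain k where k: "k:N" "y = x ** k" by blast
 thus "y:pr {x}" using rep_eq[of x y] assms Nc unfolding pr_def by (auto simp: gsimps)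
qed

lemma pr_dim: assumes "X<=rep ` C" "DQ (%e. e 0:X)" "X~={}" shows "dim N<=dim (pr X)"
proof -
 obtain x where x: "x:X" using assms by blast
 have xc: "x:C" "rep x = x" using QC_C[OF subsetD[OF assms(1) x]] .
 have "pr {x}<=pr X" unfolding pr_def using x by auto
 thus ?thesis using dim_mono[OF _ ds_pr[OF assms(2)], of "pr {x}"] pr_coset[OF xc] dim_translate[OF N(2) xc(1)] by simp
qed

lemma DQ_mult: "DQ (%e. e 0 = rep (e 1 ** e 2))" and DQ_eq: "DQ (%e. e 0 = e 1)"
 and DQ_const: "c:rep ` C==>DQ (%e. e 0 = c)"
proof -
 have "D (%e. inv (e 0) ** (e 1 ** e 2):N)" by (rule D_mem[OF N(2)], intro Dr)
 thus "DQ (%e. e 0 = rep (e 1 ** e 2))" unfolding DQ_def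
  by (rule D_cong) (simp add: rng rep_mult2 rep_eq)
 have "D (%e. inv (e 0) ** e 1:N)" by (rule D_mem[OF N(2)], intro Dr)
 thus "DQ (%e. e 0 = e 1)" unfolding DQ_def by (rule D_cong) (simp add: rng rep_eq)
 assume c: "c:rep ` C"
 have "D (%e. inv (e 0) ** c:N)" by (rule D_mem[OF N(2)], intro Dr) (rule QC_C(1)[OF c])
 thus "DQ (%e. e 0 = c)" unfolding DQ_def
 proof (rule D_cong)
  fix e :: "nat => 'b" assume "range e<=C"
  thus "(inv (e 0) ** c:N) = (rep (e 0) = c)" using rep_eq[of "e 0" c] QC_C[OF c] by (auto simp: rng)
 qed
qed

lemma DQ_rel: assumes "DQ (%e. R (e 0) (e 1))" shows "D (%e. R (rep (e 0)) (rep (e 1)))"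
 using assms unfolding DQ_def .

lemma pr_sub: "X<=rep ` C==>rep ` pr X = X"
 unfolding pr_def by auto

lemma pr_subgroup: assumes "subgroup X Q" "DQ (%e. e 0:X)" shows "dsub (pr X)" "N<=pr X" "X<=rep ` C"
proof -
 interpret q: group Q by (rule group_Q)
 note s = subgroup.subset[OF assms(1)] subgroup.one_closed[OF assms(1)] subgroup.m_closed[OF assms(1)] subgroup.m_inv_closed[OF assms(1)]
 show X: "X<=rep ` C" using s(1) by simp
 have inv: "inv\<^bsub>Q\<^esub> (rep x) = rep (inv x)" if "x:C" for x
  by (rule q.inv_equality) (use that in "simp_all add: rep_mult2")
 show "dsub (pr X)"
 proof (rule dsubI)
  show "ds (pr X)" by (rule ds_pr[OF assms(2)])
  show "\<one>:pr X" unfolding pr_def using s(2) by simp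
 next
  fix x assume x: "x:pr X"
  thus "inv x:pr X" using s(4)[of "rep x"] inv[of x] unfolding pr_def by simp
  fix y assume "y:pr X"
  thus "x ** y:pr X" using x s(3)[of "rep x" "rep y"] unfolding pr_def by (simp add: rep_mult2)
 qed
 show "N<=pr X"
 proof
  fix x assume x: "x:N"
  have "rep x = rep \<one>" using rep_eq[of \<one> x] x Nc by simp
  thus "x:pr X" unfolding pr_def using s(2) x Nc by simp
 qed
qed

lemma quot_ranked_group: "ranked_group Q DQ dimQ"
proof -
 interpret q: group Q by (rule group_Q)
 have nn: "0<=dim N" by (rule dsub_dim[OF dN])
 show ?thesis
 proof (unfold_locales, simp_all only: Q_simps)
  fix ph ps assume a: "DQ ph" "!!e. range e<=rep ` C==>ph e = ps e"
  show "DQ ps" unfolding DQ_def by (rule D_cong[OF a(1)[unfolded DQ_def]]) (rule a(2), auto)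
 next
  fix ph ps assume "DQ ph" "DQ ps" thus "DQ (%e. ph e & ps e)" unfolding DQ_def by (rule D_conj)
 next
  fix ph assume p: "DQ ph"
  thus "DQ (%e. ~ph e)" unfolding DQ_def by (rule D_not)
  have *: "(%i. rep (case_nat x e i)) = case_nat (rep x) (%i. rep (e i))" for x e by (rule ext) (simp split: nat.split)
  have "D (%e. EX x:C. ph (%i. rep (case_nat x e i)))" using D_ex0[OF p[unfolded DQ_def]] .
  thus "DQ (%e. EX x:rep ` C. ph (case_nat x e))" unfolding DQ_def * by simp
  fix f
  show "DQ (%e. ph (%i. e (f i)))" using D_rename[OF p[unfolded DQ_def], of f] unfolding DQ_def .
 next
  show "DQ (%e. e 0 = rep (e 1 ** e 2))" by (rule DQ_mult)
  show "DQ (%e. e 0 = e 1)" by (rule DQ_eq)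
  show "dimQ {} = -1" unfolding dimQ_def by simp
 next
  fix c assume "c:rep ` C" thus "DQ (%e. e 0 = c)" by (rule DQ_const)
 next
  fix X assume "X<=rep ` C" "DQ (%e. e 0:X)" "X~={}" thus "0<=dimQ X" using pr_dim[of X] unfolding dimQ_def by simp
 next
  fix x assume "x:rep ` C" thus "dimQ {x} = 0"
   using pr_coset[OF QC_C] dim_translate(2)[OF N(2) QC_C(1)] unfolding dimQ_def by simp
 next
  fix X Y assume a: "Y<=rep ` C" "DQ (%e. e 0:X)" "DQ (%e. e 0:Y)" "X<=Y"
  have "pr X<=pr Y" using a unfolding pr_def by blast
  thus "dimQ X<=dimQ Y" using dim_mono[OF ds_pr[OF a(2)] ds_pr[OF a(3)]] pr_dim[OF a(1,3)] a(4) unfolding dimQ_def by (cases "X = {}"; cases "Y = {}") auto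
 next
  fix X Y assume a: "X<=rep ` C" "Y<=rep ` C" "DQ (%e. e 0:X)" "DQ (%e. e 0:Y)"
  have "pr (X Un Y) = pr X Un pr Y" unfolding pr_def by blast
  thus "dimQ (X Un Y) = max (dimQ X) (dimQ Y)"
   using dim_Un[OF ds_pr[OF a(3)] ds_pr[OF a(4)]] pr_dim[OF a(1,3)] pr_dim[OF a(2,4)] unfolding dimQ_def by (cases "X = {}"; cases "Y = {}") auto
 next
  fix R X Y a b assume r: "DQ (%e. R (e 0) (e 1))" and xy: "X<=rep ` C" "Y<=rep ` C" "DQ (%e. e 0:X)" "DQ (%e. e 0:Y)" "X~={}" "0<=a"
   and ab: "!!x. x:X==>a<=dimQ {y:Y. R x y}" "!!y. y:Y==>dimQ {x:X. R x y}<=b"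
  have Yne: "Y~={}"
  proof
   assume "Y = {}"
   obtain x where "x:X" using xy by blast
   thus False using ab(1)[of x] xy(6) \<open>Y = {}\<close> unfolding dimQ_def by simp
  qed
  have s: "{y:pr Y. R (rep x) (rep y)} = pr {y:Y. R (rep x) y}" "{z:pr X. R (rep z) (rep x)} = pr {z:X. R z (rep x)}" for x
   unfolding pr_def by auto
  \<comment> \<open>Preimages add \<open>dim N\<close> to each of the four terms.\<close>
  have "dim (pr X) + (a + dim N)<=dim (pr Y) + (b + dim N)"
  proof (rule double_count[OF DQ_rel[OF r] ds_pr[OF xy(3)] ds_pr[OF xy(4)] pr_ne[OF xy(1,5)]])
   show "0<=a + dim N" using xy nn by simp
   fix x assume "x:pr X"
   hence "a<=dimQ {y:Y. R (rep x) y}" using ab(1) unfolding pr_def by blast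
   thus "a + dim N<=dim {y:pr Y. R (rep x) (rep y)}" unfolding s dimQ_def using xy(6) by (simp split: if_splits)
  next
   fix y assume "y:pr Y"
   hence b: "dimQ {x:X. R x (rep y)}<=b" using ab(2) unfolding pr_def by blast
   show "dim {x:pr X. R (rep x) (rep y)}<=b + dim N"
   proof (cases "{x:X. R x (rep y)} = {}")
    case True
    hence "-1<=b" "pr {x:X. R x (rep y)} = {}" using b unfolding dimQ_def pr_def by (simp, blast)
    thus ?thesis unfolding s using dim_empty nn by simp
   next
    case False thus ?thesis using b unfolding s dimQ_def by (simp split: if_splits)
   qed
  qed
  thus "dimQ X + a<=dimQ Y + b" unfolding dimQ_def using xy(5) Yne by simp
 next
  fix H assume H: "subgroup H Q" "DQ (%e. e 0:H)"
  note h = pr_subgroup[OF H]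
  obtain M where M: "!!K. dsub K==>K<=pr H==>dim K = dim (pr H)==>finite (lcosets K (pr H)) & card (lcosets K (pr H))<=M"
   using index[OF h(1)] by blast
  show "EX M. ALL K. subgroup K Q & DQ (%e. e 0:K) & K<=H & dimQ K = dimQ H -->
    finite ((%h. (%k. rep (h ** k)) ` K) ` H) & card ((%h. (%k. rep (h ** k)) ` K) ` H)<=M"
  proof (intro exI[of _ M] allI impI, elim conjE)
   fix K assume K: "subgroup K Q" "DQ (%e. e 0:K)" "K<=H" "dimQ K = dimQ H"
   note k = pr_subgroup[OF K(1,2)]
   have ne: "K~={}" "H~={}" using subgroup.one_closed[OF K(1)] K(3) by auto
   have "dim (pr K) = dim (pr H)" "pr K<=pr H" using K(3,4) ne unfolding dimQ_def pr_def by auto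
   hence f: "finite (lcosets (pr K) (pr H))" "card (lcosets (pr K) (pr H))<=M" using M[OF k(1)] by blast+
   define E F where "E = (%h. (%k. h ** k) ` pr K)" and "F = (%h. (%k. rep (h ** k)) ` K)"
   have EF: "rep ` E h = F (rep h)" if hh: "h:pr H" for h
   proof -
    have hc: "h:C" using hh unfolding pr_def by blast
    have "rep ` (%k. h ** k) ` pr K = (%k. rep (rep h ** rep k)) ` pr K" unfolding image_image
     by (rule image_cong) (use hc in "auto simp: rep_mult2 pr_def")
    also have "... = (%k. rep (rep h ** k)) ` rep ` pr K" by (simp only: image_image)
    finally show ?thesis using pr_sub[OF k(3)] unfolding E_def F_def by simp
   qed
   have "F ` rep ` pr H = (%X. rep ` X) ` E ` pr H" unfolding image_image by (rule image_cong) (use EF in auto)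
   hence e: "(%h. (%k. rep (h ** k)) ` K) ` H = (%X. rep ` X) ` lcosets (pr K) (pr H)"
    using pr_sub[OF h(3)] unfolding E_def F_def by simp
   show "finite ((%h. (%k. rep (h ** k)) ` K) ` H) & card ((%h. (%k. rep (h ** k)) ` K) ` H)<=M"
    unfolding e using f card_image_le[OF f(1), of "%X. rep ` X"] by (meson finite_imageI order_trans)
  qed
 qed
qed

end

section \<open>Transfer of subgroups, normalizers and central series to the quotient\<close>

context quot
begin

interpretation q: ranked_group Q DQ dimQ by (rule quot_ranked_group)

lemma inv_Q: "x:C==>inv\<^bsub>Q\<^esub> (rep x) = rep (inv x)"
 by (rule q.inv_equality) (simp_all add: rep_mult2)

lemma cj_Q: "g:C==>x:C==>q.cj (rep g) (rep x) = rep (cj g x)"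
 unfolding q.cj_def cj_def by (simp add: inv_Q rep_mult2)

lemma cm_Q: "g:C==>x:C==>q.cm (rep g) (rep x) = rep (cm g x)"
 unfolding q.cm_def cm_def by (simp add: inv_Q rep_mult2)

lemma cj_img_Q: assumes "g:C" "L<=C" shows "q.cj (rep g) ` rep ` L = rep ` cj g ` L"
 unfolding image_image by (rule image_cong) (use assms cj_Q in auto)

lemma mem: assumes "dsub L" "N<=L" "x:C" shows "rep x:rep ` L <-> x:L"
proof
 note l = dsubD[OF assms(1)]
 assume "rep x:rep ` L"
 then obtain y where y: "y:L" "rep x = rep y" by blast
 hence "inv y ** x:L" using rep_eq[of y x] assms l by auto
 hence "y ** (inv y ** x):L" using y l by blast
 thus "x:L" using y l assms by (auto simp: r_cancel_inv)
qed simp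

lemma pr_rep: assumes "dsub L" "N<=L" shows "pr (rep ` L) = L"
 using mem[OF assms] dsubD(3)[OF assms(1)] unfolding pr_def by blast

lemma rep_inj: "dsub L==>N<=L==>dsub M==>N<=M==>rep ` L = rep ` M==>L = M"
 using pr_rep by metis

lemma dsub_pr: assumes "q.dsub X" shows "dsub (pr X)" "N<=pr X" "X<=rep ` C" "rep ` pr X = X"
proof -
 have s: "subgroup X Q" "DQ (%e. e 0:X)" using assms unfolding q.dsub_def q.ds_def by blast+
 show "dsub (pr X)" "N<=pr X" "X<=rep ` C" "rep ` pr X = X" using pr_subgroup[OF s] pr_sub by blast+
qed

lemma dsub_rep: assumes "dsub L" "N<=L" shows "q.dsub (rep ` L)"
proof (rule q.dsubI)
 note l = dsubD[OF assms(1)]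
 have "D (%e. e 0:L)" using l(2) unfolding ds_def by blast
 hence "D (%e. rep (e 0):rep ` L)" by (rule D_cong) (use mem[OF assms] rng in auto)
 thus "q.ds (rep ` L)" unfolding q.ds_def DQ_def using l(3) by auto
 show "\<one>\<^bsub>Q\<^esub>:rep ` L" using l by simp
next
 note l = dsubD[OF assms(1)]
 fix x assume "x:rep ` L"
 then obtain a where a: "a:L" "x = rep a" by blast
 have ac: "a:C" using a l by blast
 show "inv\<^bsub>Q\<^esub> x:rep ` L" using a ac l inv_Q by simp
 fix y assume "y:rep ` L"
 then obtain b where b: "b:L" "y = rep b" by blast
 have bc: "b:C" using b l by blast
 show "x \<otimes>\<^bsub>Q\<^esub> y:rep ` L" using a b ac bc l by (simp add: rep_mult2)
qed

lemma dim_rep: assumes "dsub L" "N<=L" shows "dimQ (rep ` L) = dim L - dim N"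
 unfolding dimQ_def using pr_rep[OF assms] dsubD(4)[OF assms(1)] by auto

lemma dim_less: assumes "dsub L" "N<=L" "dimQ X<dimQ (rep ` L)" shows "dim (pr X)<dim L"
proof (cases "X = {}")
 case True thus ?thesis using dim_empty dsub_dim[OF assms(1)] unfolding pr_def by simp
next
 case False thus ?thesis using assms(3) unfolding dim_rep[OF assms(1,2)] by (simp add: dimQ_def)
qed

lemma conn_rep: assumes "conn L" "N<=L" shows "q.conn (rep ` L)"
 unfolding q.conn_def
proof (intro conjI allI impI; (elim conjE)?)
 have L: "dsub L" using assms conn_dsub by blast
 show "q.dsub (rep ` L)" by (rule dsub_rep[OF L assms(2)])
 fix K assume K: "q.dsub K" "K<=rep ` L" "dimQ K = dimQ (rep ` L)"
 note k = dsub_pr[OF K(1)]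
 have "pr K<=L" using K(2) pr_rep[OF L assms(2)] unfolding pr_def by blast
 moreover have "dim (pr K) = dim L" using K(3) dim_rep[OF L assms(2)] dim_rep[OF k(1,2)] k(4) by simp
 ultimately have "pr K = L" using connD[OF assms(1) k(1)] by blast
 thus "K = rep ` L" using k(4) by simp
qed

text \<open>Because \<open>N\<close> is connected, it lies in the connected component of the
  preimage; so the image of that component has full dimension in \<open>X\<close>.\<close>

lemma conn_pr: assumes "conn N" "q.conn X" shows "conn (pr X)"
proof -
 note x = dsub_pr[OF q.conn_dsub[OF assms(2)]]
 note c = cc[OF x(1)]
 have n: "N<=cc (pr X)" by (rule conn_sub_cc[OF assms(1) x(1,2)])
 have "rep ` cc (pr X)<=X" using c(2) x(4) by blast
 moreover have "dimQ (rep ` cc (pr X)) = dimQ X" using dim_rep[OF conn_dsub[OF c(1)] n] dim_rep[OF x(1,2)] c(3) x(4) by simp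
 ultimately have "rep ` cc (pr X) = X" using q.connD[OF assms(2) dsub_rep[OF conn_dsub[OF c(1)] n]] by blast
 hence "cc (pr X) = pr X" using pr_rep[OF conn_dsub[OF c(1)] n] by simp
 thus ?thesis using c(1) by simp
qed

lemma nm_Q: assumes "dsub K" "dsub M" "N<=M" shows "q.nm (rep ` K) (rep ` M) <-> nm K M"
proof -
 have "q.cj (rep k) (rep x):rep ` M <-> cj k x:M" if "k:K" "x:M" for k x
 proof -
  have "k:C" "x:C" using that dsubD(3)[OF assms(1)] dsubD(3)[OF assms(2)] by auto
  thus ?thesis using cj_Q mem[OF assms(2,3)] by simp
 qed
 thus ?thesis unfolding q.nm_def nm_def by auto
qed

lemma U_Q: assumes K: "dsub K" and M: "dsub M" "M<=K" "nm K M" "N<=M" shows "q.U (rep ` K) (rep ` M) i = rep ` U K M i"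
proof (induction i)
 case (Suc i)
 have u: "dsub (U K M i)" "N<=U K M i" using U_facts[OF K M(1-3)] U_chain[OF K M(1-3), of 0 i] M(4) by auto
 have *: "q.cm (rep x) (rep g):rep ` U K M i <-> cm x g:U K M i" if "x:K" "g:K" for x g
 proof -
  have "x:C" "g:C" using that dsubD(3)[OF K] by auto
  thus ?thesis using cm_Q mem[OF u] by simp
 qed
 show ?case unfolding q.U.simps U.simps Suc
 proof (intro Set.set_eqI iffI)
  fix x assume "x:{x:rep ` K. ALL g:rep ` K. q.cm x g:rep ` U K M i}"
  then obtain y where "y:K" "x = rep y" "ALL g:K. q.cm (rep y) (rep g):rep ` U K M i" by blast
  thus "x:rep ` {x:K. ALL g:K. cm x g:U K M i}" using * by blast
 next
  fix x assume "x:rep ` {x:K. ALL g:K. cm x g:U K M i}"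
  thus "x:{x:rep ` K. ALL g:rep ` K. q.cm x g:rep ` U K M i}" using * by auto
 qed
qed simp

lemma nilm_Q: assumes K: "dsub K" and M: "dsub M" "M<=K" "nm K M" "N<=M" shows "q.nilm (rep ` K) (rep ` M) <-> nilm K M"
proof -
 have "rep ` K<=rep ` U K M i <-> K<=U K M i" for i
 proof -
  have u: "dsub (U K M i)" "N<=U K M i" using U_facts[OF K M(1-3)] U_chain[OF K M(1-3), of 0 i] M(4) by auto
  show ?thesis using mem[OF u] dsubD(3)[OF K] by blast
 qed
 thus ?thesis unfolding q.nilm_def nilm_def U_Q[OF assms] by simp
qed

lemma N_cj: assumes "dsub L" "N<=L" "g:C" shows "dsub (cj g ` L)" "N<=cj g ` L"
proof -
 show "dsub (cj g ` L)" by (rule dsub_cj[OF assms(1,3)])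
 show "N<=cj g ` L"
 proof
  fix x assume x: "x:N"
  hence "cj (inv g) x:L" "x = cj g (cj (inv g) x)" using Ncj[of "inv g" x] assms Nc by auto
  thus "x:cj g ` L" by blast
 qed
qed

lemma nrm_Q: assumes "dsub L" "N<=L" shows "q.nrm (rep ` L) = rep ` nrm L"
proof -
 have LC: "L<=C" using dsubD(3)[OF assms(1)] .
 have 1: "q.cj (rep g) ` rep ` L = rep ` L <-> cj g ` L = L" if "g:C" for g
  unfolding cj_img_Q[OF that LC] using rep_inj[OF N_cj[OF assms that] assms] by auto
 have 2: "{g:rep ` C. p g} = rep ` {g:C. r g}" if "!!g. g:C==>p (rep g) = r g" for p r using that by auto
 show ?thesis unfolding q.nrm_def nrm_def Q_simps by (rule 2, rule 1)
qed

lemma mp_Q: assumes "K<=C" "M<=C" shows "q.mp (rep ` K) (rep ` M) = rep ` mp K M"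
proof (intro Set.set_eqI iffI)
 fix x assume "x:q.mp (rep ` K) (rep ` M)"
 then obtain k m where km: "k:K" "m:M" "x = rep (rep k ** rep m)" unfolding q.mp_def by auto
 hence "x = rep (k ** m)" using assms by (auto simp: rep_mult2 subset_iff)
 thus "x:rep ` mp K M" using mpI[OF km(1,2) assms] by blast
next
 fix x assume "x:rep ` mp K M"
 then obtain k m where km: "k:K" "m:M" "x = rep (k ** m)" unfolding mp_def by blast
 have kc: "k:C" "m:C" using km assms by auto
 hence "x = rep (rep k ** rep m)" "x:rep ` C" using km rep_mult2 by auto
 thus "x:q.mp (rep ` K) (rep ` M)" unfolding q.mp_def Q_simps using km by blast
qed

lemma rep_N: "rep ` N = {rep \<one>}"
proof -
 have "rep x = rep \<one>" if "x:N" for x using rep_eq[of \<one> x] Nc[OF that] that by simp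
 hence "rep ` N<={rep \<one>}" by blast
 thus ?thesis using imageI[OF N(4), of rep] by blast
qed

lemma quot_conn: "conn C==>q.conn (rep ` C)" by (rule conn_rep[OF _ N(3)])

lemma quot_dim: "dimQ (rep ` C) = dim C - dim N" by (rule dim_rep[OF dsub_C N(3)])

lemma quot_solv: assumes solv shows "q.solv"
 unfolding q.solv_def
proof (intro allI impI, elim conjE)
 fix M K assume a: "q.dsub M" "q.dsub K" "M \<subset> K" "q.nm K M"
 note m = dsub_pr[OF a(1)] and k = dsub_pr[OF a(2)]
 have "nm (pr K) (pr M)" using nm_Q[OF k(1) m(1,2)] a(4) m(4) k(4) by simp
 moreover have "pr M<=pr K" using a(3) unfolding pr_def by blast
 moreover have "pr M~=pr K"
 proof
  assume "pr M = pr K"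
  hence "rep ` pr M = rep ` pr K" by (rule arg_cong)
  thus False using m(4) k(4) a(3) by simp
 qed
 ultimately obtain L where L: "dsub L" "pr M<=L" "L \<subset> pr K" "ALL x:pr K. ALL y:pr K. cm x y:L"
  using assms[unfolded solv_def, rule_format, of "pr M" "pr K"] m(1) k(1) by blast
 have NL: "N<=L" using L m by blast
 show "EX L. q.dsub L & M<=L & L \<subset> K & (ALL x:K. ALL y:K. q.cm x y:L)"
 proof (rule exI[of _ "rep ` L"], intro conjI ballI)
  show "q.dsub (rep ` L)" by (rule dsub_rep[OF L(1) NL])
  show "M<=rep ` L" using m(4) L(2) by blast
  show "rep ` L \<subset> K" using k L(3) rep_inj[OF L(1) NL k(1,2)] by blast
  fix x y assume "x:K" "y:K"
  then obtain x' y' where xy: "x':pr K" "y':pr K" "x = rep x'" "y = rep y'" using k(4) by blast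
  thus "q.cm x y:rep ` L" using cm_Q[of x' y'] L(4) unfolding pr_def by auto
 qed
qed

text \<open>This is why \<open>rel\<close> carries \<open>N\<close>: each clause for the trivial
  subgroup of the quotient has a literal preimage in the group.\<close>

lemma quot_rel: assumes cN: "conn N" and r: "q.rel (rep ` C) {rep \<one>} X" shows "rel C N (pr X)"
proof -
 note X = q.relD(1,4,5)[OF r] and cj = q.relD(6)[OF r] and d1 = q.relD(7)[OF r] and d2 = q.relD(8)[OF r] and sp = q.relD(9)[OF r]
 define L where "L = pr X"
 note x = dsub_pr[OF q.conn_dsub[OF X(1)], folded L_def]
 have cL: "conn L" unfolding L_def by (rule conn_pr[OF cN X(1)])
 have LC: "L<=C" using dsubD(3)[OF x(1)] .
 have nmN: "nm K N" if "K<=C" for K using nN that unfolding nm_def by blast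
 have one: "{rep \<one>}<=rep ` K" if "N<=K" for K using that N(4) by blast
 have cji: "q.cj (rep g) ` X = rep ` cj g ` L" if "g:C" for g using cj_img_Q[OF that LC] x(4) by simp
 have eqs: "rep x:rep ` cj g ` L <-> x:cj g ` L" "rep ` cj g ` L = X <-> cj g ` L = L" if "g:C" "x:C" for g x
 proof -
  show "rep x:rep ` cj g ` L <-> x:cj g ` L" by (rule mem[OF N_cj[OF x(1,2) that(1)] that(2)])
  show "rep ` cj g ` L = X <-> cj g ` L = L" using rep_inj[OF N_cj[OF x(1,2) that(1)] x(1,2)] x(4) by auto
 qed
 have "rel C N L" unfolding rel_def
 proof (intro conjI allI impI; (elim conjE)?)
  show "conn L" "N<=L" "L<=C" by fact+
  show "nilm L N" using nilm_Q[OF x(1) dN x(2) nmN[OF LC] order_refl] X(2) x(4) rep_N by simp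
  have "q.nrm X = rep ` nrm L" using nrm_Q[OF x(1,2)] x(4) by simp
  moreover have "q.nrm X = X" using X(3) unfolding q.nrm_def by auto
  ultimately have "nrm L = L" using rep_inj[OF nrm_dsub(1)[OF x(1)] _ x(1,2)] nrm_dsub(2)[OF x(1)] x(2,4) by auto
  thus "nrm L Int C = L" using LC by blast
 next
  fix L' assume L': "conn L'" "N<=L'" "L'<=C" "nilm L' N" "dim (nrm L' Int C) = dim L'"
  note l = conn_dsub[OF L'(1)] and m = nrm_dsub[OF conn_dsub[OF L'(1)]]
  have Nm: "N<=nrm L'" using m(2) L'(2) by blast
  have e: "nrm L' Int C = nrm L'" "rep ` nrm L' Int rep ` C = rep ` nrm L'" using dsubD(3)[OF m(1)] by auto
  have "EX g:rep ` C. rep ` L' = q.cj g ` X"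
  proof (rule cj[OF conn_rep[OF L'(1,2)] one[OF L'(2)]])
   show "rep ` L'<=rep ` C" using L'(3) by blast
   show "q.nilm (rep ` L') {rep \<one>}" using nilm_Q[OF l dN L'(2) nmN[OF L'(3)] order_refl] L'(4) rep_N by simp
   show "dimQ (q.nrm (rep ` L') Int rep ` C) = dimQ (rep ` L')"
    using nrm_Q[OF l L'(2)] e dim_rep[OF m(1) Nm] dim_rep[OF l L'(2)] L'(5) by simp
  qed
  then obtain g where g: "g:C" "rep ` L' = q.cj (rep g) ` X" by blast
  hence "rep ` L' = rep ` cj g ` L" using cji by simp
  hence "L' = cj g ` L" using rep_inj[OF l L'(2) N_cj[OF x(1,2) g(1)]] by blast
  thus "EX g:C. L' = cj g ` L" using g by blast
 next
  have "bad C L = pr (q.bad (rep ` C) X)"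
  proof (intro Set.set_eqI)
   fix y
   show "y:bad C L <-> y:pr (q.bad (rep ` C) X)"
   proof (cases "y:C")
    case True
    have "y:L <-> rep y:X" using True unfolding L_def pr_def by simp
    moreover have "(EX g:rep ` C. rep y:q.cj g ` X & q.cj g ` X~=X) <-> (EX g:C. y:cj g ` L & cj g ` L~=L)"
     using eqs[OF _ True] cji by (simp add: bex_simps cong: bex_cong)
    ultimately show ?thesis unfolding pr_def using True by simp
   next
    case False thus ?thesis unfolding pr_def using LC by blast
   qed
  qed
  thus "dim (bad C L)<dim L" using dim_less[OF x(1,2)] d1 x(4) by simp
 next
  have "unc C L = pr (q.unc (rep ` C) X)"
  proof (intro Set.set_eqI)
   fix y
   show "y:unc C L <-> y:pr (q.unc (rep ` C) X)"
   proof (cases "y:C")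
    case True
    have "(ALL g:rep ` C. rep y~:q.cj g ` X) <-> (ALL g:C. y~:cj g ` L)" using eqs(1)[OF _ True] cji by (simp cong: ball_cong)
    thus ?thesis unfolding pr_def using True by simp
   qed (simp add: pr_def)
  qed
  thus "dim (unc C L)<dim C" using dim_less[OF dsub_C N(3) d2] by simp
 next
  fix M assume M: "conn M" "N<=M" "M<=C" "nm C M" "nilm C M"
  note m = conn_dsub[OF M(1)]
  have "q.mp X (rep ` M) = rep ` C"
  proof (rule sp[OF conn_rep[OF M(1,2)] one[OF M(2)]])
   show "rep ` M<=rep ` C" using M(3) by blast
   show "q.nm (rep ` C) (rep ` M)" using nm_Q[OF dsub_C m M(2)] M(4) by blast
   show "q.nilm (rep ` C) (rep ` M)" using nilm_Q[OF dsub_C m M(3,4,2)] M(5) by blast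
  qed
  hence e: "rep ` mp L M = rep ` C" using mp_Q[OF LC M(3)] x(4) by simp
  have "nm L M" using M(4) LC unfolding nm_def by blast
  hence d: "dsub (mp L M)" "N<=mp L M" using mp_dsub[OF x(1) m] mp_sub(1)[OF x(1) m] x(2) by auto
  show "mp L M = C" by (rule rep_inj[OF d dsub_C N(3) e])
 qed
 thus ?thesis unfolding L_def .
qed

end

subsection \<open>Carter subgroups\<close>

context ranked_group
begin

lemma cj_mem: assumes "X<=C" "g:C" "y:C" shows "y:cj g ` X <-> cj (inv g) y:X"
proof
 assume "y:cj g ` X" thus "cj (inv g) y:X" using assms by auto
next
 assume a: "cj (inv g) y:X"
 have "y = cj g (cj (inv g) y)" using assms by simp
 thus "y:cj g ` X" using a by blast
qed

lemma cj_img: "X<=C==>g:C==>h:C==>cj g ` cj h ` X = cj (g ** h) ` X"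
 unfolding image_image by (rule image_cong) (auto simp: cj_cj)

lemma cj_img_one: assumes "X<=C" shows "cj \<one> ` X = X"
proof -
 have "cj \<one> ` X = id ` X" by (rule image_cong) (use assms in auto)
 thus ?thesis by simp
qed

lemma cj_img_inv: assumes "X<=C" "g:C" shows "cj (inv g) ` cj g ` X = X" "cj g ` cj (inv g) ` X = X"
 using cj_img[OF assms(1), of "inv g" g] cj_img[OF assms(1), of g "inv g"] cj_img_one[OF assms(1)] assms by simp_all

lemma cj_img_eq: assumes "Y<=C" "g:C" "X = cj g ` Y" shows "Y = cj (inv g) ` X"
 using cj_img_inv[OF assms(1,2)] assms(3) by simp

lemma nrm_C: "nrm Q<=C" unfolding nrm_def by blast

text \<open>The condition on conjugates as sets becomes first order through membership of g in the
  normalizer, which is a definable subgroup.\<close>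

lemma ds_bad: assumes Q: "dsub Q" and K: "ds K" shows "ds (bad K Q)"
proof -
 note q = dsubD[OF Q]
 have KC: "K<=C" using K unfolding ds_def by blast
 have "ds {x:Q. EX g:K. cj (inv g) x:Q & ~g:nrm Q}"
  by (rule ds_Collect[OF q(2)], rule D_bex[OF K], rule D_conj[OF D_mem[OF q(2)] D_not[OF D_mem[OF dsubD(2)[OF nrm_dsub(1)[OF Q]]]]])
    (intro T_cj T_inv T_var)+
 moreover have "{x:Q. EX g:K. cj (inv g) x:Q & ~g:nrm Q} = bad K Q"
  using cj_mem[OF q(3)] KC q(3) unfolding nrm_def by blast
 ultimately show ?thesis by simp
qed

lemma ds_uncovered: assumes Q: "dsub Q" and K: "ds K" shows "ds (unc K Q)"
proof -
 note q = dsubD[OF Q]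
 have KC: "K<=C" using K unfolding ds_def by blast
 have "ds {x:K. ALL g:K. ~cj (inv g) x:Q}"
  by (rule ds_Collect[OF K], rule D_ball[OF K], rule D_not[OF D_mem[OF q(2)]]) (intro T_cj T_inv T_var)
 moreover have "{x:K. ALL g:K. ~cj (inv g) x:Q} = unc K Q" using cj_mem[OF q(3)] KC by blast
 ultimately show ?thesis by simp
qed

text \<open>\<open>Y\<close> is a union of cosets of \<open>A\<close> and is small compared with
  \<open>QA\<close>. Counting along these cosets shows that \<open>Q\<close>, which meets almost all
  cosets in \<open>QA\<close> equally, meets \<open>Y\<close> in a small set.\<close>

lemma slice:
 assumes Q: "dsub Q" and A: "dsub A" and Y: "ds Y" "!!y a. y:Y==>a:A==>y ** a:Y" and d: "dim Y<dim (mp Q A)"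
 shows "dim (Q Int Y)<dim Q"
proof (cases "Q Int Y = {}")
 case True thus ?thesis using dim_empty dsub_dim[OF Q] by simp
next
 case False
 note q = dsubD[OF Q] and a = dsubD[OF A]
 have YC: "Y<=C" using Y unfolding ds_def by blast
 have R: "D (%e. inv (e 0) ** e 1:A)" by (rule D_mem[OF a(2)], intro Dr)
 have "dim (Q Int Y) + dim A<=dim Y + dim (Q Int A)"
 proof (rule double_count[OF R ds_Int[OF q(2) Y(1)] Y(1) False dsub_dim[OF A]])
  fix x assume x: "x:Q Int Y"
  have xc: "x:C" using x q by blast
  have "(%k. x ** k) ` A<={y:Y. inv x ** y:A}" using x xc a Y(2) by (auto simp: l_cancel_inv subset_iff)
  moreover have "ds {y:Y. inv x ** y:A}" by (rule ds_Collect[OF Y(1)], rule D_mem[OF a(2)], intro T_mult T_const T_var inv_closed xc)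
  ultimately show "dim A<=dim {y:Y. inv x ** y:A}" using dim_translate[OF a(2) xc] dim_mono by metis
 next
  fix y assume "y:Y"
  hence yc: "y:C" using YC by blast
  let ?X = "{x:Q Int Y. inv x ** y:A}"
  show "dim ?X<=dim (Q Int A)"
  proof (cases "?X = {}")
   case True thus ?thesis using dim_empty dsub_dim[OF dsub_Int[OF Q A]] by (simp only:)
  next
   case False
   then obtain x0 where x0: "x0:Q" "inv x0 ** y:A" by blast
   have c0: "x0:C" using x0 q by blast
   have "?X<=(%k. x0 ** k) ` (Q Int A)"
   proof
    fix x assume x: "x:?X"
    have xc: "x:C" using x q by blast
    have "(inv x0 ** y) ** inv (inv x ** y):A" using x x0 a by blast
    moreover have "(inv x0 ** y) ** inv (inv x ** y) = inv x0 ** x" using xc c0 yc by (simp add: gsimps)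
    ultimately have "inv x0 ** x:Q Int A" using x x0 q by auto
    moreover have "x = x0 ** (inv x0 ** x)" using xc c0 by (simp add: gsimps)
    ultimately show "x:(%k. x0 ** k) ` (Q Int A)" by blast
   qed
   moreover have "ds ?X" by (rule ds_Collect[OF ds_Int[OF q(2) Y(1)]], rule D_mem[OF a(2)], intro T_mult T_inv T_const T_var yc)
   ultimately show ?thesis using dim_translate[OF dsubD(2)[OF dsub_Int[OF Q A]] c0] dim_mono by metis
  qed
 qed
 thus ?thesis using dim_mp[OF Q A] d by linarith
qed

text \<open>Conjugates of \<open>X\<close> are indexed by cosets of \<open>Q\<close>, as
  \<open>Q\<close> leaves \<open>X\<close> invariant. Their union has dimension at most
  \<open>dim C - dim Q + dim X\<close>.\<close>

lemma conj_small:
 assumes Q: "dsub Q" and X: "ds X" "!!q x. q:Q==>x:X==>cj q x:X" and d: "dim X<dim Q"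
 shows "ds {y:C. EX g:C. y:cj g ` X}" "dim {y:C. EX g:C. y:cj g ` X}<dim C"
proof -
 note q = dsubD[OF Q]
 let ?Y = "{y:C. EX g:C. y:cj g ` X}"
 have XC: "X<=C" using X unfolding ds_def by blast
 have e: "?Y = {y:C. EX g:C. cj (inv g) y:X}" using cj_mem[OF XC] by blast
 show Y: "ds ?Y" unfolding e by (rule ds_Collect[OF ds_C], rule D_ex, rule D_mem[OF X(1)], intro T_cj T_inv T_var)
 show "dim ?Y<dim C"
 proof (cases "?Y = {}")
  case True thus ?thesis using dim_empty dsub_dim[OF dsub_C] by (simp only:)
 next
  case False
  have R: "D (%e. cj (inv (e 1)) (e 0):X)" by (rule D_mem[OF X(1)], intro T_cj T_inv T_var)
  have "dim ?Y + dim Q<=dim C + dim X"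
  proof (rule double_count[OF R Y ds_C False dsub_dim[OF Q]])
   fix y assume "y:?Y"
   then obtain g where g: "y:C" "g:C" "cj (inv g) y:X" unfolding e by blast
   have "(%k. g ** k) ` Q<={h:C. cj (inv h) y:X}"
   proof
    fix h assume "h:(%k. g ** k) ` Q"
    then obtain k where k: "k:Q" "h = g ** k" by blast
    have kc: "k:C" using k q by blast
    have "cj (inv k) (cj (inv g) y):X" using X(2) q k g by blast
    thus "h:{h:C. cj (inv h) y:X}" using k kc g by (simp add: cj_cj inv_mult_group)
   qed
   moreover have "ds {h:C. cj (inv h) y:X}" by (rule ds_Collect[OF ds_C], rule D_mem[OF X(1)], intro T_cj T_inv T_const T_var g(1))
   ultimately show "dim Q<=dim {h:C. cj (inv h) y:X}" using dim_translate[OF q(2) g(2)] dim_mono by metis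
  next
   fix g assume g: "g:C"
   have "{y:?Y. cj (inv g) y:X} = cj g ` X"
   proof (intro Set.set_eqI iffI)
    fix y assume "y:{y:?Y. cj (inv g) y:X}" thus "y:cj g ` X" using cj_mem[OF XC g] by blast
   next
    fix y assume y: "y:cj g ` X"
    have "y:C" using y XC g by auto
    thus "y:{y:?Y. cj (inv g) y:X}" using y cj_mem[OF XC g] g by blast
   qed
   thus "dim {y:?Y. cj (inv g) y:X}<=dim X" using dim_cj(2)[OF X(1) g] by simp
  qed
  thus ?thesis using d by linarith
 qed
qed

lemma nrm_cc: assumes H: "dsub H" shows "nrm H<=nrm (cc H)"
proof
 fix g assume g: "g:nrm H"
 note n = nrm_dsub[OF H]
 have "nm (nrm H) (cc H)" by (rule nm_cc[OF H dsubD(1)[OF n(1)] n(3)])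
 moreover have "inv g:nrm H" "g:C" using g n(1) dsubD by blast+
 ultimately have "cj g ` cc H = cc H" using nrm_iff[OF dsubD(3)[OF conn_dsub[OF cc(1)[OF H]]], of g] g unfolding nm_def by blast
 thus "g:nrm (cc H)" unfolding nrm_def using g nrm_C by blast
qed

text \<open>\<open>Q\<close> is the connected component of its normalizer \<open>L\<close> in
  \<open>K\<close>. What normalizes \<open>L\<close> also normalizes \<open>Q\<close>, so
  \<open>L\<close> is its own normalizer, and the normalizer condition leaves only
  \<open>L = K\<close>.\<close>

lemma nil_self:
 assumes K: "conn K" and N: "dsub N" "N<=K" "nm K N" "nilm K N" and Q: "conn Q" "N<=Q" "Q<=K" "dim (nrm Q Int K) = dim Q"
 shows "Q = K"
proof -
 define L where "L = nrm Q Int K"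
 have dK: "dsub K" and dQ: "dsub Q" using K Q conn_dsub by blast+
 have dL: "dsub L" unfolding L_def by (rule dsub_Int[OF nrm_dsub(1)[OF dQ] dK])
 have QL: "Q<=L" unfolding L_def using nrm_dsub(2)[OF dQ] Q(3) by blast
 have "Q<=cc L" by (rule conn_sub_cc[OF Q(1) dL QL])
 hence QcL: "Q = cc L" using connD[OF cc(1)[OF dL] dQ] cc(3)[OF dL] Q(4) unfolding L_def by simp
 have "L = K"
 proof (rule ccontr)
  assume "L~=K"
  moreover have "L<=K" "N<=L" unfolding L_def using Q(2) QL L_def by auto
  ultimately obtain x where x: "x:K" "x~:L" "x:nrm L" using nilm_normalizer[OF dK N(1-3) dL _ _ _ N(4)] by blast
  hence "x:nrm Q" using nrm_cc[OF dL] QcL by auto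
  thus False using x unfolding L_def by blast
 qed
 thus ?thesis using connD[OF K dQ Q(3)] Q(4) unfolding L_def by simp
qed

lemma nilm_mp:
 assumes Q: "dsub Q" and A: "dsub A" "nm C A" and N: "N<=A" "nilm Q N" shows "nilm (mp Q A) A"
proof -
 note q = dsubD[OF Q] and a = dsubD[OF A(1)]
 let ?H = "mp Q A"
 have nQ: "nm Q A" using A(2) q(3) unfolding nm_def by blast
 have H: "dsub ?H" by (rule mp_dsub[OF Q A(1) nQ])
 note s = mp_sub[OF Q A(1)]
 have nH: "nm ?H A" using A(2) dsubD(3)[OF H] unfolding nm_def by blast
 note f = U_facts[OF H A(1) s(2) nH]
 have "U Q N i<=U ?H A i" for i
 proof (induction i)
  case 0 thus ?case using N by simp
 next
  case (Suc i)
  have u: "dsub (U ?H A i)" "nm ?H (U ?H A i)" "A<=U ?H A i" using f[of i] U_chain[OF H A(1) s(2) nH, of 0 i] by auto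
  show ?case
  proof
   fix x assume x: "x:U Q N (Suc i)"
   have xc: "x:Q" "x:C" using x q by auto
   have "cm x g:U ?H A i" if "g:?H" for g
   proof -
    obtain p b where g: "p:Q" "b:A" "g = p ** b" using \<open>g:?H\<close> unfolding mp_def by blast
    have c: "p:C" "b:C" using g q a by auto
    have "cm x g = cm x p ** cj p (cm x b)" using g c xc by (simp add: cm_def cj_def gsimps)
    moreover have "cm x b:A" using cm_cj[OF xc(2) c(2)] A(2) xc g a unfolding nm_def by auto
    hence "cj p (cm x b):A" using A(2) c unfolding nm_def by blast
    moreover have "cm x p:U ?H A i" using x g Suc by auto
    ultimately show ?thesis using dsubD(5)[OF u(1)] u(3) by auto
   qed
   thus "x:U ?H A (Suc i)" using xc s by auto
  qed
 qed
 moreover obtain i where "Q<=U Q N i" using N unfolding nilm_def by blast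
 ultimately have "Q<=U ?H A i" by blast
 moreover have "A<=U ?H A i" using U_chain[OF H A(1) s(2) nH, of 0 i] by simp
 ultimately have "?H<=U ?H A i" using mp_least f by blast
 thus ?thesis unfolding nilm_def by blast
qed

lemma nilm_cj: assumes "K<=C" "g:C" "nilm K {\<one>}" shows "nilm (cj g ` K) {\<one>}"
proof -
 have "cj g ` U K {\<one>} i<=U (cj g ` K) {\<one>} i" for i
 proof (induction i)
  case 0 thus ?case using assms by simp
 next
  case (Suc i)
  show ?case
  proof
   fix y assume "y:cj g ` U K {\<one>} (Suc i)"
   then obtain x where x: "x:K" "ALL k:K. cm x k:U K {\<one>} i" "y = cj g x" by auto
   have "cm y h:U (cj g ` K) {\<one>} i" if hh: "h:cj g ` K" for h
   proof -
    obtain k where k: "k:K" "h = cj g k" using hh by blast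
    have "x:C" "k:C" using x k assms(1) by auto
    hence "cm y h = cj g (cm x k)" using cj_cm[of g x k] x k assms(2) by simp
    thus ?thesis using Suc x k by blast
   qed
   thus "y:U (cj g ` K) {\<one>} (Suc i)" using x by auto
  qed
 qed
 thus ?thesis using assms(3) unfolding nilm_def by blast
qed

definition carter :: "'b set => bool" where "carter Q <-> conn Q & nilm Q {\<one>} & dim (nrm Q) = dim Q"

lemma nrm_cj: assumes "Q<=C" "g:C" shows "nrm (cj g ` Q)<=cj g ` nrm Q"
proof
 fix h assume h: "h:nrm (cj g ` Q)"
 have hc: "h:C" and e: "cj h ` cj g ` Q = cj g ` Q" using h unfolding nrm_def by auto
 have "cj (inv g ** (h ** g)) ` Q = cj (inv g) ` cj h ` cj g ` Q" using cj_img[OF assms(1)] cj_img[of "cj g ` Q"] assms hc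
  by (simp add: cj_img[symmetric] image_subset_iff subset_iff)
 also have "... = Q" using e cj_img_inv(1)[OF assms] by simp
 finally have "cj (inv g ** (h ** g)) ` Q = Q" .
 moreover have k: "cj (inv g) h = inv g ** (h ** g)" "cj (inv g) h:C" using assms hc by (simp_all add: cj_def gsimps)
 ultimately have "cj (inv g) h:nrm Q" unfolding nrm_def by simp
 thus "h:cj g ` nrm Q" using cj_mem[OF nrm_C assms(2) hc] by blast
qed

lemma carter_cj: assumes "carter Q" "g:C" shows "carter (cj g ` Q)"
proof -
 have Q: "conn Q" "nilm Q {\<one>}" "dim (nrm Q) = dim Q" using assms unfolding carter_def by blast+
 note q = conn_dsub[OF Q(1)]
 have QC: "Q<=C" using dsubD(3)[OF q] .
 have c: "conn (cj g ` Q)" by (rule conn_cj[OF Q(1) assms(2)])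
 note n = nrm_dsub[OF conn_dsub[OF c]]
 have "dim (nrm (cj g ` Q))<=dim (cj g ` nrm Q)"
  using dim_mono[OF dsubD(2)[OF n(1)] dim_cj(1)[OF dsubD(2)[OF nrm_dsub(1)[OF q]] assms(2)] nrm_cj[OF QC assms(2)]] .
 also have "... = dim (cj g ` Q)" using dim_cj(2)[OF dsubD(2)[OF nrm_dsub(1)[OF q]] assms(2)] dim_cj(2)[OF dsubD(2)[OF q] assms(2)] Q(3) by simp
 finally have "dim (nrm (cj g ` Q)) = dim (cj g ` Q)" using dim_mono[OF dsubD(2)[OF conn_dsub[OF c]] dsubD(2)[OF n(1)] n(2)] by simp
 thus ?thesis unfolding carter_def using c nilm_cj[OF QC assms(2) Q(2)] by blast
qed

lemma carterD: assumes "carter Q" shows "conn Q" "dsub Q" "Q<=C" "nilm Q {\<one>}" "dim (nrm Q) = dim Q" "{\<one>}<=Q"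
 using assms conn_dsub dsubD(3,4) unfolding carter_def by auto

lemma carter_in: assumes "carter Q" "dsub H" "Q<=H" shows "dim (nrm Q Int H) = dim Q"
proof -
 note q = carterD[OF assms(1)] and n = nrm_dsub[OF carterD(2)[OF assms(1)]]
 note i = dsubD(2)[OF dsub_Int[OF n(1) assms(2)]]
 have "dim Q<=dim (nrm Q Int H)" by (rule dim_mono[OF dsubD(2)[OF q(2)] i]) (use n(2) assms in blast)
 moreover have "dim (nrm Q Int H)<=dim (nrm Q)" by (rule dim_mono[OF i dsubD(2)[OF n(1)]]) blast
 ultimately show ?thesis using q(5) by simp
qed

lemma rel_conj: assumes "rel H {\<one>} Q0" "carter Q" "dsub H" "Q<=H" shows "EX g:H. Q = cj g ` Q0"
 by (rule relD(6)[OF assms(1) carterD(1,6)[OF assms(2)] assms(4) carterD(4)[OF assms(2)] carter_in[OF assms(2-4)]])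

lemma nm_sub: "nm C A==>K<=C==>nm K A" unfolding nm_def by blast

end

text \<open>The hypothesis \<open>IHquo\<close> on quotients is already pulled back to the group by
  \<open>quot_rel\<close>, so no quotient has to be formed in this step.\<close>

locale carter_step = ranked_group G D dim for G :: "'b monoid" (structure) and D dim +
 assumes cnC: "conn C" and sv: solv
  and IHsub: "!!H. conn H==>H~=C==>EX Q. rel H {\<one>} Q"
  and IHquo: "!!N. conn N==>nm C N==>0<dim N==>EX H. rel C N H"
begin

lemma nrm_whole: "nrm C = C" using nrm_dsub(2)[OF dsub_C] nrm_C by blast

text \<open>A Frattini argument shows that Carter subgroups map to Carter subgroups of quotients.\<close>

lemma carter_image:
 assumes Q: "carter Q" and A: "conn A" "nm C A"
 shows "conn (mp Q A)" "A<=mp Q A" "nilm (mp Q A) A" "dim (nrm (mp Q A)) = dim (mp Q A)"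
proof -
 note q = carterD[OF Q] and dA = conn_dsub[OF A(1)]
 have nQ: "nm Q A" by (rule nm_sub[OF A(2) q(3)])
 let ?H = "mp Q A"
 note s = mp_sub[OF q(2) dA]
 show cH: "conn ?H" by (rule conn_mp[OF q(1) A(1) nQ])
 note dH = conn_dsub[OF cH] and h = dsubD[OF conn_dsub[OF cH]]
 show "A<=?H" by (rule s(2))
 show "nilm ?H A" by (rule nilm_mp[OF q(2) dA A(2) _ q(4)]) (use dsubD(4)[OF dA] in simp)
 show "dim (nrm ?H) = dim ?H"
 proof (cases "?H = C")
  case True thus ?thesis using nrm_whole by simp
 next
  case False
  then obtain Q0 where Q0: "rel ?H {\<one>} Q0" using IHsub[OF cH] by blast
  have Q0C: "Q0<=C" using relD(3)[OF Q0] h(3) by blast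
  obtain g0 where g0: "g0:?H" "Q = cj g0 ` Q0" using rel_conj[OF Q0 Q dH s(1)] by blast
  have g0c: "g0:C" using g0 h by blast
  note n = nrm_dsub[OF dH] and m = nrm_dsub[OF q(2)]
  \<comment> \<open>An element x normalizing \<open>?H\<close> moves \<open>Q\<close> to another
    Carter subgroup of \<open>?H\<close>, conjugate to \<open>Q\<close> inside \<open>?H\<close>.
    Correcting x by the conjugating element makes it normalize \<open>Q\<close>.\<close>
  have "nrm ?H<=mp ?H (nrm Q)"
  proof
   fix x assume x: "x:nrm ?H"
   have xc: "x:C" and xH: "cj x ` ?H = ?H" using x unfolding nrm_def by auto
   have "cj x ` Q<=?H" using xH s(1) by blast
   then obtain g1 where g1: "g1:?H" "cj x ` Q = cj g1 ` Q0" using rel_conj[OF Q0 carter_cj[OF Q xc] dH] by blast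
   have g1c: "g1:C" using g1 h by blast
   let ?h = "g1 ** inv g0"
   have Q0e: "Q0 = cj (inv g0) ` Q" by (rule cj_img_eq[OF Q0C g0c g0(2)])
   have "cj x ` Q = cj ?h ` Q" using g1(2) Q0e cj_img[OF q(3) g1c, of "inv g0"] g0c by simp
   hence "cj (inv ?h) ` cj x ` Q = Q" using cj_img_inv(1)[OF q(3), of ?h] g0c g1c by simp
   hence "cj (inv ?h ** x) ` Q = Q" using cj_img[OF q(3), of "inv ?h" x] g0c g1c xc by simp
   hence "inv ?h ** x:nrm Q" unfolding nrm_def using g0c g1c xc by simp
   moreover have "?h:?H" by (rule h(5)[OF g1(1) h(6)[OF g0(1)]])
   moreover have "x = ?h ** (inv ?h ** x)" using g0c g1c xc by (simp add: r_cancel_inv del: inv_mult_group)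
   ultimately show "x:mp ?H (nrm Q)" using mpI[of ?h ?H "inv ?h ** x" "nrm Q"] h(3) nrm_C by simp
  qed
  hence "dim (nrm ?H)<=dim (mp ?H (nrm Q))" using dim_mono[OF dsubD(2)[OF n(1)] ds_mp[OF h(2) dsubD(2)[OF m(1)]]] by blast
  moreover have "dim (mp ?H (nrm Q)) + dim (?H Int nrm Q) = dim ?H + dim (nrm Q)" by (rule dim_mp[OF dH m(1)])
  moreover have "dim Q<=dim (?H Int nrm Q)"
   by (rule dim_mono[OF dsubD(2)[OF q(2)] ds_Int[OF h(2) dsubD(2)[OF m(1)]]]) (use s(1) m(2) in blast)
  moreover have "dim ?H<=dim (nrm ?H)" by (rule dim_mono[OF h(2) dsubD(2)[OF n(1)] n(2)])
  ultimately show ?thesis using q(5) by simp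
 qed
qed

lemma carter_supplement: assumes Q: "carter Q" and N: "conn N" "nm C N" "nilm C N" shows "mp Q N = C"
proof -
 note i = carter_image[OF Q N(1,2)]
 have "nrm (mp Q N) Int C = nrm (mp Q N)" using nrm_C by blast
 thus ?thesis using nil_self[OF cnC conn_dsub[OF N(1)] _ N(2,3) i(1,2)] i(4) dsubD(3)[OF conn_dsub[OF N(1)]]
   dsubD(3)[OF conn_dsub[OF i(1)]] by simp
qed

lemma relI:
 assumes Q: "carter Q" "nrm Q = Q" and cj: "!!Q'. carter Q'==>EX g:C. Q' = cj g ` Q"
  and d: "dim (bad C Q)<dim Q" "dim (unc C Q)<dim C"
 shows "rel C {\<one>} Q"
proof -
 have "carter Q'" if "conn Q'" "nilm Q' {\<one>}" "dim (nrm Q' Int C) = dim Q'" for Q'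
 proof -
  have "nrm Q' Int C = nrm Q'" using nrm_C by blast
  thus ?thesis using that unfolding carter_def by simp
 qed
 thus ?thesis unfolding rel_def using carterD[OF Q(1)] Q(2) cj d carter_supplement[OF Q(1)] by auto
qed

lemma nilpotent_case: assumes nil: "nilm C {\<one>}" shows "rel C {\<one>} C"
proof (rule relI)
 have cjC: "cj g ` C = C" if "g:C" for g using nrm_whole that unfolding nrm_def by blast
 show "carter C" unfolding carter_def using cnC nil nrm_whole by simp
 show "nrm C = C" by (rule nrm_whole)
 have "bad C C = {}" using cjC by blast
 thus "dim (bad C C)<dim C" using dim_empty dsub_dim[OF dsub_C] by (simp only:)
 have "unc C C = {}" using cjC one_closed by blast
 thus "dim (unc C C)<dim C" using dim_empty dsub_dim[OF dsub_C] by (simp only:)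
 fix Q' assume Q': "carter Q'"
 have "nm C {\<one>}" unfolding nm_def by simp
 hence "Q' = C" using nil_self[OF cnC dsub_one _ _ nil carterD(1,6,3)[OF Q'] carter_in[OF Q' dsub_C carterD(3)[OF Q']]] by simp
 thus "EX g:C. Q' = cj g ` C" using cjC one_closed by blast
qed

text \<open>Dimension minimality is among normal subgroups of positive dimension. Commutativity uses
  solvability: the commutators of \<open>A\<close> lie in a normal subgroup of dimension 0, so every
  element has finitely many conjugates under the connected group \<open>A\<close>.\<close>

lemma minimal_normal:
 assumes "~nilm C {\<one>}"
 shows "EX A. conn A & nm C A & 0<dim A & (ALL B. dsub B & B<=A & nm C B --> dim B = 0 | B = A) & (ALL a:A. ALL b:A. a ** b = b ** a)"
proof -
 have "dim C~=0"
 proof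
  assume "dim C = 0"
  hence "{\<one>} = C" using connD[OF cnC dsub_one] dim_single by simp
  hence "C<=U C {\<one>} 0" by simp
  thus False using assms unfolding nilm_def by blast
 qed
 hence C0: "0<dim C" using dsub_dim[OF dsub_C] by simp
 have nC: "nm C C" unfolding nm_def by simp
 obtain A0 where A0: "dsub A0" "nm C A0" "0<dim A0" and m: "!!B. dsub B==>nm C B==>0<dim B==>nat (dim A0)<=nat (dim B)"
  using ex_has_least_nat[of "%B. dsub B & nm C B & 0<dim B" C "%B. nat (dim B)"] dsub_C nC C0 by blast
 define A where "A = cc A0"
 have A: "conn A" "dim A = dim A0" "nm C A" unfolding A_def using cc[OF A0(1)] nm_cc[OF A0(1) subgroup_self A0(2)] by auto
 note dA = conn_dsub[OF A(1)] and a = dsubD[OF conn_dsub[OF A(1)]]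
 have min: "dim B = 0 | B = A" if B: "dsub B" "B<=A" "nm C B" for B
 proof (cases "dim B = 0")
  case False
  hence "0<dim B" using dsub_dim[OF B(1)] by simp
  hence "dim A<=dim B" using m[OF B(1,3)] A(2) by simp
  hence "dim B = dim A" using dim_mono[OF dsubD(2)[OF B(1)] a(2) B(2)] by (rule antisym[rotated])
  hence "B = A" by (rule connD[OF A(1) B(1,2)])
  thus ?thesis by blast
 qed simp
 have "{\<one>}~=A" using A A0 dim_single by force
 hence "{\<one>} \<subset> A" "nm A {\<one>}" using a unfolding nm_def by auto
 then obtain L where L: "dsub L" "L \<subset> A" "ALL x:A. ALL y:A. cm x y:L" using sv[unfolded solv_def, rule_format, of "{\<one>}" A] dsub_one dA by blast
 note l = dsubD[OF L(1)]
 \<comment> \<open>The normal core in \<open>C\<close> of the proper subgroup \<open>L\<close>; by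
   minimality of \<open>A\<close> it is finite.\<close>
 define R where "R = {x:A. ALL g:C. cj g x:L}"
 have R: "dsub R"
 proof (rule dsubI)
  show "ds R" unfolding R_def by (rule ds_Collect[OF a(2)], rule D_ball[OF ds_C], rule D_mem[OF l(2)], intro T_cj T_var)
 qed (use a l in "auto simp: R_def cj_mult cj_inv subset_iff")
 have nR: "nm C R" unfolding nm_def
 proof (intro ballI)
  fix g x assume g: "g:C" and x: "x:R"
  have xc: "x:C" "x:A" using x a unfolding R_def by auto
  have "cj h (cj g x):L" if "h:C" for h using x g that cj_cj[OF that g xc(1)] unfolding R_def by simp
  thus "cj g x:R" using A(3) g xc unfolding R_def nm_def by blast
 qed
 have "R<=L"
 proof
  fix x assume x: "x:R"
  hence "cj \<one> x:L" "x:C" using a unfolding R_def by auto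
  thus "x:L" by simp
 qed
 hence dR: "dim R = 0" using min[OF R _ nR] L(2) unfolding R_def by blast
 have cmR: "cm x y:R" if xy: "x:A" "y:A" for x y
 proof -
  have c: "x:C" "y:C" using xy a by auto
  have "cj g (cm x y):L" if g: "g:C" for g
  proof -
   have "cj g x:A" "cj g y:A" using A(3) g xy unfolding nm_def by blast+
   thus ?thesis using L(3) cj_cm[OF g c] by simp
  qed
  moreover have "cm x y:A" unfolding cm_def by (intro a(5,6) xy)
  ultimately show ?thesis unfolding R_def by blast
 qed
 have "x ** y = y ** x" if xy: "x:A" "y:A" for x y
 proof -
  have c: "x:C" "y:C" using xy a by auto
  have "cj x y = y"
  proof (rule conn_fix[OF A(1) c(2), of "(%r. r ** y) ` R"])
   show "finite ((%r. r ** y) ` R)" using finite_dim0[OF R dR] by simp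
   show "(%r. r ** y) ` R<=C" using dsubD(3)[OF R] c by auto
   fix h assume h: "h:A"
   hence "cj h y = cm h y ** y" using cj_eq_cm c a by blast
   thus "cj h y:(%r. r ** y) ` R" using cmR[OF h xy(2)] by blast
  qed (rule xy(1))
  thus ?thesis using cj_fix[OF c] by simp
 qed
 thus ?thesis using A A0(3) min by (intro exI[of _ A]) auto
qed

lemma cj_mp: assumes "Q<=C" "A<=C" "g:C" "cj g ` Q<=Q" "cj g ` A<=A" "x:mp Q A" shows "cj g x:mp Q A"
proof -
 obtain q a where x: "q:Q" "a:A" "x = q ** a" using assms(6) unfolding mp_def by blast
 hence "cj g x = cj g q ** cj g a" using cj_mult[of g q a] assms by blast
 moreover have "cj g q:Q" "cj g a:A" using x assms by blast+
 ultimately show ?thesis using mpI[of "cj g q" Q "cj g a" A] assms by simp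
qed

text \<open>A Carter subgroup \<open>Q\<close> of \<open>H\<close> supplements \<open>A\<close> in
  \<open>H\<close>. Whatever normalizes \<open>Q\<close> normalizes \<open>QA = H\<close> and so
  lies in \<open>H\<close>. Conjugacy is obtained in two stages: first the images of Carter
  subgroups modulo \<open>A\<close>, then inside \<open>H\<close>.\<close>

lemma proper_case:
 assumes A: "conn A" "nm C A" and H: "rel C A H" "H~=C" shows "EX Q. rel C {\<one>} Q"
proof -
 note cH' = relD(1,2,4)[OF H(1)] and Hcj = relD(6)[OF H(1)] and Hd1 = relD(7)[OF H(1)] and Hd2 = relD(8)[OF H(1)]
 have "nrm H = H" using relD(5)[OF H(1)] nrm_C by blast
 note cH = cH' this
 note dH = conn_dsub[OF cH(1)] and h = dsubD[OF conn_dsub[OF cH(1)]] and dA = conn_dsub[OF A(1)] and a = dsubD[OF conn_dsub[OF A(1)]]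
 obtain Q where QH: "rel H {\<one>} Q" using IHsub[OF cH(1) H(2)] by blast
 note cQ = relD(1,3,4,5)[OF QH] and Qd1 = relD(7)[OF QH] and Qd2 = relD(8)[OF QH] and sup = relD(9)[OF QH]
 note dQ = conn_dsub[OF cQ(1)] and q = dsubD[OF conn_dsub[OF cQ(1)]]
 have QA: "mp Q A = H" by (rule sup[OF A(1) _ cH(2) nm_sub[OF A(2) h(3)] cH(3)]) (use a in simp)
 have gH: "g:H" if g: "g:nrm Q" for g
 proof -
  have gc: "g:C" "inv g:nrm Q" using g nrm_C dsubD(6)[OF nrm_dsub(1)[OF dQ]] by auto
  have A': "cj k ` A<=A" if "k:C" for k using A(2) that unfolding nm_def by blast
  have "cj k x:H" if "k:nrm Q" "x:H" for k x
  proof -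
   have "k:C" "cj k ` Q<=Q" using that(1) unfolding nrm_def by auto
   thus ?thesis using cj_mp[OF q(3) a(3) _ _ A'] that(2) unfolding QA by blast
  qed
  hence "cj g ` H = H" using nrm_iff[OF h(3) gc(1)] g gc(2) by blast
  thus ?thesis using cH(4) gc unfolding nrm_def by blast
 qed
 have nQ: "nrm Q = Q" using gH cQ(4) nrm_dsub(2)[OF dQ] by blast
 have car: "carter Q" unfolding carter_def using cQ nQ by simp
 have "rel C {\<one>} Q"
 proof (rule relI[OF car nQ])
  fix Q' assume Q': "carter Q'"
  note i = carter_image[OF Q' A] and q' = carterD[OF Q']
  have e: "nrm (mp Q' A) Int C = nrm (mp Q' A)" using nrm_C by blast
  obtain g where g: "g:C" "mp Q' A = cj g ` H"
   using Hcj[OF i(1,2) dsubD(3)[OF conn_dsub[OF i(1)]] i(3)] i(4) e by auto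
  have "H = cj (inv g) ` mp Q' A" by (rule cj_img_eq[OF h(3) g])
  hence "cj (inv g) ` Q'<=H" using mp_sub(1)[OF q'(2) dA] by blast
  then obtain k where k: "k:H" "cj (inv g) ` Q' = cj k ` Q" using rel_conj[OF QH carter_cj[OF Q' inv_closed[OF g(1)]] dH] by blast
  have kc: "k:C" using k h by blast
  have "Q' = cj g ` cj k ` Q" using cj_img_inv(2)[OF q'(3) g(1)] k(2) by simp
  hence "Q' = cj (g ** k) ` Q" using cj_img[OF q(3) g(1) kc] by simp
  thus "EX g:C. Q' = cj g ` Q" using g kc by blast
 next
  let ?Y = "bad C H" and ?Z = "bad H Q"
  have Y: "ds ?Y" by (rule ds_bad[OF dH ds_C])
  have Z: "ds ?Z" by (rule ds_bad[OF dQ h(2)])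
  have small: "dim (Q Int ?Y)<dim Q"
  proof (rule slice[OF dQ dA Y])
   fix y b assume y: "y:?Y" and b: "b:A"
   then obtain g where g: "g:C" "y:cj g ` H" "cj g ` H~=H" by blast
   have bc: "b:C" using b a by blast
   have "cj (inv g) b:A" using A(2) g(1) b unfolding nm_def by blast
   hence "b:cj g ` H" using cj_mem[OF h(3) g(1) bc] cH(2) by blast
   hence "y ** b:cj g ` H" using dsubD(5)[OF dsub_cj[OF dH g(1)] g(2)] by blast
   moreover have "y ** b:H" using y b cH(2) h(5) by blast
   ultimately show "y ** b:?Y" using g by blast
  qed (use Hd1 QA in simp)
  \<comment> \<open>Conjugation by g either preserves \<open>H\<close>, so that g lies in
    \<open>H\<close>, or it does not. The second kind of bad element lies in a small union of cosets
    of \<open>A\<close>, which \<open>slice\<close> cuts down to \<open>Q\<close>.\<close>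
  have "bad C Q<=?Z Un (Q Int ?Y)"
  proof
   fix x assume "x:bad C Q"
   then obtain g where x: "x:Q" "g:C" "x:cj g ` Q" "cj g ` Q~=Q" by blast
   show "x:?Z Un (Q Int ?Y)"
   proof (cases "cj g ` H = H")
    case True
    hence "g:nrm H" unfolding nrm_def using x by blast
    thus ?thesis using x cH(4) by blast
   next
    case False thus ?thesis using x cQ(2) by blast
   qed
  qed
  hence "dim (bad C Q)<=dim (?Z Un (Q Int ?Y))"
   by (rule dim_mono[OF ds_bad[OF dQ ds_C] ds_Un[OF Z ds_Int[OF q(2) Y]]])
  also have "...<dim Q" by (rule dim_less_Un[OF Z ds_Int[OF q(2) Y] Qd1 small])
  finally show "dim (bad C Q)<dim Q" .
 next
  let ?X = "unc H Q" and ?W = "unc C H"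
  have X: "ds ?X" by (rule ds_uncovered[OF dQ h(2)])
  have W: "ds ?W" by (rule ds_uncovered[OF dH ds_C])
  have inv: "cj k x:?X" if k: "k:H" and x: "x:?X" for k x
  proof -
   have c: "k:C" "x:C" using k x h by auto
   have "cj k x~:cj g ` Q" if g: "g:H" for g
   proof
    assume "cj k x:cj g ` Q"
    hence "cj (inv g) (cj k x):Q" using cj_mem[OF q(3), of g "cj k x"] g h c by auto
    hence "cj (inv (inv k ** g)) x:Q" using c g h by (auto simp: cj_cj inv_mult_group)
    hence "x:cj (inv k ** g) ` Q" using cj_mem[OF q(3), of "inv k ** g" x] c g h by auto
    thus False using x k g h by blast
   qed
   thus ?thesis using k x h by (auto simp: cj_def)
  qed
  have S: "ds {y:C. EX g:C. y:cj g ` ?X}" "dim {y:C. EX g:C. y:cj g ` ?X}<dim C"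
   by (rule conj_small(1)[OF dH X _ Qd2], rule inv, assumption+, rule conj_small(2)[OF dH X _ Qd2], rule inv, assumption+)
  \<comment> \<open>An uncovered element either misses all conjugates of \<open>H\<close>, or is
    conjugate to an element of \<open>H\<close> that the conjugates of \<open>Q\<close> under
    \<open>H\<close> do not cover.\<close>
  have "unc C Q<=?W Un {y:C. EX g:C. y:cj g ` ?X}"
  proof
   fix x assume x: "x:unc C Q"
   show "x:?W Un {y:C. EX g:C. y:cj g ` ?X}"
   proof (cases "x:?W")
    case False
    then obtain g y where g: "g:C" "y:H" "x = cj g y" using x by blast
    have "y~:cj k ` Q" if k: "k:H" for k
    proof
     assume "y:cj k ` Q"
     hence "x:cj g ` cj k ` Q" using g by blast
     moreover have "k:C" using k h by blast
     ultimately show False using x cj_img[OF q(3) g(1)] g(1) by auto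
    qed
    hence "y:?X" using g by blast
    thus ?thesis using g x by blast
   qed simp
  qed
  hence "dim (unc C Q)<=dim (?W Un {y:C. EX g:C. y:cj g ` ?X})"
   by (rule dim_mono[OF ds_uncovered[OF dQ ds_C] ds_Un[OF W S(1)]])
  also have "...<dim C" by (rule dim_less_Un[OF W S(1) Hd2 S(2)])
  finally show "dim (unc C Q)<dim C" .
 qed
 thus ?thesis by blast
qed

end

section \<open>The case of a noncentral minimal subgroup with nilpotent quotient\<close>

locale carter_min = minimal_action G D dim A + carter_step G D dim for G :: "'b monoid" (structure) and D dim A
begin

text \<open>\<open>A\<close> has no nontrivial fixed points, so it meets every term of the upper
  central series trivially.\<close>

lemma not_nil: "~nilm C {\<one>}"
proof
 assume "nilm C {\<one>}"
 then obtain k where k: "C<=U C {\<one>} k" unfolding nilm_def by blast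
 have "A Int U C {\<one>} i<={\<one>}" for i
 proof (induction i)
  case (Suc i)
  show ?case
  proof
   fix a assume a: "a:A Int U C {\<one>} (Suc i)"
   have "cj g a = a" if g: "g:C" for g
   proof -
    have "cm a g:A Int U C {\<one>} i" using a g cm_A by auto
    hence "cm a g = \<one>" using Suc by blast
    hence "a:Kf g" using a unfolding Kf_def by blast
    thus ?thesis using Kf_iff[OF g] by blast
   qed
   thus "a:{\<one>}" using fixed_trivial a by blast
  qed
 qed simp
 hence "A<={\<one>}" using k AC by blast
 hence "ALL g:C. ALL a:A. cj g a = a" by auto
 thus False using ncA by blast
qed

lemma A_proper: "A~=C"
proof
 assume "A = C"
 hence "ALL g:C. ALL a:A. cj g a = a" using Cz(3) unfolding Cz_def by blast
 thus False using ncA by blast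
qed

text \<open>Let \<open>B\<close> be the connected component of the preimage of the centre of
  \<open>C/A\<close>. If some v in \<open>B\<close> moves \<open>A\<close>, its centralizer is a
  supplement. If \<open>B\<close> centralizes \<open>A\<close>, then \<open>B\<close> is abelian,
  and a commutator map from \<open>B\<close> onto \<open>A\<close> has an infinite normal kernel
  meeting \<open>A\<close> trivially; the supplement comes from the quotient by the connected
  component of that kernel.\<close>

lemma supplement: "EX P. dsub P & mp P A = C & P~=C"
proof -
 define V where "V = U C A 1"
 note f = U_facts[OF dsub_C dA A(3) nA]
 have V: "dsub V" "V<=C" "nm C V" "A<=V" unfolding V_def
  using f[of 1] conjunct2[OF conjunct2[OF conjunct2[OF f[of 0]]]] by (blast, blast, blast, simp only: U.simps(1) One_nat_def)
 have Vd: "dim A<dim V" unfolding V_def by (rule center_dim[OF cC dA nA conn_dim_less[OF cC dA A(3) A_proper] nilA])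
 have VA: "cm v g:A" "cm g v:A" if "v:V" "g:C" for v g
 proof -
  show 1: "cm v g:A" using that unfolding V_def by simp
  have "v:C" using V that by blast
  thus "cm g v:A" using cm_inverse[of v g] A(6)[OF 1] that by simp
 qed
 have VZ: "V<=Z" unfolding V_def Z_def by (rule U_mono[OF Cz(3)])
 define B where "B = cc V"
 have B: "conn B" "B<=V" "dim B = dim V" "nm C B" "A<=B" unfolding B_def
  using cc[OF V(1)] nm_cc[OF V(1) subgroup_self V(3)] conn_sub_cc[OF cA V(1,4)] by auto
 note dB = conn_dsub[OF B(1)] and b = dsubD[OF conn_dsub[OF B(1)]]
 show ?thesis
 proof (cases "B<=Cz")
  case False
  then obtain v where v: "v:B" "v~:Cz" by blast
  have vZ: "v:Z" "v:V" "v:C" using v B VZ V by auto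
  have onto: "(%a. cm a v) ` A = A" using Z_onto0[OF vZ(1) v(2)] by blast
  \<comment> \<open>The conjugates of v lie in \<open>A\<close> times v, and 1-v is onto
    \<open>A\<close>; so each g can be corrected by an element of \<open>A\<close> to centralize
    v.\<close>
  define P where "P = {g:C. cj g v = v}"
  have P: "dsub P"
  proof (rule dsubI)
   show "ds P" unfolding P_def by (rule ds_Collect[OF ds_C], rule D_eq[OF T_cj[OF T_var T_const[OF vZ(3)]] T_const[OF vZ(3)]])
   show "\<one>:P" unfolding P_def using vZ by simp
  next
   fix x assume x: "x:P"
   hence "cj x v = v" "x:C" unfolding P_def by auto
   thus "inv x:P" using cj_inv_cj(1)[of x v] vZ unfolding P_def by simp
   fix y assume "y:P"
   thus "x ** y:P" using x vZ unfolding P_def by (simp add: cj_cj[symmetric])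
  qed
  have "C<=mp P A"
  proof
   fix g assume g: "g:C"
   have c: "cm g v:A" by (rule VA(2)[OF vZ(2) g])
   hence c': "cj (inv g) (inv (cm g v)):A" using nA g A(6) unfolding nm_def by blast
   hence "cj (inv g) (inv (cm g v)):(%a. cm a v) ` A" using onto by simp
   then obtain a where a: "a:A" "cj (inv g) (inv (cm g v)) = cm a v" by blast
   have ac: "a:C" "cm g v:C" using a AC c by auto
   have "cj (g ** a) v = cj g (cm a v ** v)" using cj_cj[OF g ac(1) vZ(3)] cj_eq_cm[OF ac(1) vZ(3)] by simp
   also have "... = cj g (cm a v) ** cj g v" using cj_mult[of g "cm a v" v] g ac vZ by simp
   also have "... = inv (cm g v) ** (cm g v ** v)" using a(2)[symmetric] cj_eq_cm[OF g vZ(3)] cj_inv_cj(2)[OF g, of "inv (cm g v)"] ac by simp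
   also have "... = v" using ac vZ by (simp add: l_cancel_inv)
   finally have "g ** a:P" unfolding P_def using g ac by simp
   moreover have "inv a:A" using a A by blast
   moreover have "g = (g ** a) ** inv a" using g ac by (simp add: m_assoc)
   ultimately show "g:mp P A" using mpI[of "g ** a" P "inv a" A] dsubD(3)[OF P] A(3) by simp
  qed
  hence PA: "mp P A = C" unfolding mp_def by blast
  have "P~=C"
  proof
   assume "P = C"
   have "cj v a = a" if a: "a:A" for a
   proof -
    have ac: "a:C" using AC a by blast
    hence "cj a v = v" using \<open>P = C\<close> unfolding P_def by blast
    thus ?thesis using cj_fix[of a v] cj_fix[of v a] ac vZ by simp
   qed
   thus False using v vZ unfolding Cz_def by blast
  qed
  thus ?thesis using P PA by blast
 next
  case True
  have BC: "x:C" "x:V" if "x:B" for x using that b B by auto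
  have BA: "cj x a = a" "cm x a = \<one>" "cm a x = \<one>" "x ** a = a ** x" if "x:B" "a:A" for x a
  proof -
   have c: "x:C" "a:C" using BC AC that by auto
   show 1: "cj x a = a" using that True unfolding Cz_def by blast
   thus "x ** a = a ** x" using cj_fix[OF c] by blast
   thus "cm x a = \<one>" "cm a x = \<one>" using cm_eq_one[OF c] cm_eq_one[OF c(2,1)] by auto
  qed
  \<comment> \<open>Conjugation changes x and y only by factors from \<open>A\<close>, which commute
    with \<open>B\<close>. Hence \<open>cm x y\<close> is fixed by the whole group, and it lies in
    \<open>A\<close>.\<close>
  have Bab: "cm x y = \<one>" if xy: "x:B" "y:B" for x y
  proof (rule fixed_trivial)
   have c: "x:C" "y:C" using BC xy by auto
   show m: "cm x y:A" by (rule VA(1)[OF BC(2)[OF xy(1)] c(2)])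
   have m': "cm y x:A" by (rule VA(1)[OF BC(2)[OF xy(2)] c(1)])
   fix h assume h: "h:C"
   define a1 a2 where "a1 = cm h x" and "a2 = cm h y"
   have a12: "a1:A" "a2:A" "a1:C" "a2:C" unfolding a1_def a2_def using VA(2) BC xy h AC by auto
   have aB: "a2 ** y:B" using b(5) a12 B(5) xy by blast
   have "cj h (cm x y) = cm (a1 ** x) (a2 ** y)" using cj_cm[OF h c] cj_eq_cm[OF h c(1)] cj_eq_cm[OF h c(2)] unfolding a1_def a2_def by simp
   also have "... = cj a1 (cm x (a2 ** y)) ** cm a1 (a2 ** y)" by (rule cm_mult) (use a12 c in auto)
   also have "cm a1 (a2 ** y) = \<one>" by (rule BA(3)[OF aB a12(1)])
   also have "cm x (a2 ** y) = inv (cm (a2 ** y) x)" using cm_inverse[of "a2 ** y" x] a12 c by simp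
   also have "cm (a2 ** y) x = cj a2 (cm y x) ** cm a2 x" by (rule cm_mult) (use a12 c in auto)
   also have "cm a2 x = \<one>" by (rule BA(3)[OF xy(1) a12(2)])
   also have "cj a2 (cm y x) = cm y x" by (rule BA(1)[OF subsetD[OF B(5) a12(2)] m'])
   also have "inv (cm y x ** \<one>) = cm x y" using cm_inverse[OF c(2,1)] c by simp
   also have "cj a1 (cm x y) = cm x y" by (rule BA(1)[OF subsetD[OF B(5) a12(1)] m])
   finally show "cj h (cm x y) = cm x y" using c by simp
  qed
  define C' where "C' = {g:C. ALL x:B. cj g x = x}"
  have C': "dsub C'"
  proof (rule dsubI)
   show "ds C'" unfolding C'_def by (rule ds_Collect[OF ds_C], rule D_ball[OF b(2)], rule D_eq[OF T_cj[OF T_var T_var] T_var])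
   show "\<one>:C'" unfolding C'_def using BC by simp
  next
   fix g assume g: "g:C'"
   hence "cj (inv g) x = x" if "x:B" for x
   proof -
    have "cj g x = x" "g:C" using g that unfolding C'_def by auto
    thus ?thesis using cj_inv_cj(1)[of g x] BC that by simp
   qed
   thus "inv g:C'" using g unfolding C'_def by simp
   fix h assume h: "h:C'"
   have "cj (g ** h) x = x" if "x:B" for x using g h that BC(1)[OF that] cj_cj[of g h x] unfolding C'_def by simp
   thus "g ** h:C'" using g h unfolding C'_def by simp
  qed
  have nC': "nm C C'" unfolding nm_def
  proof (intro ballI)
   fix h g assume h: "h:C" and g: "g:C'"
   have gc: "g:C" using g unfolding C'_def by blast
   have "cj (cj h g) x = x" if x: "x:B" for x
   proof -
    have xc: "x:C" using BC x by blast
    have "cj (inv h) x:B" using B(4) h x unfolding nm_def by blast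
    hence "cj g (cj (inv h) x) = cj (inv h) x" using g unfolding C'_def by blast
    hence "cj h (cj g (cj (inv h) x)) = x" using h xc by simp
    moreover have "cj h (cj g (cj (inv h) x)) = cj (cj h g) x" using h gc xc by (simp add: cj_def gsimps)
    ultimately show ?thesis by simp
   qed
   thus "cj h g:C'" using h gc unfolding C'_def by simp
  qed
  have C'C: "C'<=C" unfolding C'_def by blast
  have BC': "B<=C'"
  proof
   fix x assume x: "x:B"
   have "cj x y = y" if "y:B" for y using Bab[OF x that] cm_eq_one[of x y] cj_fix[of x y] BC x that by blast
   thus "x:C'" unfolding C'_def using BC x by blast
  qed
  have C'ne: "C'~=C"
  proof
   assume "C' = C"
   hence "ALL g:C. ALL a:A. cj g a = a" using B(5) unfolding C'_def by blast
   thus False using ncA by blast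
  qed
  have nilC': "nilm C C'" by (rule nilm_mono[OF nilA]) (use B(5) BC' in blast)
  \<comment> \<open>The first term of the series leaving the centralizer of \<open>B\<close>: z is
    central modulo \<open>C'\<close> but does not centralize \<open>B\<close>, which makes the map
    taking x to \<open>cm x z\<close> an equivariant, nontrivial homomorphism from \<open>B\<close>
    to \<open>A\<close>.\<close>
  obtain i z where z: "z:U C C' (Suc i)" "z~:C'" "U C C' i<=C'"
   using nilm_center[OF dsub_C C' C'C nC' order_refl C'C C'ne nilC'] by blast
  note W = U_facts[OF dsub_C C' C'C nC', of 1]
  have zW: "z:U C C' 1" "z:C" using z by auto
  have zW': "inv z:U C C' 1" using W dsubD(6) zW by blast
  have th: "cm x z:A" if "x:B" for x using VA(1) BC that zW by blast
  have hom: "cm (x ** y) z = cm x z ** cm y z" if xy: "x:B" "y:B" for x y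
  proof -
   have "cm (x ** y) z = cj x (cm y z) ** cm x z" by (rule cm_mult) (use BC xy zW in auto)
   thus ?thesis using BA(1)[OF xy(1) th[OF xy(2)]] abA[OF th[OF xy(1)] th[OF xy(2)]] by simp
  qed
  have equ: "cm (cj h x) z = cj h (cm x z)" if h: "h:C" and x: "x:B" for h x
  proof -
   have xc: "x:C" using BC x by blast
   define c where "c = inv z ** cj (inv h) z"
   have "c = cm (inv z) (inv h)" unfolding c_def using h zW by (simp add: cm_def cj_def gsimps)
   hence c: "c:C'" "c:C" using zW' h C'C by auto
   have "cj c (inv x) = inv x" using c(1) b(6)[OF x] unfolding C'_def by blast
   moreover have "cm x (z ** c) = x ** cj z (cj c (inv x))" using xc c zW by (simp add: cm_def cj_def gsimps)
   ultimately have "cm x (z ** c) = cm x z" using cm_split[OF xc zW(2)] by simp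
   moreover have "z ** c = cj (inv h) z" unfolding c_def using h zW by (simp add: r_cancel_inv)
   moreover have "cm (cj h x) z = cj h (cm x (cj (inv h) z))" using h xc zW by (simp add: cj_cm)
   ultimately show ?thesis by simp
  qed
  note hf = hom_facts[OF dB T_cm_const[OF zW(2)] hom]
  let ?I = "(%x. cm x z) ` B"
  have IA: "?I<=A" using th by blast
  have nI: "nm C ?I" unfolding nm_def
  proof (intro ballI)
   fix h y assume h: "h:C" and "y:?I"
   then obtain x where x: "x:B" "y = cm x z" by blast
   hence "cj h y = cm (cj h x) z" "cj h x:B" using equ[OF h x(1)] B(4) h unfolding nm_def by auto
   thus "cj h y:?I" by blast
  qed
  have I1: "?I~={\<one>}"
  proof
   assume I: "?I = {\<one>}"
   have "cj z x = x" if x: "x:B" for x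
   proof -
    have xc: "x:C" using BC x by blast
    have "cm x z = \<one>" using I x by blast
    thus ?thesis using cm_eq_one[OF xc zW(2)] cj_fix[OF zW(2) xc] by simp
   qed
   thus False using z zW unfolding C'_def by blast
  qed
  have I: "?I = A" using minA[OF hf(1) IA nI] normal_dim0_trivial[OF hf(1) IA nI] I1 by blast
  have zCz: "z~:Cz"
  proof
   assume zz: "z:Cz"
   have "cm x z = \<one>" if x: "x:B" for x
   proof (rule fixed_trivial[OF th[OF x]])
    fix h assume h: "h:C"
    have xc: "x:C" using BC x by blast
    have a: "cm h x:A" "cm h x:C" using VA(2)[OF BC(2)[OF x] h] AC by auto
    have "cj z (cm h x) = cm h x" using zz a unfolding Cz_def by blast
    hence 1: "cm (cm h x) z = \<one>" using cj_fix[OF zW(2) a(2)] cm_eq_one[OF a(2) zW(2)] by simp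
    have "cj h (cm x z) = cm (cm h x ** x) z" using equ[OF h x] cj_eq_cm[OF h xc] by simp
    also have "... = cm (cm h x) z ** cm x z" by (rule hom[OF subsetD[OF B(5) a(1)] x])
    finally show "cj h (cm x z) = cm x z" using 1 xc zW by simp
   qed
   hence "?I<={\<one>}" by blast
   thus False using I1 dsubD(4)[OF hf(1)] by blast
  qed
  define K where "K = {x:B. cm x z = \<one>}"
  have K: "dsub K" "dim B = dim K + dim A" unfolding K_def using hf(2,3) I by auto
  have nK: "nm C K" unfolding nm_def
  proof (intro ballI)
   fix h x assume h: "h:C" and x: "x:K"
   thus "cj h x:K" using equ[OF h, of x] B(4) unfolding K_def nm_def by auto
  qed
  have KA: "A Int K = {\<one>}"
  proof (rule normal_dim0_trivial)
   show d: "dsub (A Int K)" by (rule dsub_Int[OF dA K(1)])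
   show n: "nm C (A Int K)" using nA nK unfolding nm_def by blast
   have "A Int K~=A"
   proof
    assume e: "A Int K = A"
    have "cj z a = a" if a: "a:A" for a
    proof -
     have "cm a z = \<one>" using e a unfolding K_def by blast
     thus ?thesis using cm_eq_one[OF AC[OF a] zW(2)] cj_fix[OF zW(2) AC[OF a]] by simp
    qed
    thus False using zCz zW unfolding Cz_def by blast
   qed
   thus "dim (A Int K) = 0" using minA[OF d _ n] by blast
  qed simp
  \<comment> \<open>Infinite because \<open>B\<close> has larger dimension than \<open>A\<close>. A
    Carter subgroup modulo \<open>K0\<close> supplements \<open>A\<close> times \<open>K0\<close>
    and contains \<open>K0\<close>, so it supplements \<open>A\<close>. It is proper: otherwise the
    group would be nilpotent modulo \<open>K0\<close> and modulo \<open>A\<close>, which meet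
    trivially, hence nilpotent.\<close>
  define K0 where "K0 = cc K"
  have K0: "conn K0" "nm C K0" "K0<=K" "0<dim K0" unfolding K0_def
   using cc[OF K(1)] nm_cc[OF K(1) subgroup_self nK] K(2) Vd B(3) by auto
  note k0 = dsubD[OF conn_dsub[OF K0(1)]]
  obtain P where P: "rel C K0 P" using IHquo[OF K0(1,2,4)] by blast
  note cP = relD(1,2,4)[OF P] and sup = relD(9)[OF P]
  have nAK: "nm A K0" by (rule nm_sub[OF K0(2) A(3)])
  have M: "conn (mp A K0)" by (rule conn_mp[OF cA K0(1) nAK])
  note s = mp_sub[OF dA conn_dsub[OF K0(1)]]
  have nM: "nm C (mp A K0)" unfolding nm_def
  proof (intro ballI)
   fix h x assume h: "h:C" and x: "x:mp A K0"
   show "cj h x:mp A K0" by (rule cj_mp[OF A(3) k0(3) h _ _ x]) (use nA K0(2) h in "auto simp: nm_def")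
  qed
  have PM: "mp P (mp A K0) = C" by (rule sup[OF M s(2) dsubD(3)[OF conn_dsub[OF M]] nM nilm_mono[OF nilA s(1)]])
  note p = dsubD[OF conn_dsub[OF cP(1)]]
  have "C<=mp P A"
  proof
   fix g assume "g:C"
   then obtain x a k where g: "x:P" "a:A" "k:K0" "g = x ** (a ** k)" using PM unfolding mp_def by blast
   have kB: "k:B" using g(3) K0(3) unfolding K_def by blast
   have c: "x:C" "a:C" "k:C" using g p AC BC(1)[OF kB] by auto
   have "g = (x ** k) ** a" using g(4) BA(4)[OF kB g(2)] c by (simp add: m_assoc)
   moreover have "x ** k:P" using g p cP(2) by blast
   ultimately show "g:mp P A" using mpI[of "x ** k" P a A] g(2) p(3) A(3) by simp
  qed
  hence PA: "mp P A = C" unfolding mp_def by blast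
  have "P~=C"
  proof
   assume "P = C"
   hence nl: "nilm C K0" using cP(3) by simp
   have "A Int K0 = {\<one>}" using KA K0(3) A(4) k0(4) by blast
   hence "nilm C {\<one>}" using nilm_int[OF dsub_C dA A(3) nA conn_dsub[OF K0(1)] k0(3) K0(2) nilA nl] by simp
   thus False using not_nil by blast
  qed
  thus ?thesis using conn_dsub[OF cP(1)] PA by blast
 qed
qed

text \<open>The intersection is normalized by \<open>Q\<close> and centralized by the abelian group
  \<open>A\<close>, so it is normal in \<open>QA\<close>. Minimality makes it finite, and then it is
  trivial.\<close>

lemma compl_normal: assumes Q: "dsub Q" "mp Q A = C" "Q~=C" shows "Q Int A = {\<one>}"
proof -
 note q = dsubD[OF Q(1)]
 have d: "dsub (Q Int A)" by (rule dsub_Int[OF Q(1) dA])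
 have n: "nm C (Q Int A)" unfolding nm_def
 proof (intro ballI)
  fix g x assume g: "g:C" and x: "x:Q Int A"
  obtain p a where pa: "p:Q" "a:A" "g = p ** a" using g Q(2) unfolding mp_def by blast
  have c: "p:C" "a:C" "x:C" using pa x q AC by auto
  have "cj a x = x" using cj_fix[of a x] abA[of a x] c x pa by blast
  hence "cj g x = cj p x" using pa cj_cj[of p a x] c by simp
  moreover have "cj p x:Q" unfolding cj_def by (intro q(5,6) pa(1) IntD1[OF x])
  moreover have "cj g x:A" using nA g x unfolding nm_def by blast
  ultimately show "cj g x:Q Int A" by simp
 qed
 have "Q Int A~=A"
 proof
  assume "Q Int A = A"
  hence "mp Q A<=Q" using mp_least[OF Q(1)] by blast
  thus False using Q q(3) by blast
 qed
 hence "dim (Q Int A) = 0" using minA[OF d _ n] by blast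
 thus ?thesis using normal_dim0_trivial[OF d _ n] by blast
qed

lemma carter_compl: assumes "carter Q" shows "mp Q A = C" "Q Int A = {\<one>}"
proof -
 show s: "mp Q A = C" by (rule carter_supplement[OF assms cA nA nilA])
 have "Q~=C" using carterD(4)[OF assms] not_nil by blast
 thus "Q Int A = {\<one>}" using compl_normal[OF carterD(2)[OF assms] s] by blast
qed

text \<open>\<open>A\<close> acts trivially on itself, so \<open>Tb\<close> is a union of cosets of
  \<open>A\<close>, as \<open>slice\<close> requires.\<close>

lemma Tb_translate: assumes "g:Tb" "a:A" shows "g ** a:Tb"
proof -
 obtain b where b: "g:C" "b:A" "b~=\<one>" "cm b g = \<one>" using assms(1) unfolding Tb_def by blast
 have "cm b (g ** a) = \<one>" using cm_Cz[OF b(2,1), of a] Cz(3) assms(2) b(4) by auto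
 thus ?thesis unfolding Tb_def using b AC[OF assms(2)] by blast
qed

text \<open>Write g as p times a with p in \<open>Q\<close>. The condition puts
  \<open>cm a x\<close> into \<open>Q Int A\<close>, which is trivial, so x fixes a; outside
  \<open>Tb\<close> this leaves only the identity.\<close>

lemma carter_absorb: assumes Q: "carter Q" and x: "x:Q" "x~:Tb" and g: "g:C" "cm g x:Q" shows "g:Q"
proof -
 note c = carter_compl[OF Q] and q = dsubD[OF carterD(2)[OF Q]]
 obtain p a where pa: "p:Q" "a:A" "g = p ** a" using g c(1) unfolding mp_def by blast
 have cc: "p:C" "a:C" "x:C" using pa x q AC by auto
 have ax: "cm a x:A" "cm a x:C" using cm_A[OF pa(2) cc(3)] AC by auto
 have e: "cm g x = cj p (cm a x) ** cm p x" using cm_mult[OF cc] pa by simp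
 have px: "cm p x:Q" unfolding cm_def by (intro q(5,6) pa(1) x(1))
 have "cm g x ** inv (cm p x):Q" using g px q by blast
 hence f: "cj p (cm a x):Q" using e cc ax by (simp add: m_assoc)
 have "cj (inv p) (cj p (cm a x)):Q" unfolding cj_def[of "inv p"] by (intro q(5,6) pa(1) f)
 hence "cm a x:Q Int A" using ax cc by simp
 hence "a:Kf x" using c(2) pa unfolding Kf_def by blast
 hence "a = \<one>" using not_Tb(1)[OF cc(3) x(2)] by blast
 thus ?thesis using pa cc by simp
qed

lemma carter_sub: assumes P: "carter P" and Q: "carter Q" and x: "x:P" "x:Q" "x~:Tb" shows "Q<=P"
proof -
 note p = dsubD[OF carterD(2)[OF P]] and q = dsubD[OF carterD(2)[OF Q]]
 have "U Q {\<one>} i<=P" for i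
 proof (induction i)
  case 0 thus ?case using p by simp
 next
  case (Suc i)
  show ?case
  proof
   fix y assume y: "y:U Q {\<one>} (Suc i)"
   hence "cm y x:P" "y:C" using Suc x q by auto
   thus "y:P" using carter_absorb[OF P x(1,3)] by blast
  qed
 qed
 thus ?thesis using carterD(4)[OF Q] unfolding nilm_def by blast
qed

text \<open>With x also its factor p in \<open>Q\<close> lies outside \<open>Tb\<close>, so 1-p is
  onto \<open>A\<close>, and an element of \<open>A\<close> conjugating p to x is found by solving
  one equation.\<close>

lemma carter_cover: assumes Q: "carter Q" and x: "x:C" "x~:Tb" shows "EX c:A. x:cj c ` Q"
proof -
 note q = dsubD[OF carterD(2)[OF Q]]
 obtain p a where pa: "p:Q" "a:A" "x = p ** a" using x carter_compl(1)[OF Q] unfolding mp_def by blast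
 have c: "p:C" "a:C" using pa q AC by auto
 have "p~:Tb" using Tb_translate[of p a] pa x by blast
 hence "(%b. cm b p) ` A = A" using not_Tb(2)[OF c(1)] by blast
 moreover have "cj p a:A" using nA pa c unfolding nm_def by blast
 ultimately have "cj p a:(%b. cm b p) ` A" by simp
 then obtain b where b: "b:A" "cj p a = cm b p" by blast
 have bc: "b:C" using AC b by blast
 have "cj b p = cj p a ** p" using cj_eq_cm[OF bc c(1)] b by simp
 also have "... = x" using pa c by (simp add: cj_def gsimps)
 finally show ?thesis using pa b by blast
qed

lemma minimal_case: "EX Q. rel C {\<one>} Q"
proof -
 obtain P where P: "dsub P" "mp P A = C" "P~=C" using supplement by blast
 define Q where "Q = cc P"
 have Q: "conn Q" "Q<=P" "dim Q = dim P" unfolding Q_def using cc[OF P(1)] by auto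
 note dQ = conn_dsub[OF Q(1)] and q = dsubD[OF conn_dsub[OF Q(1)]]
 have d: "dsub (mp Q A)" by (rule mp_dsub[OF dQ dA nm_sub[OF nA q(3)]])
 \<comment> \<open>The connected component of the supplement still supplements \<open>A\<close>: by
   \<open>dim_mp\<close> the product has full dimension, and the group is connected.\<close>
 have "dim (Q Int A)<=dim (P Int A)" using dim_mono[OF dsubD(2)[OF dsub_Int[OF dQ dA]] dsubD(2)[OF dsub_Int[OF P(1) dA]]] Q(2) by blast
 hence "dim C<=dim (mp Q A)" using dim_mp[OF dQ dA] dim_mp[OF P(1) dA] P(2) Q(3) by simp
 hence QA: "mp Q A = C" using connD[OF cC d] dim_mono[OF dsubD(2)[OF d] ds_C] dsubD(3)[OF d] by simp
 have "Q~=C" using Q P dsubD(3)[OF P(1)] by blast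
 hence Q1: "Q Int A = {\<one>}" using compl_normal[OF dQ QA] by blast
 have nl: "nilm Q {\<one>}" using nilm_sub[OF nilA dQ q(3)] Q1 by (simp add: Int_commute)
 \<comment> \<open>The \<open>A\<close>-part a of a normalizing element normalizes \<open>Q\<close>
   too. Its commutators with \<open>Q\<close> lie in \<open>Q Int A\<close>, so a is fixed by
   \<open>Q\<close> and by \<open>A\<close>, hence by everything.\<close>
 have "nrm Q<=Q"
 proof
  fix g assume g: "g:nrm Q"
  have "g:C" using g nrm_C by blast
  then obtain p a where pa: "p:Q" "a:A" "g = p ** a" using QA unfolding mp_def by blast
  have c: "p:C" "a:C" using pa q AC by auto
  have "a = inv p ** g" using pa c by (simp add: l_cancel_inv)
  moreover have "inv p:nrm Q" using pa q nrm_dsub(2)[OF dQ] by blast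
  ultimately have an: "a:nrm Q" using g dsubD(5)[OF nrm_dsub(1)[OF dQ]] by simp
  have ax: "cj x a = a" if x: "x:Q" for x
  proof -
   have xc: "x:C" using x q by blast
   have "cj a x:Q" using an x unfolding nrm_def by blast
   hence 1: "cm a x:Q" using cm_cj[OF c(2) xc] x q by simp
   have "cm a x:A" by (rule cm_A[OF pa(2) xc])
   hence "cm a x = \<one>" using 1 Q1 by blast
   thus ?thesis using cm_eq_one[OF c(2) xc] cj_fix[OF xc c(2)] by simp
  qed
  have "a = \<one>"
  proof (rule fixed_trivial[OF pa(2)])
   fix h assume "h:C"
   then obtain x b where xb: "x:Q" "b:A" "h = x ** b" using QA unfolding mp_def by blast
   have xc: "x:C" "b:C" using xb q AC by auto
   have "cj b a = a" using cj_fix[OF xc(2) c(2)] abA[OF xb(2) pa(2)] by blast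
   thus "cj h a = a" using ax[OF xb(1)] cj_cj[OF xc c(2)] xb by simp
  qed
  thus "g:Q" using pa c by simp
 qed
 hence nQ: "nrm Q = Q" using nrm_dsub(2)[OF dQ] by blast
 have car: "carter Q" unfolding carter_def using Q nl nQ by simp
 have small: "dim (Q Int Tb)<dim Q"
 proof (rule slice[OF dQ dA ds_Tb])
  show "dim Tb<dim (mp Q A)" unfolding QA by (rule Tb_small)
 qed (rule Tb_translate)
 have "rel C {\<one>} Q"
 proof (rule relI[OF car nQ])
  fix Q' assume Q': "carter Q'"
  have "Q Int Tb~=Q" using small by auto
  then obtain x where x: "x:Q" "x~:Tb" by blast
  have xc: "x:C" using x q by blast
  obtain c where c: "c:A" "x:cj c ` Q'" using carter_cover[OF Q' xc x(2)] by blast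
  have cc: "c:C" using AC c by blast
  have "carter (cj c ` Q')" by (rule carter_cj[OF Q' cc])
  hence "cj c ` Q' = Q" using carter_sub[OF car _ x(1) c(2) x(2)] carter_sub[OF _ car c(2) x] by blast
  hence "Q' = cj (inv c) ` Q" using cj_img_eq[OF carterD(3)[OF Q'] cc] by blast
  thus "EX g:C. Q' = cj g ` Q" using cc by blast
 next
  have "bad C Q<=Q Int Tb"
  proof
   fix x assume "x:bad C Q"
   then obtain g where x: "x:Q" "g:C" "x:cj g ` Q" "cj g ` Q~=Q" by blast
   have c: "carter (cj g ` Q)" by (rule carter_cj[OF car x(2)])
   have "x:Tb"
   proof (rule ccontr)
    assume "x~:Tb"
    hence "cj g ` Q = Q" using carter_sub[OF car c x(1,3)] carter_sub[OF c car x(3,1)] by blast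
    thus False using x by blast
   qed
   thus "x:Q Int Tb" using x by blast
  qed
  thus "dim (bad C Q)<dim Q"
   using dim_mono[OF ds_bad[OF dQ ds_C] ds_Int[OF q(2) ds_Tb]] small by force
 next
  have "unc C Q<=Tb" using carter_cover[OF car] AC by blast
  thus "dim (unc C Q)<dim C"
   using dim_mono[OF ds_uncovered[OF dQ ds_C] ds_Tb] Tb_small by force
 qed
 thus ?thesis by blast
qed

end

lemma (in carter_step) step: "EX Q. rel C {\<one>} Q"
proof (cases "nilm C {\<one>}")
 case True thus ?thesis using nilpotent_case by blast
next
 case False
 obtain A where A: "conn A" "nm C A" "0<dim A" and min: "!!B. dsub B==>B<=A==>nm C B==>dim B = 0 | B = A"
  and ab: "!!a b. a:A==>b:A==>a ** b = b ** a" using minimal_normal[OF False] by blast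
 note a = dsubD[OF conn_dsub[OF A(1)]]
 obtain H where H: "rel C A H" using IHquo[OF A] by blast
 show ?thesis
 proof (cases "H = C")
  case True
  hence nl: "nilm C A" using relD(4)[OF H] by simp
  have nc: "~(ALL g:C. ALL a:A. cj g a = a)"
  proof
   assume c: "ALL g:C. ALL a:A. cj g a = a"
   have "A<=U C {\<one>} 1"
   proof
    fix x assume x: "x:A"
    have "cm x g = \<one>" if g: "g:C" for g
    proof -
     have xc: "x:C" using x a by blast
     have "cj g x = x" using c g x by blast
     thus ?thesis using cm_eq_one[OF xc g] cj_fix[OF g xc] by simp
    qed
    thus "x:U C {\<one>} 1" using x a by auto
   qed
   thus False using nilm_trans[OF nl] False by blast
  qed
  interpret carter_min G D dim A by unfold_locales (use cnC A nl nc min ab in auto)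
  show ?thesis by (rule minimal_case)
 next
  case False thus ?thesis using proper_case[OF A(1,2) H] by blast
 qed
qed

text \<open>The induction varies the whole structure. A subgroup keeps the dimension function, while
  a quotient replaces carrier, predicates and dimension; both stay on the same type, which the
  induction needs.\<close>

theorem carter_theorem:
 fixes G :: "'b monoid" and D dim
 assumes "ranked_group G D dim" "ranked_group.conn G D dim (carrier G)" "ranked_group.solv G D"
 shows "EX Q. ranked_group.rel G D dim (carrier G) {\<one>\<^bsub>G\<^esub>} Q"
 using assms
proof (induction "nat (dim (carrier G))" arbitrary: G D dim rule: less_induct)
 case less
 interpret ranked_group G D dim by (rule less.prems(1))
 have c: "conn C" and s: solv using less.prems by blast+
 have sub: "EX Q. rel H {\<one>\<^bsub>G\<^esub>} Q" if H: "conn H" "H~=C" for H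
 proof -
  note dH = conn_dsub[OF H(1)]
  have "dim H<dim C" using conn_dim_less[OF c dH dsubD(3)[OF dH] H(2)] .
  hence "nat (dim (carrier (sg H)))<nat (dim C)" using dsub_dim[OF dH] by simp
  then obtain Q where "ranked_group.rel (sg H) (DS H) dim (carrier (sg H)) {\<one>\<^bsub>sg H\<^esub>} Q"
   using less.hyps[of dim "sg H" "DS H"] sub_ranked_group[OF dH] sub_conn[OF dH H(1)] sub_solv[OF dH s] by auto
  thus ?thesis using sub_rel[OF dH] by auto
 qed
 have quo: "EX H. rel C N H" if N: "conn N" "nm C N" "0<dim N" for N
 proof -
  have cN: "conn N" "0<dim N" by fact+
  interpret quot G D dim N by unfold_locales (use conn_dsub[OF N(1)] N(2) in auto)
  have "dim N<=dim C" by (rule dim_mono[OF N(2) ds_C N(3)])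
  hence "nat (dimQ (carrier Q))<nat (dim C)" using quot_dim cN(2) by simp
  then obtain X where "ranked_group.rel Q DQ dimQ (carrier Q) {\<one>\<^bsub>Q\<^esub>} X"
   using less.hyps[of dimQ Q DQ] quot_ranked_group quot_conn[OF c] quot_solv[OF s] by auto
  thus ?thesis using quot_rel[OF cN(1)] by auto
 qed
 interpret carter_step G D dim by unfold_locales (use c s sub quo in auto)
 show ?case by (rule step)
qed

subsection \<open>Cartan subgroups\<close>

context ranked_group
begin

text \<open>For a fixed y in \<open>K\<close> the x with \<open>cm x y\<close> in \<open>L\<close>
  form a definable subgroup, because \<open>K\<close> normalizes \<open>L\<close>. It contains the
  hull as soon as it contains the generators; the second argument follows by symmetry.\<close>

lemma hull_comm:
 assumes K: "dsub K" and L: "dsub L" "nm K L" and X: "X<=K" and Y: "Y<=K" and c: "!!x y. x:X==>y:Y==>cm x y:L"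
  and x: "x:hull X" and y: "y:hull Y"
 shows "cm x y:L"
proof -
 note k = dsubD[OF K] and l = dsubD[OF L(1)]
 have E: "dsub {x:K. cm x y:L}" if y: "y:K" for y
 proof (rule dsubI)
  have yc: "y:C" using y k by blast
  show "ds {x:K. cm x y:L}" by (rule ds_Collect[OF k(2)], rule D_mem[OF l(2)], intro T_cm T_var T_const yc)
  show "\<one>:{x:K. cm x y:L}" using k l yc by (simp add: cm_def)
  fix x assume x: "x:{x:K. cm x y:L}"
  have xc: "x:C" using x k by blast
  have x1: "x:K" "cm x y:L" using x by blast+
  have "cj (inv x) (inv (cm x y)):L" by (rule L(2)[unfolded nm_def, rule_format, OF k(6)[OF x1(1)] l(6)[OF x1(2)]])
  thus "inv x:{x:K. cm x y:L}" using cm_inv[OF xc yc] x k by simp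
  fix x' assume x': "x':{x:K. cm x y:L}"
  have xc': "x':C" using x' k by blast
  have "cj x (cm x' y) ** cm x y:L" using x x' l L(2) unfolding nm_def by blast
  thus "x ** x':{x:K. cm x y:L}" using cm_mult[OF xc xc' yc] x x' k by simp
 qed
 have sym: "cm a b:L <-> cm b a:L" if "a:K" "b:K" for a b
 proof -
  have "a:C" "b:C" using that k by auto
  thus ?thesis using cm_inverse[of a b] cm_inverse[of b a] l(6)[of "cm a b"] l(6)[of "cm b a"] by auto
 qed
 have XC: "X<=C" "Y<=C" using X Y k by auto
 have xK: "x:K" "y:K" using hull(3)[OF XC(1) K X] hull(3)[OF XC(2) K Y] x y by auto
 have 1: "cm x b:L" if b: "b:Y" for b
 proof -
  have "X<={x:K. cm x b:L}" using X c b by blast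
  thus ?thesis using hull(3)[OF XC(1) E[of b]] b Y x by blast
 qed
 have "Y<={y:K. cm y x:L}" using Y 1 sym xK by blast
 hence "cm y x:L" using hull(3)[OF XC(2) E[OF xK(1)]] y by blast
 thus ?thesis using sym xK by blast
qed

text \<open>If \<open>K/N\<close> were definably perfect, then inductively the hull of
  \<open>N\<close> and the i-th derived subgroup of \<open>K\<close> would be all of
  \<open>K\<close>: it contains the commutators of \<open>K\<close> by \<open>hull_comm\<close>. At
  the end of the derived series this hull is inside \<open>N\<close>.\<close>

lemma solvable_solv: assumes "solvable G" shows solv
 unfolding solv_def
proof (intro allI impI, elim conjE, rule ccontr)
 fix N K assume N: "dsub N" and K: "dsub K" and NK: "N \<subset> K" and nm: "nm K N"
  and no: "~(EX L. dsub L & N<=L & L \<subset> K & (ALL x:K. ALL y:K. cm x y:L))"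
 note n = dsubD[OF N] and k = dsubD[OF K]
 define de where "de i = (derived G ^^ i) K" for i
 have de0: "de 0 = K" and deS: "de (Suc i) = generate G (derived_set G (de i))" for i unfolding de_def by (simp_all add: derived_def)
 have cmd: "cm x y:derived_set G (de i)" if "x:de i" "y:de i" for x y i using that unfolding cm_def by blast
 have sub: "de i<=K" for i
 proof (induction i)
  case (Suc i)
  show ?case unfolding deS by (rule generate_subgroup_incl[OF derived_set_incl[OF Suc k(1)] k(1)])
 qed (simp add: de0)
 have nrmde: "cj h x:de i" if h: "h:K" and "x:de i" for h x i
  using that(2)
 proof (induction i arbitrary: x)
  case 0
  hence "x:K" using de0 by simp
  thus ?case unfolding de0 cj_def by (intro k(5,6) h)
 next
  case (Suc i)
  have hc: "h:C" using h k by blast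
  have dc: "derived_set G (de i)<=C" using sub[of i] k by blast
  have S: "cj h z:derived_set G (de i)" if zz: "z:derived_set G (de i)" for z
  proof -
   obtain a b where ab: "a:de i" "b:de i" "z = cm a b" using zz unfolding cm_def by blast
   have "a:C" "b:C" using ab sub[of i] k by auto
   hence "cj h z = cm (cj h a) (cj h b)" using ab cj_cm[OF hc] by simp
   thus ?thesis using cmd Suc.IH ab by simp
  qed
  from Suc.prems show ?case unfolding deS
  proof (induction rule: generate.induct)
   case one thus ?case using hc generate.one[of G] by simp
  next
   case (incl z) show ?case by (rule generate.incl[OF S[OF incl]])
  next
   case (inv z) show ?case unfolding cj_inv[OF hc subsetD[OF dc inv]] by (rule generate.inv[OF S[OF inv]])
  next
   case (eng y z)
   have "y:C" "z:C" using eng(1,2) generate_incl[OF dc] by blast+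
   thus ?case using eng generate.eng[of "cj h y" G _ "cj h z"] cj_mult[OF hc] by simp
  qed
 qed
 have key: "K<=hull (N Un de i)" for i
 proof (induction i)
  case 0 thus ?case using hull(2)[of "N Un de 0"] n k unfolding de0 by blast
 next
  case (Suc i)
  have inK: "N Un de j<=K" "N Un de j<=C" for j using NK sub[of j] k by auto
  note h = hull[OF inK(2)]
  let ?L = "hull (N Un de (Suc i))"
  have LK: "?L<=K" by (rule h(3)[OF K inK(1)])
  have nL: "nm K ?L" unfolding nm_def
  proof (intro ballI)
   fix g x assume g: "g:K" and x: "x:?L"
   have gc: "g:C" using g k by blast
   have "N Un de (Suc i)<=cj (inv g) ` ?L"
   proof
    fix y assume y: "y:N Un de (Suc i)"
    have "cj g y:N Un de (Suc i)" using y g nm nrmde unfolding nm_def by blast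
    hence "cj g y:?L" using h(2) by blast
    moreover have "y:C" using y inK by blast
    ultimately show "y:cj (inv g) ` ?L" using cj_mem[OF dsubD(3)[OF h(1)], of "inv g" y] gc by simp
   qed
   hence "?L<=cj (inv g) ` ?L" using h(3)[OF dsub_cj[OF h(1)]] gc by blast
   hence "x:cj (inv g) ` ?L" "x:C" using x dsubD(3)[OF h(1)] by auto
   thus "cj g x:?L" using cj_mem[OF dsubD(3)[OF h(1)], of "inv g" x] gc by simp
  qed
  have "cm x y:?L" if xy: "x:N Un de i" "y:N Un de i" for x y
  proof -
   have c: "x:K" "y:K" "x:C" "y:C" using subsetD[OF inK(1)[of i]] subsetD[OF inK(2)[of i]] xy by blast+
   consider "x:N" | "y:N" | "x:de i" "y:de i" using xy by blast
   thus ?thesis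
   proof cases
    case 1
    hence "cm x y:N" using cm_split[OF c(3,4)] n nm c(2) unfolding nm_def by auto
    thus ?thesis using h(2) by blast
   next
    case 2
    hence "cm x y:N" using cm_cj[OF c(3,4)] n nm c(1) unfolding nm_def by auto
    thus ?thesis using h(2) by blast
   next
    case 3
    have "cm x y:de (Suc i)" unfolding deS by (rule generate.incl[OF cmd[OF 3]])
    thus ?thesis using h(2) by blast
   qed
  qed
  hence "ALL x:K. ALL y:K. cm x y:?L" using hull_comm[OF K h(1) nL inK(1) inK(1)] Suc by blast
  thus ?case using no h(1) LK h(2) by blast
 qed
 obtain m where "(derived G ^^ m) C = {\<one>}" using assms unfolding solvable_iff_trivial_derived_seq by blast
 hence "de m<={\<one>}" using mono_exp_of_derived[OF k(3), of m] unfolding de_def by simp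
 hence "N Un de m<=N" using n by blast
 hence "hull (N Un de m)<=N" using hull(3)[OF _ N] n(3) by blast
 thus False using key[of m] NK by blast
qed

lemma sub_inv: "subgroup X G==>x:X==>inv\<^bsub>sg X\<^esub> x = inv x" using m_inv_consistent .

lemma lower_central_sub: assumes X: "subgroup X G" shows "lower_central (sg X) i<=X"
proof (induction i)
 case (Suc i)
 interpret S: group "sg X" by (rule subgroup_imp_group[OF X])
 have "(UN a:lower_central (sg X) i. UN b:carrier (sg X).
   {a \<otimes>\<^bsub>sg X\<^esub> b \<otimes>\<^bsub>sg X\<^esub> inv\<^bsub>sg X\<^esub> a \<otimes>\<^bsub>sg X\<^esub> inv\<^bsub>sg X\<^esub> b})<=carrier (sg X)"
  using Suc S.m_closed S.inv_closed by (auto simp: subset_iff)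
 from S.generate_incl[OF this] show ?case by simp
qed simp

lemma lower_central_cm: assumes X: "subgroup X G" and "a:lower_central (sg X) i" "b:X"
 shows "cm a b:lower_central (sg X) (Suc i)"
proof -
 have "a:X" using lower_central_sub[OF X] assms(2) by blast
 hence "cm a b = a \<otimes>\<^bsub>sg X\<^esub> b \<otimes>\<^bsub>sg X\<^esub> inv\<^bsub>sg X\<^esub> a \<otimes>\<^bsub>sg X\<^esub> inv\<^bsub>sg X\<^esub> b"
  using sub_inv[OF X] assms(3) unfolding cm_def by simp
 thus ?thesis unfolding lower_central.simps using assms by (intro generate.incl) auto
qed

text \<open>By \<open>hull_comm\<close> the hulls of the lower central terms of \<open>X\<close> are
  again central in \<open>hull X\<close> one step at a time, so counted from the trivial end they
  lie in the upper central series.\<close>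

lemma nilpotent_hull: assumes X: "subgroup X G" and nil: "nilpotent (sg X)" shows "nilm (hull X) {\<one>}"
proof -
 let ?l = "lower_central (sg X)"
 obtain k where k: "?l k = {\<one>}" using nil unfolding nilpotent_def by auto
 have XC: "X<=C" using subgroup.subset[OF X] .
 note h = hull[OF XC]
 have lX: "?l i<=X" "?l i<=C" for i using lower_central_sub[OF X] XC by blast+
 have n1: "nm (hull X) {\<one>}" using dsubD(3)[OF h(1)] unfolding nm_def by auto
 have one: "{\<one>}<=hull X" using dsubD(4)[OF h(1)] by blast
 note f = U_facts[OF h(1) dsub_one one n1]
 have "hull (?l (k - j))<=U (hull X) {\<one>} j" if "j<=k" for j
  using that
 proof (induction j)
  case 0 thus ?case using hull(3)[OF _ dsub_one, of "{\<one>}"] k by simp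
 next
  case (Suc j)
  let ?i = "k - Suc j"
  have e: "Suc ?i = k - j" using Suc.prems by simp
  have IH: "?l (k - j)<=U (hull X) {\<one>} j" using Suc hull(2)[OF lX(2)[of "k - j"]] by simp
  have lH: "?l ?i<=hull X" using lX h(2) by blast
  have "cm x y:U (hull X) {\<one>} j" if "x:hull (?l ?i)" "y:hull X" for x y
  proof (rule hull_comm[OF h(1) _ _ lH h(2) _ that])
   show "dsub (U (hull X) {\<one>} j)" "nm (hull X) (U (hull X) {\<one>} j)" using f[of j] by blast+
   fix a b assume "a:?l ?i" "b:X"
   hence "cm a b:?l (Suc ?i)" by (rule lower_central_cm[OF X])
   thus "cm a b:U (hull X) {\<one>} j" using IH e by auto
  qed
  moreover have "hull (?l ?i)<=hull X" by (rule hull(3)[OF lX(2) h(1) lH])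
  ultimately show ?case by auto
 qed
 from this[of k] show ?thesis unfolding nilm_def by auto
qed

lemma nilpotent_nilm: assumes K: "dsub K" and nil: "nilm K {\<one>}" shows "nilpotent (sg K)"
proof -
 note k = dsubD[OF K]
 let ?l = "lower_central (sg K)"
 interpret S: group "sg K" by (rule subgroup_imp_group[OF k(1)])
 obtain m where m: "K<=U K {\<one>} m" using nil unfolding nilm_def by blast
 have n1: "nm K {\<one>}" using k(3) unfolding nm_def by auto
 have one: "{\<one>}<=K" using k(4) by blast
 note f = U_facts[OF K dsub_one one n1]
 have "?l i<=U K {\<one>} (m - i)" if "i<=m" for i
  using that
 proof (induction i)
  case 0 thus ?case using m by simp
 next
  case (Suc i)
  have e: "m - i = Suc (m - Suc i)" using Suc.prems by simp
  have sg: "subgroup (U K {\<one>} (m - Suc i)) (sg K)"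
   using subgroup_incl[OF dsubD(1) k(1)] f by blast
  have "?l i<=U K {\<one>} (Suc (m - Suc i))" using Suc e by simp
  hence c: "cm a b:U K {\<one>} (m - Suc i)" if "a:?l i" "b:K" for a b using that by auto
  show ?case unfolding lower_central.simps
  proof (rule S.generate_subgroup_incl[OF _ sg], clarsimp)
   fix a b assume ab: "a:?l i" "b:K"
   have "a:K" using ab lower_central_sub[OF k(1)] by blast
   thus "a ** b ** inv\<^bsub>sg K\<^esub> a ** inv\<^bsub>sg K\<^esub> b:U K {\<one>} (m - Suc i)"
    using c[OF ab] sub_inv[OF k(1)] ab unfolding cm_def by simp
  qed
 qed
 from this[of m] have "?l m<={\<one>}" by simp
 moreover have "\<one>:?l m" using k(4) generate.one[of "sg K"] by (cases m) auto
 ultimately have "?l m = {\<one>\<^bsub>sg K\<^esub>}" by auto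
 thus ?thesis unfolding nilpotent_def using S.is_group by blast
qed

lemma dim_rcoset: assumes "ds K" "f:C" shows "ds (K #> f)" "dim (K #> f) = dim K"
proof -
 have KC: "K<=C" using assms unfolding ds_def by blast
 have "f ** cj (inv f) k = k ** f" if "k:K" for k using that KC assms(2) by (auto simp: cj_def gsimps)
 hence "K #> f = (%k. f ** k) ` cj (inv f) ` K" unfolding r_coset_def by (auto simp: image_iff)
 thus "ds (K #> f)" "dim (K #> f) = dim K"
  using dim_translate[OF dim_cj(1)[OF assms(1) inv_closed[OF assms(2)]] assms(2)] dim_cj(2)[OF assms(1) inv_closed[OF assms(2)]] by simp_all
qed

text \<open>One direction covers \<open>H\<close> by finitely many translates of equal dimension;
  the other is the finiteness of the number of cosets for subgroups of full dimension.\<close>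

lemma finite_index_dim: assumes K: "dsub K" and H: "dsub H" and KH: "K<=H" shows "finite_index G K H <-> dim K = dim H"
proof
 note k = dsubD[OF K] and h = dsubD[OF H]
 assume "finite_index G K H"
 then obtain F where F: "finite F" "F<=H" "H = (UN f:F. K #> f)" unfolding finite_index_def by blast
 have "ds (K #> f) & dim (K #> f)<=dim K" if "f:F" for f using dim_rcoset[OF k(2), of f] F(2) h(3) that by auto
 hence "dim (UN f:F. K #> f)<=dim K" using dim_UN[OF F(1), of "%f. K #> f" "dim K"] dim_ge[OF k(2)] by blast
 thus "dim K = dim H" using dim_mono[OF k(2) h(2) KH] F(3) by simp
next
 note k = dsubD[OF K] and h = dsubD[OF H]
 assume d: "dim K = dim H"
 have fin: "finite (lcosets K H)" using index[OF H] K KH d by blast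
 define rp where "rp X = (SOME r. r:H & X = (%k. r ** k) ` K)" for X
 have rp: "rp X:H & X = (%k. rp X ** k) ` K" if "X:lcosets K H" for X
  unfolding rp_def by (rule someI_ex) (use that in blast)
 \<comment> \<open>Inverses turn representatives of left cosets into representatives of right
   cosets, which \<open>finite_index\<close> asks for.\<close>
 define F where "F = (%X. inv (rp X)) ` lcosets K H"
 have FH: "F<=H" unfolding F_def using rp h(6) by blast
 have "H = (UN f:F. K #> f)"
 proof
  show "(UN f:F. K #> f)<=H" using FH KH h(5) unfolding r_coset_def by blast
  show "H<=(UN f:F. K #> f)"
  proof
   fix x assume x: "x:H"
   have xc: "x:C" "inv x:H" using x h by auto
   let ?X = "(%k. inv x ** k) ` K"
   have X: "?X:lcosets K H" using xc by blast
   have "inv x ** \<one>:?X" using k by blast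
   then obtain y where y: "y:K" "inv x = rp ?X ** y" using rp[OF X] xc by auto
   have c: "rp ?X:C" "y:C" using rp[OF X] h y k by auto
   have "x = inv (inv x)" using xc by simp
   also have "... = inv (rp ?X ** y)" by (rule arg_cong[OF y(2)])
   also have "... = inv y ** inv (rp ?X)" by (rule inv_mult_group[OF c])
   finally have "x:K #> inv (rp ?X)" unfolding r_coset_def using k(6)[OF y(1)] by blast
   thus "x:(UN f:F. K #> f)" unfolding F_def using X by blast
  qed
 qed
 thus "finite_index G K H" unfolding finite_index_def using fin FH by (intro exI[of _ F]) (auto simp: F_def)
qed

lemma normalizer_nrm: assumes "X<=C" shows "normalizer G X = nrm X"
proof -
 have "g <# X #> inv g = cj g ` X" for g unfolding l_coset_def r_coset_def cj_def by auto
 thus ?thesis unfolding normalizer_def stabilizer_def nrm_def using assms by simp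
qed

lemma conj_set_cj: "conj_set G g X = cj g ` X" unfolding conj_set_def cj_def by auto

lemma normal_iff_nm: assumes "subgroup X G" "dsub Q" "X<=Q" shows "X \<lhd> sg Q <-> nm Q X"
proof -
 note q = dsubD[OF assms(2)]
 interpret S: group "sg Q" by (rule subgroup_imp_group[OF q(1)])
 show ?thesis unfolding S.normal_inv_iff nm_def cj_def
  using subgroup_incl[OF assms(1) q(1) assms(3)] sub_inv[OF q(1)] by simp
qed

lemma nrm_hull: assumes X: "X<=C" shows "nrm X<=nrm (hull X)"
proof
 fix g assume g: "g:nrm X"
 note h = hull[OF X]
 have gc: "g:C" and e: "cj g ` X = X" using g unfolding nrm_def by auto
 have e': "cj (inv g) ` X = X" using cj_img_inv(1)[OF X gc] e by simp
 have *: "cj (inv k) x:hull X" if "k:C" "cj k ` X = X" "x:hull X" for k x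
 proof -
  have "X<=cj k ` hull X" using h(2) that(2) by blast
  hence "x:cj k ` hull X" using h(3)[OF dsub_cj[OF h(1) that(1)]] that(3) by blast
  thus ?thesis using cj_mem[OF dsubD(3)[OF h(1)] that(1)] dsubD(3)[OF h(1)] that(3) by blast
 qed
 have "cj g ` hull X = hull X"
  using nrm_iff[OF dsubD(3)[OF h(1)] gc] *[OF gc e] *[OF inv_closed[OF gc] e'] gc by simp
 thus "g:nrm (hull X)" unfolding nrm_def using gc by blast
qed

text \<open>Neither the larger nilpotent group \<open>K\<close> nor the subgroup \<open>X\<close>
  has to be definable, so both are replaced by their hulls. The hull of \<open>K\<close> is
  nilpotent and falls to the normalizer condition. The hull of \<open>X\<close> has finite index in
  the connected group \<open>Q\<close>, so it is \<open>Q\<close>, and the normalizer of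
  \<open>X\<close> lies in that of its hull.\<close>

lemma carter_cartan: assumes Q: "carter Q" "nrm Q = Q" shows "cartan_subgroup G Q"
 unfolding cartan_subgroup_def
proof (intro conjI allI impI; (elim conjE)?)
 note q = carterD[OF Q(1)] and d = dsubD[OF carterD(2)[OF Q(1)]]
 show "subgroup Q G" by (rule d(1))
 show "nilpotent (sg Q)" by (rule nilpotent_nilm[OF q(2,4)])
 fix K assume K: "subgroup K G" "Q<=K" "nilpotent (sg K)"
 have KC: "K<=C" using subgroup.subset[OF K(1)] .
 note h = hull[OF KC]
 have n1: "nm (hull K) {\<one>}" "{\<one>}<=hull K" using dsubD(3,4)[OF h(1)] unfolding nm_def by auto
 have "hull K = Q"
 proof (rule ccontr)
  assume ne: "hull K~=Q"
  have "EX x:hull K. x~:Q & x:nrm Q"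
   by (rule nilm_normalizer[OF h(1) dsub_one n1(2,1) q(2,6) _ _ nilpotent_hull[OF K(1,3)]]) (use K h(2) ne in auto)
  thus False using Q(2) by blast
 qed
 thus "K = Q" using h(2) K(2) by blast
next
 note q = carterD[OF Q(1)] and d = dsubD[OF carterD(2)[OF Q(1)]]
 fix X assume X: "X \<lhd> sg Q" "finite_index G X Q"
 have XQ: "X<=Q" using subgroup.subset[OF normal_imp_subgroup[OF X(1)]] by simp
 have sX: "subgroup X G" using incl_subgroup[OF d(1) normal_imp_subgroup[OF X(1)]] .
 have XC: "X<=C" using XQ d by blast
 note h = hull[OF XC]
 have hQ: "hull X<=Q" by (rule h(3)[OF q(2) XQ])
 obtain F where F: "finite F" "F<=Q" "Q = (UN f:F. X #> f)" using X(2) unfolding finite_index_def by blast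
 have "Q = (UN f:F. hull X #> f)"
 proof
  show "Q<=(UN f:F. hull X #> f)" using F(3) h(2) unfolding r_coset_def by blast
  show "(UN f:F. hull X #> f)<=Q" using F(2) hQ d(5) unfolding r_coset_def by blast
 qed
 hence "finite_index G (hull X) Q" unfolding finite_index_def using F by blast
 hence "dim (hull X) = dim Q" using finite_index_dim[OF h(1) q(2) hQ] by blast
 hence hX: "hull X = Q" using connD[OF q(1) h(1) hQ] by blast
 have nQ: "nm Q X" using normal_iff_nm[OF sX q(2) XQ] X(1) by blast
 have "Q<=nrm X"
 proof
  fix g assume g: "g:Q"
  hence "cj g ` X = X" using nrm_iff[OF XC, of g] nQ d unfolding nm_def by blast
  thus "g:nrm X" unfolding nrm_def using g d by blast
 qed
 hence "nrm X = Q" using nrm_hull[OF XC] hX Q(2) by auto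
 thus "finite_index G X (normalizer G X)" using normalizer_nrm[OF XC] X(2) by simp
qed

text \<open>Maximality makes \<open>Q\<close> equal to its hull, hence definable. The finite index
  condition, applied to the connected component of \<open>Q\<close>, shows that this component is
  Carter, hence conjugate to \<open>P\<close> and selfnormalizing; as \<open>Q\<close> normalizes
  it, it equals \<open>Q\<close>.\<close>

lemma cartan_carter:
 assumes Q: "cartan_subgroup G Q" and P: "carter P" "nrm P = P" "!!P'. carter P'==>EX g:C. P' = cj g ` P"
 shows "EX g:C. Q = cj g ` P" "carter Q" "nrm Q = Q"
proof -
 have Q': "subgroup Q G" "nilpotent (sg Q)" using Q unfolding cartan_subgroup_def by blast+
 have QC: "Q<=C" using subgroup.subset[OF Q'(1)] .
 note h = hull[OF QC]
 have "hull Q = Q" using Q dsubD(1)[OF h(1)] h(2) nilpotent_nilm[OF h(1) nilpotent_hull[OF Q']] unfolding cartan_subgroup_def by blast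
 hence dQ: "dsub Q" and nl: "nilm Q {\<one>}" using h(1) nilpotent_hull[OF Q'] by auto
 note c = cc[OF dQ]
 note d0 = conn_dsub[OF c(1)]
 have nm: "nm Q Q" using dsubD(5,6)[OF dQ] unfolding nm_def cj_def by blast
 have nm0: "nm Q (cc Q)" by (rule nm_cc[OF dQ Q'(1) nm])
 have "cc Q \<lhd> sg Q" using normal_iff_nm[OF dsubD(1)[OF d0] dQ c(2)] nm0 by blast
 moreover have "finite_index G (cc Q) Q" using finite_index_dim[OF d0 dQ c(2)] c(3) by blast
 ultimately have "finite_index G (cc Q) (nrm (cc Q))"
  using Q normalizer_nrm[OF dsubD(3)[OF d0]] unfolding cartan_subgroup_def by auto
 hence dm: "dim (nrm (cc Q)) = dim (cc Q)" using finite_index_dim[OF d0 nrm_dsub(1,2)[OF d0]] by simp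
 have "nilm (cc Q) ({\<one>} Int cc Q)" by (rule nilm_sub[OF nl d0 c(2)])
 moreover have "{\<one>} Int cc Q = {\<one>}" using dsubD(4)[OF d0] by blast
 ultimately have car: "carter (cc Q)" unfolding carter_def using c(1) dm by simp
 obtain g where g: "g:C" "cc Q = cj g ` P" using P(3)[OF car] by blast
 have "nrm (cc Q)<=cc Q" using nrm_cj[OF carterD(3)[OF P(1)] g(1)] g(2) P(2) by simp
 hence n: "nrm (cc Q) = cc Q" using nrm_dsub(2)[OF d0] by blast
 have "Q<=nrm (cc Q)"
 proof
  fix x assume x: "x:Q"
  hence "cj x ` cc Q = cc Q" using nrm_iff[OF dsubD(3)[OF d0], of x] nm0 dsubD(6)[OF dQ x] QC unfolding nm_def by blast
  thus "x:nrm (cc Q)" unfolding nrm_def using x QC by blast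
 qed
 hence "cc Q = Q" using n c(2) by blast
 thus "EX g:C. Q = cj g ` P" "carter Q" "nrm Q = Q" using g car n by auto
qed

lemma generic_part_eq: assumes "Q<=C" shows "generic_part G Q = Q - (bad C Q)"
proof (intro Set.set_eqI iffI)
 fix x assume x: "x:generic_part G Q"
 define R where "R Q' <-> (EX g:C. Q' = cj g ` Q) & x:Q'" for Q'
 have "x:Q & (EX! Q'. R Q')" using x unfolding generic_part_def conj_set_cj R_def by (rule CollectD)
 hence xQ: "x:Q" and ex: "EX! Q'. R Q'" by blast+
 have u: "A = B" if "R A" "R B" for A B using ex that by blast
 have "EX g:C. Q = cj g ` Q" using cj_img_one[OF assms] by (intro bexI[of _ \<one>]) simp_all
 hence "R Q" unfolding R_def using xQ by blast
 hence "Q' = Q" if "g:C" "Q' = cj g ` Q" "x:Q'" for g Q' using u[of Q' Q] that unfolding R_def by blast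
 thus "x:Q - (bad C Q)" using xQ by blast
next
 fix x assume x: "x:Q - (bad C Q)"
 have "EX! Q'. (EX g:C. Q' = cj g ` Q) & x:Q'"
 proof (rule ex1I[of _ Q])
  show "(EX g:C. Q = cj g ` Q) & x:Q" using x cj_img_one[OF assms] one_closed by blast
  fix Q' assume "(EX g:C. Q' = cj g ` Q) & x:Q'" thus "Q' = Q" using x by blast
 qed
 thus "x:generic_part G Q" unfolding generic_part_def conj_set_cj using x by blast
qed

theorem cartan_theorem:
 assumes c: "conn C" and s: "solvable G"
 shows "EX Q. cartan_subgroup G Q"
  "!!Q Q'. cartan_subgroup G Q==>cartan_subgroup G Q'==>EX g:C. Q' = conj_set G g Q"
  "!!Q. cartan_subgroup G Q==>conn Q & normalizer G Q = Q & ds (generic_part G Q) & generic_part G Q<=Q &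
    dim (Q - generic_part G Q)<dim Q & conj_closure G (generic_part G Q)<=C & dim (C - conj_closure G (generic_part G Q))<dim C"
proof -
 obtain P where r: "rel C {\<one>} P" using carter_theorem[OF ranked_group_axioms c solvable_solv[OF s]] by blast
 have nP: "nrm P = P" using relD(5)[OF r] nrm_C by blast
 have P: "carter P" unfolding carter_def using relD(1,4)[OF r] nP by simp
 note p = carterD[OF P]
 have cj: "EX g:C. P' = cj g ` P" if "carter P'" for P'
  by (rule rel_conj[OF r that dsub_C carterD(3)[OF that]])
 show "EX Q. cartan_subgroup G Q" using carter_cartan[OF P nP] by blast
 have cc: "EX g:C. Q = cj g ` P" "carter Q" "nrm Q = Q" if "cartan_subgroup G Q" for Q
  by (rule cartan_carter[OF that P nP cj], assumption)+
 show "EX g:C. Q' = conj_set G g Q" if Q: "cartan_subgroup G Q" "cartan_subgroup G Q'" for Q Q'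
 proof -
  obtain g h where g: "g:C" "Q = cj g ` P" "h:C" "Q' = cj h ` P" using cc(1)[OF Q(1)] cc(1)[OF Q(2)] by blast
  have "P = cj (inv g) ` Q" by (rule cj_img_eq[OF p(3) g(1,2)])
  hence "Q' = cj (h ** inv g) ` Q" using g cj_img[of Q h "inv g"] carterD(3)[OF cc(2)[OF Q(1)]] by simp
  thus ?thesis unfolding conj_set_cj using g by blast
 qed
 fix Q assume Q: "cartan_subgroup G Q"
 note car = cc(2)[OF Q] and nQ = cc(3)[OF Q]
 note q = carterD[OF car]
 obtain g where g: "g:C" "Q = cj g ` P" using cc(1)[OF Q] by blast
 let ?bad = "%Q. (bad C Q)"
 have bad: "ds (?bad Q)" "ds (?bad P)" using ds_bad[OF q(2) ds_C] ds_bad[OF p(2) ds_C] .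
 have "?bad Q<=cj g ` ?bad P"
 proof
  fix x assume "x:?bad Q"
  then obtain h where h: "x:Q" "h:C" "x:cj h ` Q" "cj h ` Q~=Q" by blast
  obtain y where y: "y:P" "x = cj g y" using h(1) g(2) by blast
  have yc: "y:C" using y p by blast
  let ?k = "inv g ** (h ** g)"
  have k: "?k:C" using g h by simp
  have e: "cj ?k ` P = cj (inv g) ` cj h ` Q" using g h cj_img[OF p(3), of h g] cj_img[OF p(3), of "inv g" "h ** g"] by simp
  have "cj (inv g) x:cj ?k ` P" unfolding e using h(3) by blast
  hence "y:cj ?k ` P" using y g yc by simp
  moreover have "cj ?k ` P~=P"
  proof
   assume "cj ?k ` P = P"
   hence "cj g ` cj (inv g) ` cj h ` Q = Q" using e g by simp
   moreover have "cj h ` Q<=C" using q(3) h(2) by auto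
   ultimately show False using cj_img_inv(2)[OF _ g(1)] h(4) by simp
  qed
  ultimately have "y:?bad P" using y k by blast
  thus "x:cj g ` ?bad P" using y by blast
 qed
 hence "dim (?bad Q)<=dim (?bad P)" using dim_mono[OF bad(1) dim_cj(1)[OF bad(2) g(1)]] dim_cj(2)[OF bad(2) g(1)] by simp
 hence d1: "dim (?bad Q)<dim Q" using relD(7)[OF r] g dim_cj(2)[OF dsubD(2)[OF p(2)] g(1)] by simp
 have un: "unc C Q<=unc C P"
 proof (intro subsetI CollectI conjI ballI notI)
  fix x h assume x: "x:unc C Q" and h: "h:C" and "x:cj h ` P"
  moreover have "cj h ` P = cj (h ** inv g) ` Q" using cj_img_eq[OF p(3) g] cj_img[OF q(3) h, of "inv g"] g by simp
  ultimately show False using g by blast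
 qed blast
 have gp: "generic_part G Q = Q - ?bad Q" by (rule generic_part_eq[OF q(3)])
 have dgp: "ds (generic_part G Q)" unfolding gp by (rule ds_Diff[OF dsubD(2)[OF q(2)] bad(1)])
 have gpC: "generic_part G Q<=C" using gp q(3) by blast
 have cl: "conj_closure G (generic_part G Q) = {y:C. EX h:C. cj (inv h) y:generic_part G Q}" (is "_ = ?Y")
 proof (intro Set.set_eqI iffI)
  fix y assume "y:conj_closure G (generic_part G Q)"
  then obtain x h where x: "x:generic_part G Q" "h:C" "y = cj h x" unfolding conj_closure_def cj_def by blast
  have "x:C" using x gpC by blast
  hence "cj (inv h) y = x" "y:C" using x by simp_all
  thus "y:?Y" using x by blast
 next
  fix y assume "y:?Y"
  then obtain h where h: "y:C" "h:C" "cj (inv h) y:generic_part G Q" by blast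
  hence "y = cj h (cj (inv h) y)" by simp
  thus "y:conj_closure G (generic_part G Q)" unfolding conj_closure_def using h unfolding cj_def by blast
 qed
 have inv: "cj a x:?bad Q" if a: "a:Q" and x: "x:?bad Q" for a x
 proof -
  obtain h where h: "x:Q" "h:C" "x:cj h ` Q" "cj h ` Q~=Q" using x by blast
  have ac: "a:C" using a q by blast
  have aQ: "cj a ` Q = Q" using a nQ unfolding nrm_def by blast
  have e: "cj (a ** h) ` Q = cj a ` cj h ` Q" using cj_img[OF q(3) ac h(2)] by simp
  have "cj (a ** h) ` Q~=Q"
  proof
   assume "cj (a ** h) ` Q = Q"
   hence "cj (inv a) ` cj a ` cj h ` Q = cj (inv a) ` cj a ` Q" using e aQ by simp
   moreover have "cj h ` Q<=C" using q(3) h(2) by auto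
   ultimately show False using cj_img_inv(1)[OF _ ac] q(3) h(4) by simp
  qed
  moreover have "cj a x:cj (a ** h) ` Q" unfolding e using h(3) by blast
  moreover have "cj a x:Q" using aQ h(1) by blast
  ultimately show ?thesis using ac h(2) by blast
 qed
 note S = conj_small[OF q(2) bad(1) inv d1]
 have U: "ds (unc C Q)" "ds (unc C P)" using ds_uncovered[OF q(2) ds_C] ds_uncovered[OF p(2) ds_C] .
 \<comment> \<open>An element in no conjugate of the generic part is outside all conjugates of
   \<open>Q\<close> or is conjugate to a bad element.\<close>
 have "C - ?Y<=unc C Q Un {y:C. EX h:C. y:cj h ` ?bad Q}"
 proof
  fix y assume y: "y:C - ?Y"
  show "y:unc C Q Un {y:C. EX h:C. y:cj h ` ?bad Q}"
  proof (cases "EX h:C. y:cj h ` Q")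
   case True
   then obtain h x where h: "h:C" "x:Q" "y = cj h x" by blast
   have "cj (inv h) y = x" using h q(3) by auto
   hence "x~:generic_part G Q" using y h by blast
   hence "x:?bad Q" unfolding gp using h by blast
   thus ?thesis using h y by blast
  qed (use y in blast)
 qed
 moreover have dY: "ds ?Y" by (rule ds_Collect[OF ds_C], rule D_ex, rule D_mem[OF dgp], intro T_cj T_inv T_var)
 ultimately have "dim (C - ?Y)<=dim ((unc C Q) Un {y:C. EX h:C. y:cj h ` ?bad Q})"
  using dim_mono[OF ds_Diff[OF ds_C dY] ds_Un[OF U(1) S(1)]] by blast
 also have "...<dim C" by (rule dim_less_Un[OF U(1) S(1) le_less_trans[OF dim_mono[OF U un] relD(8)[OF r]] S(2)])
 finally have "dim (C - ?Y)<dim C" .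
 moreover have "Q - generic_part G Q = ?bad Q" unfolding gp by blast
 ultimately show "conn Q & normalizer G Q = Q & ds (generic_part G Q) & generic_part G Q<=Q &
    dim (Q - generic_part G Q)<dim Q & conj_closure G (generic_part G Q)<=C & dim (C - conj_closure G (generic_part G Q))<dim C"
  unfolding cl using q(1) normalizer_nrm[OF q(3)] nQ dgp gp d1 by auto
qed

end

subsection \<open>Definable groups are groups with a dimension\<close>

context omin_group
begin

definition flat :: "(nat => 'a list) => nat => 'a" where "flat e j = e (j div n) ! (j mod n)"

text \<open>For \<open>n = 0\<close> the coding by \<open>flat\<close> is meaningless, but everything is definable.\<close>

definition gdfn :: "((nat => 'a list) => bool) => bool" where
 "gdfn ph <-> n = 0 | (EX ps. dfn ps & (ALL e. range e<=carrier G --> ph e = ps (flat e)))"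

lemma gdfnI: "dfn ps==>(!!e. 0<n==>range e<=carrier G==>ph e = ps (flat e))==>gdfn ph"
 unfolding gdfn_def by (cases "n = 0") auto

lemma gdfnE: assumes "gdfn ph" "0<n" obtains ps where "dfn ps" "!!e. range e<=carrier G==>ph e = ps (flat e)"
 using assms unfolding gdfn_def by auto

lemma flat_map: assumes "0<n" "range e<=carrier G" shows "map (%i. flat e (i + k * n)) [0..<n] = e k"
proof (rule nth_equalityI)
 have "e k:carrier G" using assms by blast
 thus l: "length (map (%i. flat e (i + k * n)) [0..<n]) = length (e k)" using len by simp
qed (simp add: flat_def)

lemma flat_map0: "0<n==>range e<=carrier G==>map (flat e) [0..<n] = e 0"
 using flat_map[of e 0] by simp

lemma gdfn_mem: assumes "X:S n" shows "gdfn (%e. e 0:X)"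
proof (rule gdfnI)
 show "dfn (%f. map (%i. f i) [0..<n]:X)" by (rule dfn_mem[OF assms ltrm_vars refl])
qed (simp add: flat_map0)

lemma gdfn_S: assumes X: "X<=carrier G" "gdfn (%e. e 0:X)" shows "X:S n"
proof (cases "n = 0")
 case True
 \<comment> \<open>M^0 has one point and hence two subsets, both definable.\<close>
 have "X<={x. length x = n}" using X(1) len by blast
 hence "X = {x. length x = n} | X = {x. length x = n} - {x. length x = n}" using True by auto
 thus ?thesis using S_UNIV S_compl[OF S_UNIV] by metis
next
 case False
 hence n: "0<n" by simp
 obtain ps where p: "dfn ps" "!!e. range e<=carrier G==>(e 0:X) = ps (flat e)" using gdfnE[OF X(2) n] by blast
 have "dfn (%e. map (%i. e i) [0..<n]:carrier G & ps (%j. e (j mod n)))"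
  by (rule dfn_conj[OF dfn_mem[OF carrier_S ltrm_vars refl] dfn_rename[OF p(1)]])
 hence "dfn (%e. map e [0..<n]:carrier G & ps (%j. map e [0..<n] ! (j mod n)))" using n by simp
 from S_I[OF this] have "{x. length x = n & x:carrier G & ps (%j. x ! (j mod n))}:S n" .
 moreover have "X = {x. length x = n & x:carrier G & ps (%j. x ! (j mod n))}"
 proof (intro Set.set_eqI)
  fix x
  have fl: "flat (%_. x) = (%j. x ! (j mod n))" by (rule ext) (simp add: flat_def)
  have "x:carrier G==>(x:X) = ps (%j. x ! (j mod n))" using p(2)[of "%_. x"] unfolding fl by auto
  thus "x:X <-> x:{x. length x = n & x:carrier G & ps (%j. x ! (j mod n))}" using X(1) len by auto
 qed
 ultimately show ?thesis by simp
qed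

lemma gdfn_rel: assumes R: "gdfn (%e. R (e 0) (e 1))" shows "dfl2 n n (%x y. x:carrier G & y:carrier G & R x y)"
proof (cases "n = 0")
 case True thus ?thesis unfolding dfl2_def by (simp add: dfn_const)
next
 case False
 hence n: "0<n" by simp
 obtain ps where p: "dfn ps" "!!e. range e<=carrier G==>R (e 0) (e 1) = ps (flat e)" using gdfnE[OF R n] by blast
 \<comment> \<open>All blocks after the first read the second argument, matching the environment x,
   y, y, and so on.\<close>
 define f where "f j = (if j<n then j else j mod n + n)" for j
 have "dfn (%e. map (%i. e i) [0..<n]:carrier G & map (%i. e (i + n)) [0..<n]:carrier G & ps (%j. e (f j)))"
  by (rule dfn_conj[OF dfn_mem[OF carrier_S ltrm_vars refl] dfn_conj[OF dfn_mem[OF carrier_S ltrm_vars refl] dfn_rename[OF p(1)]]])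
 moreover have "ps (%j. e (f j)) = R (map e [0..<n]) (map (%i. e (i + n)) [0..<n])"
  if c: "map e [0..<n]:carrier G" "map (%i. e (i + n)) [0..<n]:carrier G" for e
 proof -
  let ?x = "map e [0..<n]" and ?y = "map (%i. e (i + n)) [0..<n]"
  let ?e = "%k::nat. if k = 0 then ?x else ?y"
  have "range ?e<=carrier G" using c by auto
  from p(2)[OF this] have "R ?x ?y = ps (flat ?e)" by simp
  moreover have "flat ?e = (%j. e (f j))" using n by (auto simp: flat_def f_def fun_eq_iff div_eq_0_iff)
  ultimately show ?thesis by simp
 qed
 ultimately show ?thesis unfolding dfl2_def by (auto elim!: back_subst[of dfn])
qed

lemma odim_mono: assumes "X:S n" "Y:S n" "!!d. dge n X d==>dge n Y d" shows "odim n X<=odim n Y"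
proof (cases "X = {}")
 case True thus ?thesis unfolding odim_def by simp
next
 case False
 hence "0<=odim n X" unfolding odim_def by simp
 then obtain d where d: "odim n X = int d" using nonneg_int_cases by blast
 thus ?thesis using odim_ge[OF assms(1), of d] odim_ge[OF assms(2), of d] assms(3) by simp
qed

lemma dge_single: "dge m {x} d==>d = 0"
proof (induction m arbitrary: x d)
 case (Suc m)
 have "{y. EX t. y @ [t] = x}<={butlast x}" by auto
 moreover have "{y. infinite {t. y @ [t] = x}} = {}"
 proof -
  have "{t. y @ [t] = x}<={last x}" for y by auto
  thus ?thesis using finite_subset by blast
 qed
 ultimately show ?case using Suc.prems Suc.IH[of "butlast x" d] dge_mono[of _ "{butlast x}" m d] by (auto simp: dge_empty)
qed simp

lemma ranked: "ranked_group G gdfn (odim n)"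
proof (unfold_locales)
 fix ph ps assume a: "gdfn ph" "!!e. range e<=carrier G==>ph e = ps e"
 thus "gdfn ps" unfolding gdfn_def by auto
next
 fix ph assume "gdfn ph" thus "gdfn (%e. ~ph e)" unfolding gdfn_def using dfn_not by blast
next
 fix ph ps assume p: "gdfn ph" "gdfn ps"
 show "gdfn (%e. ph e & ps e)"
 proof (cases "n = 0")
  case False
  hence n: "0<n" by simp
  obtain ph' ps' where "dfn ph'" "!!e. range e<=carrier G==>ph e = ph' (flat e)" "dfn ps'" "!!e. range e<=carrier G==>ps e = ps' (flat e)"
   using gdfnE[OF p(1) n] gdfnE[OF p(2) n] by metis
  thus ?thesis by (intro gdfnI[OF dfn_conj]) auto
 qed (unfold gdfn_def, blast)
next
 fix ph assume p: "gdfn ph"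
 show "gdfn (%e. EX x:carrier G. ph (case_nat x e))"
 proof (cases "n = 0")
  case False
  hence n: "0<n" by simp
  obtain ps where q: "dfn ps" "!!e. range e<=carrier G==>ph e = ps (flat e)" using gdfnE[OF p n] by blast
  have "map f [0..<n] ! j = f j" if "j<n" for f :: "nat => 'a" and j using that by simp
  hence "(%j. if j<n then map f [0..<n] ! j else f (j - n + n)) = f" for f :: "nat => 'a" by auto
  hence "dfn (%f. EX x:carrier G. ps (%j. if j<n then x ! j else f (j - n)))"
   using dfn_bex[OF carrier_S, of "%x f. ps (%j. if j<n then x ! j else f (j - n))"] q(1) by simp
  thus ?thesis
  proof (rule gdfnI)
   fix e :: "nat => 'a list" assume e: "range e<=carrier G"
   have "ph (case_nat x e) = ps (%j. if j<n then x ! j else flat e (j - n))" if x: "x:carrier G" for x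
   proof -
    have "e i:carrier G" for i using e by blast
    hence "range (case_nat x e)<=carrier G" using x by (auto split: nat.split)
    moreover have "flat (case_nat x e) = (%j. if j<n then x ! j else flat e (j - n))"
    proof
     fix j show "flat (case_nat x e) j = (if j<n then x ! j else flat e (j - n))"
      using n le_div_geq[of n j] le_mod_geq[of n j] by (auto simp: flat_def not_less)
    qed
    ultimately show ?thesis using q(2) by metis
   qed
   thus "(EX x:carrier G. ph (case_nat x e)) = (EX x:carrier G. ps (%j. if j<n then x ! j else flat e (j - n)))" by blast
  qed
 qed (unfold gdfn_def, blast)
next
 fix ph f assume p: "gdfn ph"
 show "gdfn (%e. ph (%i. e (f i)))"
 proof (cases "n = 0")
  case False
  hence n: "0<n" by simp
  obtain ps where q: "dfn ps" "!!e. range e<=carrier G==>ph e = ps (flat e)" using gdfnE[OF p n] by blast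
  show ?thesis
  proof (rule gdfnI[OF dfn_rename[OF q(1), of "%j. f (j div n) * n + j mod n"]])
   fix e :: "nat => 'a list" assume "range e<=carrier G"
   hence "range (%i. e (f i))<=carrier G" by auto
   moreover have "flat (%i. e (f i)) = (%j. flat e (f (j div n) * n + j mod n))" using n by (auto simp: flat_def fun_eq_iff)
   ultimately show "ph (%i. e (f i)) = ps (%j. flat e (f (j div n) * n + j mod n))" using q(2) by metis
  qed
 qed (unfold gdfn_def, blast)
next
 show "gdfn (%e. e 0 = e 1 ** e 2)"
 proof (rule gdfnI)
  show "dfn (%f. map (%i. f (i + 1 * n)) [0..<n] @ map (%i. f (i + 2 * n)) [0..<n] @ map (%i. f (i + 0 * n)) [0..<n]:Gr)"
   by (rule dfn_graph[OF ltrm_vars ltrm_vars ltrm_vars])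
  fix e :: "nat => 'a list" assume n: "0<n" and e: "range e<=carrier G"
  have c: "e i:carrier G" "length (e i) = n" for i using e len by auto
  show "(e 0 = e 1 ** e 2) = (map (%i. flat e (i + 1 * n)) [0..<n] @ map (%i. flat e (i + 2 * n)) [0..<n] @ map (%i. flat e (i + 0 * n)) [0..<n]:Gr)"
   unfolding flat_map[OF n e] graph_iff[OF c(2) c(2)] using c by simp
 qed
next
 show "gdfn (%e. e 0 = e 1)"
 proof (rule gdfnI)
  show "dfn (%f. ALL i<n. f i = f (i + n))" by (intro dfn_ball_less dfn_eq_var)
  fix e :: "nat => 'a list" assume n: "0<n" and e: "range e<=carrier G"
  have "(ALL i<n. flat e i = flat e (i + n)) = (map (%i. flat e (i + 0 * n)) [0..<n] = map (%i. flat e (i + 1 * n)) [0..<n])" by auto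
  thus "(e 0 = e 1) = (ALL i<n. flat e i = flat e (i + n))" unfolding flat_map[OF n e] by simp
 qed
next
 fix c assume c: "c:carrier G"
 show "gdfn (%e. e 0 = c)"
 proof (rule gdfnI)
  show "dfn (%f. ALL i<n. f i = c ! i)" by (intro dfn_ball_less dfn_eq_param)
  fix e :: "nat => 'a list" assume n: "0<n" and e: "range e<=carrier G"
  have "(ALL i<n. flat e i = c ! i) = (map (flat e) [0..<n] = c)" using len[OF c] by (auto simp: list_eq_iff_nth_eq)
  thus "(e 0 = c) = (ALL i<n. flat e i = c ! i)" unfolding flat_map0[OF n e] by simp
 qed
 hence s: "{c}:S n" using gdfn_S[of "{c}"] c by simp
 have "odim n {c}<1" using odim_ge[OF s, of 1] dge_single[of n c 1] by fastforce
 moreover have "0<=odim n {c}" unfolding odim_def by simp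
 ultimately show "odim n {c} = 0" by simp
next
 show "odim n {} = -1" unfolding odim_def by simp
next
 fix X :: "'a list set" assume "X~={}" thus "0<=odim n X" unfolding odim_def by simp
next
 fix X Y assume a: "Y<=carrier G" "gdfn (%e. e 0:X)" "gdfn (%e. e 0:Y)" "X<=Y"
 hence "X:S n" "Y:S n" using gdfn_S by auto
 thus "odim n X<=odim n Y" by (rule odim_mono) (rule dge_mono[OF a(4)])
next
 fix X Y assume a: "X<=carrier G" "Y<=carrier G" "gdfn (%e. e 0:X)" "gdfn (%e. e 0:Y)"
 have s: "X:S n" "Y:S n" using gdfn_S a by auto
 have u: "X Un Y:S n" by (rule S_Un[OF s])
 have "odim n X<=odim n (X Un Y)" "odim n Y<=odim n (X Un Y)" using odim_mono[OF s(1) u] odim_mono[OF s(2) u] dge_Un by blast+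
 moreover have "odim n (X Un Y)<=max (odim n X) (odim n Y)"
 proof (cases "X Un Y = {}")
  case True thus ?thesis by simp
 next
  case False
  hence "0<=odim n (X Un Y)" unfolding odim_def by simp
  then obtain d where d: "odim n (X Un Y) = int d" using nonneg_int_cases by blast
  hence "dge n X d | dge n Y d" using odim_ge[OF u, of d] dge_Un[of n X Y d] by simp
  thus ?thesis using odim_ge[OF s(1), of d] odim_ge[OF s(2), of d] d by auto
 qed
 ultimately show "odim n (X Un Y) = max (odim n X) (odim n Y)" by simp
next
 fix R X Y a b assume r: "gdfn (%e. R (e 0) (e 1))" and xy: "X<=carrier G" "Y<=carrier G" "gdfn (%e. e 0:X)" "gdfn (%e. e 0:Y)" "X~={}" "0<=a"
  and ab: "!!x. x:X==>a<=odim n {y:Y. R x y}" "!!y. y:Y==>odim n {x:X. R x y}<=b"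
 have s: "X:S n" "Y:S n" using gdfn_S xy by auto
 let ?R = "%x y. x:X & y:Y & R x y"
 have "dfl2 n n (%x y. x:X & y:Y & (x:carrier G & y:carrier G & R x y))"
  using gdfn_rel[OF r] unfolding dfl2_def
  by (intro dfn_conj[OF dfn_mem[OF s(1) ltrm_vars[where f = "%i. i"] refl] dfn_conj[OF dfn_mem[OF s(2) ltrm_vars refl]]])
 moreover have "(%x y. x:X & y:Y & (x:carrier G & y:carrier G & R x y)) = ?R" using xy by blast
 ultimately have R: "dfl2 n n ?R" by simp
 have sec: "{y. ?R x y}:S n" if "x:X" for x
 proof -
  have l: "length x = n" using that xy len by blast
  have "dfn (%e. ?R x (map (%i. e i) [0..<n]))" by (rule dfl2_sub[OF R ltrm_const[OF l] ltrm_vars])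
  hence "{y. length y = n & ?R x y}:S n" using S_I[of "?R x"] by simp
  moreover have "{y. length y = n & ?R x y} = {y. ?R x y}" using xy len by blast
  ultimately show ?thesis by simp
 qed
 have sec': "{x. ?R x y}:S n" if "y:Y" for y
 proof -
  have l: "length y = n" using that xy len by blast
  have "dfn (%e. ?R (map (%i. e i) [0..<n]) y)" by (rule dfl2_sub[OF R ltrm_vars ltrm_const[OF l]])
  hence "{x. length x = n & ?R x y}:S n" using S_I[of "%x. ?R x y"] by simp
  moreover have "{x. length x = n & ?R x y} = {x. ?R x y}" using xy len by blast
  ultimately show ?thesis by simp
 qed
 have e: "{y. ?R x y} = {y:Y. R x y}" if "x:X" for x using that by blast
 have e': "{x. ?R x y} = {x:X. R x y}" if "y:Y" for y using that by blast
 have "0<=odim n X" using xy(5) unfolding odim_def by simp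
 then obtain p where p: "odim n X = int p" using nonneg_int_cases by blast
 hence dX: "dge n X p" using odim_ge[OF s(1), of p] by simp
 obtain a' where a': "a = int a'" using xy(6) nonneg_int_cases by blast
 have fa: "dge n {y. ?R x y} a'" if x: "x:X" for x using odim_ge[OF sec[OF x], of a'] ab(1)[OF x] e[OF x] a' by simp
 have lo: "dge n {x. dge n {y. ?R x y} a'} p" by (rule dge_mono[OF _ dX]) (use fa in blast)
 obtain x0 where x0: "x0:X" using xy by blast
 \<comment> \<open>As a is nonnegative, the fibre of \<open>x0\<close> is nonempty. The reverse
   fibre of \<open>y0\<close> then forces b to be nonnegative, so the count can be done in natural
   numbers.\<close>
 obtain y0 where y0: "y0:Y" "R x0 y0" using fa[OF x0] dge_empty[of n a'] by (metis (no_types, lifting) Collect_empty_eq)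
 have "0<=odim n {x:X. R x y0}" using x0 y0 unfolding odim_def by auto
 then obtain b' where b': "b = int b'" using ab(2)[OF y0(1)] nonneg_int_cases[of b] by force
 have up: "~dge n {x. ?R x y} (Suc b')" for y
 proof (cases "y:Y")
  case True thus ?thesis using odim_ge[OF sec'[OF True], of "Suc b'"] ab(2)[OF True] e'[OF True] b' by simp
 next
  case False thus ?thesis by (simp add: dge_empty)
 qed
 have "dge n {y. EX x. length x = n & ?R x y} (p + a' - b')" by (rule double_count[OF R lo up])
 hence "dge n Y (p + a' - b')" by (rule dge_mono[rotated]) blast
 hence "int (p + a' - b')<=odim n Y" using odim_ge[OF s(2)] by blast
 thus "odim n X + a<=odim n Y + b" using p a' b' by linarith
next
 fix H assume H: "subgroup H G" "gdfn (%e. e 0:H)"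
 have s: "K:S n" if "subgroup K G" "gdfn (%e. e 0:K)" for K using gdfn_S[OF subgroup.subset[OF that(1)] that(2)] .
 have "0<=odim n H" using subgroup.one_closed[OF H(1)] unfolding odim_def by auto
 then obtain d where d: "odim n H = int d" using nonneg_int_cases by blast
 have d': "dge n H d" "~dge n H (Suc d)" using odim_ge[OF s[OF H], of d] odim_ge[OF s[OF H], of "Suc d"] d by auto
 have lc: "lcos h K = (%k. h ** k) ` K" for h K unfolding lcos_def by blast
 obtain N where N: "!!K. K:S n & subgroup K G & K<=H & dge n K d ==>
   finite ((%h. (%k. h ** k) ` K) ` H) & card ((%h. (%k. h ** k) ` K) ` H)<=N"
  using bounded_index[OF s[OF H] H(1) d'] unfolding lc by blast
 show "EX N. ALL K. subgroup K G & gdfn (%e. e 0:K) & K<=H & odim n K = odim n H -->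
   finite ((%h. (%k. h ** k) ` K) ` H) & card ((%h. (%k. h ** k) ` K) ` H)<=N"
 proof (intro exI[of _ N] allI impI, rule N, elim conjE)
  fix K assume K: "subgroup K G" "gdfn (%e. e 0:K)" "K<=H" "odim n K = odim n H"
  thus "K:S n & subgroup K G & K<=H & dge n K d" using s[OF K(1,2)] odim_ge[OF s[OF K(1,2)], of d] d by simp
 qed
qed

end

section \<open>Return to the notions of the statement\<close>

context omin_group
begin

interpretation r: ranked_group G gdfn "odim n" by (rule ranked)

lemma ds_iff: "r.ds X <-> X<=carrier G & X:S n"
 unfolding r.ds_def using gdfn_S gdfn_mem by blast

lemma conn_iff: "r.conn H <-> definably_connected S n G H"
proof -
 have d: "r.dsub K <-> K:S n & subgroup K G" for K
  unfolding r.dsub_def ds_iff using subgroup.subset by blast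
 have "odim n K = odim n H <-> finite_index G K H" if "r.dsub K" "r.dsub H" "K<=H" for K
  using r.finite_index_dim[OF that] by simp
 thus ?thesis unfolding r.conn_def definably_connected_def using d by blast
qed

lemma cartan_definable:
 assumes c: "definably_connected S n G (carrier G)" and s: "solvable G"
 shows "EX Q. cartan_subgroup G Q"
  "!!Q Q'. cartan_subgroup G Q==>cartan_subgroup G Q'==>EX g:carrier G. Q' = conj_set G g Q"
  "!!Q. cartan_subgroup G Q==>definably_connected S n G Q & normalizer G Q = Q & generic_part G Q:S n &
    large_in n (generic_part G Q) Q & largely_generous n G (generic_part G Q)"
proof -
 note t = r.cartan_theorem[OF c[folded conn_iff] s]
 show "EX Q. cartan_subgroup G Q" by (rule t(1))
 show "EX g:carrier G. Q' = conj_set G g Q" if "cartan_subgroup G Q" "cartan_subgroup G Q'" for Q Q' by (rule t(2)[OF that])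
 show "definably_connected S n G Q & normalizer G Q = Q & generic_part G Q:S n &
    large_in n (generic_part G Q) Q & largely_generous n G (generic_part G Q)" if "cartan_subgroup G Q" for Q
  using t(3)[OF that] unfolding conn_iff ds_iff large_in_def largely_generous_def by blast
qed

end

theorem theorem8p1:
  fixes S :: "nat \<Rightarrow> 'a::linorder list set set" and n :: nat and G :: "'a list monoid"
  assumes "o_minimal S"
    and "definable_group S n G"
    and "definably_connected S n G (carrier G)"
    and "solvable G"
  shows "(\<exists>Q. cartan_subgroup G Q)
    \<and> (\<forall>Q Q'. cartan_subgroup G Q \<and> cartan_subgroup G Q' \<longrightarrow>
         (\<exists>g \<in> carrier G. Q' = conj_set G g Q))
    \<and> (\<forall>Q. cartan_subgroup G Q \<longrightarrow>
         definably_connected S n G Q \<and> normalizer G Q = Q \<and>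
         generic_part G Q \<in> S n \<and>
         large_in n (generic_part G Q) Q \<and>
         largely_generous n G (generic_part G Q))"
proof -
 interpret group G using assms(2) unfolding definable_group_def by blast
 interpret omin_group S G n
  by unfold_locales (use assms(1,2) in "auto simp: definable_group_def")
 show ?thesis using cartan_definable[OF assms(3,4)] by blast
qed

end
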